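(* Let $\Bbbk$ be a field, $S=\Bbbk[x_1,\dots,x_n]$, let $\mathfrak{a}\subset S$ be a monomial ideal and let $R:=S/\mathfrak{a}$. Then $R$ is Golod if the product in the Koszul homology $H_*(K_R)$ of $R$ is trivial and one of the following conditions holds: (1) $\mathfrak{a}$ is generated by monomials of degree $2$; (2) $\mathfrak{a}$ is generic; (3) $\mathfrak{a}$ has at most seven (minimal monomial) generators; (4) $\dim S\le 4$; (5) $\mathfrak{a}$ is squarefree and $\dim S\le 8$; (6) $\operatorname{reg}S/\mathfrak{a}\le 4$; or (7) $\mathfrak{a}$ is the Stanley–Reisner ideal of a simplicial complex of dimension at most $3$.
   Context: $K_R$ is the Koszul complex over $R$ on the images of $x_1,\dots,x_n$, a differential graded algebra (DGA). The product in $H_*(K_R)$ is trivial if the product of any two elements of positive homological degree is zero. $\operatorname{reg}$ is Castelnuovo–Mumford regularity over $S$. Massey products: let $A$ be a DGA with differential $d$, $|\cdot|$ homological degree, $\bar a=(-1)^{|a|+1}a$. $\mu_2(a_1,a_2)$ is the product in $H_*(A)$. For $k\ge 3$ and homogeneous $a_1,\dots,a_k\in H_*(A)$, $\mu_k(a_1,\dots,a_k)$ is defined if there are $a_{ij}\in A$ for $1\le i\le j\le k$, $(i,j)\ne(1,k)$, with $da_{ii}=0$, $[a_{ii}]=a_i$ and $da_{ij}=\sum_{v=i}^{j-1}\bar a_{iv}a_{v+1,j}$ for $i<j$; then $\mu_k(a_1,\dots,a_k)\subset H_*(A)$ is the set of all classes $[\sum_{v=1}^{k-1}\bar a_{1v}a_{v+1,k}]$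 so obtained. $R$ is Golod if the product and all higher Massey products on $H_*(K_R)$ are trivial, i.e. all $k$-ary Massey products ($k\ge2$) of elements of positive homological degree are defined and contain only zero. Generic (Miller–Sturmfels–Yanagawa): a monomial $m'$ strictly divides a monomial $m$ if $m'$ divides $m$ and every variable dividing $m$ also divides $m/m'$. A monomial ideal is generic if, whenever two distinct minimal generators $m_i,m_j$ have the same positive degree in some variable, there is a third minimal generator which strictly divides $\operatorname{lcm}(m_i,m_j)$. The Stanley–Reisner ideal of a simplicial complex $\Delta$ on vertex set $V$ is $(\prod_{v\in M}X_v : M\subseteq V, M\notin\Delta)\subset\Bbbk[X_v : v\in V]$. *)

theory Defs
  imports
    Complex_Main
    "HOL-Library.Poly_Mapping"
    "HOL-Library.FuncSet"
    "HOL-Library.Extended_Real"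
    "HOL-Algebra.QuotRing"
begin

section \<open>Differential graded algebras, homology, Massey products\<close>

record 'a dga = "'a ring" +
  component :: "nat \<Rightarrow> 'a set"
  differential :: "'a \<Rightarrow> 'a"

definition cycles :: "('a, 'm) dga_scheme \<Rightarrow> 'a set"
  where "cycles A = {z \<in> carrier A. differential A z = \<zero>\<^bsub>A\<^esub>}"

definition boundaries :: "('a, 'm) dga_scheme \<Rightarrow> 'a set"
  where "boundaries A = differential A ` carrier A"

definition homology :: "('a, 'm) dga_scheme \<Rightarrow> 'a set ring"
  where "homology A = (A\<lparr>carrier := cycles A\<rparr>) Quot (boundaries A)"

definition homology_class :: "('a, 'm) dga_scheme \<Rightarrow> 'a \<Rightarrow> 'a set"
  where "homology_class A z = boundaries A +>\<^bsub>A\<^esub> z"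

definition homology_component :: "('a, 'm) dga_scheme \<Rightarrow> nat \<Rightarrow> 'a set set"
  where "homology_component A p = homology_class A ` (cycles A \<inter> component A p)"

text \<open>\<open>signed R k r\<close> is $(-1)^k r$.\<close>

definition signed :: "('a, 'm) ring_scheme \<Rightarrow> nat \<Rightarrow> 'a \<Rightarrow> 'a"
  where "signed R k r = (if even k then r else \<ominus>\<^bsub>R\<^esub> r)"

text \<open>
  The classes \<open>\<alpha> 1, \<dots>, \<alpha> k\<close> are given together with their degrees \<open>\<delta> 1, \<dots>, \<delta> k\<close>.  The defining
  equations force \<open>a i j\<close> into degree $|\alpha_i| + \dots + |\alpha_j| + (j - i)$; the degree is also
  prescribed when the right-hand side of the equation happens to vanish.
\<close>

definition massey_degree :: "(nat \<Rightarrow> nat) \<Rightarrow> nat \<Rightarrow> nat \<Rightarrow> nat"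
  where "massey_degree \<delta> i j = (\<Sum>v=i..j. \<delta> v) + (j - i)"

text \<open>The sum of $\bar a_{iv}\, a_{v+1,j}$ over $i \le v < j$, where $\bar a = (-1)^{|a|+1} a$.\<close>

definition massey_sum ::
  "('a, 'm) dga_scheme \<Rightarrow> (nat \<Rightarrow> nat) \<Rightarrow> (nat \<Rightarrow> nat \<Rightarrow> 'a) \<Rightarrow> nat \<Rightarrow> nat \<Rightarrow> 'a"
  where "massey_sum A \<delta> a i j =
    (\<Oplus>\<^bsub>A\<^esub>v\<in>{i..<j}. signed A (massey_degree \<delta> i v + 1) (a i v) \<otimes>\<^bsub>A\<^esub> a (v + 1) j)"

definition defining_system ::
  "('a, 'm) dga_scheme \<Rightarrow> nat \<Rightarrow> (nat \<Rightarrow> nat) \<Rightarrow> (nat \<Rightarrow> 'a set) \<Rightarrow> (nat \<Rightarrow> nat \<Rightarrow> 'a) \<Rightarrow> bool"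
  where "defining_system A k \<delta> \<alpha> a \<longleftrightarrow>
    (\<forall>i j. 1 \<le> i \<and> i \<le> j \<and> j \<le> k \<and> (i, j) \<noteq> (1, k)
       \<longrightarrow> a i j \<in> component A (massey_degree \<delta> i j)) \<and>
    (\<forall>i\<in>{1..k}. differential A (a i i) = \<zero>\<^bsub>A\<^esub> \<and> homology_class A (a i i) = \<alpha> i) \<and>
    (\<forall>i j. 1 \<le> i \<and> i < j \<and> j \<le> k \<and> (i, j) \<noteq> (1, k)
       \<longrightarrow> differential A (a i j) = massey_sum A \<delta> a i j)"

definition massey_product ::
  "('a, 'm) dga_scheme \<Rightarrow> nat \<Rightarrow> (nat \<Rightarrow> nat) \<Rightarrow> (nat \<Rightarrow> 'a set) \<Rightarrow> 'a set set"
  where "massey_product A k \<delta> \<alpha> =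
    {homology_class A (massey_sum A \<delta> a 1 k) | a. defining_system A k \<delta> \<alpha> a}"

definition massey_defined ::
  "('a, 'm) dga_scheme \<Rightarrow> nat \<Rightarrow> (nat \<Rightarrow> nat) \<Rightarrow> (nat \<Rightarrow> 'a set) \<Rightarrow> bool"
  where "massey_defined A k \<delta> \<alpha> \<longleftrightarrow> (\<exists>a. defining_system A k \<delta> \<alpha> a)"

definition trivial_product :: "('a, 'm) dga_scheme \<Rightarrow> bool"
  where "trivial_product A \<longleftrightarrow>
    (\<forall>p>0. \<forall>q>0. \<forall>\<alpha>\<in>homology_component A p. \<forall>\<beta>\<in>homology_component A q.
       \<alpha> \<otimes>\<^bsub>homology A\<^esub> \<beta> = \<zero>\<^bsub>homology A\<^esub>)"

definition trivial_higher_massey_products :: "('a, 'm) dga_scheme \<Rightarrow> bool"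
  where "trivial_higher_massey_products A \<longleftrightarrow>
    (\<forall>k\<ge>3. \<forall>\<delta> \<alpha>. (\<forall>i\<in>{1..k}. \<delta> i > 0 \<and> \<alpha> i \<in> homology_component A (\<delta> i)) \<longrightarrow>
       massey_defined A k \<delta> \<alpha> \<and> massey_product A k \<delta> \<alpha> \<subseteq> {\<zero>\<^bsub>homology A\<^esub>})"


section \<open>The Koszul complex\<close>

text \<open>
  The Koszul complex of the elements \<open>x 0, \<dots>, x (n - 1)\<close> of \<open>R\<close>, i.e. the exterior algebra on
  generators $e_0, \dots, e_{n-1}$ with differential $e_i \mapsto x_i$.  An element is given by its
  coefficients on the basis elements $e_U = e_{u_1} \wedge \dots \wedge e_{u_p}$, where
  $U = \{u_1 < \dots < u_p\}$.  For disjoint \<open>U\<close> and \<open>W\<close> one has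
  $e_U \wedge e_W = (-1)^{s} e_{U \cup W}$, where $s$ is the number of inversions between \<open>U\<close>
  and \<open>W\<close>.
\<close>

definition inversions :: "nat set \<Rightarrow> nat set \<Rightarrow> nat"
  where "inversions U W = card {(u, w). u \<in> U \<and> w \<in> W \<and> w < u}"

definition koszul :: "('a, 'm) ring_scheme \<Rightarrow> nat \<Rightarrow> (nat \<Rightarrow> 'a) \<Rightarrow> (nat set \<Rightarrow> 'a) dga"
  where "koszul R n x =
    \<lparr>carrier = Pow {..<n} \<rightarrow>\<^sub>E carrier R,
     mult = (\<lambda>f g. \<lambda>U\<in>Pow {..<n}.
       \<Oplus>\<^bsub>R\<^esub>V\<in>Pow U. signed R (inversions V (U - V)) (f V \<otimes>\<^bsub>R\<^esub> g (U - V))),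
     one = (\<lambda>U\<in>Pow {..<n}. if U = {} then \<one>\<^bsub>R\<^esub> else \<zero>\<^bsub>R\<^esub>),
     zero = (\<lambda>U\<in>Pow {..<n}. \<zero>\<^bsub>R\<^esub>),
     add = (\<lambda>f g. \<lambda>U\<in>Pow {..<n}. f U \<oplus>\<^bsub>R\<^esub> g U),
     component = (\<lambda>p. {f \<in> Pow {..<n} \<rightarrow>\<^sub>E carrier R.
       \<forall>U\<in>Pow {..<n}. f U \<noteq> \<zero>\<^bsub>R\<^esub> \<longrightarrow> card U = p}),
     differential = (\<lambda>f. \<lambda>U\<in>Pow {..<n}.
       \<Oplus>\<^bsub>R\<^esub>i\<in>{..<n} - U. signed R (card {j \<in> U. j < i}) (x i \<otimes>\<^bsub>R\<^esub> f (insert i U)))\<rparr>"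


section \<open>Polynomial rings and monomial ideals\<close>

type_synonym monomial = "nat \<Rightarrow>\<^sub>0 nat"

type_synonym 'k polynomial = "(nat \<Rightarrow>\<^sub>0 nat) \<Rightarrow>\<^sub>0 'k"

definition monomials :: "nat \<Rightarrow> monomial set"
  where "monomials n = {t. Poly_Mapping.keys t \<subseteq> {..<n}}"

definition poly_ring :: "nat \<Rightarrow> 'k::field polynomial ring"
  where "poly_ring n =
    \<lparr>carrier = {f. Poly_Mapping.keys f \<subseteq> monomials n}, mult = (*), one = 1, zero = 0, add = (+)\<rparr>"

definition mono_poly :: "monomial \<Rightarrow> 'k::field polynomial"
  where "mono_poly t = Poly_Mapping.single t 1"

definition var :: "nat \<Rightarrow> 'k::field polynomial"
  where "var i = mono_poly (Poly_Mapping.single i 1)"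

lemma cring_poly_ring: "cring (poly_ring n :: 'k::field polynomial ring)"
proof (rule cringI)
  have add_closed: "f + g \<in> carrier (poly_ring n)"
    if "f \<in> carrier (poly_ring n)" "g \<in> carrier (poly_ring n)" for f g :: "'k polynomial"
    using that Poly_Mapping.keys_add[of f g] by (auto simp: poly_ring_def)
  show "abelian_group (poly_ring n :: 'k polynomial ring)"
  proof (rule abelian_groupI)
    fix f :: "'k polynomial" assume "f \<in> carrier (poly_ring n)"
    then show "\<exists>g\<in>carrier (poly_ring n). g \<oplus>\<^bsub>poly_ring n\<^esub> f = \<zero>\<^bsub>poly_ring n\<^esub>"
      by (intro bexI[of _ "- f"]) (auto simp: poly_ring_def)
  qed (use add_closed in \<open>auto simp: poly_ring_def add_ac\<close>)
  show "comm_monoid (poly_ring n :: 'k polynomial ring)"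
  proof (rule comm_monoidI)
    fix f g :: "'k polynomial"
    assume f: "f \<in> carrier (poly_ring n)" and g: "g \<in> carrier (poly_ring n)"
    have "Poly_Mapping.keys t \<subseteq> {..<n}" if "t \<in> Poly_Mapping.keys (f * g)" for t
    proof -
      obtain r s where "t = r + s" "r \<in> Poly_Mapping.keys f" "s \<in> Poly_Mapping.keys g"
        using Poly_Mapping.keys_mult[of f g] \<open>t \<in> _\<close> by blast
      with f g Poly_Mapping.keys_add[of r s] show ?thesis
        unfolding poly_ring_def monomials_def by fastforce
    qed
    then show "f \<otimes>\<^bsub>poly_ring n\<^esub> g \<in> carrier (poly_ring n)"
      by (auto simp: poly_ring_def monomials_def)
  qed (auto simp: poly_ring_def monomials_def mult_ac)
qed (auto simp: poly_ring_def distrib_right)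

definition mdegree :: "monomial \<Rightarrow> nat"
  where "mdegree t = (\<Sum>i\<in>Poly_Mapping.keys t. Poly_Mapping.lookup t i)"

definition mdvd :: "monomial \<Rightarrow> monomial \<Rightarrow> bool"
  where "mdvd s t \<longleftrightarrow> (\<forall>i. Poly_Mapping.lookup s i \<le> Poly_Mapping.lookup t i)"

text \<open>Exponentwise maximum, as subtraction of exponents is truncated.\<close>

definition mlcm :: "monomial \<Rightarrow> monomial \<Rightarrow> monomial"
  where "mlcm s t = s + (t - s)"

lemma lookup_mlcm:
  "Poly_Mapping.lookup (mlcm s t) i = max (Poly_Mapping.lookup s i) (Poly_Mapping.lookup t i)"
  by (simp add: mlcm_def lookup_add lookup_minus)

definition strictly_divides :: "monomial \<Rightarrow> monomial \<Rightarrow> bool"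
  where "strictly_divides s t \<longleftrightarrow>
    mdvd s t \<and> (\<forall>i. Poly_Mapping.lookup t i > 0 \<longrightarrow> Poly_Mapping.lookup (t - s) i > 0)"

definition monomial_span :: "nat \<Rightarrow> monomial set \<Rightarrow> 'k::field polynomial set"
  where "monomial_span n G = Idl\<^bsub>poly_ring n\<^esub> (mono_poly ` G)"

definition monomial_ideal :: "nat \<Rightarrow> 'k::field polynomial set \<Rightarrow> bool"
  where "monomial_ideal n I \<longleftrightarrow> (\<exists>G\<subseteq>monomials n. I = monomial_span n G)"

definition min_gens :: "nat \<Rightarrow> 'k::field polynomial set \<Rightarrow> monomial set"
  where "min_gens n I = {t \<in> monomials n. mono_poly t \<in> I \<and>
    (\<forall>s\<in>monomials n. mono_poly s \<in> I \<and> mdvd s t \<longrightarrow> s = t)}"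

definition generated_in_degree :: "nat \<Rightarrow> nat \<Rightarrow> 'k::field polynomial set \<Rightarrow> bool"
  where "generated_in_degree n d I \<longleftrightarrow>
    (\<exists>G\<subseteq>monomials n. (\<forall>t\<in>G. mdegree t = d) \<and> I = monomial_span n G)"

definition squarefree_ideal :: "nat \<Rightarrow> 'k::field polynomial set \<Rightarrow> bool"
  where "squarefree_ideal n I \<longleftrightarrow>
    (\<exists>G\<subseteq>monomials n. (\<forall>t\<in>G. \<forall>i. Poly_Mapping.lookup t i \<le> 1) \<and> I = monomial_span n G)"

definition generic_ideal :: "nat \<Rightarrow> 'k::field polynomial set \<Rightarrow> bool"
  where "generic_ideal n I \<longleftrightarrow>
    (\<forall>s\<in>min_gens n I. \<forall>t\<in>min_gens n I.
       s \<noteq> t \<and> (\<exists>i<n. Poly_Mapping.lookup s i = Poly_Mapping.lookup t i \<and>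
                     Poly_Mapping.lookup s i > 0)
       \<longrightarrow> (\<exists>u\<in>min_gens n I. u \<noteq> s \<and> u \<noteq> t \<and> strictly_divides u (mlcm s t)))"


section \<open>Dimension, regularity, Stanley--Reisner ideals\<close>

definition krull_dim :: "('a, 'm) ring_scheme \<Rightarrow> ereal"
  where "krull_dim R = (SUP l\<in>{l. \<exists>P. (\<forall>i\<le>l. primeideal (P i) R) \<and> (\<forall>i<l. P i \<subset> P (Suc i))}.
    ereal (real l))"

text \<open>
  A homogeneous map $\bigoplus_{l < r} S(-s_l) \to \bigoplus_{m < r'} S(-s'_m)$ of degree 0 is given
  by a matrix \<open>M\<close> whose entry \<open>M m l\<close> is homogeneous of degree \<open>s l - s' m\<close>.
\<close>

definition free_module :: "nat \<Rightarrow> nat \<Rightarrow> (nat \<Rightarrow> 'k::field polynomial) set"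
  where "free_module n r = {..<r} \<rightarrow>\<^sub>E carrier (poly_ring n)"

definition graded_matrix ::
  "nat \<Rightarrow> nat \<Rightarrow> (nat \<Rightarrow> int) \<Rightarrow> nat \<Rightarrow> (nat \<Rightarrow> int) \<Rightarrow> (nat \<Rightarrow> nat \<Rightarrow> 'k::field polynomial) \<Rightarrow> bool"
  where "graded_matrix n r s r' s' M \<longleftrightarrow>
    (\<forall>m<r'. \<forall>l<r. M m l \<in> carrier (poly_ring n) \<and>
       (\<forall>t\<in>Poly_Mapping.keys (M m l). int (mdegree t) = s l - s' m))"

definition matrix_apply ::
  "nat \<Rightarrow> nat \<Rightarrow> (nat \<Rightarrow> nat \<Rightarrow> 'k::field polynomial) \<Rightarrow> (nat \<Rightarrow> 'k polynomial) \<Rightarrow> nat \<Rightarrow> 'k polynomial"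
  where "matrix_apply r r' M u = (\<lambda>m\<in>{..<r'}. \<Sum>l<r. M m l * u l)"

text \<open>
  A minimal graded free resolution of $S/I$ with modules $F_i = \bigoplus_{l < r_i} S(-s_{i,l})$.
  The map $F_{i+1} \to F_i$ is \<open>\<phi> (Suc i)\<close>; the augmentation $F_0 \to S/I$ is given by the lifts
  \<open>\<epsilon> l\<close> to $S$ of the images of the basis elements.
\<close>

definition minimal_free_resolution ::
  "nat \<Rightarrow> 'k::field polynomial set \<Rightarrow> (nat \<Rightarrow> nat) \<Rightarrow> (nat \<Rightarrow> nat \<Rightarrow> int) \<Rightarrow>
   (nat \<Rightarrow> 'k polynomial) \<Rightarrow> (nat \<Rightarrow> nat \<Rightarrow> nat \<Rightarrow> 'k polynomial) \<Rightarrow> bool"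
  where "minimal_free_resolution n I r s \<epsilon> \<phi> \<longleftrightarrow>
    graded_matrix n (r 0) (s 0) 1 (\<lambda>_. 0) (\<lambda>_. \<epsilon>) \<and>
    (\<forall>i. graded_matrix n (r (Suc i)) (s (Suc i)) (r i) (s i) (\<phi> (Suc i))) \<and>
    (\<forall>p\<in>carrier (poly_ring n). \<exists>u\<in>free_module n (r 0). p - (\<Sum>l<r 0. \<epsilon> l * u l) \<in> I) \<and>
    {u \<in> free_module n (r 0). (\<Sum>l<r 0. \<epsilon> l * u l) \<in> I}
      = matrix_apply (r 1) (r 0) (\<phi> 1) ` free_module n (r 1) \<and>
    (\<forall>i. {u \<in> free_module n (r (i + 1)).
            matrix_apply (r (i + 1)) (r i) (\<phi> (i + 1)) u = (\<lambda>m\<in>{..<r i}. 0)}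
      = matrix_apply (r (i + 2)) (r (i + 1)) (\<phi> (i + 2)) ` free_module n (r (i + 2))) \<and>
    (\<forall>i. \<forall>m<r i. \<forall>l<r (Suc i). Poly_Mapping.lookup (\<phi> (Suc i) m l) 0 = 0)"

text \<open>
  The regularity of $S/I$ is the supremum of $j - i$ over all \<open>i\<close> and all degrees \<open>j\<close> of basis
  elements of $F_i$, for the minimal graded free resolution $F$ of $S/I$.  As $F$ is unique up to
  isomorphism, the infimum is over a set with a single element.  The regularity of the zero
  module is \<open>-\<infinity>\<close>.
\<close>

definition regularity :: "nat \<Rightarrow> 'k::field polynomial set \<Rightarrow> ereal"
  where "regularity n I =
    Inf {SUP (i, l)\<in>{(i, l). l < r i}. ereal (real_of_int (s i l - int i)) | r s.
         \<exists>\<epsilon> \<phi>. minimal_free_resolution n I r s \<epsilon> \<phi>}"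

text \<open>
  The vertex set is $\{0, \dots, n-1\}$; as $\{v\} \notin \Delta$ is allowed, so are variables
  among the generators of the Stanley--Reisner ideal.
\<close>

definition simplicial_complex :: "nat \<Rightarrow> nat set set \<Rightarrow> bool"
  where "simplicial_complex n \<Delta> \<longleftrightarrow> \<Delta> \<subseteq> Pow {..<n} \<and> (\<forall>M\<in>\<Delta>. \<forall>N\<subseteq>M. N \<in> \<Delta>)"

definition simplicial_dim :: "nat set set \<Rightarrow> ereal"
  where "simplicial_dim \<Delta> = (SUP M\<in>\<Delta>. ereal (real (card M) - 1))"

definition stanley_reisner_ideal :: "nat \<Rightarrow> nat set set \<Rightarrow> 'k::field polynomial set"
  where "stanley_reisner_ideal n \<Delta> =
    Idl\<^bsub>poly_ring n\<^esub> {\<Prod>v\<in>M. var v | M. M \<subseteq> {..<n} \<and> M \<notin> \<Delta>}"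


section \<open>Golod rings\<close>

definition quotient_koszul ::
  "nat \<Rightarrow> 'k::field polynomial set \<Rightarrow> (nat set \<Rightarrow> 'k polynomial set) dga"
  where "quotient_koszul n I =
    koszul (poly_ring n Quot I) n (\<lambda>i. I +>\<^bsub>poly_ring n\<^esub> var i)"

definition golod :: "nat \<Rightarrow> 'k::field polynomial set \<Rightarrow> bool"
  where "golod n I \<longleftrightarrow>
    trivial_product (quotient_koszul n I) \<and> trivial_higher_massey_products (quotient_koszul n I)"

end

theory Submission
  imports Defs "HOL-Library.Function_Algebras"
begin

text \<open>
  Everything is graded by \<open>\<nat>\<^sup>n\<close>. To a word of homogeneous non-bounding cycles one attaches, as long as the
  obstructions of its proper subwords bound, an obstruction cycle whose degree \<open>m\<close> is the sum of those of the letters.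
  Gauge transformations reduce an arbitrary defining system to words, so it suffices that every obstruction bounds.

  Contraction by \<open>e\<^sub>v\<close> turns obstructions into sums of obstructions of smaller degree, which settles the case that a quadratic
  generator divides \<open>x\<^sup>m\<close>. Otherwise every letter lies in strand at least 2 (internal minus homological degree),
  so the obstruction of three or more letters lies in strand at least 5; this settles (1), (5), (6) and (7).

  In the other cases the degrees of the letters may be assumed coprime: if two of them involve \<open>v\<close>, the letters can be moved to a
  sub-DGA in which products of elements of positive degree in \<open>v\<close> vanish. In (2), nonzero homology in degree \<open>m\<close> lies in
  homological degree the number of generators dividing \<open>x\<^sup>m\<close>; this number is additive along a word, the degree of the obstruction is not.
  In (3) and (4), the trivial product yields, for two coprime generators, a third one dividing their product. For (4)
  this makes the homology in degree \<open>m\<close> vanish; for (3) it leaves words of length three and six or seven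
  generators, where the obstruction is computed from explicit cycles.
\<close>

section \<open>The exterior algebra\<close>

text \<open>Triviality of the product settles words of length two, but a primitive is unique only up
  to cycles, so the obstruction of a longer word depends on the choices made inside it. Here one
  primitive \<open>gam w\<close> is fixed for every word, and a different choice is accounted for by
  additional words: the class of the cycle added on an interval becomes a single letter on that
  interval. Such words have the same degree and fewer letters. This is why words are ordered by
  degree first and by length second, and why all words are treated at once instead of one Massey
  product at a time. The degree m part of the Koszul complex is the chain complex of a simplex
  relative to a subcomplex. By \<open>Lam_iff\<close> its basis consists of the hitting sets of the
  sets \<open>full m g\<close>, with g running over the generators that divide m; homology is then
  computed by arguments on hitting sets. The number seven: k pairwise coprime letters require k
  generators dividing the letters and a further one for each of the k(k-1)/2 pairs, all distinct.
  These are 6 for k = 3, which leaves room for one more generator, and 10 for k = 4.\<close>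

lemma sign_shuffle: "(-1) ^ (a + b) * ((-1) ^ (b + c) * (f * g)) = (-1) ^ c * ((-1::'r::comm_ring_1) ^ a * f * g)"
 by (simp add: power_add mult_ac)

text \<open>The exterior product as an operation on all functions of sets. For an infinite U the sum
  ranges over an infinite set and is therefore 0, which lets associativity and the Leibniz rule hold
  on the whole type.\<close>

definition emul :: "(nat set => 'r) => (nat set => 'r) => nat set => 'r::comm_ring_1"
 where "emul f g U = (\<Sum>V\<in>Pow U. (-1) ^ inversions V (U - V) * (f V * g (U - V)))"

text \<open>The grading involution. With it the Leibniz rule and the signs in Massey products can be
  written without mentioning degrees.\<close>

definition esg :: "(nat set => 'r) => nat set => 'r::comm_ring_1"
 where "esg f U = (-1) ^ card U * f U"

definition below :: "nat set => nat => nat"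
 where "below U i = card {j \<in> U. j < i}"

text \<open>Interior multiplication by the dual of e_i. The Koszul differential \<open>ediff\<close>
  is a linear combination of these operators, so its properties follow from theirs: they
  anticommute, have square zero and are antiderivations.\<close>

definition contr :: "nat => (nat set => 'r) => nat set => 'r::comm_ring_1"
 where "contr i f U = (if i \<in> U then 0 else (-1) ^ below U i * f (insert i U))"

definition wedge :: "nat => (nat set => 'r) => nat set => 'r::comm_ring_1"
 where "wedge i f U = (if i \<in> U then (-1) ^ below U i * f (U - {i}) else 0)"

definition ediff :: "nat => (nat => 'r) => (nat set => 'r) => nat set => 'r::comm_ring_1"
 where "ediff n x f U = (\<Sum>i<n. x i * contr i f U)"

lemma emul_infinite [simp]: "infinite U ==> emul f g U = 0" by (simp add: emul_def)

lemma esg_esg [simp]: "esg (esg f) = f" by (simp add: esg_def fun_eq_iff flip: mult.assoc power_add mult_2)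

lemma contr_self [simp]: "contr i (contr i f) U = 0" by (simp add: contr_def)

section \<open>Signs and the exterior product\<close>

lemma inversions_Un_left:
 assumes "finite V" "finite W" "finite X" "V \<inter> W = {}"
 shows "inversions (V \<union> W) X = inversions V X + inversions W X"
proof -
 have "{(u, w). u \<in> V \<union> W & w \<in> X & w < u} =
   {(u, w). u \<in> V & w \<in> X & w < u} \<union> {(u, w). u \<in> W & w \<in> X & w < u}" by auto
 moreover have "finite {(u, w). u \<in> V & w \<in> X & w < u}"
  by (rule finite_subset[of _ "V \<times> X"]) (use assms in auto)
 moreover have "finite {(u, w). u \<in> W & w \<in> X & w < u}"
  by (rule finite_subset[of _ "W \<times> X"]) (use assms in auto)
 ultimately show ?thesis unfolding inversions_def using assms(4) by (subst card_Un_disjoint[symmetric]) auto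
qed

lemma inversions_Un_right:
 assumes "finite V" "finite W" "finite X" "V \<inter> W = {}"
 shows "inversions X (V \<union> W) = inversions X V + inversions X W"
proof -
 have "{(u, w). u \<in> X & w \<in> V \<union> W & w < u} =
   {(u, w). u \<in> X & w \<in> V & w < u} \<union> {(u, w). u \<in> X & w \<in> W & w < u}" by auto
 moreover have "finite {(u, w). u \<in> X & w \<in> V & w < u}"
  by (rule finite_subset[of _ "X \<times> V"]) (use assms in auto)
 moreover have "finite {(u, w). u \<in> X & w \<in> W & w < u}"
  by (rule finite_subset[of _ "X \<times> W"]) (use assms in auto)
 ultimately show ?thesis unfolding inversions_def using assms(4) by (subst card_Un_disjoint[symmetric]) auto
qed

lemma inversions_singleton_left: "inversions {i} X = below X i"
proof -
 have "{(u, w). u \<in> {i} & w \<in> X & w < u} = Pair i ` {j \<in> X. j < i}" by auto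
 thus ?thesis by (simp add: inversions_def below_def card_image inj_on_def)
qed

lemma inversions_singleton_right: "inversions X {i} = card {j \<in> X. i < j}"
proof -
 have "{(u, w). u \<in> X & w \<in> {i} & w < u} = (%j. (j, i)) ` {j \<in> X. i < j}" by auto
 thus ?thesis by (simp add: inversions_def card_image inj_on_def)
qed

lemma inversions_empty [simp]: "inversions {} X = 0" "inversions X {} = 0" by (simp_all add: inversions_def)

lemma below_Un:
 assumes "finite V" "finite W" "V \<inter> W = {}"
 shows "below (V \<union> W) i = below V i + below W i"
proof -
 have "{j \<in> V \<union> W. j < i} = {j \<in> V. j < i} \<union> {j \<in> W. j < i}" by auto
 thus ?thesis unfolding below_def using assms by (subst card_Un_disjoint[symmetric]) auto
qed

lemma below_insert_self [simp]: "below (insert i U) i = below U i"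
 unfolding below_def by (rule arg_cong[where f = card]) auto

lemma below_remove_self [simp]: "below (U - {i}) i = below U i"
 by (auto simp: below_def intro!: arg_cong[where f = card])

lemma card_below_above:
 assumes "finite V" "i ~: V"
 shows "card V = below V i + card {j \<in> V. i < j}"
proof -
 have "V = {j \<in> V. j < i} \<union> {j \<in> V. i < j}" using assms(2) by (auto) (metis linorder_neqE_nat)
 hence "card V = card ({j \<in> V. j < i} \<union> {j \<in> V. i < j})" by simp
 also have "... = below V i + card {j \<in> V. i < j}"
  unfolding below_def using assms by (subst card_Un_disjoint) auto
 finally show ?thesis .
qed

lemma below_insert:
 assumes "finite U" "j ~: U"
 shows "below (insert j U) i = below U i + (if j < i then 1 else 0)"
proof -
 have "{k \<in> insert j U. k < i} = (if j < i then insert j {k \<in> U. k < i} else {k \<in> U. k < i})" by auto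
 thus ?thesis using assms by (simp add: below_def)
qed

text \<open>Both sides are sums over the ordered partitions of U into three blocks, and the exponent
  of the sign counts the inversions between all three pairs of blocks.\<close>

lemma emul_assoc: "emul (emul f g) h = emul f (emul g h)"
proof
 fix U
 show "emul (emul f g) h U = emul f (emul g h) U"
 proof (cases "finite U")
  case True
  let ?t = "%W X. (-1) ^ (inversions W X + inversions W (U - W - X) + inversions X (U - W - X)) * (f W * g X * h (U - W - X))"
  have "emul (emul f g) h U = (\<Sum>V\<in>Pow U. \<Sum>W\<in>Pow V. ?t W (V - W))"
  proof -
   have "(-1) ^ inversions V (U - V) * (emul f g V * h (U - V)) = (\<Sum>W\<in>Pow V. ?t W (V - W))" if "V \<in> Pow U" for V
   proof -
    have "(-1) ^ inversions V (U - V) * ((-1) ^ inversions W (V - W) * (f W * g (V - W)) * h (U - V)) = ?t W (V - W)"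
     if "W \<in> Pow V" for W
    proof -
     have W: "W \<subseteq> V" "V \<subseteq> U" using that \<open>V \<in> Pow U\<close> by auto
     have fin: "finite V" "finite W" using W True by (auto intro: finite_subset)
     have eq: "U - W - (V - W) = U - V" using W by auto
     have "inversions (W \<union> (V - W)) (U - V) = inversions W (U - V) + inversions (V - W) (U - V)"
      by (rule inversions_Un_left) (use fin True in auto)
     hence "inversions V (U - V) = inversions W (U - V) + inversions (V - W) (U - V)"
      using W by (simp add: Un_absorb1)
     thus ?thesis unfolding eq by (simp add: power_add algebra_simps)
    qed
    thus ?thesis by (simp add: emul_def sum_distrib_left sum_distrib_right)
   qed
   thus ?thesis unfolding emul_def[of "emul f g"] by (intro sum.cong) auto
  qed
  also have "... = (\<Sum>(V,W)\<in>Sigma (Pow U) Pow. ?t W (V - W))"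
   by (rule sum.Sigma) (insert True, auto intro: finite_subset)
  also have "... = (\<Sum>(W,X)\<in>Sigma (Pow U) (%W. Pow (U - W)). ?t W X)"
   by (rule sum.reindex_bij_witness[where j = "%(V,W). (W, V - W)" and i = "%(W,X). (W \<union> X, W)"]) auto
  also have "... = (\<Sum>W\<in>Pow U. \<Sum>X\<in>Pow (U - W). ?t W X)"
   by (rule sum.Sigma[symmetric]) (insert True, auto intro: finite_subset)
  also have "... = emul f (emul g h) U"
  proof -
   have "(-1) ^ inversions W (U - W) * (f W * ((-1) ^ inversions X (U - W - X) * (g X * h (U - W - X)))) = ?t W X"
    if "W \<in> Pow U" "X \<in> Pow (U - W)" for W X
   proof -
    have fin: "finite X" "finite W" using that True by (auto intro: finite_subset)
    have "inversions W (X \<union> (U - W - X)) = inversions W X + inversions W (U - W - X)"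
     by (rule inversions_Un_right) (use fin True in auto)
    moreover have "X \<union> (U - W - X) = U - W" using that by auto
    ultimately show ?thesis by (simp add: power_add algebra_simps)
   qed
   thus ?thesis unfolding emul_def[of f] emul_def[of g] sum_distrib_left by (intro sum.cong refl) auto
  qed
  finally show ?thesis .
 qed simp
qed

lemma emul_add_left: "emul (%U. f U + f' U) g = (%U. emul f g U + emul f' g U)"
 and emul_add_right: "emul f (%U. g U + g' U) = (%U. emul f g U + emul f g' U)"
 by (rule ext; simp add: emul_def sum.distrib[symmetric] algebra_simps)+

lemma esg_emul: "esg (emul f g) = emul (esg f) (esg g)"
proof
 fix U
 show "esg (emul f g) U = emul (esg f) (esg g) U"
 proof (cases "finite U")
  case True
  have "(-1) ^ card U * ((-1) ^ inversions V (U - V) * (f V * g (U - V))) =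
    (-1) ^ inversions V (U - V) * (((-1) ^ card V * f V) * ((-1) ^ card (U - V) * g (U - V)))" if "V \<in> Pow U" for V
  proof -
   have "card U = card V + card (U - V)" using that True
    by (metis Diff_subset PowD card_Diff_subset card_mono finite_subset le_add_diff_inverse)
   thus ?thesis by (simp add: power_add algebra_simps)
  qed
  thus ?thesis by (simp add: esg_def emul_def sum_distrib_left)
 qed (simp add: esg_def)
qed

lemma contr_contr: "contr i (contr j f) U = - contr j (contr i f) U" if "finite U"
proof -
 consider "i \<in> U | j \<in> U | i = j" | "i ~: U" "j ~: U" "i < j" | "i ~: U" "j ~: U" "j < i" by force
 thus ?thesis by cases (insert that, auto simp: contr_def below_insert insert_commute power_add)
qed

text \<open>Split the subsets according to whether they contain i. For i not in U this gives the two
  summands, \<open>esg\<close> being the sign of moving e_i past the first factor. For i in U the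
  left side is 0, and on the right the terms of V and of \<open>insert i V\<close> cancel.\<close>

lemma contr_emul:
 "contr i (emul f g) U = emul (contr i f) g U + emul (esg f) (contr i g) U"
proof (cases "finite U")
 case False
 hence "infinite (insert i U)" by simp
 with False show ?thesis by (simp add: contr_def)
next
 case fin: True
 show ?thesis
 proof (cases "i \<in> U")
  case True
  let ?W = "U - {i}"
  have U: "U = insert i ?W" using True by auto
  have sp: "(\<Sum>V\<in>Pow U. F V) = (\<Sum>V\<in>Pow ?W. F V + F (insert i V))" for F :: "nat set => 'a"
  proof -
   have "Pow U = Pow ?W \<union> insert i ` Pow ?W" using Pow_insert[of i ?W] U by simp
   moreover have "sum F (Pow ?W \<union> insert i ` Pow ?W) = sum F (Pow ?W) + sum F (insert i ` Pow ?W)"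
    by (rule sum.union_disjoint) (use fin in auto)
   moreover have "inj_on (insert i) (Pow ?W)" by (auto simp: inj_on_def)
   ultimately show ?thesis by (simp add: sum.reindex sum.distrib)
  qed
  have "(-1) ^ inversions V (U - V) * (contr i f V * g (U - V)) +
    (-1) ^ inversions (insert i V) (U - insert i V) * (contr i f (insert i V) * g (U - insert i V)) +
    ((-1) ^ inversions V (U - V) * (esg f V * contr i g (U - V)) +
    (-1) ^ inversions (insert i V) (U - insert i V) * (esg f (insert i V) * contr i g (U - insert i V))) = 0"
   if "V \<in> Pow ?W" for V
  proof -
   let ?X = "U - insert i V"
   have V: "finite V" "i ~: V" "finite ?X" "i ~: ?X" using that fin by (auto intro: finite_subset)
   have UV: "U - V = insert i ?X" "insert i ?X = {i} \<union> ?X" "insert i V = {i} \<union> V" using that True by auto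
   have 1: "inversions V (insert i ?X) = card {j \<in> V. i < j} + inversions V ?X"
    unfolding UV(2) using V by (subst inversions_Un_right) (auto simp: inversions_singleton_right)
   have 2: "inversions (insert i V) ?X = below ?X i + inversions V ?X"
    unfolding UV(3) using V by (subst inversions_Un_left) (auto simp: inversions_singleton_left)
   have 3: "card V = below V i + card {j \<in> V. i < j}" by (rule card_below_above) (use V in auto)
   have "contr i g (insert i ?X) = 0" "contr i f (insert i V) = 0" by (auto simp: contr_def)
   moreover have "contr i f V = (-1) ^ below V i * f (insert i V)" "contr i g ?X = (-1) ^ below ?X i * g (insert i ?X)"
    using V by (auto simp: contr_def)
   moreover have "esg f (insert i V) = (-1) ^ (card V + 1) * f (insert i V)" using V by (simp add: esg_def)
   ultimately show ?thesis unfolding UV(1) 1 2 3 by (simp add: power_add algebra_simps)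
  qed
  hence "emul (contr i f) g U + emul (esg f) (contr i g) U = 0"
   unfolding emul_def sp sum.distrib[symmetric] by (intro sum.neutral) auto
  thus ?thesis using True by (simp add: contr_def)
 next
  case False
  have Pow: "Pow (insert i U) = Pow U \<union> insert i ` Pow U" by (rule Pow_insert)
  have sp: "(\<Sum>V\<in>Pow (insert i U). F V) = (\<Sum>V\<in>Pow U. F (insert i V)) + (\<Sum>V\<in>Pow U. F V)" for F :: "nat set => 'a"
  proof -
   have "sum F (Pow U \<union> insert i ` Pow U) = sum F (Pow U) + sum F (insert i ` Pow U)"
    by (rule sum.union_disjoint) (use fin False in auto)
   moreover have "inj_on (insert i) (Pow U)" using False by (auto simp: inj_on_def)
   ultimately show ?thesis by (simp add: Pow sum.reindex add.commute)
  qed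
  have a: "(-1) ^ below U i * ((-1) ^ inversions (insert i V) (insert i U - insert i V) *
       (f (insert i V) * g (insert i U - insert i V))) =
     (-1) ^ inversions V (U - V) * (contr i f V * g (U - V))" if "V \<in> Pow U" for V
  proof -
   let ?X = "U - V"
   have V: "finite V" "i ~: V" "finite ?X" "i ~: ?X" using that fin False by (auto intro: finite_subset)
   have X: "insert i U - insert i V = ?X" "insert i V = {i} \<union> V" using False by auto
   have 2: "inversions (insert i V) ?X = below ?X i + inversions V ?X"
    unfolding X(2) using V by (subst inversions_Un_left) (auto simp: inversions_singleton_left)
   have "below (V \<union> ?X) i = below V i + below ?X i" by (rule below_Un) (use V in auto)
   moreover have "V \<union> ?X = U" using that by auto
   ultimately have e: "below U i = below V i + below ?X i" by (simp only:)
   show ?thesis unfolding X(1) 2 e sign_shuffle using V by (simp add: contr_def)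
  qed
  have b: "(-1) ^ below U i * ((-1) ^ inversions V (insert i U - V) *
       (f V * g (insert i U - V))) =
     (-1) ^ inversions V (U - V) * (esg f V * contr i g (U - V))" if "V \<in> Pow U" for V
  proof -
   let ?X = "U - V"
   have V: "finite V" "i ~: V" "finite ?X" "i ~: ?X" using that fin False by (auto intro: finite_subset)
   have X: "insert i U - V = insert i ?X" "insert i ?X = {i} \<union> ?X" using V by auto
   have 1: "inversions V (insert i ?X) = card {j \<in> V. i < j} + inversions V ?X"
    unfolding X(2) using V by (subst inversions_Un_right) (auto simp: inversions_singleton_right)
   have "below (V \<union> ?X) i = below V i + below ?X i" by (rule below_Un) (use V in auto)
   moreover have "V \<union> ?X = U" using that by auto
   moreover have 3: "card V = below V i + card {j \<in> V. i < j}" by (rule card_below_above) (use V in auto)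
   ultimately show ?thesis unfolding X(1) 1 using V by (simp add: contr_def esg_def power_add)
  qed
  have "contr i (emul f g) U = (-1) ^ below U i * emul f g (insert i U)" using False by (simp add: contr_def)
  also have "... = (\<Sum>V\<in>Pow U. (-1) ^ below U i * ((-1) ^ inversions (insert i V) (insert i U - insert i V) *
       (f (insert i V) * g (insert i U - insert i V)))) +
     (\<Sum>V\<in>Pow U. (-1) ^ below U i * ((-1) ^ inversions V (insert i U - V) * (f V * g (insert i U - V))))"
   by (simp only: emul_def sp sum_distrib_left distrib_left)
  also have "... = emul (contr i f) g U + emul (esg f) (contr i g) U"
   unfolding emul_def by (intro arg_cong2[where f = "(+)"] sum.cong refl a b)
  finally show ?thesis .
 qed
qed

lemma contr_esg: "contr i (esg f) U = - esg (contr i f) U" if "finite U" using that by (auto simp: contr_def esg_def)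

text \<open>One of the two composites of \<open>contr i\<close> and \<open>wedge i\<close> is the
  projection to the sets avoiding i, the other the projection to the sets containing i.\<close>

lemma contr_wedge: "contr i (wedge i f) U = f U - wedge i (contr i f) U"
 by (auto simp: contr_def wedge_def insert_absorb minus_one_power_iff)

lemma contr_wedge_ne: "contr i (wedge j f) U = - wedge j (contr i f) U" if "finite U" "i ~= j"
proof -
 consider "j ~: U" | "i \<in> U" | "j \<in> U" "i ~: U" by blast
 thus ?thesis
 proof cases
  case 3
  define W where "W = U - {j}"
  have U: "U = insert j W" "j ~: W" "i ~: W" "finite W" using 3 that unfolding W_def by auto
  have "insert i U - {j} = insert i W" using U that by auto
  moreover have "i < j | j < i" using that by auto
  ultimately show ?thesis using that U by (auto simp: contr_def wedge_def below_insert insert_commute)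
 qed (insert that, auto simp: contr_def wedge_def)
qed

text \<open>The terms of (i, j) and (j, i) cancel by anticommutation. The diagonal is treated
  separately with \<open>contr_self\<close>, since in characteristic 2 anticommutation says nothing
  about it.\<close>

lemma ediff_ediff: "ediff n x (ediff n x f) U = 0" if "finite U"
proof -
 have c: "contr i (ediff n x f) U = (\<Sum>j<n. x j * contr i (contr j f) U)" for i
  by (simp add: ediff_def contr_def sum_distrib_left algebra_simps)
 have "ediff n x (ediff n x f) U = (\<Sum>i<n. \<Sum>j<n. x i * x j * contr i (contr j f) U)"
  by (simp add: ediff_def[of n x "ediff n x f"] c sum_distrib_left mult.assoc)
 define S where "S = (\<Sum>i<n. \<Sum>j<n. x i * x j * contr i (contr j f) U)"
 have "S = (\<Sum>p\<in>{..<n}\<times>{..<n}. x (fst p) * x (snd p) * contr (fst p) (contr (snd p) f) U)" (is "_ = sum ?F _")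
  unfolding S_def by (simp add: sum.cartesian_product case_prod_unfold)
 also have "... = sum ?F {p\<in>{..<n}\<times>{..<n}. fst p < snd p} + sum ?F {p\<in>{..<n}\<times>{..<n}. ~ fst p < snd p}"
  by (subst sum.union_disjoint[symmetric]) (auto intro!: sum.cong)
 also have "sum ?F {p\<in>{..<n}\<times>{..<n}. ~ fst p < snd p} = sum ?F {p\<in>{..<n}\<times>{..<n}. snd p < fst p}"
 proof (rule sum.mono_neutral_right)
  show "\<forall>p\<in>{p\<in>{..<n}\<times>{..<n}. ~ fst p < snd p} - {p\<in>{..<n}\<times>{..<n}. snd p < fst p}. ?F p = 0"
  proof
   fix p assume "p \<in> {p\<in>{..<n}\<times>{..<n}. ~ fst p < snd p} - {p\<in>{..<n}\<times>{..<n}. snd p < fst p}"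
   then obtain i where "p = (i, i)" by (cases p) auto
   thus "?F p = 0" by simp
  qed
 qed auto
 also have "... = (\<Sum>p\<in>{p\<in>{..<n}\<times>{..<n}. fst p < snd p}. - ?F p)"
  by (rule sum.reindex_bij_witness[where i = prod.swap and j = prod.swap])
    (auto simp: contr_contr[OF that, of "snd _" "fst _"] mult.commute[of "x (snd _)"])
 finally have "S = 0" by (simp add: sum_negf)
 thus ?thesis using \<open>ediff n x (ediff n x f) U = _\<close> S_def by simp
qed

lemma emul_scale_right: "emul f (%V. c * g V) = (%U. c * emul f g U)"
 and emul_scale_left: "emul (%V. c * f V) g = (%U. c * emul f g U)"
 by (rule ext; simp add: emul_def sum_distrib_left mult_ac)+

lemma emul_sum_right: "emul f (%V. \<Sum>i\<in>S. g i V) U = (\<Sum>i\<in>S. emul f (g i) U)"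
 and emul_sum_left: "emul (%V. \<Sum>i\<in>S. g' i V) h U = (\<Sum>i\<in>S. emul (g' i) h U)"
  by (simp_all add: emul_def sum_distrib_left sum_distrib_right sum.swap[of _ S])

lemma ediff_emul: "ediff n x (emul f g) U = emul (ediff n x f) g U + emul (esg f) (ediff n x g) U"
proof -
 have "emul (ediff n x f) g U = (\<Sum>i<n. x i * emul (contr i f) g U)"
  using emul_sum_left[of "%i V. x i * contr i f V" "{..<n}" g U]
  by (simp add: ediff_def[abs_def] emul_scale_left)
 moreover have "emul (esg f) (ediff n x g) U = (\<Sum>i<n. x i * emul (esg f) (contr i g) U)"
  using emul_sum_right[of "esg f" "%i V. x i * contr i g V" "{..<n}" U]
  by (simp add: ediff_def[abs_def] emul_scale_right)
 ultimately show ?thesis by (simp add: ediff_def[of n x "emul f g"] contr_emul distrib_left sum.distrib)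
qed

lemma ediff_esg: "ediff n x (esg f) U = - esg (ediff n x f) U" if "finite U"
 by (simp add: ediff_def contr_esg[OF that] esg_def sum_distrib_left mult_ac sum_negf)

lemma contr_ediff: "contr i (ediff n x f) U = - ediff n x (contr i f) U" if "finite U"
proof -
 have "contr i (ediff n x f) U = (\<Sum>j<n. x j * contr i (contr j f) U)"
  by (simp add: ediff_def contr_def sum_distrib_left algebra_simps)
 thus ?thesis by (simp add: ediff_def contr_contr[OF that, of i] sum_negf)
qed

text \<open>Exterior multiplication by e_v is a homotopy between multiplication by x_v and 0. If all
  coefficients are 1 it is a contracting homotopy, which is the source of
  \<open>cone\<close>.\<close>

lemma ediff_wedge:
 assumes "finite U" "v < n"
 shows "ediff n x (wedge v f) U = x v * f U - wedge v (ediff n x f) U"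
proof -
 have "contr i (wedge v f) U = (if i = v then f U else 0) - wedge v (contr i f) U" for i
  using contr_wedge[of v f U] contr_wedge_ne[OF assms(1), of i v f] by (cases "i = v") auto
 hence "ediff n x (wedge v f) U = (\<Sum>i<n. x i * (if i = v then f U else 0)) - (\<Sum>i<n. x i * wedge v (contr i f) U)"
  by (simp add: ediff_def right_diff_distrib sum_subtractf)
 also have "(\<Sum>i<n. x i * (if i = v then f U else 0)) = x v * f U"
  using assms(2) by (simp add: if_distrib[where f = "%z. _ * z"] cong: if_cong)
 also have "(\<Sum>i<n. x i * wedge v (contr i f) U) = wedge v (ediff n x f) U"
  by (simp add: wedge_def ediff_def sum_distrib_left algebra_simps)
 finally show ?thesis .
qed

definition ee :: "nat set => nat set => 'r::comm_ring_1"
 where "ee V U = (if U = V then 1 else 0)"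

lemma emul_ee_singleton: "emul (ee {v}) f U = wedge v f U" if "finite U"
proof (cases "v \<in> U")
 case True
 have "emul (ee {v}) f U = (\<Sum>V\<in>Pow U. if V = {v} then (-1) ^ inversions {v} (U - {v}) * f (U - {v}) else 0)"
  unfolding emul_def by (rule sum.cong) (auto simp: ee_def)
 thus ?thesis using True that by (simp add: wedge_def inversions_singleton_left)
next
 case False
 thus ?thesis unfolding emul_def by (intro trans[OF sum.neutral]) (auto simp: ee_def wedge_def)
qed

lemma emul_ee_ee:
 assumes "finite V" "finite W"
 shows "emul (ee V) (ee W) = (%U. if V \<inter> W = {} then (-1) ^ inversions V W * ee (V \<union> W) U else 0)"
proof
 fix U
 show "emul (ee V) (ee W) U = (if V \<inter> W = {} then (-1) ^ inversions V W * ee (V \<union> W) U else (0::'a))"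
 proof (cases "finite U")
  case True
  have "emul (ee V) (ee W) U = (\<Sum>X\<in>Pow U. if X = V then (-1) ^ inversions V (U - V) * ee W (U - V) else (0::'a))"
   unfolding emul_def by (rule sum.cong) (auto simp: ee_def)
  also have "... = (if V \<subseteq> U then (-1) ^ inversions V (U - V) * ee W (U - V) else (0::'a))" using True by simp
  also have "... = (if V \<inter> W = {} then (-1) ^ inversions V W * ee (V \<union> W) U else (0::'a))"
   by (cases "V \<subseteq> U & U - V = W") (auto simp: ee_def)
  finally show ?thesis .
 next
  case False
  with assms show ?thesis by (auto simp: ee_def)
 qed
qed

section \<open>Maurer--Cartan systems\<close>

text \<open>A path is stored as the list of its steps, each given by its end point and a label from
  the label set of the interval passed. The labels form a word, so a sum over paths distributes the
  letters of words over consecutive intervals.\<close>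

fun ispath :: "(nat => nat => 'b set) => nat => (nat \<times> 'b) list => nat => bool" where
 "ispath H x [] y \<longleftrightarrow> x = y"
| "ispath H x ((z, b) # p) y \<longleftrightarrow> x < z & b \<in> H x z & ispath H z p y"

definition paths :: "(nat => nat => 'b set) => nat => nat => (nat \<times> 'b) list set"
 where "paths H x y = {p. ispath H x p y}"

definition stop :: "nat => (nat \<times> 'b) list => nat"
 where "stop x p = (if p = [] then x else fst (last p))"

lemma ispath_stop: "ispath H x p y ==> stop x p = y"
 by (induction p arbitrary: x) (auto simp: stop_def split: if_splits)

lemma ispath_le: "ispath H x p y ==> x + length p <= y" by (induction p arbitrary: x) fastforce+

lemma ispath_less: "ispath H x p y ==> p ~= [] ==> x < y"
 using ispath_le[of H x p y] by (cases p) auto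

lemma ispath_append: "ispath H x (p @ q) y \<longleftrightarrow> ispath H x p (stop x p) & ispath H (stop x p) q y"
proof (induction p arbitrary: x)
 case (Cons a p)
 obtain z b where "a = (z, b)" by force
 moreover have "stop x ((z, b) # p) = stop z p" by (simp add: stop_def)
 ultimately show ?case using Cons by auto
qed (simp add: stop_def)

lemma ispath_mono: "ispath H x p y ==> (!!u v. x <= u ==> u < v ==> v <= y ==> H u v \<subseteq> H' u v) ==> ispath H' x p y"
proof (induction p arbitrary: x)
 case (Cons a p)
 obtain z b where a: "a = (z, b)" by force
 with Cons.prems have "x < z" "b \<in> H x z" "ispath H z p y" by auto
 moreover have "z <= y" using ispath_le[OF \<open>ispath H z p y\<close>] by simp
 moreover have "ispath H' z p y"
  by (rule Cons.IH) (use Cons.prems \<open>x < z\<close> \<open>ispath H z p y\<close> in auto)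
 ultimately show ?case using a Cons.prems(2)[of x z] by auto
qed simp

text \<open>No step of a path with at least two steps covers the whole interval.\<close>

lemma ispath_mono2:
 assumes "ispath H x p y" "length p >= 2"
  "!!u v. x <= u ==> u < v ==> v <= y ==> (u, v) ~= (x, y) ==> H u v \<subseteq> H' u v"
 shows "ispath H' x p y"
proof -
 obtain z b q where p: "p = (z, b) # q" "q ~= []" using assms(2) by (cases p; cases "tl p") auto
 with assms have z: "x < z" "b \<in> H x z" "ispath H z q y" by auto
 have "z < y" using ispath_less z(3) p(2) by metis
 moreover have "ispath H' z q y" by (rule ispath_mono[OF z(3)]) (use assms(3) z in auto)
 ultimately show ?thesis using p z assms(3)[of x z] by auto
qed

lemma finite_paths:
 assumes "!!u v. x <= u ==> u < v ==> v <= y ==> finite (H u v)"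
 shows "finite (paths H x y)"
proof -
 let ?L = "\<Union>u\<in>{x..y}. \<Union>v\<in>{u<..y}. H u v"
 have "set p \<subseteq> {x..y} \<times> ?L" if "ispath H x p y" for p
 proof -
  have "set p \<subseteq> {x'..y} \<times> (\<Union>u\<in>{x'..y}. \<Union>v\<in>{u<..y}. H u v)" if "ispath H x' p y" for x'
   using that
  proof (induction p arbitrary: x')
   case (Cons a p)
   obtain z b where a: "a = (z, b)" by force
   with Cons.prems have z: "x' < z" "b \<in> H x' z" "ispath H z p y" by auto
   have "z <= y" using ispath_le[OF z(3)] by simp
   with z have "(z, b) \<in> {x'..y} \<times> (\<Union>u\<in>{x'..y}. \<Union>v\<in>{u<..y}. H u v)" by force
   moreover have "{z..y} \<times> (\<Union>u\<in>{z..y}. \<Union>v\<in>{u<..y}. H u v) \<subseteq> {x'..y} \<times> (\<Union>u\<in>{x'..y}. \<Union>v\<in>{u<..y}. H u v)"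
    using z(1) by (intro Sigma_mono UN_mono) auto
   ultimately show ?case using Cons.IH[OF z(3)] a by auto
  qed simp
  thus ?thesis using that by blast
 qed
 hence "paths H x y \<subseteq> {p. set p \<subseteq> {x..y} \<times> ?L & length p <= y - x}"
  unfolding paths_def using ispath_le by fastforce
 moreover have "finite ({x..y} \<times> ?L)" using assms by auto
 ultimately show ?thesis using finite_lists_length_le finite_subset by blast
qed

text \<open>There is no unit: in the model below, the product of 1 and x is the normal form of x
  instead of x. There is no grading either; degrees enter only through the involution
  \<open>sg\<close>.\<close>

locale nudga =
 fixes mul :: "'a::ab_group_add => 'a => 'a" (infixl "\<cdot>" 70)
  and d :: "'a => 'a" and sg :: "'a => 'a"
 assumes mul_assoc: "(x \<cdot> y) \<cdot> z = x \<cdot> (y \<cdot> z)"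
  and mul_add_left: "(x + y) \<cdot> z = x \<cdot> z + y \<cdot> z"
  and mul_add_right: "x \<cdot> (y + z) = x \<cdot> y + x \<cdot> z"
  and d_add: "d (x + y) = d x + d y"
  and d_d: "d (d x) = 0"
  and sg_add: "sg (x + y) = sg x + sg y"
  and sg_mul: "sg (x \<cdot> y) = sg x \<cdot> sg y"
  and sg_sg: "sg (sg x) = x"
  and d_sg: "d (sg x) = - sg (d x)"
  and d_mul: "d (x \<cdot> y) = d x \<cdot> y + sg x \<cdot> d y"
begin

lemma mul_zero [simp]: "0 \<cdot> x = 0" "x \<cdot> 0 = 0"
 using mul_add_left[of 0 0 x] mul_add_right[of x 0 0] by simp_all

lemma d_zero [simp]: "d 0 = 0" and sg_zero [simp]: "sg 0 = 0" using d_add[of 0 0] sg_add[of 0 0] by simp_all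

lemma mul_minus_left: "(- x) \<cdot> y = - (x \<cdot> y)"
 by (rule minus_unique[symmetric]) (simp add: mul_add_left[symmetric])

lemma mul_minus_right: "x \<cdot> (- y) = - (x \<cdot> y)"
 by (rule minus_unique[symmetric]) (simp add: mul_add_right[symmetric])

lemma d_minus: "d (- x) = - d x" by (rule minus_unique[symmetric]) (simp add: d_add[symmetric])

lemma sg_minus: "sg (- x) = - sg x" by (rule minus_unique[symmetric]) (simp add: sg_add[symmetric])

lemma d_diff: "d (x - y) = d x - d y" using d_add[of x "- y"] by (simp add: d_minus)

lemma mul_diff_left: "(x - y) \<cdot> z = x \<cdot> z - y \<cdot> z"
 using mul_add_left[of x "- y" z] by (simp add: mul_minus_left)

lemma mul_diff_right: "x \<cdot> (y - z) = x \<cdot> y - x \<cdot> z"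
 using mul_add_right[of x y "- z"] by (simp add: mul_minus_right)

lemma mul_sum_left: "sum f S \<cdot> y = (\<Sum>i\<in>S. f i \<cdot> y)"
 by (induction S rule: infinite_finite_induct) (auto simp: mul_add_left)

lemma mul_sum_right: "y \<cdot> sum f S = (\<Sum>i\<in>S. y \<cdot> f i)"
 by (induction S rule: infinite_finite_induct) (auto simp: mul_add_right)

lemma d_sum: "d (sum f S) = (\<Sum>i\<in>S. d (f i))" by (induction S rule: infinite_finite_induct) (auto simp: d_add)

lemma sg_sum: "sg (sum f S) = (\<Sum>i\<in>S. sg (f i))"
 by (induction S rule: infinite_finite_induct) (auto simp: sg_add)

definition bar :: "'a => 'a" where "bar x = - sg x"

lemma bar_zero [simp]: "bar 0 = 0" and bar_bar [simp]: "bar (bar x) = x"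
 and bar_add: "bar (x + y) = bar x + bar y"
 and bar_mul: "bar (x \<cdot> y) = - (bar x \<cdot> bar y)" and bar_minus: "bar (- x) = - bar x"
 and d_bar: "d (bar x) = - bar (d x)"
 by (simp_all add: bar_def sg_add sg_minus sg_sg sg_mul mul_minus_left mul_minus_right d_minus d_sg)

lemma bar_diff: "bar (x - y) = bar x - bar y" using bar_add[of x "- y"] by (simp add: bar_minus)

lemma bar_sum: "bar (sum f S) = (\<Sum>i\<in>S. bar (f i))" by (simp add: bar_def sg_sum sum_negf)

text \<open>The product of strictly upper triangular matrices.\<close>

definition mm :: "(nat => nat => 'a) => (nat => nat => 'a) => nat => nat => 'a"
 where "mm A B x y = (\<Sum>z\<in>{x<..<y}. A x z \<cdot> B z y)"

abbreviation bm :: "(nat => nat => 'a) => nat => nat => 'a"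
 where "bm A x y \<equiv> bar (A x y)"

text \<open>The entry (x, y) belongs to the letters x + 1, ..., y. So a_{ij} of a defining system is
  the entry (i - 1, j), and its equations become the Maurer--Cartan equation d A =
  \<open>msum A\<close>.\<close>

definition msum :: "(nat => nat => 'a) => nat => nat => 'a"
 where "msum A = mm (bm A) A"

lemma mm_cong:
 assumes "!!z. x < z ==> z < y ==> A x z = A' x z" "!!z. x < z ==> z < y ==> B z y = B' z y"
 shows "mm A B x y = mm A' B' x y" unfolding mm_def using assms by (intro sum.cong) auto

lemma mm_assoc: "mm (mm A B) C x y = mm A (mm B C) x y"
proof -
 have "mm (mm A B) C x y = (\<Sum>z\<in>{x<..<y}. \<Sum>w\<in>{x<..<z}. A x w \<cdot> (B w z \<cdot> C z y))"
  by (simp add: mm_def mul_sum_left mul_assoc)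
 also have "... = (\<Sum>(z,w)\<in>Sigma {x<..<y} (%z. {x<..<z}). A x w \<cdot> (B w z \<cdot> C z y))"
  by (rule sum.Sigma) auto
 also have "... = (\<Sum>(w,z)\<in>Sigma {x<..<y} (%w. {w<..<y}). A x w \<cdot> (B w z \<cdot> C z y))"
  by (rule sum.reindex_bij_witness[where i = prod.swap and j = prod.swap]) auto
 also have "... = (\<Sum>w\<in>{x<..<y}. \<Sum>z\<in>{w<..<y}. A x w \<cdot> (B w z \<cdot> C z y))"
  by (rule sum.Sigma[symmetric]) auto
 also have "... = mm A (mm B C) x y" by (simp add: mm_def mul_sum_right)
 finally show ?thesis .
qed

lemma mm_add_left: "mm (%x y. A x y + B x y) C x y = mm A C x y + mm B C x y"
 and mm_add_right: "mm A (%x y. B x y + C x y) x y = mm A B x y + mm A C x y"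
 and mm_diff_left: "mm (%x y. A x y - B x y) C x y = mm A C x y - mm B C x y"
 and mm_diff_right: "mm A (%x y. B x y - C x y) x y = mm A B x y - mm A C x y"
 by (simp_all add: mm_def mul_add_left mul_add_right mul_diff_left mul_diff_right sum.distrib sum_subtractf)

lemma bar_mm: "bar (mm A B x y) = - mm (bm A) (bm B) x y" by (simp add: mm_def bar_sum bar_mul sum_negf)

lemma d_mm: "d (mm A B x y) = mm (%x y. d (A x y)) B x y - mm (bm A) (%x y. d (B x y)) x y"
 by (simp add: mm_def d_sum d_mul bar_def mul_minus_left sum.distrib sum_negf)

text \<open>A gauge transformation \<open>b\<close> from \<open>G\<close> to \<open>a\<close> on the proper subintervals of \<open>{x..y}\<close> makes the
 two curvature terms on \<open>{x..y}\<close> cohomologous.\<close>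

lemma gauge_curvature:
 assumes a: "!!u v. x <= u ==> u < v ==> v <= y ==> (u, v) ~= (x, y) ==> d (a u v) = msum a u v"
  and G: "!!u v. x <= u ==> u < v ==> v <= y ==> (u, v) ~= (x, y) ==> d (G u v) = msum G u v"
  and b: "!!u v. x <= u ==> u < v ==> v <= y ==> (u, v) ~= (x, y) ==>
   a u v = G u v + d (b u v) - mm a b u v - mm (bm b) G u v"
 shows "d (mm a b x y + mm (bm b) G x y) = msum G x y - msum a x y"
proof -
 \<comment> \<open>The gauge relation solved for d b. After substitution the cubic terms cancel by
   \<open>mm_assoc\<close>.\<close>
 let ?db = "%u v. a u v - G u v + mm a b u v + mm (bm b) G u v"
 have db: "d (b u v) = ?db u v" if "x <= u" "u < v" "v <= y" "(u, v) ~= (x, y)" for u v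
  using b[OF that] by (simp add: algebra_simps)
 have "d (mm a b x y) = mm (mm (bm a) a) b x y - mm (bm a) ?db x y"
  unfolding d_mm by (intro arg_cong2[where f = "(-)"] mm_cong) (auto simp: a db msum_def)
 hence 1: "d (mm a b x y) = mm (mm (bm a) a) b x y - (mm (bm a) a x y - mm (bm a) G x y
    + mm (bm a) (mm a b) x y + mm (bm a) (mm (bm b) G) x y)" by (simp add: mm_add_right mm_diff_right)
 let ?bdb = "%u v. bm a u v - bm G u v - mm (bm a) (bm b) u v - mm b (bm G) u v"
 have bdb: "bar (d (b u v)) = ?bdb u v" if "x <= u" "u < v" "v <= y" "(u, v) ~= (x, y)" for u v
  by (simp add: db[OF that] bar_add bar_diff bar_mm)
 have "d (mm (bm b) G x y) = mm (%u v. - bar (d (b u v))) G x y - mm b (%u v. d (G u v)) x y"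
  unfolding d_mm by (simp add: d_bar)
 also have "mm (%u v. - bar (d (b u v))) G x y = - mm (%u v. bar (d (b u v))) G x y"
  by (simp add: mm_def mul_minus_left sum_negf)
 also have "mm (%u v. bar (d (b u v))) G x y = mm ?bdb G x y" by (rule mm_cong) (auto simp: bdb)
 also have "mm b (%u v. d (G u v)) x y = mm b (mm (bm G) G) x y" by (rule mm_cong) (auto simp: G msum_def)
 finally have 2: "d (mm (bm b) G x y) = - (mm (bm a) G x y - mm (bm G) G x y - mm (mm (bm a) (bm b)) G x y
    - mm (mm b (bm G)) G x y) - mm b (mm (bm G) G) x y" by (simp add: mm_add_left mm_diff_left)
 show ?thesis unfolding d_add 1 2 msum_def by (simp add: mm_assoc)
qed

section \<open>Obstructions of words and sums over paths\<close>

definition Oword :: "('b list => 'a) => 'b list => 'a"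
 where "Oword \<gamma> w = (\<Sum>i\<in>{1..<length w}. bar (\<gamma> (take i w)) \<cdot> \<gamma> (drop i w))"

text \<open>The (x, y) entry of the system assembled from the values of all words whose letters are
  spread over the interval.\<close>

definition Gam :: "('b list => 'a) => (nat => nat => 'b set) => nat => nat => 'a"
 where "Gam \<gamma> H x y = (\<Sum>p\<in>paths H x y. \<gamma> (map snd p))"

text \<open>A pair of paths that meet at z is one path together with a place to cut it. Hence
  \<open>Gam\<close> satisfies the Maurer--Cartan equation as soon as the value of every occurring
  word is a primitive of its obstruction.\<close>

lemma msum_Gam:
 assumes fin: "!!u v. x <= u ==> u < v ==> v <= y ==> finite (H u v)"
 shows "msum (Gam \<gamma> H) x y = (\<Sum>p\<in>paths H x y. Oword \<gamma> (map snd p))"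
proof -
 have f: "finite (paths H x y)" by (rule finite_paths) (rule fin)
 have f1: "finite (paths H x z)" if "z \<in> {x<..<y}" for z by (rule finite_paths) (use fin that in auto)
 have f2: "finite (paths H z y)" if "z \<in> {x<..<y}" for z by (rule finite_paths) (use fin that in auto)
 let ?t = "%p q. bar (\<gamma> (map snd p)) \<cdot> \<gamma> (map snd q)"
 have "msum (Gam \<gamma> H) x y = (\<Sum>z\<in>{x<..<y}. \<Sum>pq\<in>paths H x z \<times> paths H z y. ?t (fst pq) (snd pq))"
  unfolding msum_def mm_def Gam_def bar_sum mul_sum_left unfolding mul_sum_right
  by (simp add: sum.cartesian_product case_prod_unfold)
 also have "... = (\<Sum>(z, pq)\<in>Sigma {x<..<y} (%z. paths H x z \<times> paths H z y). ?t (fst pq) (snd pq))"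
  by (rule sum.Sigma) (use f1 f2 in auto)
 also have "... = (\<Sum>(p, i)\<in>Sigma (paths H x y) (%p. {1..<length p}). ?t (take i p) (drop i p))"
 proof (rule sum.reindex_bij_witness[where j = "%(z, pq). (fst pq @ snd pq, length (fst pq))"
    and i = "%(p, i). (stop x (take i p), (take i p, drop i p))"], goal_cases)
  case (1 a)
  thus ?case by (auto simp: paths_def ispath_stop)
 next
  case (2 a)
  then obtain z p q where a: "a = (z, p, q)" "x < z" "z < y" "ispath H x p z" "ispath H z q y"
   by (auto simp: paths_def)
  hence "p ~= []" "q ~= []" by auto
  thus ?case using a by (auto simp: paths_def ispath_append ispath_stop Suc_le_eq)
 next
  case (3 b)
  thus ?case by auto
 next
  case (4 b)
  then obtain p i where b: "b = (p, i)" "ispath H x p y" "1 <= i" "i < length p" by (auto simp: paths_def)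
  hence "ispath H x (take i p @ drop i p) y" by simp
  hence 1: "ispath H x (take i p) (stop x (take i p))" "ispath H (stop x (take i p)) (drop i p) y"
   unfolding ispath_append by auto
  moreover have "take i p ~= []" "drop i p ~= []" using b by auto
  ultimately show ?case using b ispath_less[OF 1(1)] ispath_less[OF 1(2)] by (auto simp: paths_def)
 next
  case (5 a)
  thus ?case by auto
 qed
 also have "... = (\<Sum>p\<in>paths H x y. \<Sum>i\<in>{1..<length p}. ?t (take i p) (drop i p))"
  by (rule sum.Sigma[symmetric]) (use f in auto)
 also have "... = (\<Sum>p\<in>paths H x y. Oword \<gamma> (map snd p))"
  by (simp add: Oword_def take_map drop_map)
 finally show ?thesis .
qed

text \<open>The words of one letter are the only ones to involve \<open>H x y\<close>; the remaining
  ones are determined by the proper subintervals. Letters can therefore be added interval by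
  interval.\<close>

lemma Gam_split:
 assumes "x < y" and fin: "!!u v. x <= u ==> u < v ==> v <= y ==> finite (H u v)"
 shows "Gam \<gamma> H x y = (\<Sum>b\<in>H x y. \<gamma> [b]) + (\<Sum>p\<in>{p\<in>paths H x y. 2 <= length p}. \<gamma> (map snd p))"
proof -
 have "paths H x y = (%b. [(y, b)]) ` H x y \<union> {p\<in>paths H x y. 2 <= length p}"
 proof (intro equalityI subsetI)
  fix p assume p: "p \<in> paths H x y"
  hence "p ~= []" using assms(1) by (auto simp: paths_def)
  then consider z b where "p = [(z, b)]" | "2 <= length p" by (cases p; cases "tl p") auto
  thus "p \<in> (%b. [(y, b)]) ` H x y \<union> {p\<in>paths H x y. 2 <= length p}"
   by cases (insert p, auto simp: paths_def)
 qed (insert assms(1), auto simp: paths_def)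
 hence "Gam \<gamma> H x y = (\<Sum>p\<in>(%b. [(y, b)]) ` H x y \<union> {p\<in>paths H x y. 2 <= length p}. \<gamma> (map snd p))"
  unfolding Gam_def by simp
 also have "... = (\<Sum>p\<in>(%b. [(y, b)]) ` H x y. \<gamma> (map snd p)) + (\<Sum>p\<in>{p\<in>paths H x y. 2 <= length p}. \<gamma> (map snd p))"
  by (rule sum.union_disjoint) (use finite_paths[OF fin] fin assms(1) in auto)
 finally show ?thesis by (simp add: sum.reindex inj_on_def)
qed

lemma long_paths_cong:
 assumes "!!u v. x <= u ==> u < v ==> v <= y ==> (u, v) ~= (x, y) ==> H u v = H' u v"
 shows "{p\<in>paths H x y. 2 <= length p} = {p\<in>paths H' x y. 2 <= length p}"
 using assms by (auto simp: paths_def elim!: ispath_mono2)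

lemma Gam_cong:
 assumes "!!u v. x <= u ==> u < v ==> v <= y ==> H u v = H' u v"
 shows "Gam \<gamma> H x y = Gam \<gamma> H' x y"
proof -
 have "paths H x y = paths H' x y"
  unfolding paths_def by (intro Collect_cong iffI; erule ispath_mono) (use assms in auto)
 thus ?thesis by (simp add: Gam_def)
qed

text \<open>Every Maurer--Cartan system is gauge equivalent to one of the form \<open>Gam\<close>.
  This goes by the length of intervals: the deviation of a from \<open>Gam\<close>, corrected by the
  gauge terms, is a cycle; \<open>sel\<close> splits it into letters, which enter H, and a boundary,
  whose primitive enters the gauge b. C and D are the spaces of entries and of gauge entries, L
  contains the admissible letters, and Q records further properties of the selection.\<close>

lemma MC_decomposition:
 fixes \<gamma> :: "'b list => 'a"
 assumes xy0: "x0 < y0"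
  and C0: "!!x y. 0 \<in> C x y" "!!x y u v. u \<in> C x y ==> v \<in> C x y ==> u + v \<in> C x y"
   "!!x y u. u \<in> C x y ==> - u \<in> C x y"
  and D0: "!!x y u. u \<in> D x y ==> bar u \<in> D x y"
  and CD: "!!x y z u v. u \<in> C x z ==> v \<in> D z y ==> u \<cdot> v \<in> C x y"
   "!!x y z u v. u \<in> D x z ==> v \<in> C z y ==> u \<cdot> v \<in> C x y"
  and aC: "!!x y. x0 <= x ==> x < y ==> y <= y0 ==> (x, y) ~= (x0, y0) ==> a x y \<in> C x y"
  and aMC: "!!x y. x0 <= x ==> x < y ==> y <= y0 ==> (x, y) ~= (x0, y0) ==> d (a x y) = msum a x y"
  and sel: "!!x y e. x0 <= x ==> x < y ==> y <= y0 ==> (x, y) ~= (x0, y0) ==> e \<in> C x y ==> d e = 0 ==>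
    (y = Suc x ==> e = a x y) ==>
    \<exists>S \<beta>. finite S & S \<subseteq> L x y & Q x y S & \<beta> \<in> D x y & e = (\<Sum>b\<in>S. \<gamma> [b]) + d \<beta>"
  and good: "!!x y p. x0 <= x ==> x < y ==> y <= y0 ==> (x, y) ~= (x0, y0) ==> p \<in> paths L x y ==>
    \<gamma> (map snd p) \<in> C x y & d (\<gamma> (map snd p)) = Oword \<gamma> (map snd p)"
 obtains H f where
  "!!x y. finite (H x y)" "H x0 y0 = {}"
  "!!x y. x0 <= x ==> x < y ==> y <= y0 ==> (x, y) ~= (x0, y0) ==> H x y \<subseteq> L x y & Q x y (H x y)"
  "msum a x0 y0 = (\<Sum>p\<in>paths H x0 y0. Oword \<gamma> (map snd p)) + d f"
proof -
 define inr where "inr x y \<longleftrightarrow> x0 <= x & x < y & y <= y0 & (x, y) ~= (x0, y0)" for x y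
 define E where "E H b x y = mm a b x y + mm (bm b) (Gam \<gamma> H) x y" for H b x y
 \<comment> \<open>H and b are constructed on intervals of length at most N. The whole interval (x0,
   y0) is exempt, so H stays empty there.\<close>
 define ok where "ok N H b \<longleftrightarrow> (\<forall>x y. if inr x y & y <= x + N then finite (H x y) & H x y \<subseteq> L x y & Q x y (H x y) &
   b x y \<in> D x y & a x y + E H b x y = Gam \<gamma> H x y + d (b x y) else H x y = {} & b x y = 0)" for N H b
 have sumC: "sum h S \<in> C x y" if "!!p. p \<in> S ==> h p \<in> C x y" for h :: "'c => 'a" and S x y
  using that by (induction S rule: infinite_finite_induct) (simp_all add: C0)
 have sub: "finite (H x y)" "H x y \<subseteq> L x y" if "ok N H b" for N H b x y
  using that unfolding ok_def by (cases "inr x y & y <= x + N"; simp)+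
 have g: "\<gamma> (map snd p) \<in> C x y & d (\<gamma> (map snd p)) = Oword \<gamma> (map snd p)"
  if "ok N H b" "inr x y" "p \<in> paths H x y" for N H b x y p
 proof -
  have "p \<in> paths L x y"
   using that(3) unfolding paths_def mem_Collect_eq by (rule ispath_mono) (rule sub(2)[OF that(1)])
  thus ?thesis using good[of x y p] that(2) by (simp add: inr_def)
 qed
 have dG: "d (Gam \<gamma> H x y) = msum (Gam \<gamma> H) x y" and GC: "Gam \<gamma> H x y \<in> C x y"
  if "ok N H b" "inr x y" for N H b x y
  using g[OF that] msum_Gam[of x y H \<gamma>] sub(1)[OF that(1)] by (auto simp: Gam_def d_sum intro: sumC)
 have dE: "d (E H b x y) = msum (Gam \<gamma> H) x y - msum a x y"
  if ok: "ok N H b" and xy: "x0 <= x" "y <= y0" "y <= x + Suc N" for N H b x y unfolding E_def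
 proof (rule gauge_curvature)
  fix u v assume uv: "x <= u" "u < v" "v <= y" "(u, v) ~= (x, y)"
  hence i: "inr u v" "v <= u + N" using xy by (auto simp: inr_def)
  show "d (a u v) = msum a u v" using aMC i(1) by (simp add: inr_def)
  show "d (Gam \<gamma> H u v) = msum (Gam \<gamma> H) u v" by (rule dG[OF ok i(1)])
  have "a u v + E H b u v = Gam \<gamma> H u v + d (b u v)" using ok i unfolding ok_def by meson
  thus "a u v = Gam \<gamma> H u v + d (b u v) - mm a b u v - mm (bm b) (Gam \<gamma> H) u v"
   by (simp add: E_def algebra_simps)
 qed
 have "\<exists>H b. ok N H b" for N
 proof (induction N)
  case 0
  have "ok 0 (%_ _. {}) (%_ _. 0)" by (auto simp: ok_def inr_def)
  thus ?case by blast
 next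
  case (Suc N)
  then obtain H b where ok: "ok N H b" by blast
  define top where "top x y \<longleftrightarrow> inr x y & y = x + Suc N" for x y
  have E0: "H x y = {}" if "top x y" for x y using ok that unfolding ok_def top_def by fastforce
  have "\<exists>S \<beta>. finite S & S \<subseteq> L x y & Q x y S & \<beta> \<in> D x y & a x y + E H b x y - Gam \<gamma> H x y = (\<Sum>b\<in>S. \<gamma> [b]) + d \<beta>"
   if t: "top x y" for x y
  proof (rule sel)
   have i: "inr x y" "y = x + Suc N" using t unfolding top_def by blast+
   show xy: "x0 <= x" "x < y" "y <= y0" "(x, y) ~= (x0, y0)" using i by (auto simp: inr_def)
   have "a x z \<cdot> b z y \<in> C x y" "bar (b x z) \<cdot> Gam \<gamma> H z y \<in> C x y" if z: "x < z" "z < y" for z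
   proof -
    have "inr z y" "inr x z" "y <= z + N" "z <= x + N" using z xy i(2) by (auto simp: inr_def)
    hence "b z y \<in> D z y" "b x z \<in> D x z" "a x z \<in> C x z" "Gam \<gamma> H z y \<in> C z y"
     using ok aC GC[OF ok] unfolding ok_def inr_def by meson+
    thus "a x z \<cdot> b z y \<in> C x y" "bar (b x z) \<cdot> Gam \<gamma> H z y \<in> C x y" using CD D0 by blast+
   qed
   hence "E H b x y \<in> C x y" unfolding E_def mm_def by (intro C0(2) sumC) auto
   hence "a x y + E H b x y + - Gam \<gamma> H x y \<in> C x y" using aC[OF xy] GC[OF ok i(1)] by (intro C0)
   thus "a x y + E H b x y - Gam \<gamma> H x y \<in> C x y" by simp
   \<comment> \<open>By \<open>gauge_curvature\<close> the boundary of E is the difference of the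
     two curvatures on (x, y), and these are the boundaries of \<open>Gam\<close> and of a.\<close>
   show "d (a x y + E H b x y - Gam \<gamma> H x y) = 0"
    using dE[OF ok xy(1,3) eq_refl[OF i(2)]] aMC[OF xy] dG[OF ok i(1)] by (simp add: d_diff d_add)
   \<comment> \<open>A unit interval has no inner points, hence no corrections. This is what makes
     it possible to prescribe the letters there.\<close>
   show "a x y + E H b x y - Gam \<gamma> H x y = a x y" if "y = Suc x"
   proof -
    have "{x<..<y} = {}" using that by auto
    hence "E H b x y = 0" by (simp add: E_def mm_def)
    moreover have em: "{p\<in>paths H x y. 2 <= length p} = {}" using ispath_le[of H x _ y] that by (force simp: paths_def)
    have "Gam \<gamma> H x y = 0" using Gam_split[OF xy(2), of H \<gamma>] sub(1)[OF ok] E0[OF t] unfolding em by simp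
    ultimately show ?thesis by simp
   qed
  qed
  then obtain S \<beta> where S: "!!x y. top x y ==> finite (S x y) & S x y \<subseteq> L x y & Q x y (S x y) & \<beta> x y \<in> D x y &
    a x y + E H b x y - Gam \<gamma> H x y = (\<Sum>b\<in>S x y. \<gamma> [b]) + d (\<beta> x y)" by metis
  define H' where "H' x y = (if top x y then S x y else H x y)" for x y
  define b' where "b' x y = (if top x y then \<beta> x y else b x y)" for x y
  have G': "Gam \<gamma> H' x y = Gam \<gamma> H x y" if "y <= x + N" for x y
   by (rule Gam_cong) (insert that, auto simp: H'_def top_def)
  have E': "E H' b' x y = E H b x y" if "y <= x + Suc N" for x y
   unfolding E_def by (intro arg_cong2[where f = "(+)"] mm_cong) (insert that G', auto simp: b'_def top_def)
  have "ok (Suc N) H' b'" unfolding ok_def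
  proof (intro allI)
   fix x y
   consider "top x y" | "inr x y & y <= x + N" "~ top x y" | "~ (inr x y & y <= x + Suc N)" "~ top x y"
    by (force simp: top_def)
   thus "if inr x y & y <= x + Suc N then finite (H' x y) & H' x y \<subseteq> L x y & Q x y (H' x y) &
    b' x y \<in> D x y & a x y + E H' b' x y = Gam \<gamma> H' x y + d (b' x y) else H' x y = {} & b' x y = 0"
   proof cases
    case 1
    hence i: "inr x y" "y = x + Suc N" "x < y" by (auto simp: top_def inr_def)
    have fin: "finite (H' u v)" for u v using S[of u v] sub(1)[OF ok, of u v] by (simp add: H'_def)
    have "{p\<in>paths H' x y. 2 <= length p} = {p\<in>paths H x y. 2 <= length p}"
     by (rule long_paths_cong) (insert i(2), auto simp: H'_def top_def)
    hence "Gam \<gamma> H' x y = (\<Sum>b\<in>S x y. \<gamma> [b]) + Gam \<gamma> H x y"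
     using Gam_split[OF i(3), of H' \<gamma>] Gam_split[OF i(3), of H \<gamma>] fin sub(1)[OF ok] E0[OF 1] 1 by (simp add: H'_def)
    thus ?thesis using S[OF 1] 1 i E'[of y x] by (auto simp: H'_def b'_def algebra_simps)
   next
    case 2
    thus ?thesis using ok G'[of y x] E'[of y x] unfolding ok_def by (simp add: H'_def b'_def)
   next
    case 3
    hence "~ (inr x y & y <= x + N)" by auto
    hence "H x y = {} & b x y = 0" using ok unfolding ok_def by meson
    thus ?thesis using 3 unfolding if_not_P[OF 3(1)] by (simp add: H'_def b'_def)
   qed
  qed
  thus ?case by blast
 qed
 then obtain H b where ok: "ok y0 H b" by blast
 show thesis
 proof (rule that[of H "- E H b x0 y0"])
  have "msum (Gam \<gamma> H) x0 y0 = (\<Sum>p\<in>paths H x0 y0. Oword \<gamma> (map snd p))" by (rule msum_Gam) (rule sub(1)[OF ok])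
  thus "msum a x0 y0 = (\<Sum>p\<in>paths H x0 y0. Oword \<gamma> (map snd p)) + d (- E H b x0 y0)"
   using dE[OF ok, of x0 y0] by (simp add: d_minus)
  show "H x0 y0 = {}" using ok[unfolded ok_def, rule_format, of x0 y0] by (simp add: inr_def)
  show "H x y \<subseteq> L x y & Q x y (H x y)" if "x0 <= x" "x < y" "y <= y0" "(x, y) ~= (x0, y0)" for x y
   using ok that unfolding ok_def inr_def by (meson trans_le_add2)
 qed (rule sub(1)[OF ok])
qed

end

section \<open>Monomials\<close>

abbreviation (input) cf where "cf \<equiv> Poly_Mapping.lookup"
abbreviation (input) ks where "ks \<equiv> Poly_Mapping.keys"
abbreviation (input) sing where "sing \<equiv> Poly_Mapping.single"

definition ind :: "nat set => monomial"
 where "ind U = (\<Sum>i\<in>U. sing i 1)"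

lemma cf_ind: "finite U ==> cf (ind U) i = (if i \<in> U then 1 else 0)"
 by (simp add: ind_def lookup_sum lookup_single when_def)

lemma ks_ind: "finite U ==> ks (ind U) = U" by (auto simp: in_keys_iff cf_ind split: if_splits)

lemma ind_empty [simp]: "ind {} = 0" by (simp add: ind_def)

lemma ind_singleton [simp]: "ind {i} = sing i 1" by (simp add: ind_def)

lemma mdvd_refl [simp]: "mdvd s s" and mdvd_trans: "mdvd s t ==> mdvd t u ==> mdvd s u"
 and mdvd_add_left [simp]: "mdvd s (s + t)" and mdvd_add_right [simp]: "mdvd t (s + t)"
 and mdvd_zero [simp]: "mdvd 0 s"
 using order_trans by (auto simp: mdvd_def lookup_add intro!: poly_mapping_eqI) blast+

lemma cf_pos: "i \<in> ks (s :: monomial) \<longleftrightarrow> 1 <= cf s i" unfolding in_keys_iff by linarith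

lemma mdvd_keys: "mdvd s t ==> ks s \<subseteq> ks t"
 unfolding mdvd_def cf_pos subset_iff by (meson order_trans)

lemma mdvd_imp_add: "mdvd s t ==> t = s + (t - s)"
 by (rule poly_mapping_eqI) (simp add: mdvd_def lookup_add lookup_minus)

lemma cf_sing_mult:
 fixes p :: "'k::field polynomial"
 shows "cf (sing s a * p) t = (if mdvd s t then a * cf p (t - s) else 0)"
proof -
 let ?X = "%l. Sum_any (%q. cf p q when t = l + q)"
 have "cf (sing s a * p) t = Sum_any (%l. cf (sing s a) l * ?X l)" by (rule lookup_mult)
 also have "(%l. cf (sing s a) l * ?X l) = (%l. (a * ?X s) when s = l)"
  by (auto simp: lookup_single when_def)
 also have "Sum_any (%l. (a * ?X s) when s = l) = a * ?X s" by simp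
 also have "?X s = (if mdvd s t then cf p (t - s) else 0)"
 proof (cases "mdvd s t")
  case True
  have "t = s + q \<longleftrightarrow> t - s = q" for q using mdvd_imp_add[OF True] by auto
  with True show ?thesis by simp
 next
  case False
  hence "t ~= s + q" for q by auto
  with False show ?thesis by simp
 qed
 finally show ?thesis by simp
qed

lemma cf_var_mult: "cf (var i * p) t = (if 1 <= cf t i then cf p (t - sing i 1) else (0::'k::field))"
proof -
 have "mdvd (sing i 1) t \<longleftrightarrow> 1 <= cf t i" by (auto simp: mdvd_def lookup_single when_def)
 thus ?thesis by (simp add: var_def mono_poly_def cf_sing_mult)
qed

lemma cf_mult_nonzero:
 fixes p q :: "'k::field polynomial"
 shows "cf (p * q) t ~= 0 ==> \<exists>s u. t = s + u & cf p s ~= 0 & cf q u ~= 0"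
 using Poly_Mapping.keys_mult[of p q] by (auto simp: in_keys_iff)

lemma cf_neg_one: "cf ((-1) ^ k * p) t = (-1) ^ k * cf (p :: 'k::field polynomial) t" by (cases "even k") auto

lemma cf_sum: "cf (sum f S) t = (\<Sum>i\<in>S. cf (f i) t)" by (rule lookup_sum)

lemma mdegree_superset: "finite S ==> ks t \<subseteq> S ==> mdegree t = (\<Sum>i\<in>S. cf t i)"
 unfolding mdegree_def by (rule sum.mono_neutral_left) (auto simp: in_keys_iff)

lemma mdegree_add: "mdegree (s + t) = mdegree s + mdegree t"
proof -
 let ?S = "ks s \<union> ks t"
 have "ks (s + t) \<subseteq> ?S" by (rule Poly_Mapping.keys_add)
 thus ?thesis using mdegree_superset[of ?S s] mdegree_superset[of ?S t] mdegree_superset[of ?S "s + t"]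
  by (simp add: lookup_add sum.distrib)
qed

lemma mdegree_sing [simp]: "mdegree (sing i k) = k" by (cases "k = 0") (auto simp: mdegree_def)

lemma mdegree_zero [simp]: "mdegree 0 = 0" by (simp add: mdegree_def)

lemma mdegree_eq_0: "mdegree t = 0 \<longleftrightarrow> t = 0"
 by (auto simp: mdegree_def in_keys_iff intro!: poly_mapping_eqI)

lemma mdegree_ind: "finite U ==> mdegree (ind U) = card U" by (simp add: mdegree_def ks_ind cf_ind)

lemma mdvd_ind: "finite U ==> mdvd (ind U) m \<longleftrightarrow> U \<subseteq> ks m"
 by (auto simp: mdvd_def cf_ind cf_pos)

lemma mdegree_diff_ind: "U \<subseteq> ks m ==> mdegree m = mdegree (m - ind U) + card U"
proof -
 assume "U \<subseteq> ks m"
 hence "finite U" using finite_keys finite_subset by blast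
 hence "m = ind U + (m - ind U)" using \<open>U \<subseteq> ks m\<close> by (intro mdvd_imp_add) (simp add: mdvd_ind)
 thus ?thesis using mdegree_add[of "ind U" "m - ind U"] mdegree_ind[OF \<open>finite U\<close>] by simp
qed

lemma mdvd_mdegree: "mdvd s t ==> mdegree s <= mdegree t"
 using mdvd_imp_add[of s t] mdegree_add[of s "t - s"] by simp

section \<open>The multigraded Koszul complex of a monomial quotient\<close>

type_synonym 'k elt = "nat set => 'k polynomial"
type_synonym 'k ext = "nat set => 'k"

text \<open>The ideal is given by the up-set \<open>A\<close> of its monomials; the Koszul complex of the quotient is
 modelled by the normal forms, i.e. by the elements without any coefficient at a monomial of \<open>A\<close>.
 The operations are total on the type and satisfy the DGA laws there.\<close>

locale monomial_koszul =
 fixes n :: nat and A :: "monomial set" and field_type :: "'k::field itself"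
 assumes upset: "s \<in> A ==> mdvd s t ==> t \<in> A"
begin

definition nfp :: "'k polynomial => 'k polynomial"
 where "nfp p = Poly_Mapping.mapp (%t c. if t \<in> A then 0 else c) p"

lemma cf_nfp: "cf (nfp p) t = (if t \<in> A then 0 else cf p t)"
 by (auto simp: nfp_def lookup_mapp in_keys_iff when_def)

lemma nfp_add: "nfp (p + q) = nfp p + nfp q" and nfp_minus: "nfp (- p) = - nfp p"
 and nfp_zero [simp]: "nfp 0 = 0" and nfp_nfp [simp]: "nfp (nfp p) = nfp p"
 by (rule poly_mapping_eqI; simp add: cf_nfp lookup_add)+

lemma nfp_sum: "nfp (sum f S) = (\<Sum>i\<in>S. nfp (f i))" by (rule poly_mapping_eqI) (simp add: cf_nfp cf_sum)

lemma nfp_neg_one: "nfp ((-1) ^ k * p) = (-1) ^ k * nfp p" by (rule poly_mapping_eqI) (simp add: cf_nfp cf_neg_one)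

text \<open>The difference of p and \<open>nfp p\<close> is supported on A, and so are its multiples
  because A is an up-set.\<close>

lemma nfp_mult_nfp: "nfp (nfp p * q) = nfp (p * q)"
proof -
 have "nfp ((p - nfp p) * q) = 0"
 proof (rule poly_mapping_eqI)
  fix t
  show "cf (nfp ((p - nfp p) * q)) t = cf 0 t"
  proof (rule ccontr)
   assume "cf (nfp ((p - nfp p) * q)) t ~= cf 0 t"
   hence "t ~: A" "cf ((p - nfp p) * q) t ~= 0" by (auto simp: cf_nfp split: if_splits)
   then obtain s u where "t = s + u" "cf (p - nfp p) s ~= 0" using cf_mult_nonzero by blast
   hence "s \<in> A" "mdvd s t" by (auto simp: lookup_minus cf_nfp split: if_splits)
   with upset \<open>t ~: A\<close> show False by blast
  qed
 qed
 thus ?thesis using nfp_add[of "(p - nfp p) * q" "nfp p * q"] by (simp add: left_diff_distrib)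
qed

lemma nfp_mult_nfp': "nfp (q * nfp p) = nfp (q * p)" using nfp_mult_nfp[of p q] by (simp add: mult.commute)

definition nf :: "'k elt => 'k elt"
 where "nf c U = (if U \<subseteq> {..<n} then nfp (c U) else 0)"

definition mul :: "'k elt => 'k elt => 'k elt" (infixl "\<cdot>" 70)
 where "x \<cdot> y = nf (emul x y)"

definition dd :: "'k elt => 'k elt"
 where "dd x = nf (ediff n var x)"

lemma finite_below_n: "U \<subseteq> {..<n} ==> finite U" by (rule finite_subset) auto

lemma nf_emul_nf: "nf (emul (nf x) y) = nf (emul x y)" "nf (emul x (nf y)) = nf (emul x y)"
proof -
 have "nfp (nf x V * y (U - V)) = nfp (x V * y (U - V))"
  "nfp (x V * nf y (U - V)) = nfp (x V * y (U - V))" if "V \<in> Pow U" "U \<subseteq> {..<n}" for U V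
  using that by (auto simp: nf_def nfp_mult_nfp nfp_mult_nfp')
 thus "nf (emul (nf x) y) = nf (emul x y)" "nf (emul x (nf y)) = nf (emul x y)"
  by (auto simp: nf_def[of "emul _ _"] emul_def nfp_sum nfp_neg_one fun_eq_iff intro!: sum.cong)
qed

lemma contr_nf: "contr i (nf x) U = nf (contr i x) U" if "i < n"
 using that by (auto simp: contr_def nf_def nfp_neg_one)

lemma nf_ediff_nf: "nf (ediff n var (nf x)) = nf (ediff n var x)"
proof
 fix U
 have "nfp (var i * contr i (nf x) U) = nfp (var i * contr i x U)" if "i < n" "U \<subseteq> {..<n}" for i
  using that by (simp add: contr_nf nf_def nfp_mult_nfp')
 thus "nf (ediff n var (nf x)) U = nf (ediff n var x) U"
  by (auto simp: nf_def[of "ediff _ _ _"] ediff_def nfp_sum intro!: sum.cong)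
qed

lemma nf_add: "nf (x + y) = nf x + nf y" and nf_nf [simp]: "nf (nf x) = nf x"
 and nf_zero [simp]: "nf 0 = 0" and nf_minus: "nf (- x) = - nf x" by (auto simp: nf_def fun_eq_iff nfp_add nfp_minus)

lemma nf_cong: "(!!U. U \<subseteq> {..<n} ==> x U = y U) ==> nf x = nf y"
 by (auto simp: nf_def)

text \<open>The laws of the exterior algebra survive the projection \<open>nf\<close>, since by
  \<open>nf_emul_nf\<close> and \<open>nf_ediff_nf\<close> inner projections may be dropped. On
  subsets of {..<n} the finiteness needed for d d = 0 is automatic.\<close>

sublocale nudga mul dd esg
proof
 fix x y z :: "'k elt"
 show "x \<cdot> y \<cdot> z = x \<cdot> (y \<cdot> z)" by (simp add: mul_def nf_emul_nf emul_assoc)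
 show "(x + y) \<cdot> z = x \<cdot> z + y \<cdot> z"
  using emul_add_left[of x y z] by (simp add: mul_def plus_fun_def flip: nf_add[unfolded plus_fun_def])
 show "x \<cdot> (y + z) = x \<cdot> y + x \<cdot> z"
  using emul_add_right[of x y z] by (simp add: mul_def plus_fun_def flip: nf_add[unfolded plus_fun_def])
 have "ediff n var (x + y) = ediff n var x + ediff n var y"
  by (auto simp: ediff_def contr_def algebra_simps sum.distrib[symmetric] fun_eq_iff intro!: sum.cong)
 thus "dd (x + y) = dd x + dd y" by (simp add: dd_def nf_add)
 show "dd (dd x) = 0"
  by (auto simp: dd_def nf_ediff_nf nf_def[of "ediff n var _"] ediff_ediff finite_below_n fun_eq_iff)
 show "esg (x + y) = esg x + esg y" by (auto simp: esg_def fun_eq_iff algebra_simps)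
 have esg_nf: "esg (nf w) = nf (esg w)" for w :: "'k elt" by (auto simp: esg_def nf_def fun_eq_iff nfp_neg_one)
 show "esg (x \<cdot> y) = esg x \<cdot> esg y" by (simp add: mul_def esg_nf esg_emul)
 show "esg (esg x) = x" by simp
 have "dd (esg x) = nf (- esg (ediff n var x))" unfolding dd_def
  by (rule nf_cong) (simp add: ediff_esg finite_below_n)
 thus "dd (esg x) = - esg (dd x)" by (simp add: dd_def esg_nf nf_minus)
 have "dd (x \<cdot> y) = nf (ediff n var (emul x y))" by (simp add: dd_def mul_def nf_ediff_nf)
 also have "... = nf (emul (ediff n var x) y + emul (esg x) (ediff n var y))"
  by (rule nf_cong) (simp add: ediff_emul)
 finally show "dd (x \<cdot> y) = dd x \<cdot> y + esg x \<cdot> dd y"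
  by (simp add: nf_add mul_def dd_def nf_emul_nf)
qed

section \<open>Homogeneous elements\<close>

definition im :: "monomial => nat => int" where "im m i = int (cf m i)"

text \<open>The term x^t e_U has multidegree t + U. Both degrees are integers so that differences of
  degrees are always available; a degree with a negative entry contains only 0.\<close>

definition homog :: "(nat => int) => int => 'k elt set"
 where "homog M p = {c. \<forall>U t. cf (c U) t ~= 0 --> U \<subseteq> {..<n} & ks t \<subseteq> {..<n} & t ~: A &
  (\<forall>i. int (cf t i) + (if i \<in> U then 1 else 0) = M i) & int (card U) = p}"

definition homog_p :: "int => 'k elt set"
 where "homog_p p = {c. \<forall>U t. cf (c U) t ~= 0 --> U \<subseteq> {..<n} & ks t \<subseteq> {..<n} & t ~: A & int (card U) = p}"

lemma homog_subset: "homog M p \<subseteq> homog_p p" unfolding homog_def homog_p_def by blast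

lemma homog_zero: "0 \<in> homog M p" and homog_p_zero: "0 \<in> homog_p p" by (auto simp: homog_def homog_p_def)

lemma homog_add: "x \<in> homog M p ==> y \<in> homog M p ==> x + y \<in> homog M p"
 and homog_p_add: "x \<in> homog_p p ==> y \<in> homog_p p ==> x + y \<in> homog_p p"
 unfolding homog_def homog_p_def mem_Collect_eq plus_fun_def lookup_add by (metis add.right_neutral)+

lemma homog_minus: "x \<in> homog M p ==> - x \<in> homog M p"
 and homog_p_minus: "x \<in> homog_p p ==> - x \<in> homog_p p"
 unfolding homog_def homog_p_def by (simp_all add: fun_Compl_def)

lemma homog_sum: "(!!i. i \<in> S ==> f i \<in> homog M p) ==> sum f S \<in> homog M p"
 by (induction S rule: infinite_finite_induct) (auto intro: homog_zero homog_add)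

lemma homog_p_sum: "(!!i. i \<in> S ==> f i \<in> homog_p p) ==> sum f S \<in> homog_p p"
 by (induction S rule: infinite_finite_induct) (auto intro: homog_p_zero homog_p_add)

lemma homog_esg: "x \<in> homog M p ==> esg x \<in> homog M p"
 and homog_p_esg: "x \<in> homog_p p ==> esg x \<in> homog_p p"
 by (auto simp: homog_def homog_p_def esg_def cf_neg_one)

lemma homog_bar: "x \<in> homog M p ==> bar x \<in> homog M p"
 and homog_p_bar: "x \<in> homog_p p ==> bar x \<in> homog_p p"
 by (simp_all add: bar_def homog_minus homog_p_minus homog_esg homog_p_esg)

lemma esg_homog_p: "x \<in> homog_p (int p) ==> esg x = (%U. (-1) ^ p * x U)"
proof
 fix U assume x: "x \<in> homog_p (int p)"
 show "esg x U = (-1) ^ p * x U"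
 proof (cases "x U = 0")
  case False
  then obtain t where "cf (x U) t ~= 0" by (metis lookup_zero poly_mapping_eqI)
  with x have "card U = p" by (auto simp: homog_p_def)
  thus ?thesis by (simp add: esg_def)
 qed (simp add: esg_def)
qed

lemma nf_eq_self: "x \<in> homog_p p ==> nf x = x"
proof
 fix U assume x: "x \<in> homog_p p"
 show "nf x U = x U"
 proof (rule poly_mapping_eqI)
  fix t show "cf (nf x U) t = cf (x U) t" using x by (cases "cf (x U) t = 0") (auto simp: nf_def cf_nfp homog_p_def)
 qed
qed

lemma cf_emul_nonzero:
 fixes x y :: "'k elt"
 assumes "cf (emul x y U) t ~= 0"
 obtains V s u where "V \<subseteq> U" "t = s + u" "cf (x V) s ~= 0" "cf (y (U - V)) u ~= 0"
proof -
 have "cf (emul x y U) t = (\<Sum>V\<in>Pow U. (-1) ^ inversions V (U - V) * cf (x V * y (U - V)) t)"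
  unfolding emul_def cf_sum by (simp only: cf_neg_one)
 moreover have "\<exists>V\<in>Pow U. cf (x V * y (U - V)) t ~= 0"
 proof (rule ccontr)
  assume "~ ?thesis"
  hence "(\<Sum>V\<in>Pow U. (-1) ^ inversions V (U - V) * cf (x V * y (U - V)) t) = 0"
   by (intro sum.neutral) auto
  with assms calculation show False by simp
 qed
 ultimately obtain V where V: "V \<subseteq> U" "cf (x V * y (U - V)) t ~= 0" by blast
 from cf_mult_nonzero[OF V(2)] obtain s u where "t = s + u" "cf (x V) s ~= 0" "cf (y (U - V)) u ~= 0" by blast
 with V(1) show ?thesis by (rule that)
qed

lemma cf_ediff_nonzero:
 fixes x :: "'k elt"
 assumes "cf (ediff n var x U) t ~= 0"
 obtains i where "i < n" "i ~: U" "1 <= cf t i" "cf (x (insert i U)) (t - sing i 1) ~= 0"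
proof -
 have "cf (ediff n var x U) t = (\<Sum>i<n. cf (var i * contr i x U) t)" by (simp add: ediff_def cf_sum)
 then obtain i where "i < n" "cf (var i * contr i x U) t ~= 0"
  using assms by (metis (no_types, lifting) lessThan_iff sum.neutral)
 hence "i < n" "i ~: U" "1 <= cf t i" "cf (x (insert i U)) (t - sing i 1) ~= 0"
  by (auto simp: cf_var_mult contr_def cf_neg_one split: if_splits)
 thus ?thesis by (rule that)
qed

lemma cf_mul: "cf ((x \<cdot> y) U) t ~= 0 ==> U \<subseteq> {..<n} & t ~: A & cf (emul x y U) t ~= 0"
 by (auto simp: mul_def nf_def cf_nfp split: if_splits)

lemma cf_dd: "cf (dd x U) t ~= 0 ==> U \<subseteq> {..<n} & t ~: A & cf (ediff n var x U) t ~= 0"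
 by (auto simp: dd_def nf_def cf_nfp split: if_splits)

lemma keys_add_subset: "ks s \<subseteq> B ==> ks u \<subseteq> B ==> ks (s + u :: monomial) \<subseteq> B"
 using Poly_Mapping.keys_add[of s u] by blast

lemma card_split: "finite U ==> V \<subseteq> U ==> card U = card V + card (U - V)"
 by (metis card_Diff_subset card_mono finite_subset le_add_diff_inverse)

lemma homog_mul: "x \<in> homog M p ==> y \<in> homog M' p' ==> x \<cdot> y \<in> homog (%i. M i + M' i) (p + p')"
 unfolding homog_def[of "%i. M i + M' i"] mem_Collect_eq
proof (intro allI impI)
 fix U t assume x: "x \<in> homog M p" and y: "y \<in> homog M' p'" and "cf ((x \<cdot> y) U) t ~= 0"
 hence U: "U \<subseteq> {..<n}" "t ~: A" "cf (emul x y U) t ~= 0" using cf_mul by blast+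
 then obtain V s u where V: "V \<subseteq> U" "t = s + u" "cf (x V) s ~= 0" "cf (y (U - V)) u ~= 0"
  using cf_emul_nonzero by metis
 have "ks s \<subseteq> {..<n} & (\<forall>i. int (cf s i) + (if i \<in> V then 1 else 0) = M i) & int (card V) = p"
  using x V(3) unfolding homog_def by blast
 hence 1: "ks s \<subseteq> {..<n}" "!!i. M i = int (cf s i) + (if i \<in> V then 1 else 0)" "p = int (card V)"
  by metis+
 have "ks u \<subseteq> {..<n} & (\<forall>i. int (cf u i) + (if i \<in> U - V then 1 else 0) = M' i) & int (card (U - V)) = p'"
  using y V(4) unfolding homog_def by blast
 hence 2: "ks u \<subseteq> {..<n}" "!!i. M' i = int (cf u i) + (if i \<in> U - V then 1 else 0)" "p' = int (card (U - V))"
  by metis+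
 have "card U = card V + card (U - V)" using card_split finite_below_n U V by blast
 moreover have "\<forall>i. int (cf t i) + (if i \<in> U then 1 else 0) = M i + M' i"
  using V 1 2 by (auto simp: lookup_add)
 ultimately show "U \<subseteq> {..<n} & ks t \<subseteq> {..<n} & t ~: A & (\<forall>i. int (cf t i) + (if i \<in> U then 1 else 0) = M i + M' i) &
   int (card U) = p + p'" using U 1 2 V keys_add_subset by auto
qed

lemma homog_p_mul: "x \<in> homog_p p ==> y \<in> homog_p p' ==> x \<cdot> y \<in> homog_p (p + p')"
 unfolding homog_p_def[of "p + p'"] mem_Collect_eq
proof (intro allI impI)
 fix U t assume x: "x \<in> homog_p p" and y: "y \<in> homog_p p'" and "cf ((x \<cdot> y) U) t ~= 0"
 hence U: "U \<subseteq> {..<n}" "t ~: A" "cf (emul x y U) t ~= 0" using cf_mul by blast+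
 then obtain V s u where V: "V \<subseteq> U" "t = s + u" "cf (x V) s ~= 0" "cf (y (U - V)) u ~= 0"
  using cf_emul_nonzero by metis
 have 1: "ks s \<subseteq> {..<n}" "p = int (card V)" "ks u \<subseteq> {..<n}" "p' = int (card (U - V))"
  using x y V(3,4) by (auto simp: homog_p_def)
 have "card U = card V + card (U - V)" using card_split finite_below_n U V by blast
 thus "U \<subseteq> {..<n} & ks t \<subseteq> {..<n} & t ~: A & int (card U) = p + p'" using U 1 V keys_add_subset by auto
qed

lemma homog_p_dd: "x \<in> homog_p p ==> dd x \<in> homog_p (p - 1)"
 unfolding homog_p_def[of "p - 1"] mem_Collect_eq
proof (intro allI impI)
 fix U t assume x: "x \<in> homog_p p" and "cf (dd x U) t ~= 0"
 hence U: "U \<subseteq> {..<n}" "t ~: A" "cf (ediff n var x U) t ~= 0" using cf_dd by blast+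
 then obtain i where i: "i < n" "i ~: U" "1 <= cf t i" "cf (x (insert i U)) (t - sing i 1) ~= 0"
  using cf_ediff_nonzero by blast
 have "t = sing i 1 + (t - sing i 1)"
  by (rule poly_mapping_eqI) (insert i, auto simp: lookup_add lookup_minus lookup_single when_def)
 moreover have "ks (t - sing i 1) \<subseteq> {..<n}" "int (card (insert i U)) = p" using x i by (auto simp: homog_p_def)
 moreover have "ks (sing i (1::nat)) \<subseteq> {..<n}" using i by simp
 ultimately show "U \<subseteq> {..<n} & ks t \<subseteq> {..<n} & t ~: A & int (card U) = p - 1"
  using U i finite_below_n[of U] keys_add_subset[of "sing i 1" "{..<n}" "t - sing i 1"] by auto
qed

lemma nf_dd [simp]: "nf (dd x) = dd x" by (simp add: dd_def)

text \<open>The coefficients of the degree \<open>m\<close> part: \<open>f U\<close> is the coefficient of $x^{m - U} e_U$.\<close>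

definition lift :: "monomial => 'k ext => 'k elt"
 where "lift m f U = (if U \<subseteq> ks m then sing (m - ind U) (f U) else 0)"

definition low :: "monomial => 'k elt => 'k ext"
 where "low m c U = (if U \<subseteq> ks m then cf (c U) (m - ind U) else 0)"

text \<open>The sets U with x^{m-U} in A form the upper Koszul simplicial complex of A in degree m,
  and \<open>Lam m\<close> is the family of its nonfaces. The degree m part of the Koszul complex is
  thus the chain complex of the full simplex on \<open>ks m\<close> relative to that complex, and
  \<open>tr m\<close> is the passage to the quotient.\<close>

definition Lam :: "monomial => nat set set"
 where "Lam m = {U. U \<subseteq> ks m & m - ind U ~: A}"

definition tr :: "monomial => 'k ext => 'k ext"
 where "tr m f U = (if U \<in> Lam m then f U else 0)"

definition sup :: "monomial => 'k ext => bool"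
 where "sup m f = (\<forall>U. f U ~= 0 --> U \<in> Lam m)"

text \<open>Once the multidegree is fixed, the set U determines the monomial, and multiplication by
  x_i is invisible in the coefficients.\<close>

abbreviation ed :: "'k ext => 'k ext" where "ed \<equiv> ediff n (%_. 1)"

abbreviation mon :: "monomial => bool" where "mon m \<equiv> ks m \<subseteq> {..<n}"

definition hp :: "nat => 'k ext => bool" where "hp p f = (\<forall>U. f U ~= 0 --> card U = p)"

definition cyc :: "monomial => 'k ext => bool"
 where "cyc m f \<longleftrightarrow> sup m f & tr m (ed f) = 0"

definition exact :: "monomial => 'k ext => bool"
 where "exact m f = (\<exists>g. sup m g & f = tr m (ed g))"

lemma finite_sub_keys: "U \<subseteq> ks m ==> finite U" using finite_keys finite_subset by blast

section \<open>Passage between homogeneous elements and their coefficients\<close>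

lemma Lam_finite: "U \<in> Lam m ==> finite U" by (auto simp: Lam_def finite_sub_keys)

lemma Lam_up: "U \<in> Lam m ==> U \<subseteq> V ==> V \<subseteq> ks m ==> V \<in> Lam m"
proof -
 assume a: "U \<in> Lam m" "U \<subseteq> V" "V \<subseteq> ks m"
 have "mdvd (m - ind V) (m - ind U)"
  using a finite_sub_keys[of V m] finite_sub_keys[of U m] by (auto simp: mdvd_def lookup_minus cf_ind)
 with a upset show ?thesis by (auto simp: Lam_def)
qed

lemma cf_diff_ind: "U \<subseteq> ks m ==> cf (m - ind U) i + (if i \<in> U then 1 else 0) = cf m i"
 using finite_sub_keys[of U m] by (auto simp: lookup_minus cf_ind cf_pos)

lemma diff_ind_unique:
 assumes "!!i. int (cf t i) + (if i \<in> U then 1 else 0) = im m i"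
 shows "U \<subseteq> ks m" "t = m - ind U"
proof -
 have a: "cf t i + (if i \<in> U then 1 else 0) = cf m i" for i
  using assms[of i] by (auto simp: im_def split: if_splits)
 show U: "U \<subseteq> ks m"
 proof
  fix i assume "i \<in> U" thus "i \<in> ks m" using a[of i] by (auto simp: cf_pos)
 qed
 show "t = m - ind U"
 proof (rule poly_mapping_eqI)
  fix i show "cf t i = cf (m - ind U) i" using a[of i] cf_diff_ind[OF U, of i] by simp
 qed
qed

lemma cf_lift: "cf (lift m f U) t = (if U \<subseteq> ks m & t = m - ind U then f U else 0)"
 by (auto simp: lift_def lookup_single when_def)

lemma low_lift: "low m (lift m f) U = (if U \<subseteq> ks m then f U else 0)" by (simp add: low_def cf_lift)

lemma sup_low_lift: "sup m f ==> low m (lift m f) = f"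
 by (auto simp: low_lift sup_def Lam_def fun_eq_iff)

lemma lift_homog: "mon m ==> sup m f ==> hp p f ==> lift m f \<in> homog (im m) (int p)"
 unfolding homog_def
proof (intro CollectI allI impI)
 fix U t assume a: "mon m" "sup m f" "hp p f" "cf (lift m f U) t ~= 0"
 hence U: "U \<subseteq> ks m" "t = m - ind U" "f U ~= 0" by (auto simp: cf_lift split: if_splits)
 hence "int (cf t i) + (if i \<in> U then 1 else 0) = im m i" for i
  using cf_diff_ind[OF U(1), of i] by (auto simp: im_def split: if_splits)
 moreover have "ks t \<subseteq> ks m" unfolding U(2) by (rule mdvd_keys) (auto simp: mdvd_def lookup_minus)
 ultimately show "U \<subseteq> {..<n} & ks t \<subseteq> {..<n} & t ~: A &
  (\<forall>i. int (cf t i) + (if i \<in> U then 1 else 0) = im m i) & int (card U) = int p"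
  using a U unfolding sup_def Lam_def hp_def by blast
qed

lemma homog_lift:
 assumes "c \<in> homog (im m) p"
 shows "c = lift m (low m c)" "sup m (low m c)" "p >= 0 ==> hp (nat p) (low m c)"
proof -
 have a: "U \<subseteq> ks m & t = m - ind U & t ~: A & int (card U) = p" if "cf (c U) t ~= 0" for U t
 proof -
  have h: "(\<forall>i. int (cf t i) + (if i \<in> U then 1 else 0) = im m i) & t ~: A & int (card U) = p"
   using assms that unfolding homog_def by blast
  hence "U \<subseteq> ks m" "t = m - ind U" using diff_ind_unique[of t U m] by auto
  with h show ?thesis by blast
 qed
 show "c = lift m (low m c)"
 proof
  fix U show "c U = lift m (low m c) U"
   by (rule poly_mapping_eqI) (insert a[of U], auto simp: cf_lift low_def)
 qed
 show "sup m (low m c)" unfolding sup_def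
 proof (intro allI impI)
  fix U assume "low m c U ~= 0"
  hence "cf (c U) (m - ind U) ~= 0" by (auto simp: low_def split: if_splits)
  from a[OF this] show "U \<in> Lam m" by (simp add: Lam_def)
 qed
 show "hp (nat p) (low m c)" if "p >= 0" unfolding hp_def
 proof (intro allI impI)
  fix U assume "low m c U ~= 0"
  hence "cf (c U) (m - ind U) ~= 0" by (auto simp: low_def split: if_splits)
  from a[OF this] have "int (card U) = p" by blast
  thus "card U = nat p" by linarith
 qed
qed

lemma homog_nonempty_im:
 assumes "c \<in> homog M p" "c ~= 0"
 obtains m where "M = im m" "mon m" "p >= 0"
proof -
 obtain U where "c U ~= 0" using assms(2) by (auto simp: fun_eq_iff)
 then obtain t where "cf (c U) t ~= 0" by (metis lookup_zero poly_mapping_eqI)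
 hence a: "U \<subseteq> {..<n}" "ks t \<subseteq> {..<n}" "!!i. int (cf t i) + (if i \<in> U then 1 else 0) = M i" "int (card U) = p"
  using assms(1) unfolding homog_def by blast+
 have f: "finite U" using a(1) finite_below_n by blast
 have "M i = im (t + ind U) i" for i using a(3)[of i] f by (simp add: im_def lookup_add cf_ind split: if_splits)
 moreover have "mon (t + ind U)" by (rule keys_add_subset) (use a f ks_ind in auto)
 ultimately show ?thesis using that[of "t + ind U"] a by auto
qed

lemma lift_eq_iff: "sup m f ==> sup m g ==> lift m f = lift m g \<longleftrightarrow> f = g"
 using sup_low_lift by metis

lemma lift_add: "lift m (f + g) = lift m f + lift m g" and lift_minus: "lift m (- f) = - lift m f"
 and lift_zero [simp]: "lift m 0 = 0" and lift_diff: "lift m (f - g) = lift m f - lift m g"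
 by (auto simp: lift_def fun_eq_iff single_add single_uminus single_diff)

lemma sup_add: "sup m f ==> sup m g ==> sup m (f + g)" and sup_minus: "sup m f ==> sup m (- f)"
 and sup_diff: "sup m f ==> sup m g ==> sup m (f - g)"
 and sup_zero [simp]: "sup m 0" and sup_tr [simp]: "sup m (tr m f')"
 by (auto simp: sup_def tr_def) (metis add_0 diff_zero)+

lemma tr_id: "sup m f ==> tr m f = f" by (auto simp: sup_def tr_def fun_eq_iff)

lemma tr_add: "tr m (f + g) = tr m f + tr m g" and tr_minus: "tr m (- f) = - tr m f"
 and tr_diff: "tr m (f - g) = tr m f - tr m g" and tr_zero [simp]: "tr m 0 = 0" by (auto simp: tr_def fun_eq_iff)

lemma ed_zero [simp]: "ed 0 = 0" by (auto simp: ediff_def contr_def fun_eq_iff intro!: sum.neutral)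

lemma ed_add: "ed (f + g) = ed f + ed g" and ed_minus: "ed (- f) = - ed f"
 and ed_diff: "ed (f - g) = ed f - ed g"
 by (auto simp: ediff_def contr_def fun_eq_iff algebra_simps sum.distrib[symmetric] sum_subtractf[symmetric]
   sum_negf[symmetric] intro!: sum.cong)

lemma low_dd:
 assumes "mon m" "U \<in> Lam m"
 shows "low m (dd y) U = ed (low m y) U"
proof -
 have U: "U \<subseteq> ks m" "m - ind U ~: A" "U \<subseteq> {..<n}" "finite U"
  using assms Lam_finite by (auto simp: Lam_def)
 have "low m (dd y) U = cf (ediff n var y U) (m - ind U)" using U by (simp add: low_def dd_def nf_def cf_nfp)
 also have "... = (\<Sum>i<n. cf (var i * contr i y U) (m - ind U))" by (simp add: ediff_def cf_sum)
 also have "... = (\<Sum>i<n. 1 * contr i (low m y) U)"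
 proof (rule sum.cong, rule refl)
  fix i
  show "cf (var i * contr i y U) (m - ind U) = 1 * contr i (low m y) U"
  proof (cases "i \<in> U")
   case False
   have "m - ind U - sing i 1 = m - ind (insert i U)" by (rule poly_mapping_eqI)
      (insert False U, auto simp: lookup_minus cf_ind lookup_single when_def)
   moreover have "1 <= cf (m - ind U) i \<longleftrightarrow> i \<in> ks m" using False U by (simp add: lookup_minus cf_ind cf_pos)
   ultimately show ?thesis using False U by (auto simp: cf_var_mult contr_def cf_neg_one low_def)
  qed (simp add: cf_var_mult contr_def)
 qed
 finally show ?thesis by (simp add: ediff_def)
qed

lemma cf_dd_support:
 assumes "cf (dd (lift m f) U) t ~= 0"
 shows "U \<in> Lam m" "t = m - ind U"
proof -
 have U: "U \<subseteq> {..<n}" "t ~: A" "cf (ediff n var (lift m f) U) t ~= 0" using cf_dd assms by blast+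
 then obtain i where i: "i < n" "i ~: U" "1 <= cf t i" "cf (lift m f (insert i U)) (t - sing i 1) ~= 0"
  using cf_ediff_nonzero by blast
 hence iU: "insert i U \<subseteq> ks m" "t - sing i 1 = m - ind (insert i U)" by (auto simp: cf_lift split: if_splits)
 have fin: "finite U" using U finite_below_n by blast
 show t: "t = m - ind U"
 proof (rule poly_mapping_eqI)
  fix j
  have "cf (t - sing i 1) j = cf (m - ind (insert i U)) j" using iU by simp
  moreover have "1 <= cf m i" using iU by (simp add: cf_pos)
  ultimately show "cf t j = cf (m - ind U) j" using i fin
   by (auto simp: lookup_minus cf_ind lookup_single when_def split: if_splits)
 qed
 with iU U show "U \<in> Lam m" by (auto simp: Lam_def)
qed

lemma dd_lift: "mon m ==> sup m f ==> dd (lift m f) = lift m (tr m (ed f))"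
proof
 fix U assume m: "mon m" and f: "sup m f"
 show "dd (lift m f) U = lift m (tr m (ed f)) U"
 proof (rule poly_mapping_eqI)
  fix t
  show "cf (dd (lift m f) U) t = cf (lift m (tr m (ed f)) U) t"
  proof (cases "U \<in> Lam m & t = m - ind U")
   case True
   hence "cf (dd (lift m f) U) t = low m (dd (lift m f)) U" by (auto simp: low_def Lam_def)
   also have "... = ed f U" using low_dd[OF m, of U "lift m f"] True sup_low_lift[OF f] by simp
   finally show ?thesis using True by (auto simp: cf_lift tr_def Lam_def)
  next
   case False
   hence "cf (dd (lift m f) U) t = 0" using cf_dd_support by blast
   with False show ?thesis by (auto simp: cf_lift tr_def)
  qed
 qed
qed

text \<open>A primitive of a degree m element may be replaced by its own degree m part: coefficients
  outside \<open>Lam m\<close> are dropped, and \<open>Lam_up\<close> shows that they do not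
  contribute to the boundary inside \<open>Lam m\<close>.\<close>

lemma exact_iff:
 assumes "mon m" "sup m f"
 shows "exact m f \<longleftrightarrow> (\<exists>y. dd y = lift m f)"
proof
 assume "exact m f" thus "\<exists>y. dd y = lift m f" using dd_lift[OF assms(1)] by (auto simp: exact_def)
next
 assume "\<exists>y. dd y = lift m f"
 then obtain y where y: "dd y = lift m f" by blast
 have "tr m (ed (tr m (low m y))) = f"
 proof
  fix U
  show "tr m (ed (tr m (low m y))) U = f U"
  proof (cases "U \<in> Lam m")
   case True
   have "ed (tr m (low m y)) U = ed (low m y) U"
   proof -
    have "contr i (tr m (low m y)) U = contr i (low m y) U" for i
    proof -
     have "insert i U \<in> Lam m | low m y (insert i U) = 0"
      using Lam_up[OF True, of "insert i U"] by (auto simp: low_def)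
     thus ?thesis by (auto simp: contr_def tr_def)
    qed
    thus ?thesis by (simp add: ediff_def)
   qed
   also have "... = low m (lift m f) U" using low_dd[OF assms(1) True, of y] y by simp
   finally show ?thesis using True sup_low_lift[OF assms(2)] by (simp add: tr_def)
  qed (insert assms(2), auto simp: tr_def sup_def)
 qed
 thus "exact m f" unfolding exact_def by (metis sup_tr)
qed

lemma cyc_iff: "mon m ==> sup m f ==> cyc m f \<longleftrightarrow> dd (lift m f) = 0"
 using lift_eq_iff[of m "tr m (ed f)" 0] by (simp add: cyc_def dd_lift)

lemma mul_lift:
 assumes "mon m" "mon m'" "sup m f" "sup m' g"
 shows "lift m f \<cdot> lift m' g = lift (m + m') (tr (m + m') (emul f g))"
proof
 fix U
 show "(lift m f \<cdot> lift m' g) U = lift (m + m') (tr (m + m') (emul f g)) U"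
 proof (cases "U \<subseteq> {..<n}")
  case True
  hence fin: "finite U" by (rule finite_below_n)
  have sf: "f V = 0" if "~ V \<subseteq> ks m" for V using assms(3) that by (auto simp: sup_def Lam_def)
  have sg: "g V = 0" if "~ V \<subseteq> ks m'" for V using assms(4) that by (auto simp: sup_def Lam_def)
  have kk: "ks (m + m') = ks m \<union> ks m'" by (auto simp: in_keys_iff lookup_add)
  have t: "lift m f V * lift m' g (U - V) = sing (m + m' - ind U) (f V * g (U - V))" if "V \<in> Pow U" for V
  proof (cases "V \<subseteq> ks m & U - V \<subseteq> ks m'")
   case True
   have "m - ind V + (m' - ind (U - V)) = m + m' - ind U"
   proof (rule poly_mapping_eqI)
    fix i
    have "cf (m - ind V) i + (if i \<in> V then 1 else 0) = cf m i"
     "cf (m' - ind (U - V)) i + (if i \<in> U - V then 1 else 0) = cf m' i" by (rule cf_diff_ind, use True in simp)+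
    thus "cf (m - ind V + (m' - ind (U - V))) i = cf (m + m' - ind U) i"
     using that fin by (auto simp: lookup_add lookup_minus cf_ind split: if_splits)
   qed
   with True show ?thesis by (simp add: lift_def mult_single)
  next
   case False
   hence "f V = 0 | g (U - V) = 0" using sf[of V] sg[of "U - V"] by blast
   with False show ?thesis by (auto simp: lift_def)
  qed
  have "emul (lift m f) (lift m' g) U = (\<Sum>V\<in>Pow U. (-1) ^ inversions V (U - V) * sing (m + m' - ind U) (f V * g (U - V)))"
   unfolding emul_def using t by (intro sum.cong) auto
  hence e: "cf (emul (lift m f) (lift m' g) U) s = (if s = m + m' - ind U then emul f g U else 0)" for s
   by (simp add: cf_sum cf_neg_one lookup_single when_def emul_def)
  have z: "emul f g U = 0" if "~ U \<subseteq> ks m \<union> ks m'" unfolding emul_def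
  proof (rule sum.neutral, rule ballI)
   fix V assume "V \<in> Pow U"
   hence "~ V \<subseteq> ks m | ~ U - V \<subseteq> ks m'" using that by auto
   hence "f V = 0 | g (U - V) = 0" using sf[of V] sg[of "U - V"] by blast
   thus "(-1) ^ inversions V (U - V) * (f V * g (U - V)) = 0" by auto
  qed
  show ?thesis
   by (rule poly_mapping_eqI) (insert z True, auto simp: mul_def nf_def cf_nfp e cf_lift tr_def Lam_def kk)
 next
  case False
  hence "~ U \<subseteq> ks (m + m')" using assms(1,2) keys_add_subset[of m "{..<n}" m'] by blast
  with False show ?thesis by (simp add: mul_def nf_def lift_def)
 qed
qed

lemma contr_lift:
 assumes "v \<in> ks m"
 shows "contr v (lift m f) = lift (m - sing v 1) (contr v f)"
proof
 fix U
 show "contr v (lift m f) U = lift (m - sing v 1) (contr v f) U"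
 proof (cases "v \<in> U")
  case False
  have 1: "insert v U \<subseteq> ks m \<longleftrightarrow> U \<subseteq> ks (m - sing v 1)"
  proof -
   have "U \<subseteq> ks m \<longleftrightarrow> U \<subseteq> ks (m - sing v 1)" unfolding subset_iff in_keys_iff
    using False by (metis (full_types) diff_zero lookup_minus lookup_single_not_eq)
   thus ?thesis using assms by auto
  qed
  show ?thesis
  proof (cases "insert v U \<subseteq> ks m")
   case True
   hence fin: "finite U" using finite_sub_keys[of "insert v U" m] by simp
   have "m - ind (insert v U) = m - sing v 1 - ind U"
    by (rule poly_mapping_eqI) (insert fin False, auto simp: lookup_minus cf_ind lookup_single when_def)
   thus ?thesis using True 1 False by (cases "even (below U v)") (auto simp: contr_def lift_def single_uminus)
  next
   case F: False
   thus ?thesis using False 1 by (auto simp: contr_def lift_def)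
  qed
 qed (simp add: contr_def lift_def)
qed

end

section \<open>Words of homogeneous cycles\<close>

context nudga
begin

text \<open>The Bianchi identity: both halves of the boundary equal the triple product of the
  matrix, by associativity.\<close>

lemma d_msum:
 assumes "!!u v. x <= u ==> u < v ==> v <= y ==> (u, v) ~= (x, y) ==> d (a u v) = msum a u v"
 shows "d (msum a x y) = 0"
proof -
 have "d (msum a x y) = mm (%u v. - bar (d (a u v))) a x y - mm a (%u v. d (a u v)) x y"
  by (simp add: msum_def d_mm d_bar)
 also have "mm (%u v. - bar (d (a u v))) a x y = mm (mm a (bm a)) a x y"
  by (rule mm_cong) (auto simp: assms msum_def bar_mm)
 also have "mm a (%u v. d (a u v)) x y = mm a (mm (bm a) a) x y" by (rule mm_cong) (auto simp: assms msum_def)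
 finally show ?thesis by (simp add: mm_assoc)
qed

definition subw :: "'b list => nat => nat => 'b list"
 where "subw w x y = take (y - x) (drop x w)"

lemma length_subw: "y <= length w ==> length (subw w x y) = y - x" by (simp add: subw_def)

lemma subw_all: "subw w 0 (length w) = w" by (simp add: subw_def)

lemma set_subw: "set (subw w x y) \<subseteq> set w"
 unfolding subw_def by (meson set_drop_subset set_take_subset order_trans)

lemma Oword_subw:
 assumes "x <= y" "y <= length w"
 shows "Oword \<gamma> (subw w x y) = msum (%u v. \<gamma> (subw w u v)) x y"
proof -
 have "Oword \<gamma> (subw w x y) = (\<Sum>i\<in>{1..<y - x}. bar (\<gamma> (subw w x (x + i))) \<cdot> \<gamma> (subw w (x + i) y))"
  unfolding Oword_def length_subw[OF assms(2)]
 proof (rule sum.cong[OF refl])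
  fix i assume "i \<in> {1..<y - x}"
  hence "take i (subw w x y) = subw w x (x + i)" "drop i (subw w x y) = subw w (x + i) y"
   by (simp_all add: subw_def drop_take add.commute)
  thus "bar (\<gamma> (take i (subw w x y))) \<cdot> \<gamma> (drop i (subw w x y)) = bar (\<gamma> (subw w x (x + i))) \<cdot> \<gamma> (subw w (x + i) y)"
   by simp
 qed
 also have "... = (\<Sum>z\<in>{x<..<y}. bar (\<gamma> (subw w x z)) \<cdot> \<gamma> (subw w z y))"
  by (rule sum.reindex_bij_witness[where i = "%z. z - x" and j = "%i. x + i"]) auto
 finally show ?thesis by (simp add: msum_def mm_def)
qed

end

context monomial_koszul
begin

section \<open>Exactness in a fixed degree\<close>

lemma ks_diff_le: "ks (m - s) \<subseteq> ks (m :: monomial)" by (rule mdvd_keys) (auto simp: mdvd_def lookup_minus)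

lemma hp_zero [simp]: "hp p 0" by (simp add: hp_def)

text \<open>By \<open>ediff_wedge\<close>, d(e_v f) = f - e_v d f, so f is the boundary of e_v f if
  the last term vanishes on \<open>Lam m\<close>. The condition concerns \<open>ed f\<close> before
  truncation: its values at U - {v} count even where this set is not in
  \<open>Lam m\<close>.\<close>

lemma cone:
 assumes "mon m" "v \<in> ks m" "sup m f" "tr m (wedge v (ed f)) = 0"
 shows "exact m f"
proof -
 have "sup m (wedge v f)" unfolding sup_def
 proof (intro allI impI)
  fix U assume "wedge v f U ~= 0"
  hence U: "v \<in> U" "U - {v} \<in> Lam m" using assms(3) by (auto simp: wedge_def sup_def split: if_splits)
  hence "U \<subseteq> ks m" using assms(2) by (auto simp: Lam_def)
  thus "U \<in> Lam m" using Lam_up[OF U(2)] by auto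
 qed
 moreover have "tr m (ed (wedge v f)) = f"
 proof
  fix U show "tr m (ed (wedge v f)) U = f U"
  proof (cases "U \<in> Lam m")
   case True
   have "ed (wedge v f) U = f U - wedge v (ed f) U"
    using assms(1,2) ediff_wedge[OF Lam_finite[OF True], of v n "%_. 1" f] by auto
   moreover have "wedge v (ed f) U = 0" using True fun_cong[OF assms(4), of U] by (simp add: tr_def)
   ultimately show ?thesis using True by (simp add: tr_def)
  qed (insert assms(3), auto simp: tr_def sup_def)
 qed
 ultimately show ?thesis unfolding exact_def by metis
qed

lemma exact_hp:
 assumes "exact m f" "hp p f"
 obtains g where "sup m g" "hp (Suc p) g" "f = tr m (ed g)"
proof -
 obtain g where g: "sup m g" "f = tr m (ed g)" using assms(1) by (auto simp: exact_def)
 define g' where "g' U = (if card U = Suc p then g U else 0)" for U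
 have "f = tr m (ed g')"
 proof
  fix U
  show "f U = tr m (ed g') U"
  proof (cases "U \<in> Lam m")
   case True
   have fin: "finite U" by (rule Lam_finite[OF True])
   show ?thesis
   proof (cases "card U = p")
    case c: True
    have "contr i g' U = contr i g U" for i using c fin by (simp add: contr_def g'_def)
    hence "ed g' U = ed g U" by (simp add: ediff_def)
    thus ?thesis using True g(2) by (simp add: tr_def)
   next
    case c: False
    have "contr i g' U = 0" for i using c fin by (simp add: contr_def g'_def)
    hence "ed g' U = 0" by (simp add: ediff_def)
    thus ?thesis using c assms(2) by (auto simp: tr_def hp_def)
   qed
  next
   case False
   thus ?thesis using g(2) by (simp add: tr_def)
  qed
 qed
 moreover have "sup m g'" using g(1) by (auto simp: sup_def g'_def)
 moreover have "hp (Suc p) g'" by (auto simp: hp_def g'_def)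
 ultimately show ?thesis using that by blast
qed

lemma exact_zero [simp]: "exact m 0" unfolding exact_def by (rule exI[of _ 0]) simp

lemma exact_add: "exact m f ==> exact m g ==> exact m (f + g)"
 unfolding exact_def by (metis sup_add ed_add tr_add)

lemma exact_minus: "exact m f ==> exact m (- f)"
 unfolding exact_def by (metis sup_minus ed_minus tr_minus)

lemma exact_diff: "exact m f ==> exact m g ==> exact m (f - g)"
 using exact_add[OF _ exact_minus, of m f g] by simp

lemma exact_sup: "exact m f ==> sup m f" by (auto simp: exact_def)

lemma exact_tr_ed: "sup m g ==> exact m (tr m (ed g))" by (auto simp: exact_def)

lemma exact_cyc: "mon m ==> exact m f ==> cyc m f"
 using exact_iff[of m f] cyc_iff[of m f] exact_sup d_d by metis

lemma cyc_diff: "cyc m f ==> cyc m g ==> cyc m (f - g)"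
 by (simp add: cyc_def sup_diff ed_diff tr_diff)

lemma homog_boundary:
 assumes "dd y \<in> homog M p"
 obtains y' where "y' \<in> homog M (p + 1)" "dd y' = dd y"
proof (cases "dd y = 0")
 case True
 thus ?thesis using that[of 0] homog_zero by simp
next
 case False
 then obtain m where m: "M = im m" "mon m" "p >= 0" using homog_nonempty_im assms by metis
 define f where "f = low m (dd y)"
 have f: "dd y = lift m f" "sup m f" "hp (nat p) f" using homog_lift[of "dd y" m p] assms m unfolding f_def by auto
 hence "exact m f" using exact_iff[OF m(2) f(2)] by blast
 then obtain g where g: "sup m g" "hp (Suc (nat p)) g" "f = tr m (ed g)" using exact_hp f(3) by metis
 hence "dd (lift m g) = dd y" using dd_lift m f by simp
 moreover have "lift m g \<in> homog M (p + 1)" using lift_homog[OF m(2) g(1,2)] m by (simp add: add.commute)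
 ultimately show ?thesis using that by blast
qed

section \<open>Letters, words and chosen primitives\<close>

type_synonym 'c label = "monomial \<times> nat \<times> 'c ext"

text \<open>Bounding cycles are excluded, so every criterion for exactness restricts the possible
  letters.\<close>

definition labels :: "'k label set"
 where "labels = {(m, p, f). mon m & p >= 1 & hp p f & cyc m f & ~ exact m f}"

abbreviation words :: "'k label list set" where "words \<equiv> lists labels"

definition lval :: "'k label => 'k elt" where "lval b = lift (fst b) (snd (snd b))"

definition wdeg :: "'k label list => monomial" where "wdeg w = sum_list (map fst w)"

definition wp :: "'k label list => nat" where "wp w = sum_list (map (%b. fst (snd b)) w)"

text \<open>One primitive of the obstruction is chosen for every word, in the degree prescribed by
  its letters. The choice is meaningful only if such a primitive exists, which is what
  \<open>wgood\<close> expresses.\<close>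

function gam :: "'k label list => 'k elt" where
 "gam w = (if length w <= 1 then (if w = [] then 0 else lval (hd w))
   else (SOME y. y \<in> homog (im (wdeg w)) (int (wp w) + int (length w) - 1) &
    dd y = (\<Sum>i\<in>{1..<length w}. bar (gam (take i w)) \<cdot> gam (drop i w))))" by pat_completeness auto
termination by (relation "Wellfounded.measure length") auto

declare gam.simps [simp del]

definition wgood :: "'k label list => bool"
 where "wgood w \<longleftrightarrow> gam w \<in> homog (im (wdeg w)) (int (wp w) + int (length w) - 1) & dd (gam w) = Oword gam w"

text \<open>Subwords and contractions lower the degree. A change of primitives keeps the degree and
  merges several letters into one, hence the second clause.\<close>

definition smaller :: "'k label list => 'k label list => bool"
 where "smaller w' w \<longleftrightarrow> mdegree (wdeg w') < mdegree (wdeg w) |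
  mdegree (wdeg w') = mdegree (wdeg w) & length w' < length w"

abbreviation (input) smaller_good :: "'k label list => prop"
 where "smaller_good w \<equiv> (!!w'. w' \<in> words ==> w' ~= [] ==> smaller w' w ==> wgood w')"

lemma im_add: "im (s + t) = (%i. im s i + im t i)" by (simp add: im_def lookup_add fun_eq_iff)

lemma im_inj: "im s = im t ==> s = t" by (auto simp: im_def fun_eq_iff intro: poly_mapping_eqI)

lemma wdeg_append: "wdeg (v @ w) = wdeg v + wdeg w" and wp_append: "wp (v @ w) = wp v + wp w"
 by (simp_all add: wdeg_def wp_def)

lemma gam_single [simp]: "gam [b] = lval b" by (simp add: gam.simps)

lemma wdeg_single [simp]: "wdeg [b] = fst b" and wp_single [simp]: "wp [b] = fst (snd b)"
 by (simp_all add: wdeg_def wp_def)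

lemma label_lval:
 assumes "b \<in> labels"
 shows "lval b \<in> homog (im (fst b)) (int (fst (snd b)))" "dd (lval b) = 0" "mon (fst b)" "fst (snd b) >= 1"
proof -
 obtain m p f where b: "b = (m, p, f)" "mon m" "p >= 1" "hp p f" "cyc m f" using assms by (auto simp: labels_def)
 hence "sup m f" by (simp add: cyc_def)
 with b show "lval b \<in> homog (im (fst b)) (int (fst (snd b)))" "dd (lval b) = 0" "mon (fst b)" "fst (snd b) >= 1"
  using lift_homog[of m f p] cyc_iff[of m f] by (auto simp: lval_def)
qed

lemma label_deg: "b \<in> labels ==> fst b ~= 0"
proof
 assume b: "b \<in> labels" "fst b = 0"
 obtain m p f where e: "b = (m, p, f)" by (metis surj_pair)
 with b have "m = 0" "p >= 1" "hp p f" "sup m f" "~ exact m f" by (auto simp: labels_def cyc_def)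
 hence "f U = 0" for U by (cases "U = {}") (auto simp: sup_def Lam_def hp_def)
 hence "f = 0" by auto
 thus False using \<open>~ exact m f\<close> by simp
qed

lemma mdegree_wdeg_pos: "w \<in> words ==> w ~= [] ==> mdegree (wdeg w) > 0"
proof (induction w)
 case (Cons b w)
 hence "mdegree (fst b) > 0" using label_deg[of b] mdegree_eq_0[of "fst b"] by auto
 thus ?case by (simp add: wdeg_def mdegree_add)
qed simp

lemma wgood_single: "b \<in> labels ==> wgood [b]"
 using label_lval[of b] by (simp add: wgood_def Oword_def)

lemma lists_subw: "w \<in> words ==> subw w x y \<in> words"
 using set_subw[of w x y] by auto

lemma subw_split: "x <= z ==> z <= y ==> y <= length w ==> subw w x y = subw w x z @ subw w z y"
proof -
 assume a: "x <= z" "z <= y" "y <= length w"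
 have "subw w x y = take (z - x) (subw w x y) @ drop (z - x) (subw w x y)" by simp
 also have "take (z - x) (subw w x y) = subw w x z" using a by (simp add: subw_def min_def)
 also have "drop (z - x) (subw w x y) = subw w z y" using a by (simp add: subw_def drop_take)
 finally show ?thesis .
qed

lemma smaller_subw:
 assumes "w \<in> words" "x < y" "y <= length w" "(x, y) ~= (0, length w)"
 shows "smaller (subw w x y) w" "mdegree (wdeg (subw w x y)) < mdegree (wdeg w)"
proof -
 have "subw w 0 (length w) = subw w 0 x @ subw w x y @ subw w y (length w)"
  using subw_split[of 0 x "length w" w] subw_split[of x y "length w" w] assms by simp
 from arg_cong[OF this, of "%w. mdegree (wdeg w)"]
 have "mdegree (wdeg w) = mdegree (wdeg (subw w 0 x)) + mdegree (wdeg (subw w x y)) + mdegree (wdeg (subw w y (length w)))"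
  by (simp add: subw_all wdeg_append mdegree_add)
 moreover have "mdegree (wdeg (subw w 0 x)) > 0 | mdegree (wdeg (subw w y (length w))) > 0"
 proof (cases "x = 0")
  case True
  hence "y < length w" using assms by auto
  hence "subw w y (length w) ~= []" by (simp add: subw_def)
  thus ?thesis by (intro disjI2 mdegree_wdeg_pos lists_subw assms)
 next
  case False
  hence "subw w 0 x ~= []" using assms by (auto simp: subw_def)
  thus ?thesis by (intro disjI1 mdegree_wdeg_pos lists_subw assms)
 qed
 ultimately show "mdegree (wdeg (subw w x y)) < mdegree (wdeg w)" by auto
 thus "smaller (subw w x y) w" by (simp add: smaller_def)
qed

lemma Oword_homog:
 assumes w: "w \<in> words" and good: "!!x y. x < y ==> y <= length w ==> (x, y) ~= (0, length w) ==> wgood (subw w x y)"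
 shows "Oword gam w \<in> homog (im (wdeg w)) (int (wp w) + int (length w) - 2)" "dd (Oword gam w) = 0"
proof -
 have O: "Oword gam w = msum (%u v. gam (subw w u v)) 0 (length w)"
  using Oword_subw[of 0 "length w" w gam] by (simp add: subw_all)
 have "bar (gam (subw w 0 z)) \<cdot> gam (subw w z (length w)) \<in> homog (im (wdeg w)) (int (wp w) + int (length w) - 2)"
  if z: "0 < z" "z < length w" for z
 proof -
  have 1: "gam (subw w 0 z) \<in> homog (im (wdeg (subw w 0 z))) (int (wp (subw w 0 z)) + int z - 1)"
   using good[of 0 z] z by (auto simp: wgood_def length_subw)
  have 2: "gam (subw w z (length w)) \<in> homog (im (wdeg (subw w z (length w)))) (int (wp (subw w z (length w))) + int (length w - z) - 1)"
   using good[of z "length w"] z by (auto simp: wgood_def length_subw)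
  have "w = subw w 0 z @ subw w z (length w)" using subw_split[of 0 z "length w" w] z by (simp add: subw_all)
  hence "wdeg w = wdeg (subw w 0 z) + wdeg (subw w z (length w))" "wp w = wp (subw w 0 z) + wp (subw w z (length w))"
   using wdeg_append wp_append by metis+
  thus ?thesis using homog_mul[OF homog_bar[OF 1] 2] z by (simp add: im_add algebra_simps)
 qed
 thus "Oword gam w \<in> homog (im (wdeg w)) (int (wp w) + int (length w) - 2)"
  unfolding O msum_def mm_def by (intro homog_sum) auto
 show "dd (Oword gam w) = 0" unfolding O by (rule d_msum) (insert good, auto simp: wgood_def Oword_subw)
qed

text \<open>Induction along \<open>smaller\<close>. Any primitive of the obstruction suffices,
  because \<open>homog_boundary\<close> replaces it by one in the degree required by
  \<open>gam\<close>.\<close>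

lemma all_words_good:
 assumes step: "!!w. w \<in> words ==> length w >= 2 ==>
   PROP smaller_good w ==> \<exists>y. dd y = Oword gam w"
  and w: "w \<in> words" "w ~= []"
 shows "wgood w"
proof -
 let ?R = "inv_image (less_than <*lex*> less_than) (%w. (mdegree (wdeg w), length w))"
 have "wf ?R" by (intro wf_inv_image wf_lex_prod wf_less_than)
 hence "w \<in> words --> w ~= [] --> wgood w"
 proof (induction w rule: wf_induct_rule)
  case (less w)
  show ?case
  proof (intro impI)
   assume w: "w \<in> words" "w ~= []"
   have IH: "wgood w'" if "w' \<in> words" "w' ~= []" "smaller w' w" for w'
    using less[of w'] that by (auto simp: smaller_def)
   show "wgood w"
   proof (cases "length w >= 2")
    case True
    have sub: "wgood (subw w x y)" if "x < y" "y <= length w" "(x, y) ~= (0, length w)" for x y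
     using that by (intro IH smaller_subw lists_subw w) (auto simp: subw_def)
    obtain y where y: "dd y = Oword gam w" using step[OF w(1) True] IH by blast
    hence "dd y \<in> homog (im (wdeg w)) (int (wp w) + int (length w) - 2)"
     using Oword_homog[OF w(1) sub] by simp
    then obtain y' where "y' \<in> homog (im (wdeg w)) (int (wp w) + int (length w) - 2 + 1)" "dd y' = dd y"
     by (rule homog_boundary)
    hence "\<exists>y. y \<in> homog (im (wdeg w)) (int (wp w) + int (length w) - 1) & dd y = Oword gam w"
     using y by (intro exI[of _ y']) (simp add: algebra_simps)
    moreover have "gam w = (SOME y. y \<in> homog (im (wdeg w)) (int (wp w) + int (length w) - 1) & dd y = Oword gam w)"
     using True by (subst gam.simps) (simp add: Oword_def)
    ultimately show ?thesis unfolding wgood_def by (metis (mono_tags, lifting) someI_ex)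
   next
    case False
    then obtain b where "w = [b]" using w by (cases w; cases "tl w") auto
    thus ?thesis using wgood_single w by auto
   qed
  qed
 qed
 thus ?thesis using w by blast
qed

text \<open>A cycle that does not bound is itself a letter. The exception is the class of 1 in
  homological and multidegree 0, which \<open>p0\<close> excludes.\<close>

lemma homog_select:
 assumes e: "e \<in> homog M p" "dd e = 0" and p0: "p = 0 ==> M ~= (%_. 0)"
 shows "(\<exists>\<beta>\<in>homog M (p + 1). e = dd \<beta>) |
  (\<exists>b\<in>labels. M = im (fst b) & p = int (fst (snd b)) & e = lval b)"
proof (cases "e = 0")
 case True
 thus ?thesis using homog_zero[of M "p + 1"] by (metis d_zero)
next
 case False
 then obtain m where m: "M = im m" "mon m" "p >= 0" using homog_nonempty_im e(1) by metis
 define f where "f = low m e"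
 have f: "e = lift m f" "sup m f" "hp (nat p) f" using homog_lift[of e m p] e m unfolding f_def by auto
 have ex: ?thesis if exf: "exact m f"
 proof -
  obtain y where y: "dd y = lift m f" using exact_iff[OF m(2) f(2)] exf by blast
  hence "dd y \<in> homog M p" using f e by simp
  then obtain y' where "y' \<in> homog M (p + 1)" "dd y' = dd y" by (rule homog_boundary)
  thus ?thesis using y f(1) by metis
 qed
 have c: "cyc m f" using cyc_iff[OF m(2) f(2)] e f by simp
 show ?thesis
 proof (cases "p = 0")
  case True
  \<comment> \<open>In homological degree 0 only the empty set carries a coefficient, so
    \<open>ed f\<close> is 0 and any variable of m serves for \<open>cone\<close>.\<close>
  hence "m ~= 0" using p0 m by (auto simp: im_def fun_eq_iff)
  then obtain v where v: "v \<in> ks m" by (metis keys_eq_empty ex_in_conv)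
  have "f U = 0" if U: "infinite U | U ~= {}" for U
  proof (rule ccontr)
   assume "f U ~= 0"
   hence "finite U" "card U = 0" using f(2,3) True by (auto simp: hp_def sup_def Lam_finite)
   thus False using U by simp
  qed
  hence "ed f = 0" by (auto simp: ediff_def contr_def fun_eq_iff intro!: sum.neutral)
  hence "wedge v (ed f) = 0" by (auto simp: wedge_def)
  hence "exact m f" using cone[OF m(2) v f(2)] by simp
  thus ?thesis by (rule ex)
 next
  case False
  show ?thesis
  proof (cases "exact m f")
   case ne: False
   have "(m, nat p, f) \<in> labels" using m f c ne False by (auto simp: labels_def)
   thus ?thesis using m f by (intro disjI2 bexI[of _ "(m, nat p, f)"]) (auto simp: lval_def)
  qed (rule ex)
 qed
qed

lemma homog_p_select:
 assumes e: "e \<in> homog_p (int p)" "dd e = 0" "p >= 1"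
 obtains S \<beta> where "finite S" "S \<subseteq> labels" "!!b. b \<in> S ==> fst (snd b) = p" "\<beta> \<in> homog_p (int p + 1)"
  "e = (\<Sum>b\<in>S. lval b) + dd \<beta>"
proof -
 \<comment> \<open>The finitely many multidegrees of the terms of e. Each component is a cycle of
   its own; those that do not bound become the letters.\<close>
 define Ms where "Ms = (\<Union>U\<in>Pow {..<n}. (%t. t + ind U) ` ks (e U))"
 have fin: "finite Ms" by (simp add: Ms_def)
 have eD: "U \<subseteq> {..<n} & ks t \<subseteq> {..<n} & t ~: A & card U = p" if "cf (e U) t ~= 0" for U t
  using e(1) that unfolding homog_p_def by auto
 have Ms: "mon m" if "m \<in> Ms" for m
 proof -
  obtain U t where "U \<subseteq> {..<n}" "t \<in> ks (e U)" "m = t + ind U" using \<open>m \<in> Ms\<close> by (auto simp: Ms_def)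
  thus ?thesis using eD[of U t] keys_add_subset[of t "{..<n}" "ind U"] ks_ind[of U] finite_below_n[of U]
   by (auto simp: in_keys_iff)
 qed
 have low: "sup m (low m e)" "hp p (low m e)" for m
  using eD by (auto simp: sup_def hp_def low_def Lam_def split: if_splits)
 have sum: "e = (\<Sum>m\<in>Ms. lift m (low m e))"
 proof
  fix U
  show "e U = (\<Sum>m\<in>Ms. lift m (low m e)) U"
  proof (rule poly_mapping_eqI)
   fix t
   have fs: "(\<Sum>m\<in>Ms. lift m (low m e)) U = (\<Sum>m\<in>Ms. lift m (low m e) U)"
    by (induction Ms rule: infinite_finite_induct) auto
   have "cf ((\<Sum>m\<in>Ms. lift m (low m e)) U) t = (\<Sum>m\<in>Ms. if U \<subseteq> ks m & t = m - ind U then cf (e U) t else 0)"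
    unfolding fs cf_sum by (intro sum.cong refl) (simp add: cf_lift low_def)
   also have "... = (\<Sum>m\<in>Ms. if m = t + ind U then cf (e U) t else 0)"
   proof (cases "cf (e U) t = 0")
    case False
    hence fU: "finite U" using eD[OF False] finite_below_n by blast
    have "U \<subseteq> ks m & t = m - ind U \<longleftrightarrow> m = t + ind U" for m
    proof
     assume "U \<subseteq> ks m & t = m - ind U"
     thus "m = t + ind U" using mdvd_ind[OF fU, of m] mdvd_imp_add[of "ind U" m] by (simp add: add.commute)
    next
     assume "m = t + ind U"
     thus "U \<subseteq> ks m & t = m - ind U" using mdvd_ind[OF fU, of m] by simp
    qed
    thus ?thesis by simp
   next
    case True
    thus ?thesis by (simp only: if_cancel)
   qed
   also have "... = cf (e U) t"
   proof (cases "cf (e U) t = 0")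
    case False
    hence "U \<in> Pow {..<n}" "t \<in> ks (e U)" using eD[of U t] by (auto simp: in_keys_iff)
    hence "t + ind U \<in> Ms" unfolding Ms_def by blast
    thus ?thesis using fin by simp
   next
    case True
    thus ?thesis by (simp only: if_cancel sum.neutral_const)
   qed
   finally show "cf (e U) t = cf ((\<Sum>m\<in>Ms. lift m (low m e)) U) t" by simp
  qed
 qed
 have c: "cyc m (low m e)" if "m \<in> Ms" for m
 proof -
  have "tr m (ed (low m e)) = tr m (low m (dd e))" using low_dd[OF Ms[OF that], of _ e] by (auto simp: tr_def)
  also have "... = 0" using e(2) by (auto simp: tr_def low_def)
  finally show ?thesis using low by (simp add: cyc_def)
 qed
 define N where "N = {m\<in>Ms. ~ exact m (low m e)}"
 define S where "S = (%m. (m, p, low m e)) ` N"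
 have "\<exists>y. y \<in> homog_p (int p + 1) & dd y = lift m (low m e)" if "m \<in> Ms - N" for m
 proof -
  have "exact m (low m e)" using that by (simp add: N_def)
  then obtain g where g: "sup m g" "hp (Suc p) g" "low m e = tr m (ed g)" using exact_hp low(2) by metis
  have "mon m" using Ms that by auto
  hence "lift m g \<in> homog (im m) (int (Suc p))" using lift_homog g by blast
  thus ?thesis using dd_lift[OF \<open>mon m\<close> g(1)] g(3) homog_subset[of "im m" "int (Suc p)"]
   by (intro exI[of _ "lift m g"]) (auto simp: add.commute)
 qed
 then obtain y where y: "!!m. m \<in> Ms - N ==> y m \<in> homog_p (int p + 1) & dd (y m) = lift m (low m e)" by metis
 have "e = (\<Sum>m\<in>N. lift m (low m e)) + (\<Sum>m\<in>Ms - N. lift m (low m e))"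
  by (subst sum) (insert sum.subset_diff[of N Ms "%m. lift m (low m e)"] fin, auto simp: N_def add.commute)
 also have "(\<Sum>m\<in>N. lift m (low m e)) = (\<Sum>b\<in>S. lval b)"
  unfolding S_def by (subst sum.reindex) (auto simp: inj_on_def lval_def)
 also have "(\<Sum>m\<in>Ms - N. lift m (low m e)) = dd (\<Sum>m\<in>Ms - N. y m)"
  unfolding d_sum by (rule sum.cong) (use y in auto)
 finally show ?thesis
 proof (rule that[rotated -1])
  show "finite S" using fin by (simp add: S_def N_def)
  show "S \<subseteq> labels" using Ms c low e(3) by (auto simp: S_def N_def labels_def)
  show "(\<Sum>m\<in>Ms - N. y m) \<in> homog_p (int p + 1)" by (rule homog_p_sum) (use y in auto)
 qed (auto simp: S_def)
qed

text \<open>Here \<open>q\<close> is the sum of the shifted degrees of the first entries, so that the \<open>(x, y)\<close> entry of a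
 defining system has degree \<open>q y - q x - 1\<close>.\<close>

lemma path_degree:
 assumes "p \<in> paths (%x y. {b\<in>labels. int (fst (snd b)) = q y - q x - 1}) x y"
 shows "map snd p \<in> words" "int (wp (map snd p)) + int (length p) = q y - q x"
proof -
 have "map snd p \<in> words & int (wp (map snd p)) + int (length p) = q y - q x"
  using assms unfolding paths_def mem_Collect_eq
 proof (induction p arbitrary: x)
  case (Cons a p)
  obtain z b where a: "a = (z, b)" by (cases a)
  have "b \<in> labels" "int (fst (snd b)) = q z - q x - 1" "ispath (%x y. {b\<in>labels. int (fst (snd b)) = q y - q x - 1}) z p y"
   using Cons.prems unfolding a by auto
  thus ?case using Cons.IH[of z] unfolding a by (auto simp: wp_def)
 qed (simp add: wp_def)
 thus "map snd p \<in> words" "int (wp (map snd p)) + int (length p) = q y - q x" by auto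
qed

text \<open>The decomposition writes the obstruction of an arbitrary defining system, homogeneous
  only in homological degree, as a boundary plus obstructions of words, and these bound. Gaps of at
  least 2 in q say that all entries have positive degree.\<close>

lemma system_obstruction_exact:
 assumes good: "!!w. w \<in> words ==> w ~= [] ==> wgood w"
  and k: "k > 0" and q: "!!x y. x < y ==> q y - q x >= 2"
  and a: "!!x y. x < y ==> y <= k ==> (x, y) ~= (0, k) ==> a x y \<in> homog_p (q y - q x - 1)"
  and MC: "!!x y. x < y ==> y <= k ==> (x, y) ~= (0, k) ==> dd (a x y) = msum a x y"
 shows "\<exists>f. msum a 0 k = dd f"
proof -
 let ?L = "%x y. {b\<in>labels. int (fst (snd b)) = q y - q x - 1}"
 have pg: "wgood (map snd p) & int (wp (map snd p)) + int (length p) = q y - q x" if "p \<in> paths ?L x y" "x < y" for p x y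
 proof -
  have "p ~= []" using that by (auto simp: paths_def)
  thus ?thesis using path_degree[OF that(1)] good[of "map snd p"] by simp
 qed
 have H: "homog_p (q y - q x - 1 + 1) = homog_p (q y - q x)" for x y by simp
 obtain H f where Hf: "!!x y. finite (H x y)" "H 0 k = {}"
  "!!x y. 0 <= x ==> x < y ==> y <= k ==> (x, y) ~= (0, k) ==> H x y \<subseteq> ?L x y & True"
  "msum a 0 k = (\<Sum>p\<in>paths H 0 k. Oword gam (map snd p)) + dd f"
 proof (rule MC_decomposition[where C = "%x y. homog_p (q y - q x - 1)" and D = "%x y. homog_p (q y - q x)"
    and L = ?L and Q = "%_ _ _. True" and \<gamma> = gam and a = a, OF k])
  fix x y z u v
  show "u \<in> homog_p (q z - q x - 1) ==> v \<in> homog_p (q y - q z) ==> u \<cdot> v \<in> homog_p (q y - q x - 1)"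
   using homog_p_mul[of u "q z - q x - 1" v "q y - q z"] by (simp add: algebra_simps)
  show "u \<in> homog_p (q z - q x) ==> v \<in> homog_p (q y - q z - 1) ==> u \<cdot> v \<in> homog_p (q y - q x - 1)"
   using homog_p_mul[of u "q z - q x" v "q y - q z - 1"] by (simp add: algebra_simps)
 next
  fix x y e assume xy: "0 <= x" "x < y" "y <= k" "(x, y) ~= (0, k)" and e: "e \<in> homog_p (q y - q x - 1)" "dd e = 0"
  define p where "p = nat (q y - q x - 1)"
  have p: "q y - q x - 1 = int p" "p >= 1" using q[OF xy(2)] by (auto simp: p_def)
  obtain S \<beta> where "finite S" "S \<subseteq> labels" "!!b. b \<in> S ==> fst (snd b) = p" "\<beta> \<in> homog_p (int p + 1)"
   "e = (\<Sum>b\<in>S. lval b) + dd \<beta>" using homog_p_select[of e p] e p by metis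
  moreover have "homog_p (q y - q x) = homog_p (int p + 1)" using p(1) by (simp add: algebra_simps)
  ultimately show "\<exists>S \<beta>. finite S & S \<subseteq> ?L x y & True & \<beta> \<in> homog_p (q y - q x) & e = (\<Sum>b\<in>S. gam [b]) + dd \<beta>"
   using p by (intro exI[of _ S] exI[of _ \<beta>]) auto
 next
  fix x y p assume "x < y" "p \<in> paths ?L x y"
  thus "gam (map snd p) \<in> homog_p (q y - q x - 1) & dd (gam (map snd p)) = Oword gam (map snd p)"
   using pg[of p x y] homog_subset unfolding wgood_def by fastforce
 qed (insert a MC, auto intro: homog_p_zero homog_p_add homog_p_minus homog_p_bar)
 have "\<exists>y. Oword gam (map snd p) = dd y" if "p \<in> paths H 0 k" for p
 proof -
  have "ispath ?L 0 p k" using that unfolding paths_def mem_Collect_eq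
  proof (rule ispath_mono)
   fix u v assume "0 <= u" "u < v" "v <= k" thus "H u v \<subseteq> ?L u v"
    using Hf(2) Hf(3)[of u v] by (cases "(u, v) = (0, k)") auto
  qed
  hence "wgood (map snd p)" using pg[of p 0 k] k by (simp add: paths_def)
  thus ?thesis unfolding wgood_def by metis
 qed
 then obtain g where "!!p. p \<in> paths H 0 k ==> Oword gam (map snd p) = dd (g p)" by metis
 hence "msum a 0 k = dd (sum g (paths H 0 k) + f)" using Hf(4) by (simp add: d_add d_sum)
 thus ?thesis by blast
qed

lemma system_exists:
 assumes good: "!!w. w \<in> words ==> w ~= [] ==> wgood w"
  and z: "!!x. x < k ==> z x \<in> homog_p (int (p x)) & dd (z x) = 0 & p x >= 1"
  and q: "!!x. x < k ==> q (Suc x) = q x + int (p x) + 1"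
 obtains a where "!!x y. x < y ==> y <= k ==> a x y \<in> homog_p (q y - q x - 1)"
  "!!x y. x < y ==> y <= k ==> dd (a x y) = msum a x y"
  "!!x. x < k ==> \<exists>\<beta>\<in>homog_p (int (p x) + 1). z x = a x (Suc x) + dd \<beta>"
proof -
 have "\<exists>S. finite S & S \<subseteq> labels & (\<forall>b\<in>S. fst (snd b) = p x) & (\<exists>\<beta>\<in>homog_p (int (p x) + 1). z x = (\<Sum>b\<in>S. lval b) + dd \<beta>)"
  if "x < k" for x using homog_p_select[of "z x" "p x"] z[OF that] by metis
 then obtain S where S: "!!x. x < k ==> finite (S x) & S x \<subseteq> labels & (\<forall>b\<in>S x. fst (snd b) = p x) & (\<exists>\<beta>\<in>homog_p (int (p x) + 1). z x = (\<Sum>b\<in>S x. lval b) + dd \<beta>)"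
  by metis
 \<comment> \<open>Letters sit only on unit intervals, so \<open>Gam gam H\<close> is the system
   spanned by the chosen primitives of the words in these letters.\<close>
 define H where "H x y = (if y = Suc x & x < k then S x else {})" for x y
 let ?L = "%x y. {b\<in>labels. int (fst (snd b)) = q y - q x - 1}"
 have fin: "finite (H x y)" for x y using S by (auto simp: H_def)
 have HL: "H x y \<subseteq> ?L x y" for x y using S[of x] q[of x] by (auto simp: H_def)
 have pg: "wgood (map snd r) & int (wp (map snd r)) + int (length r) = q y - q x" if "r \<in> paths H x y" "x < y" for r x y
 proof -
  have r: "r \<in> paths ?L x y" using that(1) unfolding paths_def mem_Collect_eq by (rule ispath_mono) (rule HL)
  have "r ~= []" using that by (auto simp: paths_def)
  thus ?thesis using path_degree[OF r] good[of "map snd r"] by simp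
 qed
 show ?thesis
 proof (rule that[of "Gam gam H"])
  fix x y assume xy: "x < y" "y <= k"
  have "gam (map snd r) \<in> homog_p (q y - q x - 1)" if "r \<in> paths H x y" for r
   using pg[OF that xy(1)] homog_subset unfolding wgood_def by fastforce
  thus "Gam gam H x y \<in> homog_p (q y - q x - 1)" unfolding Gam_def by (intro homog_p_sum)
  show "dd (Gam gam H x y) = msum (Gam gam H) x y"
   using msum_Gam[of x y H gam] fin pg[of _ x y] xy by (simp add: Gam_def d_sum wgood_def)
 next
  fix x assume x: "x < k"
  have "~ 2 <= length r" if "r \<in> paths H x (Suc x)" for r
   using that ispath_le[of H x r "Suc x"] by (simp add: paths_def)
  hence em: "{r \<in> paths H x (Suc x). 2 <= length r} = {}" by blast
  have "Gam gam H x (Suc x) = (\<Sum>b\<in>H x (Suc x). gam [b])"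
   using Gam_split[of x "Suc x" H gam] fin unfolding em by simp
  hence "Gam gam H x (Suc x) = (\<Sum>b\<in>S x. lval b)" using x by (simp add: H_def)
  thus "\<exists>\<beta>\<in>homog_p (int (p x) + 1). z x = Gam gam H x (Suc x) + dd \<beta>" using S[OF x] by auto
 qed
qed

end

section \<open>Vanishing criteria for the obstruction of a word\<close>

context monomial_koszul
begin

text \<open>The multigraded form of \<open>MC_decomposition\<close>, with degrees of entries given
  as differences of potentials M and q. At the positions in X the letter is prescribed instead of
  selected. The assumption \<open>nz\<close> avoids the degrees where the class of 1 lives, which is
  neither a boundary nor a letter.\<close>

lemma homog_decomposition:
 fixes M :: "nat => nat => int" and q :: "nat => int" and X :: "nat set" and b :: "nat => 'k label"
 defines "L \<equiv> %x y. {b\<in>labels. im (fst b) = (%i. M y i - M x i) & int (fst (snd b)) = q y - q x - 1}"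
 assumes xy0: "x0 < y0"
  and a: "!!x y. x0 <= x ==> x < y ==> y <= y0 ==> (x, y) ~= (x0, y0) ==> a x y \<in> homog (%i. M y i - M x i) (q y - q x - 1)"
  and MC: "!!x y. x0 <= x ==> x < y ==> y <= y0 ==> (x, y) ~= (x0, y0) ==> dd (a x y) = msum a x y"
  and nz: "!!x y. x0 <= x ==> x < y ==> y <= y0 ==> (x, y) ~= (x0, y0) ==> q y - q x = 1 ==> M y ~= M x"
  and good: "!!x y w. x0 <= x ==> x < y ==> y <= y0 ==> (x, y) ~= (x0, y0) ==> w \<in> words ==> w ~= [] ==>
    im (wdeg w) = (%i. M y i - M x i) ==> wgood w"
  and X: "!!x. x \<in> X ==> b x \<in> L x (Suc x) & (\<exists>z. a x (Suc x) = lval (b x) + dd z)"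
 obtains H f where "!!x y. finite (H x y)"
  "!!x. x0 <= x ==> x < y0 ==> (x, Suc x) ~= (x0, y0) ==> x \<in> X ==> H x (Suc x) = {b x}"
  "!!p. p \<in> paths H x0 y0 ==> map snd p \<in> words & im (wdeg (map snd p)) = (%i. M y0 i - M x0 i)"
  "msum a x0 y0 = (\<Sum>p\<in>paths H x0 y0. Oword gam (map snd p)) + dd f"
proof -
 have pd: "map snd p \<in> words & im (wdeg (map snd p)) = (%i. M y i - M x i) &
   int (wp (map snd p)) + int (length p) = q y - q x" if "ispath L x p y" for p x y using that
 proof (induction p arbitrary: x)
  case Nil
  thus ?case by (simp add: wp_def wdeg_def im_def)
 next
  case (Cons c p)
  obtain z b where c: "c = (z, b)" by (cases c)
  have "b \<in> labels" "im (fst b) = (%i. M z i - M x i)" "int (fst (snd b)) = q z - q x - 1" "ispath L z p y"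
   using Cons.prems unfolding c L_def by auto
  thus ?case using Cons.IH[of z] unfolding c by (auto simp: wp_def wdeg_def im_add)
 qed
 obtain H f where Hf: "!!x y. finite (H x y)" "H x0 y0 = {}"
  "!!x y. x0 <= x ==> x < y ==> y <= y0 ==> (x, y) ~= (x0, y0) ==> H x y \<subseteq> L x y & (y = Suc x & x \<in> X --> H x y = {b x})"
  "msum a x0 y0 = (\<Sum>p\<in>paths H x0 y0. Oword gam (map snd p)) + dd f"
 proof (rule MC_decomposition[where C = "%x y. homog (%i. M y i - M x i) (q y - q x - 1)"
    and D = "%x y. homog (%i. M y i - M x i) (q y - q x)"
    and L = L and Q = "%x y S. y = Suc x & x \<in> X --> S = {b x}" and \<gamma> = gam and a = a, OF xy0])
  fix x y z u v
  show "u \<in> homog (%i. M z i - M x i) (q z - q x - 1) ==> v \<in> homog (%i. M y i - M z i) (q y - q z) ==> u \<cdot> v \<in> homog (%i. M y i - M x i) (q y - q x - 1)"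
   using homog_mul[of u "%i. M z i - M x i" "q z - q x - 1" v "%i. M y i - M z i" "q y - q z"] by (simp add: algebra_simps)
  show "u \<in> homog (%i. M z i - M x i) (q z - q x) ==> v \<in> homog (%i. M y i - M z i) (q y - q z - 1) ==> u \<cdot> v \<in> homog (%i. M y i - M x i) (q y - q x - 1)"
   using homog_mul[of u "%i. M z i - M x i" "q z - q x" v "%i. M y i - M z i" "q y - q z - 1"] by (simp add: algebra_simps)
 next
  fix x y e assume xy: "x0 <= x" "x < y" "y <= y0" "(x, y) ~= (x0, y0)"
   and e: "e \<in> homog (%i. M y i - M x i) (q y - q x - 1)" "dd e = 0" and ea: "y = Suc x ==> e = a x y"
  show "\<exists>S \<beta>. finite S & S \<subseteq> L x y & (y = Suc x & x \<in> X --> S = {b x}) & \<beta> \<in> homog (%i. M y i - M x i) (q y - q x) & e = (\<Sum>b\<in>S. gam [b]) + dd \<beta>"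
  proof (cases "y = Suc x & x \<in> X")
   case True
   then obtain z where z: "b x \<in> L x y" "e = lval (b x) + dd z" using X[of x] ea by auto
   have "lval (b x) \<in> homog (%i. M y i - M x i) (q y - q x - 1)"
    using z(1) label_lval(1)[of "b x"] by (auto simp: L_def)
   hence "dd z \<in> homog (%i. M y i - M x i) (q y - q x - 1)"
    using homog_add[OF e(1) homog_minus[of "lval (b x)"]] z(2) by simp
   then obtain z' where "z' \<in> homog (%i. M y i - M x i) (q y - q x - 1 + 1)" "dd z' = dd z" by (rule homog_boundary)
   thus ?thesis using True z by (intro exI[of _ "{b x}"] exI[of _ z']) simp
  next
   case False
   have "q y - q x - 1 = 0 ==> (%i. M y i - M x i) ~= (%_. 0)" using nz[OF xy] by (auto simp: fun_eq_iff)
   from homog_select[OF e this] consider \<beta> where "\<beta> \<in> homog (%i. M y i - M x i) (q y - q x - 1 + 1)" "e = dd \<beta>"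
    | c where "c \<in> L x y" "e = lval c" unfolding L_def by auto
   thus ?thesis
   proof cases
    case 1
    thus ?thesis using False by (intro exI[of _ "{}"] exI[of _ \<beta>]) auto
   next
    case 2
    thus ?thesis using False homog_zero by (intro exI[of _ "{c}"] exI[of _ 0]) auto
   qed
  qed
 next
  fix x y p assume xy: "x0 <= x" "x < y" "y <= y0" "(x, y) ~= (x0, y0)" and p: "p \<in> paths L x y"
  hence "p ~= []" "ispath L x p y" by (auto simp: paths_def)
  hence w: "map snd p \<in> words" "im (wdeg (map snd p)) = (%i. M y i - M x i)"
   "int (wp (map snd p)) + int (length p) - 1 = q y - q x - 1" "map snd p ~= []" using pd[of x p y] by auto
  have "wgood (map snd p)" by (rule good[OF xy w(1,4,2)])
  thus "gam (map snd p) \<in> homog (%i. M y i - M x i) (q y - q x - 1) & dd (gam (map snd p)) = Oword gam (map snd p)"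
   unfolding wgood_def length_map w(2,3) .
 qed (insert a MC, auto intro: homog_zero homog_add homog_minus homog_bar)
 show ?thesis
 proof (rule that[OF Hf(1) _ _ Hf(4)])
  fix p assume "p \<in> paths H x0 y0"
  hence "ispath L x0 p y0" unfolding paths_def mem_Collect_eq
  proof (rule ispath_mono)
   fix u v assume "x0 <= u" "u < v" "v <= y0" thus "H u v \<subseteq> L u v"
    using Hf(2) Hf(3)[of u v] by (cases "(u, v) = (x0, y0)") auto
  qed
  thus "map snd p \<in> words & im (wdeg (map snd p)) = (%i. M y0 i - M x0 i)" using pd by blast
 next
  fix x assume "x0 <= x" "x < y0" "(x, Suc x) ~= (x0, y0)" "x \<in> X"
  thus "H x (Suc x) = {b x}" using Hf(3)[of x "Suc x"] by auto
 qed
qed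

text \<open>With \<open>qdeg\<close>, the potentials whose differences are the degrees of the
  subwords of w. In \<open>qdeg\<close> every letter counts 1 more, since the value of a word of k
  letters lies k - 1 above the sum of their homological degrees.\<close>

definition pdeg :: "'k label list => nat => nat => int" where "pdeg w x = im (wdeg (take x w))"

definition qdeg :: "'k label list => nat => int" where "qdeg w x = int (wp (take x w)) + int x"

lemma take_subw: "x <= y ==> y <= length w ==> take y w = take x w @ subw w x y"
 using subw_split[of 0 x y w] by (simp add: subw_def)

lemma pdeg_diff: "x <= y ==> y <= length w ==> im (wdeg (subw w x y)) = (%i. pdeg w y i - pdeg w x i)"
 using take_subw[of x y w] by (simp add: pdeg_def wdeg_append im_add fun_eq_iff)

lemma qdeg_diff: "x <= y ==> y <= length w ==> int (wp (subw w x y)) + int (y - x) = qdeg w y - qdeg w x"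
 using take_subw[of x y w] by (simp add: qdeg_def wp_append)

lemma wp_ge_length: "w \<in> words ==> wp w >= length w"
proof (induction w)
 case (Cons b w)
 hence "fst (snd b) >= 1" using label_lval(4)[of b] by auto
 thus ?case using Cons by (simp add: wp_def)
qed (simp add: wp_def)

lemma qdeg_ge: "w \<in> words ==> x <= y ==> y <= length w ==> qdeg w y - qdeg w x >= 2 * int (y - x)"
 using qdeg_diff[of x y w] wp_ge_length[OF lists_subw, of w x y] length_subw[of y w x] by simp

lemma subw_Suc: "x < length w ==> subw w x (Suc x) = [w ! x]"
 by (simp add: subw_def take_Suc_conv_app_nth Cons_nth_drop_Suc[symmetric])

text \<open>A path with as many steps as its interval is long has only unit steps.\<close>

lemma full_path:
 assumes "ispath H x p y" "length p = y - x" "!!u. x <= u ==> u < y ==> H u (Suc u) = {b u}"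
 shows "p = map (%u. (Suc u, b u)) [x..<y]" using assms
proof (induction p arbitrary: x)
 case (Cons c p)
 obtain z e where c: "c = (z, e)" by (cases c)
 have z: "x < z" "e \<in> H x z" "ispath H z p y" using Cons.prems c by auto
 have "z + length p <= y" by (rule ispath_le[OF z(3)])
 hence zx: "z = Suc x" using Cons.prems(2) z(1) by auto
 hence "p = map (%u. (Suc u, b u)) [z..<y]" by (intro Cons.IH[OF z(3)]) (use Cons.prems in auto)
 moreover have "x < y" using z ispath_le[OF z(3)] by simp
 ultimately show ?case using c zx z(2) Cons.prems(3)[of x] by (simp add: upt_conv_Cons)
qed auto

lemma full_path_exists:
 assumes "x <= y" "!!u. x <= u ==> u < y ==> H u (Suc u) = {b u}"
 shows "ispath H x (map (%u. (Suc u, b u)) [x..<y]) y" using assms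
proof (induction "y - x" arbitrary: x)
 case (Suc k)
 hence "x < y" by simp
 moreover have "ispath H (Suc x) (map (%u. (Suc u, b u)) [Suc x..<y]) y"
  by (rule Suc.hyps(1)) (use Suc in auto)
 ultimately show ?case using Suc.prems(2)[of x] by (simp add: upt_conv_Cons)
qed simp

text \<open>Modulo boundaries the obstruction depends only on the classes of the letters. In the
  decomposition of a, the path of unit steps spells w; every other path has the degree of w but
  fewer letters, so its obstruction bounds by hypothesis.\<close>

lemma obstruction_unique:
 assumes w: "w \<in> words" "length w >= 2"
  and small: "PROP smaller_good w"
  and a: "!!x y. x < y ==> y <= length w ==> (x, y) ~= (0, length w) ==>
    a x y \<in> homog (im (wdeg (subw w x y))) (int (wp (subw w x y)) + int (y - x) - 1)"
  and MC: "!!x y. x < y ==> y <= length w ==> (x, y) ~= (0, length w) ==> dd (a x y) = msum a x y"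
  and diag: "!!x. x < length w ==> \<exists>z. a x (Suc x) = lval (w ! x) + dd z"
 shows "\<exists>z. Oword gam w = msum a 0 (length w) + dd z"
proof -
 let ?k = "length w"
 obtain H f where Hf: "!!x y. finite (H x y)"
  "!!x. 0 <= x ==> x < ?k ==> (x, Suc x) ~= (0, ?k) ==> x \<in> {..<?k} ==> H x (Suc x) = {w ! x}"
  "!!p. p \<in> paths H 0 ?k ==> map snd p \<in> words & im (wdeg (map snd p)) = (%i. pdeg w ?k i - pdeg w 0 i)"
  "msum a 0 ?k = (\<Sum>p\<in>paths H 0 ?k. Oword gam (map snd p)) + dd f"
 proof (rule homog_decomposition[where M = "pdeg w" and q = "qdeg w" and X = "{..<?k}" and b = "%x. w ! x" and a = a and ?x0.0 = 0 and ?y0.0 = ?k])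
  fix x y assume xy: "0 <= x" "x < y" "y <= ?k" "(x, y) ~= (0, ?k)"
  show "a x y \<in> homog (%i. pdeg w y i - pdeg w x i) (qdeg w y - qdeg w x - 1)"
   using a[of x y] xy pdeg_diff[of x y w] qdeg_diff[of x y w] by simp
  show "qdeg w y - qdeg w x = 1 ==> pdeg w y ~= pdeg w x" using qdeg_ge[OF w(1), of x y] xy by auto
  show "wgood w'" if "w' \<in> words" "w' ~= []" "im (wdeg w') = (%i. pdeg w y i - pdeg w x i)" for w'
  proof (rule small[OF that(1,2)])
   have "wdeg w' = wdeg (subw w x y)" using pdeg_diff[of x y w] that(3) xy by (intro im_inj) simp
   thus "smaller w' w" using smaller_subw(2)[OF w(1), of x y] xy by (simp add: smaller_def)
  qed
 next
  fix x assume "x \<in> {..<?k}"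
  hence x: "x < ?k" by simp
  hence "w ! x \<in> labels" using w(1) by (auto simp: in_lists_conv_set)
  moreover have "im (fst (w ! x)) = (%i. pdeg w (Suc x) i - pdeg w x i)"
   "int (fst (snd (w ! x))) = qdeg w (Suc x) - qdeg w x - 1"
   using pdeg_diff[of x "Suc x" w] qdeg_diff[of x "Suc x" w] x by (simp_all add: subw_Suc)
  ultimately show "w ! x \<in> {b \<in> labels. im (fst b) = (%i. pdeg w (Suc x) i - pdeg w x i) & int (fst (snd b)) = qdeg w (Suc x) - qdeg w x - 1} &
    (\<exists>z. a x (Suc x) = lval (w ! x) + dd z)" using diag[OF x] by blast
 qed (use MC w in auto)
 define p0 where "p0 = map (%u. (Suc u, w ! u)) [0..<?k]"
 have H1: "H u (Suc u) = {w ! u}" if "0 <= u" "u < ?k" for u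
 proof -
  have "(u, Suc u) ~= (0, ?k)" using w(2) by auto
  thus ?thesis using Hf(2)[of u] that by simp
 qed
 have p0: "p0 \<in> paths H 0 ?k" unfolding p0_def paths_def using full_path_exists[of 0 ?k H "%u. w ! u"] H1 by simp
 have w0: "map snd p0 = w" by (simp add: p0_def o_def map_nth)
 have "\<exists>y. Oword gam (map snd p) = dd y" if p: "p \<in> paths H 0 ?k - {p0}" for p
 proof -
  have "length p ~= ?k - 0" using full_path[of H 0 p ?k "%u. w ! u"] H1 p by (auto simp: p0_def paths_def)
  moreover have "length p <= ?k" using ispath_le[of H 0 p ?k] p by (simp add: paths_def)
  moreover have "p ~= []" using p w(2) by (auto simp: paths_def)
  moreover have "wdeg (map snd p) = wdeg w"
   using Hf(3)[of p] p pdeg_diff[of 0 ?k w] by (intro im_inj) (simp add: subw_all)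
  ultimately have "wgood (map snd p)" using Hf(3)[of p] p by (intro small) (auto simp: smaller_def)
  thus ?thesis unfolding wgood_def by metis
 qed
 then obtain g where g: "!!p. p \<in> paths H 0 ?k - {p0} ==> Oword gam (map snd p) = dd (g p)" by metis
 have "(\<Sum>p\<in>paths H 0 ?k. Oword gam (map snd p)) = Oword gam w + dd (sum g (paths H 0 ?k - {p0}))"
  using sum.remove[OF finite_paths[of 0 ?k H] p0, of "%p. Oword gam (map snd p)"] Hf(1) w0 g by (simp add: d_sum)
 hence "Oword gam w = msum a 0 ?k + dd (- f - sum g (paths H 0 ?k - {p0}))"
  using Hf(4) by (simp add: d_diff d_minus)
 thus ?thesis by blast
qed

section \<open>Contraction of obstructions\<close>

lemma contr_mul: "v < n ==> contr v (x \<cdot> y) = contr v x \<cdot> y + esg x \<cdot> contr v y"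
 unfolding mul_def nf_add[symmetric]
 by (rule ext) (simp add: contr_nf nf_def[of "contr _ _"] nf_def[of "_ + _"] contr_emul)

lemma contr_dd: "v < n ==> contr v (dd x) = - dd (contr v x)" unfolding dd_def nf_minus[symmetric]
 by (rule ext) (simp add: contr_nf nf_def[of "contr _ _"] nf_def[of "- _"] contr_ediff finite_below_n)

lemma contr_add: "contr v (x + y) = contr v x + contr v y" and contr_zero [simp]: "contr v 0 = 0"
 by (auto simp: contr_def fun_eq_iff algebra_simps)

lemma contr_sum: "contr v (sum f S) = (\<Sum>i\<in>S. contr v (f i))"
proof (induction S rule: infinite_finite_induct)
 case (insert x F)
 thus ?case by (simp only: sum.insert contr_add not_False_eq_True)
next
 case (infinite A)
 thus ?case by (simp only: sum.infinite contr_zero not_False_eq_True)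
qed (simp only: sum.empty contr_zero)

lemma contr_esg_nf: "nf x = x ==> contr v (esg x) = - esg (contr v x)"
proof
 fix U assume x: "nf x = x"
 show "contr v (esg x) U = (- esg (contr v x)) U"
 proof (cases "finite U")
  case False
  hence "~ insert v U \<subseteq> {..<n}" using finite_below_n by blast
  hence "nf x (insert v U) = 0" unfolding nf_def by (rule if_not_P)
  hence "x (insert v U) = 0" using x by simp
  thus ?thesis by (simp add: contr_def esg_def)
 qed (simp add: contr_esg)
qed

lemma homog_contr:
 assumes "x \<in> homog M p" shows "contr v x \<in> homog (%i. M i - (if i = v then 1 else 0)) (p - 1)"
 unfolding homog_def mem_Collect_eq
proof (intro allI impI)
 fix U t assume "cf (contr v x U) t ~= 0"
 hence v: "v ~: U" "cf (x (insert v U)) t ~= 0" by (auto simp: contr_def cf_neg_one split: if_splits)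
 hence h: "insert v U \<subseteq> {..<n} & ks t \<subseteq> {..<n} & t ~: A &
  (\<forall>i. int (cf t i) + (if i \<in> insert v U then 1 else 0) = M i) & int (card (insert v U)) = p"
  using assms unfolding homog_def by blast
 hence "finite U" using finite_below_n by blast
 hence c: "int (card U) = p - 1" using h v(1) by auto
 have "int (cf t i) + (if i \<in> U then 1 else 0) = M i - (if i = v then 1 else 0)" for i
 proof -
  have "int (cf t i) + (if i \<in> insert v U then 1 else 0) = M i" using h by blast
  thus ?thesis using v(1) by (auto split: if_splits)
 qed
 with h c show "U \<subseteq> {..<n} & ks t \<subseteq> {..<n} & t ~: A & (\<forall>i. int (cf t i) + (if i \<in> U then 1 else 0) = M i - (if i = v then 1 else 0)) & int (card U) = p - 1"
  by auto
qed

text \<open>In degree v a cycle of positive homological degree is a multiple of e_v, whose boundary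
  x_v is nonzero if x_v is not in A.\<close>

lemma label_deg_ne_var:
 assumes "b \<in> labels" "sing v 1 ~: A" shows "fst b ~= sing v 1"
proof
 assume v: "fst b = sing v 1"
 obtain m p f where e: "b = (m, p, f)" by (metis surj_pair)
 with assms v have m: "m = sing v 1" "p >= 1" "hp p f" "sup m f" "~ exact m f" "tr m (ed f) = 0" "mon m"
  by (auto simp: labels_def cyc_def)
 have "f {v} = 0"
 proof -
  have "{} \<in> Lam m" using assms(2) m by (simp add: Lam_def)
  hence "ed f {} = 0" using fun_cong[OF m(6), of "{}"] by (simp add: tr_def)
  moreover have "contr i f {} = (if i = v then f {v} else 0)" for i
   using m by (auto simp: contr_def below_def sup_def Lam_def)
  ultimately show ?thesis using m(1,7) by (simp add: ediff_def)
 qed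
 moreover have "f U = 0" if "U ~= {v}" for U
  using m that by (cases "U = {}") (auto simp: sup_def Lam_def hp_def)
 ultimately have "f = 0" by (metis ext zero_fun_apply)
 thus False using m by simp
qed

text \<open>A contraction turns a defining system \<open>a\<close> into the off-diagonal block of a larger system; its
 obstruction is that of words of smaller degree.\<close>

lemma contr_obstruction:
 assumes w: "w \<in> words" "length w >= 2"
  and small: "PROP smaller_good w"
  and v: "v < n" "sing v 1 ~: A"
 shows "\<exists>y. dd y = contr v (Oword gam w)"
proof -
 define k where "k = length w"
 define g where "g i j = gam (subw w i j)" for i j
 define \<theta> where "\<theta> c = esg (contr v c)" for c :: "'k elt"
 \<comment> \<open>Two copies of the positions of w, the first without its last and the second
   without its first position; k + i stands for position i + 1 of the second copy. Contracted values
   join the copies. Only the corner (0, 2k - 1) would require the missing value on w itself.\<close>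
 define a where "a x y = (if y < k then g x y else if k <= x then bar (g (Suc (x - k)) (Suc (y - k)))
   else if x < Suc (y - k) then \<theta> (g x (Suc (y - k))) else 0)" for x y
 define e where "e = (%i. if i = v then 1 else 0 :: int)"
 \<comment> \<open>The potential of the second copy is shifted by the degree of v, and q by 1,
   because contraction lowers both degrees.\<close>
 define M where "M x = (if x < k then pdeg w x else (%i. pdeg w (Suc (x - k)) i - e i))" for x
 define q where "q x = (if x < k then qdeg w x else qdeg w (Suc (x - k)) - 1)" for x
 have k2: "k >= 2" using w by (simp add: k_def)
 have gd: "g i j \<in> homog (%l. pdeg w j l - pdeg w i l) (qdeg w j - qdeg w i - 1)" "dd (g i j) = msum g i j"
  if "i < j" "j <= k" "(i, j) ~= (0, k)" for i j
 proof -
  have "wgood (subw w i j)" using that by (intro small lists_subw w smaller_subw(1)) (auto simp: k_def subw_def)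
  thus "g i j \<in> homog (%l. pdeg w j l - pdeg w i l) (qdeg w j - qdeg w i - 1)" "dd (g i j) = msum g i j"
   using that pdeg_diff[of i j w] qdeg_diff[of i j w] Oword_subw[of i j w gam]
   unfolding wgood_def g_def k_def by (simp_all add: length_subw)
 qed
 have gnf: "nf (g i j) = g i j" if "i < j" "j <= k" "(i, j) ~= (0, k)" for i j
  using nf_eq_self homog_subset gd(1)[OF that] by blast
 \<comment> \<open>The factor \<open>bar y\<close> in the last summand is the reason why the second
   copy carries \<open>bar g\<close>.\<close>
 have \<theta>mul: "\<theta> (bar x \<cdot> y) = bar x \<cdot> \<theta> y + bar (\<theta> x) \<cdot> bar y" if "nf x = x" for x y
 proof -
  have cb: "contr v (bar x) = esg (contr v x)"
  proof -
   have "contr v (bar x) = - contr v (esg x)" unfolding bar_def by (auto simp: contr_def fun_eq_iff)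
   thus ?thesis using contr_esg_nf[OF that] by simp
  qed
  have "\<theta> (bar x \<cdot> y) = contr v x \<cdot> esg y + bar x \<cdot> \<theta> y"
   unfolding \<theta>_def contr_mul[OF v(1)] sg_add sg_mul cb by (simp add: sg_sg)
  moreover have "bar (\<theta> x) \<cdot> bar y = contr v x \<cdot> esg y"
   by (simp add: \<theta>_def bar_def sg_sg mul_minus_left mul_minus_right)
  ultimately show ?thesis by simp
 qed
 have \<theta>sum: "\<theta> (sum f S) = (\<Sum>i\<in>S. \<theta> (f i))" for f :: "nat => _" and S by (simp add: \<theta>_def contr_sum sg_sum)
 have \<theta>msum: "\<theta> (msum g i j) = (\<Sum>z\<in>{i<..<j}. bar (g i z) \<cdot> \<theta> (g z j) + bar (\<theta> (g i z)) \<cdot> bar (g z j))"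
  if "i < j" "j <= k" for i j
  unfolding msum_def mm_def \<theta>sum by (rule sum.cong) (use \<theta>mul gnf that in auto)
 have cross: "msum a i (k + j) = (if i < Suc j then \<theta> (msum g i (Suc j)) else 0)" if "i < k" "j < k" for i j
 proof -
  have un: "{i<..<k + j} = {i<..<k} \<union> {k..<k + j}" using that by auto
  have "msum a i (k + j) = (\<Sum>z\<in>{i<..<k}. bar (a i z) \<cdot> a z (k + j)) + (\<Sum>z\<in>{k..<k + j}. bar (a i z) \<cdot> a z (k + j))"
   unfolding msum_def mm_def un by (rule sum.union_disjoint) auto
  also have "(\<Sum>z\<in>{i<..<k}. bar (a i z) \<cdot> a z (k + j)) = (\<Sum>z\<in>{i<..<k}. if z < Suc j then bar (g i z) \<cdot> \<theta> (g z (Suc j)) else 0)"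
   by (rule sum.cong) (insert that, auto simp: a_def)
  also have "... = (\<Sum>z\<in>{i<..<Suc j}. bar (g i z) \<cdot> \<theta> (g z (Suc j)))"
   by (rule sum.mono_neutral_cong_right) (use that in auto)
  also have "(\<Sum>z\<in>{k..<k + j}. bar (a i z) \<cdot> a z (k + j)) = (\<Sum>z\<in>{1..<Suc j}. if i < z then bar (\<theta> (g i z)) \<cdot> bar (g z (Suc j)) else 0)"
   by (rule sum.reindex_bij_witness[where i = "%z. k + z - 1" and j = "%z. Suc (z - k)"])
     (insert that, auto simp: a_def)
  also have "... = (\<Sum>z\<in>{i<..<Suc j}. bar (\<theta> (g i z)) \<cdot> bar (g z (Suc j)))"
   by (rule sum.mono_neutral_cong_right) auto
  finally have e: "msum a i (k + j) = (\<Sum>z\<in>{i<..<Suc j}. bar (g i z) \<cdot> \<theta> (g z (Suc j)) + bar (\<theta> (g i z)) \<cdot> bar (g z (Suc j)))"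
   by (simp only: sum.distrib)
  show ?thesis
  proof (cases "i < Suc j")
   case True
   thus ?thesis using e \<theta>msum[OF True] that by simp
  next
   case False
   hence "{i<..<Suc j} = {}" by auto
   thus ?thesis using e False by simp
  qed
 qed
 have trich: thesis if "x < y" "y <= 2 * k - 1" "(x, y) ~= (0, 2 * k - 1)"
  "y < k ==> thesis"
  "!!i j. x = k + i ==> y = k + j ==> i < j ==> j < k ==> thesis"
  "!!j. x < k ==> y = k + j ==> j < k ==> (x, Suc j) ~= (0, k) ==> thesis" for x y thesis
 proof -
  consider "y < k" | "k <= x" | "x < k" "k <= y" by linarith
  thus thesis
  proof cases
   case 2 thus thesis using that(1,2) k2 by (intro that(5)[of "x - k" "y - k"]) auto
  next
   case 3 thus thesis using that(1,2,3) k2 by (intro that(6)[of "y - k"]) auto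
  qed (rule that(4))
 qed
 have qge: "qdeg w j - qdeg w i >= 2 * int (j - i)" if "i <= j" "j <= k" for i j
  using qdeg_ge[OF w(1), of i j] that by (simp add: k_def)
 have pmono: "pdeg w i l <= pdeg w j l" if "i <= j" "j <= k" for i j l
  using fun_cong[OF pdeg_diff[of i j w], of l] that by (simp add: k_def im_def)
 have degv: "s = t + sing v 1 & mdegree t < mdegree s" if "im t = (%l. im s l - e l)" for s t
 proof -
  have "im s = im (t + sing v 1)"
   unfolding im_add using that by (auto simp: e_def im_def lookup_single when_def fun_eq_iff)
  hence "s = t + sing v 1" by (rule im_inj)
  thus ?thesis by (simp add: mdegree_add)
 qed
 have goodxy: "wgood w'" if xy: "i < j" "j <= k" and w': "w' \<in> words" "w' ~= []"
   "im (wdeg w') = (%l. pdeg w j l - pdeg w i l - e l)" for i j w'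
 proof (rule small[OF w'(1,2)])
  have "im (wdeg w') = (%l. im (wdeg (subw w i j)) l - e l)" using w'(3) pdeg_diff[of i j w] xy by (simp add: k_def)
  from degv[OF this] have "mdegree (wdeg w') < mdegree (wdeg (subw w i j))" by blast
  moreover have "mdegree (wdeg (subw w i j)) <= mdegree (wdeg w)"
   using smaller_subw(2)[OF w(1), of i j] xy by (cases "(i, j) = (0, k)") (auto simp: k_def subw_all)
  ultimately show "smaller w' w" by (simp add: smaller_def)
 qed
 obtain H f where Hf: "!!x y. finite (H x y)"
  "!!p. p \<in> paths H 0 (2 * k - 1) ==> map snd p \<in> words & im (wdeg (map snd p)) = (%i. M (2 * k - 1) i - M 0 i)"
  "msum a 0 (2 * k - 1) = (\<Sum>p\<in>paths H 0 (2 * k - 1). Oword gam (map snd p)) + dd f"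
 proof (rule homog_decomposition[where M = M and q = q and X = "{}" and a = a and ?x0.0 = 0 and ?y0.0 = "2 * k - 1"])
  show "0 < 2 * k - 1" using k2 by simp
  fix x y assume xy: "0 <= x" "x < y" "y <= 2 * k - 1" "(x, y) ~= (0, 2 * k - 1)"
  show "a x y \<in> homog (%i. M y i - M x i) (q y - q x - 1)"
  proof (rule trich[OF xy(2-4)])
   assume "y < k" thus ?thesis using xy gd(1)[of x y] by (simp add: a_def M_def q_def)
  next
   fix i j assume ij: "x = k + i" "y = k + j" "i < j" "j < k"
   thus ?thesis using homog_bar[OF gd(1)[of "Suc i" "Suc j"]] by (simp add: a_def M_def q_def)
  next
   fix j assume j: "x < k" "y = k + j" "j < k" "(x, Suc j) ~= (0, k)"
   show ?thesis
   proof (cases "x < Suc j")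
    case True
    thus ?thesis using j homog_esg[OF homog_contr[OF gd(1)[of x "Suc j"], of v]]
     by (simp add: a_def M_def q_def \<theta>_def e_def algebra_simps)
   next
    case False
    thus ?thesis using j homog_zero by (simp add: a_def)
   qed
  qed
  show "dd (a x y) = msum a x y"
  proof (rule trich[OF xy(2-4)])
   assume y: "y < k"
   hence "msum a x y = msum g x y" unfolding msum_def by (intro mm_cong) (auto simp: a_def)
   thus ?thesis using y xy gd(2)[of x y] by (simp add: a_def)
  next
   fix i j assume ij: "x = k + i" "y = k + j" "i < j" "j < k"
   have "msum a x y = (\<Sum>z\<in>{Suc i<..<Suc j}. g (Suc i) z \<cdot> bar (g z (Suc j)))"
    unfolding msum_def mm_def
    by (rule sum.reindex_bij_witness[where i = "%z. k + z - 1" and j = "%z. Suc (z - k)"])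
      (insert ij, auto simp: a_def)
   also have "... = - bar (msum g (Suc i) (Suc j))" by (simp add: msum_def mm_def bar_sum bar_mul sum_negf)
   also have "... = dd (bar (g (Suc i) (Suc j)))" using gd(2)[of "Suc i" "Suc j"] ij by (simp add: d_bar)
   finally show ?thesis using ij by (simp add: a_def)
  next
   fix j assume j: "x < k" "y = k + j" "j < k" "(x, Suc j) ~= (0, k)"
   have "dd (\<theta> (g x (Suc j))) = \<theta> (msum g x (Suc j))" if "x < Suc j"
    using gd(2)[OF that _ j(4)] j(3) contr_dd[OF v(1), of "g x (Suc j)"] by (simp add: \<theta>_def d_sg sg_minus)
   thus ?thesis using cross[of x j] j by (auto simp: a_def)
  qed
  \<comment> \<open>Homological degree 0 occurs only for a contracted letter of homological degree
    1. Its multidegree is 0 only if the letter has degree v, which \<open>label_deg_ne_var\<close>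
    rules out.\<close>
  show "M y ~= M x" if "q y - q x = 1"
  proof (rule trich[OF xy(2-4)])
   assume "y < k" thus ?thesis using that qge[of x y] xy by (simp add: q_def)
  next
   fix i j assume "x = k + i" "y = k + j" "i < j" "j < k"
   thus ?thesis using that qge[of "Suc i" "Suc j"] by (simp add: q_def)
  next
   fix j assume j: "x < k" "y = k + j" "j < k" "(x, Suc j) ~= (0, k)"
   hence q2: "qdeg w (Suc j) - qdeg w x = 2" using that by (simp add: q_def)
   have xj: "x < Suc j"
   proof (rule ccontr)
    assume "~ x < Suc j" thus False using qge[of "Suc j" x] j q2 by simp
   qed
   hence jx: "j = x" using qge[of x "Suc j"] j q2 by auto
   have "w ! x \<in> labels" using w(1) j by (auto simp: in_lists_conv_set k_def)
   hence ne: "fst (w ! x) ~= sing v 1" by (rule label_deg_ne_var[OF _ v(2)])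
   have px: "im (fst (w ! x)) = (%l. pdeg w (Suc x) l - pdeg w x l)"
    using pdeg_diff[of x "Suc x" w] j subw_Suc[of x w] by (simp add: k_def)
   show ?thesis
   proof
    assume "M y = M x"
    hence "(%l. pdeg w (Suc x) l - e l) = pdeg w x" using j jx by (simp add: M_def)
    hence "im (0::monomial) = (%l. im (fst (w ! x)) l - e l)"
     unfolding px by (auto simp: im_def fun_eq_iff algebra_simps)
    from degv[OF this] ne show False by simp
   qed
  qed
  show "wgood w'" if w': "w' \<in> words" "w' ~= []" "im (wdeg w') = (%i. M y i - M x i)" for w'
  proof (rule trich[OF xy(2-4)])
   assume y: "y < k"
   hence "wdeg w' = wdeg (subw w x y)"
    using w'(3) xy pdeg_diff[of x y w] by (intro im_inj) (simp add: M_def k_def)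
   moreover have "mdegree (wdeg (subw w x y)) < mdegree (wdeg w)"
    using smaller_subw(2)[OF w(1), of x y] xy y by (simp add: k_def)
   ultimately show ?thesis by (intro small w') (simp add: smaller_def)
  next
   fix i j assume ij: "x = k + i" "y = k + j" "i < j" "j < k"
   hence "wdeg w' = wdeg (subw w (Suc i) (Suc j))"
    using w'(3) pdeg_diff[of "Suc i" "Suc j" w] by (intro im_inj) (simp add: M_def k_def)
   moreover have "mdegree (wdeg (subw w (Suc i) (Suc j))) < mdegree (wdeg w)"
    using smaller_subw(2)[OF w(1), of "Suc i" "Suc j"] ij by (simp add: k_def)
   ultimately show ?thesis by (intro small w') (simp add: smaller_def)
  next
   fix j assume j: "x < k" "y = k + j" "j < k" "(x, Suc j) ~= (0, k)"
   hence eq: "im (wdeg w') = (%l. pdeg w (Suc j) l - pdeg w x l - e l)" using w'(3) by (simp add: M_def algebra_simps)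
   have "x < Suc j"
   proof (rule ccontr)
    assume "~ x < Suc j"
    hence "pdeg w (Suc j) v <= pdeg w x v" using pmono[of "Suc j" x v] j by simp
    hence "im (wdeg w') v < 0" using fun_cong[OF eq, of v] by (simp add: e_def)
    thus False by (simp add: im_def)
   qed
   thus ?thesis using goodxy[of x "Suc j" w'] w' eq j by simp
  qed
 qed auto
 have "\<exists>y. Oword gam (map snd p) = dd y" if "p \<in> paths H 0 (2 * k - 1)" for p
 proof -
  have "p ~= []" using that k2 by (auto simp: paths_def)
  moreover have "M (2 * k - 1) = (%i. pdeg w k i - e i)" "M 0 = pdeg w 0" using k2 by (auto simp: M_def)
  ultimately have "wgood (map snd p)" using Hf(2)[OF that] k2 by (intro goodxy[of 0 k]) (auto simp: algebra_simps)
  thus ?thesis unfolding wgood_def by metis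
 qed
 then obtain h where h: "!!p. p \<in> paths H 0 (2 * k - 1) ==> Oword gam (map snd p) = dd (h p)" by metis
 have "Oword gam w = msum g 0 k" using Oword_subw[of 0 k w gam] by (simp add: k_def subw_all g_def[abs_def])
 moreover have "2 * k - 1 = k + (k - 1)" "Suc (k - 1) = k" using k2 by auto
 \<comment> \<open>The sum at the corner is the contracted obstruction of w, and the decomposition
   expresses it by words of smaller degree.\<close>
 ultimately have "\<theta> (Oword gam w) = msum a 0 (2 * k - 1)" using cross[of 0 "k - 1"] k2 by simp
 also have "... = dd (sum h (paths H 0 (2 * k - 1)) + f)" unfolding Hf(3) by (simp add: h d_add d_sum)
 finally have "esg (contr v (Oword gam w)) = dd (sum h (paths H 0 (2 * k - 1)) + f)" by (simp add: \<theta>_def)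
 hence "contr v (Oword gam w) = esg (dd (sum h (paths H 0 (2 * k - 1)) + f))" by (metis sg_sg)
 also have "... = dd (- esg (sum h (paths H 0 (2 * k - 1)) + f))" by (simp add: d_minus d_sg)
 finally show ?thesis by metis
qed

end

context monomial_koszul
begin

text \<open>The elements satisfying the following condition form a quasi-isomorphic sub-DGA in which products of two elements of
 positive degree in the variable \<open>v\<close> vanish.\<close>

definition thin :: "nat => 'k elt => bool"
 where "thin v c = (\<forall>U t. cf (c U) t ~= 0 --> (v \<in> U & t + sing v 1 \<in> A) | (v ~: U & cf t v = 0))"

section \<open>Letters sharing a variable\<close>

lemma thin_zero: "thin v 0" and thin_bar: "thin v x ==> thin v (bar x)"
 by (auto simp: thin_def bar_def esg_def cf_neg_one)

lemma thin_add: "thin v x ==> thin v y ==> thin v (x + y)"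
 unfolding thin_def plus_fun_apply lookup_add by (metis add.right_neutral)

lemma thin_sum: "(!!i. i \<in> S ==> thin v (f i)) ==> thin v (sum f S)"
 by (induction S rule: infinite_finite_induct) (auto intro: thin_zero thin_add)

lemma thin_mul: "thin v x ==> thin v y ==> thin v (x \<cdot> y)"
 unfolding thin_def[of v "x \<cdot> y"]
proof (intro allI impI)
 fix U t assume xy: "thin v x" "thin v y" and "cf ((x \<cdot> y) U) t ~= 0"
 hence "cf (emul x y U) t ~= 0" using cf_mul by blast
 then obtain V s u where V: "V \<subseteq> U" "t = s + u" "cf (x V) s ~= 0" "cf (y (U - V)) u ~= 0"
  using cf_emul_nonzero by metis
 have x: "(v \<in> V & s + sing v 1 \<in> A) | (v ~: V & cf s v = 0)" using xy(1) V(3) unfolding thin_def by blast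
 have y: "(v \<in> U - V & u + sing v 1 \<in> A) | (v ~: U - V & cf u v = 0)" using xy(2) V(4) unfolding thin_def by blast
 consider "v \<in> V" | "v \<in> U - V" | "v ~: U" using V(1) by blast
 thus "(v \<in> U & t + sing v 1 \<in> A) | (v ~: U & cf t v = 0)"
 proof cases
  case 1
  hence "s + sing v 1 \<in> A" using x by blast
  moreover have "mdvd (s + sing v 1) (t + sing v 1)" by (simp add: V(2) mdvd_def lookup_add)
  ultimately show ?thesis using upset 1 V(1) by blast
 next
  case 2
  hence "u + sing v 1 \<in> A" using y by blast
  moreover have "mdvd (u + sing v 1) (t + sing v 1)" by (simp add: V(2) mdvd_def lookup_add)
  ultimately show ?thesis using upset 2 by blast
 next
  case 3
  thus ?thesis using x y V by (auto simp: lookup_add)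
 qed
qed

text \<open>In a thin element of positive degree in v every term contains e_v, and e_v occurs at
  most once in a product.\<close>

lemma thin_mul_zero:
 assumes "thin v x" "thin v y" "x \<in> homog M p" "y \<in> homog M' p'" "M v >= 1" "M' v >= 1"
 shows "x \<cdot> y = 0"
proof (rule ext, rule poly_mapping_eqI, rule ccontr)
 fix U t assume "cf ((x \<cdot> y) U) t ~= cf (0 U) t"
 hence "cf (emul x y U) t ~= 0" using cf_mul by auto
 then obtain V s u where V: "V \<subseteq> U" "t = s + u" "cf (x V) s ~= 0" "cf (y (U - V)) u ~= 0"
  using cf_emul_nonzero by metis
 have "int (cf s v) + (if v \<in> V then 1 else 0) = M v" "int (cf u v) + (if v \<in> U - V then 1 else 0) = M' v"
  using assms(3,4) V(3,4) unfolding homog_def by blast+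
 moreover have "(v \<in> V & s + sing v 1 \<in> A) | (v ~: V & cf s v = 0)"
  using assms(1) V(3) unfolding thin_def by blast
 moreover have "(v \<in> U - V & u + sing v 1 \<in> A) | (v ~: U - V & cf u v = 0)"
  using assms(2) V(4) unfolding thin_def by blast
 ultimately show False using assms(5,6) by (auto split: if_splits)
qed

lemma thin_free: "x \<in> homog M p ==> M v = 0 ==> thin v x" unfolding thin_def
proof (intro allI impI)
 fix U t assume "x \<in> homog M p" "M v = 0" "cf (x U) t ~= 0"
 hence "int (cf t v) + (if v \<in> U then 1 else 0) = 0" unfolding homog_def by fastforce
 thus "(v \<in> U & t + sing v 1 \<in> A) | (v ~: U & cf t v = 0)" by (auto split: if_splits)
qed

text \<open>First the terms without e_v are moved away by the homotopy \<open>wedge v\<close>. For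
  what remains, thinness of the boundary already forces thinness.\<close>

lemma thin_replace:
 assumes y: "y \<in> homog M p" "thin v (dd y)"
 obtains z y' where "y' \<in> homog M p" "thin v y'" "y' = y + dd z"
proof (cases "M v = 0 | y = 0")
 case True
 thus ?thesis using thin_free[OF y(1)] thin_zero y that[of y 0] by auto
next
 case False
 then obtain m where m: "M = im m" "mon m" "p >= 0" using homog_nonempty_im[OF y(1)] by metis
 hence vm: "v \<in> ks m" using False by (auto simp: im_def in_keys_iff)
 define f where "f = low m y"
 have f: "y = lift m f" "sup m f" "hp (nat p) f" using homog_lift[of y m p] y m unfolding f_def by auto
 \<comment> \<open>The part of f without e_v; subtracting the boundary of e_v B removes it.\<close>
 define B where "B U = (if v \<in> U then 0 else f U)" for U
 define g where "g = wedge v B"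
 have supB: "sup m B" using f(2) by (auto simp: B_def sup_def)
 have Lins: "U \<union> {v} \<in> Lam m" if "U \<in> Lam m" for U
  using Lam_up[OF that, of "U \<union> {v}"] that vm by (auto simp: Lam_def)
 have supg: "sup m g" unfolding sup_def
 proof (intro allI impI)
  fix U assume "g U ~= 0"
  hence U: "v \<in> U" "U - {v} \<in> Lam m" using supB by (auto simp: g_def wedge_def sup_def split: if_splits)
  hence "insert v (U - {v}) \<in> Lam m" using Lins[OF U(2)] by simp
  thus "U \<in> Lam m" using U(1) by (simp add: insert_absorb)
 qed
 have hpg: "hp (Suc (nat p)) g" unfolding hp_def
 proof (intro allI impI)
  fix U assume gU: "g U ~= 0"
  hence "U \<in> Lam m" using supg by (simp add: sup_def)
  hence "finite U" by (rule Lam_finite)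
  moreover have "v \<in> U" "f (U - {v}) ~= 0" using gU by (auto simp: g_def wedge_def B_def split: if_splits)
  ultimately show "card U = Suc (nat p)" using f(3) by (metis card.remove hp_def)
 qed
 define f' where "f' = f - tr m (ed g)"
 have ydd: "lift m f' = y + dd (- lift m g)" using dd_lift[OF m(2) supg] f(1) by (simp add: f'_def lift_diff d_minus)
 have "dd (lift m g) \<in> homog M p"
 proof -
  have "lift m g \<in> homog (im m) (int (Suc (nat p)))" by (rule lift_homog[OF m(2) supg hpg])
  hence "lift m g \<in> homog_p (p + 1)" using homog_subset[of "im m" "p + 1"] m(3) by (auto simp: add.commute)
  hence dp: "dd (lift m g) \<in> homog_p p" using homog_p_dd[of "lift m g" "p + 1"] by simp
  have U: "U \<subseteq> ks m & t = m - ind U" if "cf (dd (lift m g) U) t ~= 0" for U t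
   using cf_dd_support[OF that] by (auto simp: Lam_def)
  have M: "(\<forall>i. int (cf (m - ind U) i) + (if i \<in> U then 1 else 0) = M i)" if "U \<subseteq> ks m" for U
  proof
   fix i show "int (cf (m - ind U) i) + (if i \<in> U then 1 else 0) = M i"
    using cf_diff_ind[OF that, of i] by (auto simp: m im_def split: if_splits)
  qed
  show ?thesis unfolding homog_def mem_Collect_eq
  proof (intro allI impI)
   fix V t assume nz: "cf (dd (lift m g) V) t ~= 0"
   hence "V \<subseteq> {..<n} & ks t \<subseteq> {..<n} & t ~: A & int (card V) = p" using dp unfolding homog_p_def by blast
   moreover have "\<forall>i. int (cf t i) + (if i \<in> V then 1 else 0) = M i" using U[OF nz] M by blast
   ultimately show "V \<subseteq> {..<n} & ks t \<subseteq> {..<n} & t ~: A &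
     (\<forall>i. int (cf t i) + (if i \<in> V then 1 else 0) = M i) & int (card V) = p" by blast
  qed
 qed
 hence hom: "lift m f' \<in> homog M p" unfolding ydd d_minus by (intro homog_add homog_minus y(1))
 have sup': "sup m f'" unfolding f'_def by (intro sup_diff f sup_tr)
 have v': "f' U = 0" if "v ~: U" for U
 proof (cases "U \<in> Lam m")
  case True
  have "ed g U = B U - wedge v (ed B) U"
   unfolding g_def using ediff_wedge[OF Lam_finite[OF True], of v n "%_. 1" B] m(2) vm by auto
  thus ?thesis using that True by (simp add: f'_def tr_def B_def wedge_def)
 next
  case False
  thus ?thesis using sup' by (auto simp: sup_def)
 qed
 have ddeq: "dd (lift m f') = dd y" unfolding ydd d_add d_d by simp
 have thin': "t + sing v 1 \<in> A" if nz: "cf (lift m f' U) t ~= 0" and vU: "v \<in> U" for U t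
 proof (rule ccontr)
  assume tA: "t + sing v 1 ~: A"
  have U: "U \<subseteq> ks m" "t = m - ind U" "f' U ~= 0" using nz by (auto simp: cf_lift split: if_splits)
  let ?W = "U - {v}"
  have W: "finite U" "U = insert v ?W" using U(1) finite_sub_keys vU by auto
  have tW: "m - ind ?W = t + sing v 1"
  proof (rule poly_mapping_eqI)
   fix i show "cf (m - ind ?W) i = cf (t + sing v 1) i"
    using W vm vU by (auto simp: U(2) lookup_minus lookup_add cf_ind lookup_single when_def cf_pos)
  qed
  \<comment> \<open>All remaining terms contain e_v, so the boundary at U - {v} receives a
    contribution from U only. A term with x^t x_v outside A would therefore show up in the boundary
    with positive degree in v.\<close>
  have WL: "?W \<in> Lam m" using U(1) tA tW by (auto simp: Lam_def)
  have "low m (dd (lift m f')) ?W = ed f' ?W" using low_dd[OF m(2) WL, of "lift m f'"] sup_low_lift[OF sup'] by simp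
  moreover have "contr i f' ?W = (if i = v then (-1) ^ below ?W v * f' U else 0)" for i
   using W(2) v'[of "insert i ?W"] by (auto simp: contr_def)
  ultimately have "low m (dd y) ?W = (-1) ^ below ?W v * f' U" using ddeq m(2) vm by (auto simp: ediff_def)
  hence "cf (dd y ?W) (t + sing v 1) ~= 0" using U WL by (simp add: low_def Lam_def tW)
  hence "cf (t + sing v 1) v = 0" using y(2) unfolding thin_def by blast
  thus False by (simp add: lookup_add)
 qed
 have "thin v (lift m f')" unfolding thin_def
 proof (intro allI impI)
  fix U t assume nz: "cf (lift m f' U) t ~= 0"
  hence "f' U ~= 0" by (auto simp: cf_lift split: if_splits)
  hence "v \<in> U" using v' by blast
  with thin'[OF nz] show "(v \<in> U & t + sing v 1 \<in> A) | (v ~: U & cf t v = 0)" by blast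
 qed
 with hom ydd show ?thesis using that by blast
qed

text \<open>A defining system with thin entries is built in which every interval with two letters
  involving v has the entry 0. This is consistent: each product in the sum for such an interval has
  a zero factor or two factors of positive degree in v. The whole word is such an interval, so the
  obstruction of this system is 0, and \<open>obstruction_unique\<close> applies.\<close>

lemma noncoprime_obstruction:
 assumes w: "w \<in> words"
  and small: "PROP smaller_good w"
  and ij: "i1 < i2" "i2 < length w" "v \<in> ks (fst (w ! i1))" "v \<in> ks (fst (w ! i2))"
 shows "\<exists>y. dd y = Oword gam w"
proof -
 define k where "k = length w"
 define cnt where "cnt x y = card {i\<in>{x..<y}. v \<in> ks (fst (w ! i))}" for x y
 define hs where "hs x y = homog (%i. pdeg w y i - pdeg w x i) (qdeg w y - qdeg w x - 1)" for x y
 have cnt_split: "cnt x y = cnt x z + cnt z y" if "x <= z" "z <= y" for x y z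
 proof -
  have "{i\<in>{x..<y}. v \<in> ks (fst (w ! i))} = {i\<in>{x..<z}. v \<in> ks (fst (w ! i))} \<union> {i\<in>{z..<y}. v \<in> ks (fst (w ! i))}"
   using that by auto
  thus ?thesis unfolding cnt_def by (simp add: card_Un_disjoint disjoint_iff)
 qed
 have cnt2: "cnt 0 k >= 2"
 proof -
  have "{i1, i2} \<subseteq> {i\<in>{0..<k}. v \<in> ks (fst (w ! i))}" using ij by (auto simp: k_def)
  hence "card {i1, i2} <= cnt 0 k" unfolding cnt_def by (intro card_mono) auto
  thus ?thesis using ij by simp
 qed
 have pdv: "pdeg w y v - pdeg w x v >= 1" if xy: "x <= y" "y <= k" and c: "cnt x y >= 1" for x y
 proof -
  obtain i where i: "x <= i" "i < y" "v \<in> ks (fst (w ! i))"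
  proof -
   have "{i\<in>{x..<y}. v \<in> ks (fst (w ! i))} ~= {}" using c unfolding cnt_def by (metis card.empty not_one_le_zero)
   thus ?thesis using that by auto
  qed
  have "pdeg w a v <= pdeg w b v" if "a <= b" "b <= k" for a b
   using fun_cong[OF pdeg_diff[of a b w], of v] that by (simp add: k_def im_def)
  hence "pdeg w x v <= pdeg w i v" "pdeg w (Suc i) v <= pdeg w y v" using i xy by auto
  moreover have "pdeg w (Suc i) v - pdeg w i v = int (cf (fst (w ! i)) v)"
   using fun_cong[OF pdeg_diff[of i "Suc i" w], of v] i xy by (simp add: k_def im_def subw_Suc)
  moreover have "cf (fst (w ! i)) v >= 1" using i(3) by (simp add: cf_pos)
  ultimately show ?thesis by simp
 qed
 \<comment> \<open>The requirements on the entry r at the interval xy, given the entries f of its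
   proper subintervals.\<close>
 define P where "P f xy r = (case xy of (x, y) => x < y & y <= k & (x, y) ~= (0, k) -->
   r \<in> hs x y & thin v r & (y = Suc x --> (\<exists>z. r = lval (w ! x) + dd z)) & (cnt x y >= 2 --> r = 0) &
   dd r = msum (%u v. f (u, v)) x y)" for f :: "nat \<times> nat => 'k elt" and xy r
 define R where "R = {((u, v), (x, y)). x <= u & u < v & v <= y & (u, v) ~= (x, y::nat)}"
 have "R \<subseteq> Wellfounded.measure (%(x, y). y - x)" by (auto simp: R_def)
 hence wf: "wf R" using wf_subset by blast
 have cong: "P f xy r = P g xy r" if fg: "!!z. (z, xy) \<in> R ==> f z = g z" for f g xy r
 proof (cases xy)
  case (Pair x y)
  have "msum (%u v. f (u, v)) x y = msum (%u v. g (u, v)) x y"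
   unfolding msum_def by (rule mm_cong) (auto intro!: arg_cong[of _ _ bar] fg simp: Pair R_def)
  thus ?thesis by (simp add: P_def Pair)
 qed
 have diagok: "lval (w ! x) \<in> hs x (Suc x) & dd (lval (w ! x)) = 0" if "x < k" for x
 proof -
  have l: "w ! x \<in> labels" using w that by (auto simp: in_lists_conv_set k_def)
  have "im (fst (w ! x)) = (%i. pdeg w (Suc x) i - pdeg w x i)" "int (fst (snd (w ! x))) = qdeg w (Suc x) - qdeg w x - 1"
   using pdeg_diff[of x "Suc x" w] qdeg_diff[of x "Suc x" w] that by (simp_all add: subw_Suc k_def)
  with label_lval(1,2)[OF l] show ?thesis by (simp add: hs_def)
 qed
 have qge: "qdeg w j - qdeg w i >= 2 * int (j - i)" if "i <= j" "j <= k" for i j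
  using qdeg_ge[OF w(1), of i j] that by (simp add: k_def)
 have mzero: "msum (%u v. f (u, v)) x y = 0"
  if "x < y" "y <= k" "cnt x y >= 2" and Pf: "!!z. (z, (x, y)) \<in> R ==> P f z (f z)" for f x y
 proof -
  have "bar (f (x, z)) \<cdot> f (z, y) = 0" if z: "z \<in> {x<..<y}" for z
  proof -
   have P1: "P f (x, z) (f (x, z))" "P f (z, y) (f (z, y))" using z by (auto intro!: Pf simp: R_def)
   have c: "cnt x y = cnt x z + cnt z y" using cnt_split z by simp
   consider "cnt x z >= 2" | "cnt z y >= 2" | "cnt x z >= 1" "cnt z y >= 1" using c \<open>cnt x y >= 2\<close> by linarith
   thus ?thesis
   proof cases
    case 3
    thus ?thesis using P1 z \<open>y <= k\<close> pdv[of x z] pdv[of z y] homog_bar thin_bar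
     by (intro thin_mul_zero[where M = "%i. pdeg w z i - pdeg w x i" and M' = "%i. pdeg w y i - pdeg w z i"
        and p = "qdeg w z - qdeg w x - 1" and p' = "qdeg w y - qdeg w z - 1"])
       (auto simp: P_def hs_def)
   qed (use P1 z \<open>y <= k\<close> in \<open>auto simp: P_def\<close>)
  qed
  thus ?thesis by (simp add: msum_def mm_def)
 qed
 have step: "\<exists>r. P f xy r" if Pf: "!!z. (z, xy) \<in> R ==> P f z (f z)" for xy f
 proof (cases xy)
  case (Pair x y)
  show ?thesis
  proof (cases "x < y & y <= k & (x, y) ~= (0, k)")
   case True
   have Ps: "f (u, u') \<in> hs u u'" "thin v (f (u, u'))" "dd (f (u, u')) = msum (%u v. f (u, v)) u u'"
    if "x <= u" "u < u'" "u' <= y" "(u, u') ~= (x, y)" for u u'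
    using Pf[of "(u, u')"] that True by (auto simp: P_def R_def Pair)
   consider "y = Suc x" | "cnt x y >= 2" "y ~= Suc x" | "cnt x y < 2" "y ~= Suc x" by linarith
   thus ?thesis
   proof cases
    case 1
    have m0: "msum g x y = 0" for g
    proof -
     have "{x<..<y} = {}" using 1 by auto
     thus ?thesis by (simp add: msum_def mm_def)
    qed
    have "x < k" using True 1 by auto
    have "lval (w ! x) \<in> homog (%i. pdeg w y i - pdeg w x i) (qdeg w y - qdeg w x - 1)" "thin v (dd (lval (w ! x)))"
     using diagok[OF \<open>x < k\<close>] 1 thin_zero by (simp_all add: hs_def)
    then obtain z r where r: "r \<in> homog (%i. pdeg w y i - pdeg w x i) (qdeg w y - qdeg w x - 1)" "thin v r" "r = lval (w ! x) + dd z"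
     by (rule thin_replace)
    have "cnt x y <= 1" unfolding cnt_def 1 by (rule order_trans[OF card_mono[of "{x}"]]) auto
    moreover have "dd r = 0" using r(3) diagok[OF \<open>x < k\<close>] by (simp add: d_add d_d)
    ultimately have "P f xy r" using r m0 by (auto simp: P_def Pair hs_def)
    thus ?thesis by blast
   next
    case 2
    have "msum (%u v. f (u, v)) x y = 0" using True 2 Pf by (intro mzero) (auto simp: Pair)
    hence "P f xy 0" using 2 homog_zero thin_zero by (simp add: P_def Pair hs_def)
    thus ?thesis by blast
   next
    case 3
    \<comment> \<open>With at most one letter involving v the sum need not vanish, but it bounds: by
      decomposition it comes from words in the degree of a proper subword of w.\<close>
    have "\<exists>z. msum (%u v. f (u, v)) x y = dd z"
    proof -
     obtain H g where Hf: "!!x y. finite (H x y)"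
      "!!p. p \<in> paths H x y ==> map snd p \<in> words & im (wdeg (map snd p)) = (%i. pdeg w y i - pdeg w x i)"
      "msum (%u v. f (u, v)) x y = (\<Sum>p\<in>paths H x y. Oword gam (map snd p)) + dd g"
     proof (rule homog_decomposition[where M = "pdeg w" and q = "qdeg w" and X = "{}" and a = "%u v. f (u, v)" and ?x0.0 = x and ?y0.0 = y])
      fix u u' assume uu: "x <= u" "u < u'" "u' <= y" "(u, u') ~= (x, y)"
      show "f (u, u') \<in> homog (%i. pdeg w u' i - pdeg w u i) (qdeg w u' - qdeg w u - 1)"
       "dd (f (u, u')) = msum (%u v. f (u, v)) u u'" using Ps[OF uu] by (simp_all add: hs_def)
      show "qdeg w u' - qdeg w u = 1 ==> pdeg w u' ~= pdeg w u" using qge[of u u'] uu True by auto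
      show "wgood w'" if "w' \<in> words" "w' ~= []" "im (wdeg w') = (%i. pdeg w u' i - pdeg w u i)" for w'
      proof (rule small[OF that(1,2)])
       have "wdeg w' = wdeg (subw w u u')" using pdeg_diff[of u u' w] that(3) uu True by (intro im_inj) (simp add: k_def)
       thus "smaller w' w" using smaller_subw(2)[OF w(1), of u u'] uu True by (auto simp: smaller_def k_def)
      qed
     qed (use True in auto)
     have "\<exists>z. Oword gam (map snd p) = dd z" if "p \<in> paths H x y" for p
     proof -
      have "p ~= []" using that True by (auto simp: paths_def)
      have "wdeg (map snd p) = wdeg (subw w x y)"
       using Hf(2)[OF that] pdeg_diff[of x y w] True by (intro im_inj) (simp add: k_def)
      hence "wgood (map snd p)"
       using Hf(2)[OF that] \<open>p ~= []\<close> smaller_subw(2)[OF w(1), of x y] True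
       by (intro small) (auto simp: smaller_def k_def)
      thus ?thesis unfolding wgood_def by metis
     qed
     then obtain h where h: "!!p. p \<in> paths H x y ==> Oword gam (map snd p) = dd (h p)" by metis
     have "msum (%u v. f (u, v)) x y = dd (sum h (paths H x y) + g)" unfolding Hf(3) by (simp add: h d_add d_sum)
     thus ?thesis by blast
    qed
    then obtain z where z: "msum (%u v. f (u, v)) x y = dd z" by blast
    have "dd z \<in> homog (%i. pdeg w y i - pdeg w x i) (qdeg w y - qdeg w x - 2)"
     unfolding z[symmetric] msum_def mm_def
    proof (rule homog_sum)
     fix u assume u: "u \<in> {x<..<y}"
     have "bar (f (x, u)) \<in> hs x u" "f (u, y) \<in> hs u y" using Ps(1)[of x u] Ps(1)[of u y] u homog_bar by (auto simp: hs_def)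
     thus "bar (f (x, u)) \<cdot> f (u, y) \<in> homog (%i. pdeg w y i - pdeg w x i) (qdeg w y - qdeg w x - 2)"
      using homog_mul[of "bar (f (x, u))" "%i. pdeg w u i - pdeg w x i" "qdeg w u - qdeg w x - 1" "f (u, y)"
        "%i. pdeg w y i - pdeg w u i" "qdeg w y - qdeg w u - 1"] by (simp add: hs_def algebra_simps)
    qed
    then obtain z' where z': "z' \<in> homog (%i. pdeg w y i - pdeg w x i) (qdeg w y - qdeg w x - 2 + 1)" "dd z' = dd z"
     by (rule homog_boundary)
    have "thin v (dd z')" unfolding z'(2) z[symmetric] msum_def mm_def
     by (rule thin_sum) (insert Ps(2), auto intro!: thin_mul thin_bar)
    with z'(1) obtain z2 r where r: "r \<in> homog (%i. pdeg w y i - pdeg w x i) (qdeg w y - qdeg w x - 2 + 1)"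
      "thin v r" "r = z' + dd z2" by (rule thin_replace)
    hence "P f xy r" using z z' 3 by (simp add: P_def Pair hs_def d_add d_d)
    thus ?thesis by blast
   qed
  next
   case False
   thus ?thesis by (auto simp: P_def Pair)
  qed
 qed
 \<comment> \<open>Well-founded recursion over proper subintervals, with a choice at each
   stage.\<close>
 obtain f where f: "!!xy. P f xy (f xy)"
  using dependent_wf_choice[OF wf, of P] cong step by (metis (no_types, lifting))
 have "\<exists>z. Oword gam w = msum (%u v. f (u, v)) 0 (length w) + dd z"
 proof (rule obstruction_unique[OF w _ small])
  show "2 <= length w" using ij by simp
  fix x y assume xy: "x < y" "y <= length w" "(x, y) ~= (0, length w)"
  hence "f (x, y) \<in> hs x y" "dd (f (x, y)) = msum (%u v. f (u, v)) x y" using f[of "(x, y)"] by (auto simp: P_def k_def)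
  thus "f (x, y) \<in> homog (im (wdeg (subw w x y))) (int (wp (subw w x y)) + int (y - x) - 1)"
   "dd (f (x, y)) = msum (%u v. f (u, v)) x y"
   using pdeg_diff[of x y w] qdeg_diff[of x y w] xy by (simp_all add: hs_def)
 next
  fix x assume "x < length w"
  thus "\<exists>z. f (x, Suc x) = lval (w ! x) + dd z" using f[of "(x, Suc x)"] ij by (auto simp: P_def k_def)
 qed auto
 moreover have "msum (%u v. f (u, v)) 0 (length w) = 0"
 proof -
  have "0 < k" using ij(2) unfolding k_def by linarith
  thus ?thesis using mzero[of 0 k f] cnt2 f by (simp add: k_def)
 qed
 ultimately show ?thesis by (metis add_0)
qed

end

section \<open>Homology in a fixed multidegree\<close>

lemma contr_zero' [simp]: "contr v 0 = 0" by (auto simp: contr_def)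

lemma contr_diff: "contr v (f - g) = contr v f - contr v g" by (auto simp: contr_def fun_eq_iff algebra_simps)

lemma cf_sing_one: "cf (sing v (1::nat)) i = (if i = v then 1 else 0)"
 "cf (sing v (Suc 0)) i = (if i = v then 1 else 0)" by (simp_all add: lookup_single when_def)

lemma fun_nonzeroE: "f ~= 0 ==> (!!x. f x ~= 0 ==> thesis) ==> thesis"
 by (metis ext zero_fun_apply)

lemma ks_diff_sing: "ks (m :: monomial) - {v} \<subseteq> ks (m - sing v 1)"
 by (auto simp: cf_pos lookup_minus cf_sing_one split: if_splits)

lemma wedge_contr: "wedge v (contr v f) U = (if v \<in> U then f U else 0)"
 by (auto simp: wedge_def contr_def insert_absorb minus_one_power_iff)

lemma degree_two_monomial:
 assumes "mdegree q = 2"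
 obtains w w' where "q = sing w 1 + sing w' 1"
proof -
 have "q ~= 0" using assms by auto
 then obtain w where w: "w \<in> ks q" by (metis keys_eq_empty ex_in_conv)
 have d1: "mdvd (sing w 1) q" using w by (auto simp: mdvd_def cf_sing_one cf_pos)
 define q' where "q' = q - sing w 1"
 have q: "q = sing w 1 + q'" unfolding q'_def by (rule mdvd_imp_add[OF d1])
 hence "mdegree q' = 1" using assms by (simp add: mdegree_add)
 hence "q' ~= 0" by auto
 then obtain w' where w': "w' \<in> ks q'" by (metis keys_eq_empty ex_in_conv)
 have "mdvd (sing w' 1) q'" using w' by (auto simp: mdvd_def cf_sing_one cf_pos)
 hence "q' = sing w' 1 + (q' - sing w' 1)" by (rule mdvd_imp_add)
 hence "mdegree (q' - sing w' 1) = 0" using \<open>mdegree q' = 1\<close> mdegree_add[of "sing w' 1" "q' - sing w' 1"] by simp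
 hence "q' = sing w' 1" using \<open>q' = sing w' 1 + (q' - sing w' 1)\<close> by (simp add: mdegree_eq_0)
 with q that show ?thesis by blast
qed

context monomial_koszul
begin

section \<open>Contraction and exactness in a fixed degree\<close>

lemma diff_ind_insert: "v ~: U ==> finite U ==> m - ind (insert v U) = m - sing v 1 - ind U"
 by (rule poly_mapping_eqI) (auto simp: lookup_minus cf_ind cf_sing_one)

lemma Lam_insert_iff:
 assumes "v \<in> ks m" "v ~: U"
 shows "insert v U \<in> Lam m \<longleftrightarrow> U \<in> Lam (m - sing v 1)"
proof (cases "finite U")
 case True
 have "insert v U \<subseteq> ks m \<longleftrightarrow> U \<subseteq> ks (m - sing v 1)"
  using assms ks_diff_sing[of m v] ks_diff_le[of m "sing v 1"] by blast
 thus ?thesis using diff_ind_insert[OF assms(2) True, of m] by (simp add: Lam_def)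
next
 case False
 thus ?thesis using Lam_finite[of "insert v U" m] Lam_finite[of U] by auto
qed

lemma sup_contr: "v \<in> ks m ==> sup m f ==> sup (m - sing v 1) (contr v f)"
 using Lam_insert_iff by (auto simp: sup_def contr_def split: if_splits)

lemma hp_contr: "sup m f ==> hp (Suc p) f ==> hp p (contr v f)" unfolding hp_def
proof (intro allI impI)
 fix U assume a: "sup m f" "\<forall>U. f U ~= 0 --> card U = Suc p" "contr v f U ~= 0"
 hence "v ~: U" "f (insert v U) ~= 0" by (auto simp: contr_def split: if_splits)
 moreover have "insert v U \<in> Lam m" using a(1) calculation(2) by (simp add: sup_def)
 hence "finite (insert v U)" by (rule Lam_finite)
 ultimately show "card U = p" using a(2) by fastforce
qed

lemma contr_tr: "v \<in> ks m ==> contr v (tr m f) = tr (m - sing v 1) (contr v f)"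
 using Lam_insert_iff[of v m] by (auto simp: contr_def tr_def fun_eq_iff)

lemma tr_cong: "(!!U. U \<in> Lam m ==> f U = g U) ==> tr m f = tr m g"
 by (auto simp: tr_def)

lemma contr_exact: "v \<in> ks m ==> exact m f ==> exact (m - sing v 1) (contr v f)"
proof -
 assume v: "v \<in> ks m" and "exact m f"
 then obtain g where g: "sup m g" "f = tr m (ed g)" by (auto simp: exact_def)
 have "contr v f = tr (m - sing v 1) (contr v (ed g))" unfolding g(2) by (rule contr_tr[OF v])
 also have "... = tr (m - sing v 1) (ed (- contr v g))"
  by (rule tr_cong) (simp add: contr_ediff[OF Lam_finite] ed_minus)
 finally show ?thesis using sup_minus[OF sup_contr[OF v g(1)]] unfolding exact_def by blast
qed

lemma cycD: "cyc m f ==> V \<in> Lam m ==> ed f V = 0"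
proof -
 assume "cyc m f" "V \<in> Lam m"
 hence "tr m (ed f) V = 0" by (simp add: cyc_def)
 thus ?thesis using \<open>V \<in> Lam m\<close> by (simp add: tr_def)
qed

text \<open>For U in \<open>Lam m\<close> containing v, the set U - {v} is again in
  \<open>Lam m\<close>, where \<open>ed f\<close> vanishes; hence e_v annihilates
  \<open>ed f\<close>.\<close>

lemma free_variable_exact:
 assumes "mon m" "v \<in> ks m" "cyc m f" "!!U. U \<in> Lam m ==> v \<in> U ==> U - {v} \<in> Lam m"
 shows "exact m f"
proof (rule cone[OF assms(1,2)])
 show "sup m f" using assms(3) by (simp add: cyc_def)
 show "tr m (wedge v (ed f)) = 0"
 proof
  fix U
  show "tr m (wedge v (ed f)) U = 0 U" using assms(4)[of U] cycD[OF assms(3)] by (simp add: tr_def wedge_def)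
 qed
qed

text \<open>The boundary of f lives on sets U with p - 1 elements, for which x^{m-U} has degree
  \<open>mdegree m\<close> - p + 1. If no such monomial is in A, truncation removes nothing,
  \<open>ed f\<close> itself is 0, and \<open>cone\<close> applies to any variable.\<close>

lemma no_divisor_exact:
 assumes "mon m" "cyc m f" "hp p f" "p >= 1"
  and "!!t. t \<in> A ==> mdvd t m ==> mdegree t + p ~= mdegree m + 1"
 shows "exact m f"
proof -
 have supf: "sup m f" using assms(2) by (simp add: cyc_def)
 show ?thesis
 proof (cases "f = 0")
  case False
  then obtain W where W: "f W ~= 0" by (rule fun_nonzeroE)
  hence "card W = p" "W \<in> Lam m" using assms(3) supf by (auto simp: hp_def sup_def)
  hence "W ~= {}" using assms(4) by auto
  then obtain v where v: "v \<in> ks m" using \<open>W \<in> Lam m\<close> by (auto simp: Lam_def)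
  have "ed f U = 0" for U
  proof (rule ccontr)
   assume nz: "ed f U ~= 0"
   then obtain i where i: "i < n" "contr i f U ~= 0"
    by (metis (no_types, lifting) ediff_def lessThan_iff mult_zero_right sum.neutral)
   hence iU: "i ~: U" "f (insert i U) ~= 0" by (auto simp: contr_def split: if_splits)
   hence L: "insert i U \<in> Lam m" "card (insert i U) = p" using supf assms(3) by (auto simp: sup_def hp_def)
   hence fin: "finite U" using Lam_finite by fastforce
   have Uk: "U \<subseteq> ks m" using L by (auto simp: Lam_def)
   have "mdegree (m - ind U) + p = mdegree m + 1" using mdegree_diff_ind[OF Uk] L(2) fin iU(1) by simp
   moreover have "mdvd (m - ind U) m" by (auto simp: mdvd_def lookup_minus)
   ultimately have "m - ind U ~: A" using assms(5) by blast
   hence "U \<in> Lam m" using Uk by (simp add: Lam_def)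
   thus False using nz cycD[OF assms(2)] by blast
  qed
  hence "wedge v (ed f) = 0" by (auto simp: wedge_def)
  thus ?thesis using cone[OF assms(1) v supf] by simp
 qed simp
qed

text \<open>If x_v^2 divides x^m, adding v to U or removing it does not change the support of
  x^{m-U}, and membership in A depends only on the support.\<close>

lemma squarefree_exact:
 assumes "!!t. t \<in> A ==> ind (ks t) \<in> A" "mon m" "cyc m f" "cf m v >= 2"
 shows "exact m f"
proof (rule free_variable_exact[OF assms(2) _ assms(3)])
 show "v \<in> ks m" using assms(4) by (simp add: cf_pos)
 fix U assume U: "U \<in> Lam m" "v \<in> U"
 hence Uk: "U \<subseteq> ks m" "finite U" using Lam_finite by (auto simp: Lam_def)
 have "ks (m - ind (U - {v})) = ks (m - ind U)"
  using U Uk assms(4) by (auto simp: in_keys_iff lookup_minus cf_ind split: if_splits)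
 moreover have "ind (ks (m - ind U)) ~: A"
 proof
  assume a: "ind (ks (m - ind U)) \<in> A"
  have "mdvd (ind (ks (m - ind U))) (m - ind U)" by (simp add: mdvd_ind)
  with a upset U(1) show False by (auto simp: Lam_def)
 qed
 ultimately have "m - ind (U - {v}) ~: A" using assms(1) by metis
 thus "U - {v} \<in> Lam m" using Uk by (auto simp: Lam_def)
qed

text \<open>If the contraction of \<open>f\<close> by \<open>w\<close> is the boundary of \<open>g\<close>, the part of \<open>f\<close> involving $e_w$ can be traded for \<open>g\<close>.\<close>

lemma contr_exact_replace:
 assumes m: "mon m" "w \<in> ks m" and f: "sup m f" and g: "sup (m - sing w 1) g" "contr w f = tr (m - sing w 1) (ed g)"
 shows "exact m (wedge w (contr w f) - tr m g)"
proof -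
 have sw: "sup m (wedge w g)" unfolding sup_def
 proof (intro allI impI)
  fix U assume "wedge w g U ~= 0"
  hence U: "w \<in> U" "U - {w} \<in> Lam (m - sing w 1)" using g(1) by (auto simp: wedge_def sup_def split: if_splits)
  hence "insert w (U - {w}) \<in> Lam m" using Lam_insert_iff[OF m(2), of "U - {w}"] by simp
  thus "U \<in> Lam m" using U(1) by (simp add: insert_absorb)
 qed
 have "wedge w (contr w f) - tr m g = tr m (ed (- wedge w g))"
 proof
  fix U
  show "(wedge w (contr w f) - tr m g) U = tr m (ed (- wedge w g)) U"
  proof (cases "U \<in> Lam m")
   case True
   have e: "ed (wedge w g) U = g U - wedge w (ed g) U"
    using ediff_wedge[OF Lam_finite[OF True], of w n "%_. 1" g] m by auto
   have "wedge w (ed g) U = wedge w (contr w f) U"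
   proof (cases "w \<in> U")
    case wU: True
    hence "U - {w} \<in> Lam (m - sing w 1)"
     using Lam_insert_iff[OF m(2), of "U - {w}"] True by (simp add: insert_absorb)
    thus ?thesis using g(2) by (simp add: wedge_def tr_def)
   qed (simp add: wedge_def)
   thus ?thesis using True e by (simp add: tr_def ed_minus)
  next
   case False
   thus ?thesis using f by (auto simp: tr_def wedge_contr sup_def)
  qed
 qed
 thus ?thesis using sup_minus[OF sw] unfolding exact_def by blast
qed

end

text \<open>Triviality of the product, expressed in the model. The primitive z may be inhomogeneous,
  as \<open>exact_iff\<close> cuts out the relevant part.\<close>

locale trivial_koszul = monomial_koszul n A field_type
 for n and A and field_type :: "'k::field itself" +
 assumes trivial: "(x :: 'k elt) \<in> homog_p (int p) ==> y \<in> homog_p (int q) ==> dd x = 0 ==> dd y = 0 ==> p >= 1 ==> q >= 1 ==>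
  \<exists>z. dd z = x \<cdot> y"
begin

lemma product_exact:
 assumes "mon m" "mon m'" "cyc m f" "cyc m' g" "hp p f" "hp q g" "p >= 1" "q >= 1"
 shows "exact (m + m') (tr (m + m') (emul f g))"
proof -
 have s: "sup m f" "sup m' g" using assms by (auto simp: cyc_def)
 have "\<exists>z. dd z = lift m f \<cdot> lift m' g"
 proof (rule trivial)
  show "lift m f \<in> homog_p (int p)" "lift m' g \<in> homog_p (int q)"
   using lift_homog homog_subset assms s by blast+
  show "dd (lift m f) = 0" "dd (lift m' g) = 0" using cyc_iff assms s by blast+
 qed (use assms in auto)
 thus ?thesis using mul_lift[OF assms(1,2) s] exact_iff[of "m + m'" "tr (m + m') (emul f g)"]
   keys_add_subset[OF assms(1,2)] by simp
qed

section \<open>Generators of degree one and two\<close>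

lemma tr_emul_singleton: "tr m (emul (ee {w}) f) = tr m (wedge w f)"
 by (rule tr_cong) (simp add: emul_ee_singleton Lam_finite)

text \<open>Multiplication by the cycle x_u e_w, which represents the generator x_w x_u, is
  \<open>wedge w\<close> on coefficients.\<close>

lemma wedge_exact:
 assumes m: "mon m" and q: "sing w 1 + sing u 1 \<in> A" "sing u 1 ~: A" "w < n" "u < n"
  and f: "cyc m f" "hp p f" "p >= 1"
 shows "exact (sing w 1 + sing u 1 + m) (tr (sing w 1 + sing u 1 + m) (wedge w f))"
proof -
 let ?q = "sing w 1 + sing u (1::nat)"
 have monq: "mon ?q" using q by (intro keys_add_subset) auto
 have "cyc ?q (ee {w})" unfolding cyc_def
 proof
  have "?q - ind {w} = sing u 1" by simp
  moreover have "w \<in> ks ?q" by (simp add: cf_pos lookup_add)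
  ultimately show "sup ?q (ee {w})" using q by (auto simp: sup_def ee_def Lam_def split: if_splits)
  show "tr ?q (ed (ee {w})) = 0"
  proof
   fix U
   have "contr i (ee {w} :: 'k ext) U = 0" if "U ~= {}" for i using that by (auto simp: contr_def ee_def)
   moreover have "{} ~: Lam ?q" using q by (simp add: Lam_def)
   ultimately show "tr ?q (ed (ee {w})) U = 0 U" by (cases "U = {}") (simp_all add: tr_def ediff_def)
  qed
 qed
 moreover have "hp 1 (ee {w})" by (auto simp: hp_def ee_def split: if_splits)
 ultimately show ?thesis using product_exact[OF monq m _ f(1) _ f(2) _ f(3), of "ee {w}" 1] by (simp add: tr_emul_singleton)
qed

text \<open>f is homologous to a primitive g of its contraction by u. By C2 the element g equals e_r
  P on \<open>Lam m\<close>, where P is its contraction by r, and C1 makes P a cycle. So g is the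
  product of the cycles x_u e_r and P, hence exact.\<close>

lemma quadratic_core:
 assumes m: "mon m" "mdvd (sing r 1 + sing u 1) m" and q: "sing r 1 + sing u 1 \<in> A" "sing u 1 ~: A"
  and f: "cyc m f" "hp (Suc (Suc p)) f" "exact (m - sing u 1) (contr u f)"
  and fu: "!!U. f U ~= 0 ==> u \<in> U" and C1: "contr r (contr u f) = 0"
  and C2: "!!U. U \<in> Lam m ==> U \<in> Lam (m - sing u 1) ==> r \<in> U"
 shows "exact m f"
proof -
 let ?mu = "m - sing u (1::nat)" and ?q = "sing r 1 + sing u (1::nat)"
 let ?N = "?mu - sing r (1::nat)"
 have c: "cf (sing r 1 + sing u (1::nat)) i <= cf m i" for i using m(2) by (simp add: mdvd_def)
 have ks: "u \<in> ks m" "r \<in> ks ?mu" "r \<in> ks m"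
  using c[of u] c[of r] by (auto simp: cf_pos lookup_add lookup_minus cf_sing_one split: if_splits)
 have supf: "sup m f" using f(1) by (simp add: cyc_def)
 obtain g where g: "sup ?mu g" "hp (Suc (Suc p)) g" "contr u f = tr ?mu (ed g)"
  using exact_hp[OF f(3) hp_contr[OF supf f(2)]] by blast
 have "wedge u (contr u f) = f" using fu by (auto simp: wedge_contr fun_eq_iff)
 hence ex1: "exact m (f - tr m g)" using contr_exact_replace[OF m(1) ks(1) supf g(1,3)] by simp
 define P where "P = contr r g"
 have supP: "sup ?N P" unfolding P_def by (rule sup_contr[OF ks(2) g(1)])
 have "tr ?N (ed P) = - tr ?N (contr r (ed g))"
  unfolding P_def tr_minus[symmetric] by (rule tr_cong) (simp add: contr_ediff[OF Lam_finite])
 also have "tr ?N (contr r (ed g)) = contr r (tr ?mu (ed g))" by (rule contr_tr[OF ks(2), symmetric])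
 also have "... = 0" using C1 g(3) by simp
 finally have "tr ?N (ed P) = 0" by (simp add: zero_fun_def)
 hence cycP: "cyc ?N P" using supP by (simp add: cyc_def)
 have hpP: "hp (Suc p) P" unfolding P_def by (rule hp_contr[OF g(1,2)])
 have "tr m g = tr m (wedge r P)"
 proof (rule tr_cong)
  fix U assume U: "U \<in> Lam m"
  show "g U = wedge r P U" unfolding P_def wedge_contr using C2[OF U] g(1) by (auto simp: sup_def)
 qed
 moreover have "exact (?q + ?N) (tr (?q + ?N) (wedge r P))"
 proof (rule wedge_exact)
  show "mon ?N" using m(1) ks_diff_le by blast
  show "r < n" "u < n" using ks m(1) by auto
 qed (use q cycP hpP in auto)
 moreover have "?q + ?N = m"
 proof (rule poly_mapping_eqI)
  fix i show "cf (?q + ?N) i = cf m i" using c[of i] by (simp add: lookup_add lookup_minus)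
 qed
 ultimately have "exact m (tr m g)" by simp
 from exact_add[OF ex1 this] show ?thesis by simp
qed

text \<open>As w has exponent 1 in m, trading the terms with e_w for a primitive of the contraction
  by w leaves a cycle f1 without e_w. Every set in \<open>Lam m\<close> without w contains w', for
  otherwise x_w x_w' would divide x^{m-U}. This puts f1 in the situation of
  \<open>quadratic_core\<close>.\<close>

lemma quadratic_kernel_aux:
 assumes m: "mon m" "mdvd (sing w 1 + sing w' 1) m" and q: "sing w 1 + sing w' 1 \<in> A"
  and nolin: "!!v. v < n ==> sing v 1 ~: A"
  and f: "cyc m f" "hp (Suc (Suc p)) f" "exact (m - sing w 1) (contr w f)" "exact (m - sing w' 1) (contr w' f)"
  and w: "cf m w = 1" "w ~= w'"
 shows "exact m f"
proof -
 have c: "cf (sing w 1 + sing w' (1::nat)) i <= cf m i" for i using m(2) by (simp add: mdvd_def)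
 have ks: "w \<in> ks m" "w' \<in> ks m"
  using c[of w] c[of w'] by (auto simp: cf_pos lookup_add cf_sing_one split: if_splits)
 have lt: "w < n" "w' < n" using ks m by auto
 have Lw: "w' \<in> U & cf m w' = 1" if "U \<in> Lam m" "w ~: U" for U
 proof -
  have U: "U \<subseteq> ks m" "m - ind U ~: A" "finite U" using that Lam_finite by (auto simp: Lam_def)
  have "~ mdvd (sing w 1 + sing w' 1) (m - ind U)" using upset q U(2) by blast
  then obtain i where "~ cf (sing w 1 + sing w' (1::nat)) i <= cf (m - ind U) i" by (auto simp: mdvd_def)
  thus ?thesis using c[of i] w that(2) U(3) by (auto simp: lookup_add lookup_minus cf_ind cf_sing_one split: if_splits)
 qed
 have supf: "sup m f" using f(1) by (simp add: cyc_def)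
 obtain g where g: "sup (m - sing w 1) g" "hp (Suc (Suc p)) g" "contr w f = tr (m - sing w 1) (ed g)"
  using exact_hp[OF f(3) hp_contr[OF supf f(2)]] by blast
 define f1 where "f1 = (f - wedge w (contr w f)) + tr m g"
 have ex1: "exact m (f - f1)" using contr_exact_replace[OF m(1) ks(1) supf g(1,3)] by (simp add: f1_def)
 have cyc1: "cyc m f1" using cyc_diff[OF f(1) exact_cyc[OF m(1) ex1]] by simp
 have f1w: "f1 U = 0" if "w \<in> U" for U
 proof -
  have "w ~: ks (m - sing w 1)" using w by (simp add: cf_pos lookup_minus cf_sing_one)
  hence "g U = 0" using g(1) that by (auto simp: sup_def Lam_def)
  thus ?thesis using that by (simp add: f1_def wedge_contr tr_def)
 qed
 have hp1: "hp (Suc (Suc p)) f1" unfolding hp_def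
 proof (intro allI impI)
  fix U assume "f1 U ~= 0"
  hence "f U ~= 0 | g U ~= 0" by (auto simp: f1_def wedge_contr tr_def split: if_splits)
  thus "card U = Suc (Suc p)" using f(2) g(2) by (auto simp: hp_def)
 qed
 have "exact m f1"
 proof (cases "f1 = 0")
  case False
  then obtain W where W: "f1 W ~= 0" by (rule fun_nonzeroE)
  hence "W \<in> Lam m" "w ~: W" using cyc1 f1w by (auto simp: cyc_def sup_def)
  hence w1: "cf m w' = 1" using Lw by blast
  show ?thesis
  proof (rule quadratic_core[OF m q nolin[OF lt(2)] cyc1 hp1])
   show "exact (m - sing w' 1) (contr w' f1)"
    using exact_diff[OF f(4) contr_exact[OF ks(2) ex1]] by (simp add: contr_diff)
   show "!!U. f1 U ~= 0 ==> w' \<in> U" using Lw f1w cyc1 by (auto simp: cyc_def sup_def)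
   show "contr w (contr w' f1) = 0" using f1w by (auto simp: contr_def fun_eq_iff)
   show "w \<in> U" if "U \<in> Lam m" "U \<in> Lam (m - sing w' 1)" for U
   proof (rule ccontr)
    assume "w ~: U"
    hence "w' \<in> ks (m - sing w' 1)" using Lw that by (auto simp: Lam_def)
    thus False using w1 by (simp add: cf_pos lookup_minus cf_sing_one)
   qed
  qed
 qed simp
 from exact_add[OF ex1 this] show ?thesis by simp
qed

text \<open>Removing U lowers every exponent by at most 1. So \<open>Lam m\<close> is empty unless q
  reaches the exponent of m in one of its variables, and the two lemmas above treat the cases left:
  the square of a variable with exponent 2, and two variables one of which has exponent 1.\<close>

lemma quadratic_kernel:
 assumes m: "mon m" "mdvd q m" and q: "q \<in> A" "mdegree q = 2"
  and nolin: "!!v. v < n ==> sing v 1 ~: A"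
  and f: "cyc m f" "hp (Suc (Suc p)) f" "!!v. v \<in> ks m ==> exact (m - sing v 1) (contr v f)"
 shows "exact m f"
proof -
 obtain w w' where q': "q = sing w 1 + sing w' 1" using degree_two_monomial q by blast
 have c: "cf (sing w 1 + sing w' (1::nat)) i <= cf m i" for i using m(2) by (simp add: mdvd_def q')
 have ks: "w \<in> ks m" "w' \<in> ks m"
  using c[of w] c[of w'] by (auto simp: cf_pos lookup_add cf_sing_one split: if_splits)
 have supf: "sup m f" using f(1) by (simp add: cyc_def)
 have nodiv: "\<exists>i. cf (m - ind U) i < cf q i" if "U \<in> Lam m" for U
 proof -
  have "~ mdvd q (m - ind U)" using upset q that by (auto simp: Lam_def)
  thus ?thesis by (auto simp: mdvd_def linorder_not_le)
 qed
 have vanish: "f = 0" if "!!U. U \<in> Lam m ==> False" using supf that by (auto simp: sup_def fun_eq_iff)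
 show ?thesis
 proof (cases "w = w'")
  case True
  show ?thesis
  proof (cases "cf m w = 2")
   case m2: True
   have inw: "w \<in> U" if "U \<in> Lam m" for U using nodiv[OF that] m2 c Lam_finite[OF that] True
    by (auto simp: q' lookup_add lookup_minus cf_ind cf_sing_one split: if_splits)
   show ?thesis
   proof (rule quadratic_core[of m w w f p])
    show "!!U. f U ~= 0 ==> w \<in> U" using inw supf by (auto simp: sup_def)
   qed (use m q q' True nolin f ks inw in auto)
  next
   case False
   hence "cf m w >= 3" using c[of w] True by (simp add: lookup_add)
   hence "f = 0"
    using nodiv c Lam_finite True by (intro vanish) (fastforce simp: q' lookup_add lookup_minus cf_ind cf_sing_one split: if_splits)
   thus ?thesis by simp
  qed
 next
  case False
  consider "cf m w = 1" | "cf m w' = 1" | "cf m w >= 2" "cf m w' >= 2"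
   using c[of w] c[of w'] False by (fastforce simp: lookup_add cf_sing_one)
  thus ?thesis
  proof cases
   case 1
   show ?thesis by (rule quadratic_kernel_aux[of m w w' f p]) (use m q q' False nolin f ks 1 in auto)
  next
   case 2
   show ?thesis by (rule quadratic_kernel_aux[of m w' w f p]) (insert m q q' False nolin f ks 2, auto simp: add.commute)
  next
   case 3
   hence "f = 0"
    using nodiv Lam_finite False by (intro vanish) (fastforce simp: q' lookup_add lookup_minus cf_ind cf_sing_one split: if_splits)
   thus ?thesis by simp
  qed
 qed
qed

text \<open>If x_v is in A, then e_v is a cycle of positive degree. If v occurs in m, all of f is a
  multiple of e_v; otherwise e_v f bounds and f is recovered by contracting it with v.\<close>

lemma linear_exact:
 assumes m: "mon m" and v: "v < n" "sing v 1 \<in> A" and f: "cyc m f" "hp (Suc (Suc p)) f"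
 shows "exact m f"
proof -
 have supf: "sup m f" using f(1) by (simp add: cyc_def)
 let ?v = "sing v (1::nat)"
 have cyv: "cyc ?v (ee {v})" if "0 ~: A" unfolding cyc_def
 proof
  show "sup ?v (ee {v})" using that by (auto simp: sup_def ee_def Lam_def split: if_splits)
  have "{} ~: Lam ?v" using v by (simp add: Lam_def)
  moreover have "contr i (ee {v} :: 'k ext) U = 0" if "U ~= {}" for i U using that by (auto simp: contr_def ee_def)
  ultimately have "tr ?v (ed (ee {v})) U = 0 U" for U by (cases "U = {}") (simp_all add: tr_def ediff_def)
  thus "tr ?v (ed (ee {v})) = 0" by blast
 qed
 have hpv: "hp 1 (ee {v})" by (auto simp: hp_def ee_def split: if_splits)
 have prod: "exact (?v + m') (tr (?v + m') (wedge v g))" if "mon m'" "cyc m' g" "hp (Suc p') g" "0 ~: A" for m' g p'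
  using product_exact[of ?v m' "ee {v}" g 1 "Suc p'"] that cyv hpv v by (simp add: tr_emul_singleton)
 show ?thesis
 proof (cases "f = 0")
  case fnz: False
  hence A0: "0 ~: A" using supf upset by (auto simp: sup_def Lam_def)
  show ?thesis
  proof (cases "v \<in> ks m")
   case True
   have inv: "v \<in> U" "cf m v = 1" if "U \<in> Lam m" for U
   proof -
    have U: "U \<subseteq> ks m" "m - ind U ~: A" "finite U" using that Lam_finite by (auto simp: Lam_def)
    have "~ mdvd ?v (m - ind U)" using upset v U(2) by blast
    hence "cf (m - ind U) v = 0" by (auto simp: mdvd_def cf_sing_one split: if_splits)
    thus "v \<in> U" "cf m v = 1" using True U(3) by (auto simp: lookup_minus cf_ind cf_pos split: if_splits)
   qed
   have eq: "wedge v (contr v f) = f" using inv supf by (auto simp: wedge_contr sup_def fun_eq_iff)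
   have "cyc (m - ?v) (contr v f)"
   proof -
    have "tr (m - ?v) (ed (contr v f)) = - tr (m - ?v) (contr v (ed f))"
     unfolding tr_minus[symmetric] by (rule tr_cong) (simp add: contr_ediff[OF Lam_finite])
    also have "tr (m - ?v) (contr v (ed f)) = contr v (tr m (ed f))" by (rule contr_tr[OF True, symmetric])
    also have "contr v (tr m (ed f)) = 0" using f(1) by (simp add: cyc_def)
    finally have "tr (m - ?v) (ed (contr v f)) = 0" by (simp add: zero_fun_def)
    thus ?thesis using sup_contr[OF True supf] by (simp add: cyc_def)
   qed
   hence "exact (?v + (m - ?v)) (tr (?v + (m - ?v)) (wedge v (contr v f)))"
    using m ks_diff_le[of m ?v] by (intro prod[OF _ _ hp_contr[OF supf f(2)] A0]) auto
   moreover have "?v + (m - ?v) = m"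
    using True by (intro mdvd_imp_add[symmetric]) (auto simp: mdvd_def cf_sing_one cf_pos)
   ultimately show ?thesis by (simp add: eq tr_id[OF supf])
  next
   case False
   let ?m' = "?v + m"
   have kv: "v \<in> ks ?m'" by (simp add: cf_pos lookup_add)
   have mv: "?m' - ?v = m" by simp
   have "exact ?m' (tr ?m' (wedge v f))" by (rule prod[OF m f A0])
   hence "exact (?m' - ?v) (contr v (tr ?m' (wedge v f)))" by (rule contr_exact[OF kv])
   hence "exact m (tr m (contr v (wedge v f)))" unfolding contr_tr[OF kv] mv .
   moreover have "tr m (contr v (wedge v f)) = f"
   proof
    fix U show "tr m (contr v (wedge v f)) U = f U"
    proof (cases "U \<in> Lam m")
     case True
     hence "v ~: U" using False by (auto simp: Lam_def)
     thus ?thesis using True by (simp add: tr_def contr_def wedge_def minus_one_power_iff)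
    next
     case F: False
     thus ?thesis using supf by (auto simp: tr_def sup_def)
    qed
   qed
   ultimately show ?thesis by simp
  qed
 qed simp
qed

text \<open>In the following \<open>w\<close> is a word all of whose predecessors are good; its obstruction is written as the degree
 \<open>wdeg w\<close> element \<open>f\<close>.\<close>

lemma all_words_goodI:
 assumes step: "!!w f. w \<in> words ==> length w >= 3 ==>
   PROP smaller_good w ==>
   Oword gam w = lift (wdeg w) f ==> mon (wdeg w) ==> cyc (wdeg w) f ==> hp (wp w + length w - 2) f ==> exact (wdeg w) f"
  and w: "w \<in> words" "w ~= []"
 shows "wgood w"
proof (rule all_words_good[OF _ w])
 fix w assume w: "w \<in> words" "length w >= 2"
  and small: "PROP smaller_good w"
 show "\<exists>y. dd y = Oword gam w"
 proof (cases "length w = 2")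
  case True
  then obtain a b where ab: "w = [a, b]" by (auto simp: length_Suc_conv numeral_2_eq_2)
  have "a \<in> labels" "b \<in> labels" using w ab by auto
  note l = label_lval[OF this(1)] label_lval[OF this(2)]
  have "\<exists>z. dd z = lval a \<cdot> lval b"
   by (rule trivial[of _ "fst (snd a)" _ "fst (snd b)"]) (use l subsetD[OF homog_subset l(1)] subsetD[OF homog_subset l(5)] in auto)
  then obtain z where z: "dd z = lval a \<cdot> lval b" by blast
  have "Oword gam w = bar (lval a) \<cdot> lval b" by (simp add: Oword_def ab)
  also have "bar (lval a) = - (%U. (-1) ^ fst (snd a) * lval a U)"
   unfolding bar_def using esg_homog_p[OF subsetD[OF homog_subset l(1)]] by simp
  finally have "Oword gam w = - (%U. (-1) ^ fst (snd a) * lval a U) \<cdot> lval b" .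
  moreover have "(%U. (-1) ^ fst (snd a) * lval a U) = (if even (fst (snd a)) then lval a else - lval a)"
   by (auto simp: fun_eq_iff)
  ultimately have "Oword gam w = dd (- z) | Oword gam w = dd z" by (auto simp: mul_minus_left d_minus z)
  thus ?thesis by metis
 next
  case False
  hence w3: "length w >= 3" using w by simp
  have sub: "wgood (subw w x y)" if "x < y" "y <= length w" "(x, y) ~= (0, length w)" for x y
   using that by (intro small smaller_subw lists_subw w) (auto simp: subw_def)
  note O = Oword_homog[OF w(1) sub]
  have mw: "mon (wdeg w)" using w(1)
  proof (induction w)
   case (Cons b w)
   thus ?case using label_lval(3)[of b] keys_add_subset by (auto simp: wdeg_def)
  qed (simp add: wdeg_def)
  define f where "f = low (wdeg w) (Oword gam w)"
  have p: "int (wp w) + int (length w) - 2 = int (wp w + length w - 2)" using w3 by simp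
  have f: "Oword gam w = lift (wdeg w) f" "sup (wdeg w) f" "hp (wp w + length w - 2) f"
   using homog_lift[OF O(1)] unfolding p f_def by simp_all
  have "cyc (wdeg w) f" using cyc_iff[OF mw f(2)] O(2) f(1) by simp
  hence "exact (wdeg w) f" using step[OF w(1) w3 small f(1) mw _ f(3)] by blast
  thus ?thesis using exact_iff[OF mw f(2)] f(1) by simp
 qed
qed

section \<open>Obstructions in high strands\<close>

lemma golod_if_linear:
 assumes "v < n" "sing v 1 \<in> A" "w \<in> words" "w ~= []"
 shows "wgood w"
proof (rule all_words_goodI[OF _ assms(3,4)])
 fix w f assume w: "w \<in> words" "length w >= 3" "mon (wdeg w)" "cyc (wdeg w) f" "hp (wp w + length w - 2) f"
 have "wp w + length w - 2 = Suc (Suc (wp w + length w - 4))" using wp_ge_length[OF w(1)] w(2) by linarith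
 thus "exact (wdeg w) f" using linear_exact[OF w(3) assms(1,2) w(4), of "wp w + length w - 4"] w(5) by simp
qed

text \<open>All contractions of the obstruction bound by \<open>contr_obstruction\<close>, and
  \<open>quadratic_kernel\<close> passes from them to the obstruction itself.\<close>

lemma quadratic_obstruction:
 assumes w: "w \<in> words" "length w >= 3"
  and small: "PROP smaller_good w"
  and f: "Oword gam w = lift (wdeg w) f" "mon (wdeg w)" "cyc (wdeg w) f" "hp (wp w + length w - 2) f"
  and nolin: "!!v. v < n ==> sing v 1 ~: A" and q: "q \<in> A" "mdegree q = 2" "mdvd q (wdeg w)"
 shows "exact (wdeg w) f"
proof (rule quadratic_kernel[OF f(2) q(3,1,2) nolin f(3)])
 have "wp w + length w - 2 = Suc (Suc (wp w + length w - 4))" using wp_ge_length[OF w(1)] w(2) by linarith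
 thus "hp (Suc (Suc (wp w + length w - 4))) f" using f(4) by simp
 fix v assume v: "v \<in> ks (wdeg w)"
 hence "v < n" using f(2) by auto
 have sf: "sup (wdeg w) f" using f(3) by (simp add: cyc_def)
 have "\<exists>y. dd y = contr v (Oword gam w)"
  by (rule contr_obstruction) (use w small \<open>v < n\<close> nolin in auto)
 hence "\<exists>y. dd y = lift (wdeg w - sing v 1) (contr v f)" by (simp add: f(1) contr_lift[OF v])
 thus "exact (wdeg w - sing v 1) (contr v f)"
  using exact_iff[OF _ sup_contr[OF v sf]] f(2) ks_diff_le[of "wdeg w"] by blast
qed

lemma golod_if_quadratic:
 assumes quad: "!!t. t \<in> A ==> \<exists>s\<in>A. mdvd s t & mdegree s = 2"
  and w: "w \<in> words" "w ~= []"
 shows "wgood w"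
proof (rule all_words_goodI[OF _ w])
 fix w f assume w: "w \<in> words" "length w >= 3"
  and small: "PROP smaller_good w"
  and f: "Oword gam w = lift (wdeg w) f" "mon (wdeg w)" "cyc (wdeg w) f" "hp (wp w + length w - 2) f"
 have nolin: "sing v 1 ~: A" for v
 proof
  assume "sing v 1 \<in> A"
  then obtain s where "mdvd s (sing v (1::nat))" "mdegree s = 2" using quad by blast
  thus False using mdvd_mdegree by fastforce
 qed
 show "exact (wdeg w) f"
 proof (cases "\<exists>q\<in>A. mdegree q = 2 & mdvd q (wdeg w)")
  case True
  thus ?thesis using quadratic_obstruction[OF w small f nolin] by blast
 next
  case False
  hence "t ~: A" if "mdvd t (wdeg w)" for t using quad mdvd_trans that by blast
  thus ?thesis using wp_ge_length[OF w(1)] w(2) by (intro no_divisor_exact[OF f(2-4)]) auto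
 qed
qed

text \<open>Origin of the constants: if all k letters have strand at least 2, the degree of w is at
  least wp w + 2k, while the obstruction has homological degree wp w + k - 2. The difference is at
  least k + 2, that is at least 5. As wp w >= k, the degree itself is at least 3k, that is at least
  9.\<close>

lemma golod_if_low_strands:
 assumes van: "!!m p f. mon m ==> cyc m f ==> hp p f ==> p >= 1 ==> mdegree m >= p + 5 ==> mdegree m >= 9 ==> exact m f"
  and w: "w \<in> words" "w ~= []"
 shows "wgood w"
proof (cases "\<exists>v<n. sing v 1 \<in> A")
 case True
 thus ?thesis using golod_if_linear w by blast
next
 case False
 hence nolin: "!!v. v < n ==> sing v 1 ~: A" by blast
 show ?thesis
 proof (rule all_words_goodI[OF _ w])
  fix w f assume w: "w \<in> words" "length w >= 3"
   and small: "PROP smaller_good w"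
   and f: "Oword gam w = lift (wdeg w) f" "mon (wdeg w)" "cyc (wdeg w) f" "hp (wp w + length w - 2) f"
  show "exact (wdeg w) f"
  proof (cases "\<exists>q\<in>A. mdegree q = 2 & mdvd q (wdeg w)")
   case True
   thus ?thesis using quadratic_obstruction[OF w small f nolin] by blast
  next
   case noquad: False
   \<comment> \<open>By \<open>no_divisor_exact\<close> a letter of strand at most 1 requires a
     divisor in A of degree at most 2. Degree 2 is excluded by \<open>noquad\<close> and degree 1 by
     \<open>nolin\<close>; degree 0 would put all variables into A.\<close>
   have lab: "mdegree (fst b) >= fst (snd b) + 2" if b: "b \<in> labels" "mdvd (fst b) (wdeg w)" for b
   proof (rule ccontr)
    assume neg: "~ mdegree (fst b) >= fst (snd b) + 2"
    obtain m p g where e: "b = (m, p, g)" by (metis surj_pair)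
    with b have m: "mon m" "p >= 1" "hp p g" "cyc m g" "~ exact m g" by (auto simp: labels_def)
    have "exact m g"
    proof (rule no_divisor_exact[OF m(1,4,3,2)])
     fix t assume t: "t \<in> A" "mdvd t m"
     show "mdegree t + p ~= mdegree m + 1"
     proof
      assume eq: "mdegree t + p = mdegree m + 1"
      hence "mdegree t <= 2" using neg e by simp
      moreover have "mdegree t ~= 2" using noquad t mdvd_trans b(2) e by auto
      ultimately consider "mdegree t = 0" | "mdegree t = 1" by linarith
      thus False
      proof cases
       case 1
       hence "0 \<in> A" using t by (simp add: mdegree_eq_0)
       moreover have "n > 0"
       proof (rule ccontr)
        assume "~ n > 0"
        hence "m = 0" using m(1) by simp
        hence "labels \<inter> {b. fst b = 0} ~= {}" using b e by auto
        thus False using label_deg by auto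
       qed
       ultimately show False using upset[of 0 "sing 0 1"] nolin by simp
      next
       case 2
       hence "t ~= 0" by auto
       then obtain v where v: "v \<in> ks t" by (metis keys_eq_empty ex_in_conv)
       have "mdvd (sing v 1) t" using v by (auto simp: mdvd_def cf_sing_one cf_pos)
       hence "t = sing v 1 + (t - sing v 1)" by (rule mdvd_imp_add)
       hence "t = sing v 1" using 2 mdegree_add[of "sing v 1" "t - sing v 1"] mdegree_eq_0[of "t - sing v 1"] by simp
       moreover have "v < n" using v mdvd_keys[OF t(2)] m(1) by auto
       ultimately show False using nolin t by blast
      qed
     qed
    qed
    with m show False by blast
   qed
   have "mdegree (wdeg u) >= wp u + 2 * length u" if "u \<in> words" "mdvd (wdeg u) (wdeg w)" for u
    using that
   proof (induction u rule: list.induct)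
    case (Cons b u)
    have d: "wdeg (b # u) = fst b + wdeg u" by (simp add: wdeg_def)
    have "mdvd (fst b) (wdeg (b # u))" "mdvd (wdeg u) (wdeg (b # u))" by (simp_all add: d)
    hence "mdvd (fst b) (wdeg w)" "mdvd (wdeg u) (wdeg w)" using mdvd_trans Cons.prems(2) by blast+
    hence "mdegree (fst b) >= fst (snd b) + 2" "mdegree (wdeg u) >= wp u + 2 * length u"
     using Cons lab by auto
    thus ?case by (simp add: d mdegree_add wp_def)
   qed (simp add: wdeg_def wp_def)
   from this[OF w(1)] have "mdegree (wdeg w) >= wp w + 2 * length w" by simp
   thus ?thesis using wp_ge_length[OF w(1)] w(2) by (intro van[OF f(2-4)]) auto
  qed
 qed
qed

end

section \<open>Minimal generators and multidegrees\<close>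

text \<open>Polarisation of d d = 0, applied to the coefficients x + y.\<close>

lemma ediff_anticommute: "ediff n x (ediff n y f) U = - ediff n y (ediff n x f) U" if "finite U"
proof -
 have a: "ediff n (%i. x i + y i) g V = ediff n x g V + ediff n y g V" for g V
  by (simp add: ediff_def algebra_simps sum.distrib)
 have b: "ediff n z (%V. g V + h V) V = ediff n z g V + ediff n z h V" for z g h V
  by (auto simp: ediff_def contr_def algebra_simps simp flip: sum.distrib intro!: sum.cong)
 have "ediff n (%i. x i + y i) (ediff n (%i. x i + y i) f) U = 0" by (rule ediff_ediff[OF that])
 moreover have "ediff n (%i. x i + y i) f = (%V. ediff n x f V + ediff n y f V)" using a by blast
 ultimately have "ediff n x (ediff n x f) U + ediff n x (ediff n y f) U + (ediff n y (ediff n x f) U + ediff n y (ediff n y f) U) = 0"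
  by (simp add: a b)
 thus ?thesis by (simp add: ediff_ediff[OF that] eq_neg_iff_add_eq_0)
qed

definition se :: "'k => nat set => nat set => 'k::comm_ring_1"
 where "se c X U = (if U = X then c else 0)"

lemma emul_se:
 assumes "finite X" "finite Y"
 shows "\<exists>e. emul (se c X) (se d Y) = (se e (X \<union> Y) :: nat set => 'k::comm_ring_1)"
proof -
 have se: "(se a Z :: nat set => 'k) = (%U. a * ee Z U)" for a Z by (auto simp: se_def ee_def)
 have "emul (se c X) (se d Y) = (%U. c * (d * emul (ee X) (ee Y) U))"
  unfolding se emul_scale_left emul_scale_right by (rule refl)
 also have "... = se (if X \<inter> Y = {} then c * (d * (-1) ^ inversions X Y) else 0) (X \<union> Y)"
  unfolding emul_ee_ee[OF assms] by (auto simp: se_def ee_def)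
 finally show ?thesis by blast
qed

lemma contr_se: "v \<in> X ==> \<exists>e. (e = 1 | e = -1) & contr v (se c X) = se (e * c) (X - {v})"
proof (intro exI conjI ext)
 assume v: "v \<in> X"
 show "(-1::'k::comm_ring_1) ^ below X v = 1 | (-1::'k) ^ below X v = -1" by (cases "even (below X v)") auto
 fix U
 have "insert v U = X \<longleftrightarrow> U = X - {v}" if "v ~: U" using v that by auto
 moreover have "below (X - {v}) v = below X v" by simp
 ultimately show "contr v (se c X) U = se ((-1) ^ below X v * c) (X - {v}) U" using v by (auto simp: contr_def se_def)
qed

lemma contr_se_out: "v ~: X ==> contr v (se c X) = (%_. 0)"
 by (auto simp: contr_def se_def)

context monomial_koszul
begin

section \<open>Generators and hitting sets\<close>

definition gens :: "monomial set" where "gens = {g\<in>A. \<forall>s\<in>A. mdvd s g --> s = g}"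

lemma ex_gen: "t \<in> A ==> \<exists>g\<in>gens. mdvd g t"
proof (induction "mdegree t" arbitrary: t rule: less_induct)
 case less
 show ?case
 proof (cases "t \<in> gens")
  case False
  then obtain s where s: "s \<in> A" "mdvd s t" "s ~= t" using less.prems by (auto simp: gens_def)
  have "mdegree t = mdegree s + mdegree (t - s)" using mdvd_imp_add[OF s(2)] mdegree_add[of s "t - s"] by simp
  moreover have "t - s ~= 0" using mdvd_imp_add[OF s(2)] s(3) by auto
  ultimately have "mdegree s < mdegree t" using mdegree_eq_0[of "t - s"] by simp
  then obtain g where "g \<in> gens" "mdvd g s" using less s by blast
  thus ?thesis using mdvd_trans s(2) by blast
 qed (use mdvd_refl in blast)
qed

lemma gens_A: "g \<in> gens ==> g \<in> A" by (simp add: gens_def)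

lemma gens_mdvd: "g \<in> gens ==> h \<in> gens ==> mdvd g h ==> g = h" by (simp add: gens_def)

definition divs :: "monomial => monomial set" where "divs m = {g\<in>gens. mdvd g m}"

definition full :: "monomial => monomial => nat set" where "full m g = {v\<in>ks m. cf g v = cf m v}"

text \<open>A generator g divides x^{m-U} exactly if it divides x^m and U avoids the variables in
  which g has the full exponent of m. So \<open>Lam m\<close> consists of the hitting sets of the
  sets \<open>full m g\<close>.\<close>

lemma Lam_iff: "U \<in> Lam m \<longleftrightarrow> U \<subseteq> ks m & (\<forall>g\<in>divs m. U \<inter> full m g ~= {})"
proof (cases "U \<subseteq> ks m")
 case True
 have fin: "finite U" by (rule finite_sub_keys[OF True])
 have "mdvd g (m - ind U) \<longleftrightarrow> mdvd g m & U \<inter> full m g = {}" for g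
 proof
  assume d: "mdvd g (m - ind U)"
  have "cf g i <= cf m i" "i \<in> U ==> cf g i < cf m i" for i
   using d[unfolded mdvd_def, rule_format, of i] fin True by (auto simp: lookup_minus cf_ind cf_pos split: if_splits)
  thus "mdvd g m & U \<inter> full m g = {}" by (fastforce simp: mdvd_def full_def)
 next
  assume d: "mdvd g m & U \<inter> full m g = {}"
  have "cf g i <= cf (m - ind U) i" for i
  proof -
   have "cf g i <= cf m i" using d by (simp add: mdvd_def)
   moreover have "i \<in> U ==> cf g i ~= cf m i" using d True by (auto simp: full_def)
   ultimately show ?thesis using fin by (auto simp: lookup_minus cf_ind)
  qed
  thus "mdvd g (m - ind U)" by (simp add: mdvd_def)
 qed
 moreover have "m - ind U \<in> A \<longleftrightarrow> (\<exists>g\<in>gens. mdvd g (m - ind U))" using ex_gen gens_A upset by blast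
 ultimately show ?thesis using True by (auto simp: Lam_def divs_def)
qed (simp add: Lam_def)

lemma LamI: "U \<subseteq> ks m ==> (!!g. g \<in> gens ==> mdvd g m ==> \<exists>v\<in>U. cf g v = cf m v) ==> U \<in> Lam m"
 unfolding Lam_iff divs_def full_def by blast

lemma not_LamI: "g \<in> gens ==> mdvd g m ==> (!!v. v \<in> U ==> cf g v < cf m v) ==> U ~: Lam m"
 unfolding Lam_iff divs_def full_def by fastforce

lemma finite_divs: "finite (divs m)"
proof -
 have "inj_on (%g. restrict (cf g) (ks m)) (divs m)"
 proof (rule inj_onI)
  fix g h assume gh: "g \<in> divs m" "h \<in> divs m" "restrict (cf g) (ks m) = restrict (cf h) (ks m)"
  have "ks g \<subseteq> ks m" "ks h \<subseteq> ks m" using gh mdvd_keys by (auto simp: divs_def)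
  moreover have "cf g i = cf h i" if "i \<in> ks m" for i using gh(3) that by (metis restrict_apply')
  ultimately show "g = h" by (intro poly_mapping_eqI) (metis not_in_keys_iff_lookup_eq_zero subsetD)
 qed
 moreover have "(%g. restrict (cf g) (ks m)) ` divs m \<subseteq> (\<Pi>\<^sub>E i\<in>ks m. {..cf m i})"
  by (auto simp: divs_def mdvd_def)
 moreover have "finite (\<Pi>\<^sub>E i\<in>ks m. {..cf m i})" by (intro finite_PiE) auto
 ultimately show ?thesis using finite_imageD finite_subset by blast
qed

lemma free_variable:
 assumes "mon m" "cyc m f" "v \<in> ks m" "!!g. g \<in> divs m ==> v ~: full m g"
 shows "exact m f"
proof (rule free_variable_exact[OF assms(1,3,2)])
 fix U assume U: "U \<in> Lam m" "v \<in> U"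
 show "U - {v} \<in> Lam m" unfolding Lam_iff
 proof (intro conjI ballI)
  show "U - {v} \<subseteq> ks m" using U by (auto simp: Lam_def)
  fix g assume "g \<in> divs m"
  thus "(U - {v}) \<inter> full m g ~= {}" using U(1) assms(4) unfolding Lam_iff by fastforce
 qed
qed

text \<open>A set hit by y is also hit by x, so y may be dropped from a hitting set containing x.
  This makes e_x replaceable by e_y modulo boundaries.\<close>

lemma substitute_variable:
 assumes m: "mon m" "x \<in> ks m" "y \<in> ks m" "x ~= y" and dom: "!!g. g \<in> divs m ==> y \<in> full m g ==> x \<in> full m g"
  and f: "cyc m f" "hp p f" "!!U. f U ~= 0 ==> U \<inter> X = {}" and y: "y ~: X"
 obtains f' where "cyc m f'" "hp p f'" "exact m (f - f')" "!!U. f' U ~= 0 ==> U \<inter> insert x X = {}"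
proof -
 define g where "g = contr x f"
 \<comment> \<open>The boundary of e_y e_x g is e_x g - e_y g, up to a term that vanishes because f
   is a cycle at U - {y}.\<close>
 define h where "h = wedge y (wedge x g)"
 define f' where "f' = f - tr m (ed h)"
 have supf: "sup m f" using f(1) by (simp add: cyc_def)
 have xg: "wedge x g U = (if x \<in> U then f U else 0)" for U by (simp add: g_def wedge_contr)
 have suph: "sup m h" unfolding sup_def
 proof (intro allI impI)
  fix U assume "h U ~= 0"
  hence U: "y \<in> U" "U - {y} \<in> Lam m" using supf by (auto simp: h_def wedge_def[of y] xg sup_def split: if_splits)
  hence "U \<subseteq> ks m" using m by (auto simp: Lam_def)
  thus "U \<in> Lam m" using Lam_up[OF U(2)] by blast
 qed
 have xy: "x < n" "y < n" using m by auto
 have key: "ed h U = wedge x g U - wedge y g U" if U: "U \<in> Lam m" for U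
 proof -
  have fin: "finite V" if "V \<subseteq> U" for V using Lam_finite[OF U] that finite_subset by blast
  have "ed h U = wedge x g U - wedge y (ed (wedge x g)) U"
   unfolding h_def using ediff_wedge[OF Lam_finite[OF U] xy(2), of "%_. 1"] by simp
  also have "wedge y (ed (wedge x g)) U = wedge y g U"
  proof (cases "y \<in> U")
   case True
   have "ed (wedge x g) (U - {y}) = g (U - {y}) - wedge x (ed g) (U - {y})"
    using ediff_wedge[OF fin xy(1), of "U - {y}" "%_. 1"] by auto
   moreover have "wedge x (ed g) (U - {y}) = 0"
   proof (cases "x \<in> U")
    case xU: True
    have "U - {y} \<in> Lam m" unfolding Lam_iff
    proof (intro conjI ballI)
     show "U - {y} \<subseteq> ks m" using U by (auto simp: Lam_def)
     fix k assume k: "k \<in> divs m"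
     hence "U \<inter> full m k ~= {}" using U unfolding Lam_iff by blast
     thus "(U - {y}) \<inter> full m k ~= {}" using dom[OF k] xU m(4) by blast
    qed
    hence "ed f (U - {y}) = 0" by (rule cycD[OF f(1)])
    moreover have "contr x (ed f) (U - {y} - {x}) = - ed g (U - {y} - {x})"
     unfolding g_def by (rule contr_ediff[OF fin]) auto
    ultimately have "ed g (U - {y} - {x}) = 0" using xU m(4) by (auto simp: contr_def insert_absorb)
    thus ?thesis by (simp add: wedge_def)
   qed (simp add: wedge_def)
   ultimately show ?thesis by (simp add: wedge_def)
  qed (simp add: wedge_def)
  finally show ?thesis .
 qed
 have f': "f' U = (if U \<in> Lam m then (if x \<in> U then 0 else f U) + wedge y g U else 0)" for U
  using key[of U] supf by (auto simp: f'_def tr_def xg sup_def)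
 have nz: "f' U ~= 0 ==> x ~: U & (f U ~= 0 | y \<in> U & f (insert x (U - {y})) ~= 0)" for U
 proof -
  assume a: "f' U ~= 0"
  have "x ~: U & f U ~= 0 | wedge y g U ~= 0" using a by (auto simp: f' split: if_splits)
  then consider "x ~: U" "f U ~= 0" | "wedge y g U ~= 0" by blast
  thus ?thesis
  proof cases
   case 2
   hence "y \<in> U" "g (U - {y}) ~= 0" by (auto simp: wedge_def split: if_splits)
   thus ?thesis using m(4) by (auto simp: g_def contr_def split: if_splits)
  qed auto
 qed
 have ex: "exact m (f - f')" using exact_tr_ed[OF suph] by (simp add: f'_def)
 show ?thesis
 proof (rule that)
  show "cyc m f'" using cyc_diff[OF f(1) exact_cyc[OF m(1) ex]] by simp
  show "exact m (f - f')" by (rule ex)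
  show "hp p f'" unfolding hp_def
  proof (intro allI impI)
   fix U assume a: "f' U ~= 0"
   hence fin: "finite U" using Lam_finite by (auto simp: f' split: if_splits)
   have "card (insert x (U - {y})) = card U" if "x ~: U" "y \<in> U"
    using card.remove[OF fin that(2)] card_insert_disjoint[of "U - {y}" x] fin that(1) by auto
   thus "card U = p" using nz[OF a] f(2) by (auto simp: hp_def)
  qed
  show "U \<inter> insert x X = {}" if "f' U ~= 0" for U
   using nz[OF that] f(3)[of U] f(3)[of "insert x (U - {y})"] y by auto
 qed
qed

lemma substitute_variables:
 assumes m: "mon m" and D: "finite D" "!!x. x \<in> D ==> x \<in> ks m & \<phi> x \<in> ks m - D & (\<forall>g\<in>divs m. \<phi> x \<in> full m g --> x \<in> full m g)"
  and f: "cyc m f" "hp p f"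
 shows "\<exists>f'. cyc m f' & hp p f' & exact m (f - f') & (\<forall>U. f' U ~= 0 --> U \<inter> D = {})"
proof -
 have "\<exists>f'. cyc m f' & hp p f' & exact m (f - f') & (\<forall>U. f' U ~= 0 --> U \<inter> D' = {})" if "D' \<subseteq> D" for D'
  using finite_subset[OF that D(1)] that
 proof (induction D' rule: finite_induct)
  case empty
  have "exact m (f - f)" by (metis diff_self exact_zero)
  thus ?case using f by blast
 next
  case (insert x D')
  then obtain f' where f': "cyc m f'" "hp p f'" "exact m (f - f')" "!!U. f' U ~= 0 ==> U \<inter> D' = {}"
   by (meson insert_subset)
  have x: "x \<in> ks m" "\<phi> x \<in> ks m" "\<phi> x ~: D" "\<forall>g\<in>divs m. \<phi> x \<in> full m g --> x \<in> full m g"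
   using D(2)[of x] insert.prems by auto
  obtain f'' where f'': "cyc m f''" "hp p f''" "exact m (f' - f'')" "!!U. f'' U ~= 0 ==> U \<inter> insert x D' = {}"
  proof (rule substitute_variable[OF m x(1,2) _ _ f'(1,2)])
   show "x ~= \<phi> x" using x insert.prems by auto
   show "\<phi> x ~: D'" using x insert.prems by auto
  qed (use x f'(4) in auto)
  have "exact m (f - f'')" using exact_add[OF f'(3) f''(3)] by simp
  thus ?case using f'' by blast
 qed
 thus ?thesis by blast
qed

section \<open>Degrees and representatives of letters\<close>

lemma exact_scale: "exact m f ==> exact m (%U. c * f U)"
proof -
 assume "exact m f"
 then obtain g where g: "sup m g" "f = tr m (ed g)" by (auto simp: exact_def)
 have "sup m (%U. c * g U)" using g(1) by (auto simp: sup_def)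
 moreover have "(%U. c * f U) = tr m (ed (%U. c * g U))"
  unfolding g(2) by (auto simp: tr_def ediff_def contr_def sum_distrib_left fun_eq_iff algebra_simps intro!: sum.cong)
 ultimately show ?thesis unfolding exact_def by blast
qed

text \<open>A variable in which no generator is full could be removed from every hitting set, and a
  generator that is full nowhere leaves no hitting sets. Either would make the class
  trivial.\<close>

lemma label_nonempty: "(m, p, f) \<in> labels ==> divs m ~= {} & (\<forall>v\<in>ks m. \<exists>g\<in>divs m. v \<in> full m g) & (\<forall>g\<in>divs m. full m g ~= {})"
proof -
 assume b: "(m, p, f) \<in> labels"
 hence m: "mon m" "cyc m f" "~ exact m f" by (auto simp: labels_def)
 have "\<forall>v\<in>ks m. \<exists>g\<in>divs m. v \<in> full m g" using free_variable[OF m(1,2)] m(3) by blast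
 moreover have "m ~= 0" using label_deg[OF b] by simp
 then obtain v where "v \<in> ks m" by (metis keys_eq_empty ex_in_conv)
 moreover have "full m g ~= {}" if "g \<in> divs m" for g
 proof
  assume "full m g = {}"
  hence "U ~: Lam m" for U using that unfolding Lam_iff by blast
  hence "f = 0" using m(2) by (auto simp: cyc_def sup_def fun_eq_iff)
  thus False using m(3) by simp
 qed
 ultimately show ?thesis by blast
qed

lemma mdvd_full_eq: "mdvd g m ==> ks m \<subseteq> full m g ==> g = m"
proof (rule poly_mapping_eqI)
 fix i assume a: "mdvd g m" "ks m \<subseteq> full m g"
 have "cf g i <= cf m i" using a(1) by (simp add: mdvd_def)
 moreover have "cf g i = cf m i" if "i \<in> ks m" using a(2) that by (auto simp: full_def)
 ultimately show "cf g i = cf m i" by (cases "i \<in> ks m") (auto simp: in_keys_iff)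
qed

text \<open>First Koszul homology is spanned by the generators. If v is not full for a divisor g,
  then {v} is not a hitting set; as f lives on singletons, this is all that \<open>cone\<close>
  requires.\<close>

lemma label_degree_one:
 assumes b: "(m, p, f) \<in> labels" "p = 1"
 shows "m \<in> gens"
proof -
 have m: "mon m" "cyc m f" "~ exact m f" "hp 1 f" using b by (auto simp: labels_def)
 have supf: "sup m f" using m(2) by (simp add: cyc_def)
 obtain g where g: "g \<in> divs m" using label_nonempty[OF b(1)] by blast
 have "v \<in> full m g" if v: "v \<in> ks m" for v
 proof (rule ccontr)
  assume vg: "v ~: full m g"
  hence nl: "{v} ~: Lam m" using g unfolding Lam_iff by blast
  have "exact m f"
  proof (rule cone[OF m(1) v supf])
   show "tr m (wedge v (ed f)) = 0"
   proof
    fix U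
    have "wedge v (ed f) U = 0" if U: "U \<in> Lam m"
    proof (cases "v \<in> U")
     case True
     have "U ~= {v}" using U nl by blast
     hence "U - {v} ~= {}" using True by blast
     have fin: "finite U" by (rule Lam_finite[OF U])
     have "f (insert i (U - {v})) = 0" if "i ~: U - {v}" for i
     proof (rule ccontr)
      assume "f (insert i (U - {v})) ~= 0"
      hence "card (insert i (U - {v})) = 1" using m(4) by (auto simp: hp_def)
      hence "card (U - {v}) = 0" using that fin by simp
      thus False using \<open>U - {v} ~= {}\<close> fin by simp
     qed
     hence "ed f (U - {v}) = 0" by (auto simp: ediff_def contr_def intro!: sum.neutral)
     thus ?thesis by (simp add: wedge_def)
    qed (simp add: wedge_def)
    thus "tr m (wedge v (ed f)) U = 0 U" by (simp add: tr_def)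
   qed
  qed
  with m(3) show False by blast
 qed
 hence "g = m" using g mdvd_full_eq by (auto simp: divs_def)
 thus ?thesis using g by (auto simp: divs_def)
qed

lemma label_single_divisor:
 assumes b: "(m, p, f) \<in> labels" "divs m = {g}"
 shows "p = 1"
proof (rule ccontr)
 assume p: "p ~= 1"
 have m: "mon m" "cyc m f" "~ exact m f" "hp p f" "p >= 1" using b by (auto simp: labels_def)
 have "ks m \<subseteq> full m g" using label_nonempty[OF b(1)] b(2) by auto
 hence gm: "g = m" using b(2) mdvd_full_eq by (auto simp: divs_def)
 have "exact m f"
 proof (rule no_divisor_exact[OF m(1,2,4,5)])
  fix t assume "t \<in> A" "mdvd t m"
  moreover have "m \<in> gens" using b(2) gm by (auto simp: divs_def)
  ultimately have "t = m" by (auto simp: gens_def)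
  thus "mdegree t + p ~= mdegree m + 1" using p by simp
 qed
 with m show False by blast
qed

lemma divs_gen: "u \<in> gens ==> divs u = {u}" by (auto simp: divs_def gens_def)

text \<open>All variables outside X are substituted by variables of X. What remains is supported on
  hitting sets inside X, hence on X alone by minimality.\<close>

lemma cyc_representative:
 assumes f: "cyc m f" "hp p f" "mon m" and X: "X \<subseteq> ks m"
  and \<phi>: "!!v. v \<in> ks m - X ==> \<phi> v \<in> X & (\<forall>g\<in>divs m. \<phi> v \<in> full m g --> v \<in> full m g)"
  and min: "!!Y. Y \<subset> X ==> Y ~: Lam m"
 shows "\<exists>c. sup m (se c X) & hp p (se c X) & exact m (f - se c X)"
proof -
 obtain f' where f': "cyc m f'" "hp p f'" "exact m (f - f')" "!!U. f' U ~= 0 ==> U \<inter> (ks m - X) = {}"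
  using substitute_variables[of m "ks m - X" \<phi> f p] f X \<phi> by auto
 have s: "sup m f'" using f'(1) by (simp add: cyc_def)
 have "f' U = se (f' X) X U" for U
 proof (cases "f' U = 0")
  case False
  hence "U \<in> Lam m" "U \<subseteq> X" using s f'(4)[of U] by (auto simp: sup_def Lam_def)
  hence "U = X" using min by blast
  thus ?thesis by (simp add: se_def)
 qed (auto simp: se_def)
 hence "f' = se (f' X) X" by blast
 thus ?thesis using s f'(2,3) by metis
qed

end

context trivial_koszul
begin

text \<open>The boundary of e_X is supported on the sets X - {x}, and all of these are
  truncated.\<close>

lemma cyc_ee:
 assumes "X \<in> Lam m" "!!x. x \<in> X ==> X - {x} ~: Lam m"
 shows "cyc m (ee X)"
proof -
 have "tr m (ed (ee X)) U = 0 U" for U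
 proof (cases "U \<in> Lam m")
  case True
  have "contr i (ee X :: 'k ext) U = 0" for i
   using True assms(2)[of i] by (cases "i \<in> U") (auto simp: contr_def ee_def)
  thus ?thesis by (simp add: tr_def ediff_def)
 qed (simp add: tr_def)
 thus ?thesis using assms(1) by (auto simp: cyc_def sup_def ee_def split: if_splits)
qed

lemma hp_ee: "card X = p ==> hp p (ee X)" by (auto simp: hp_def ee_def split: if_splits)

lemma product_ee_exact:
 assumes "mon l" "cyc l (ee X)" "card X >= 1" "u \<in> gens" "mon u" "c \<in> ks u" "c ~: X" and L: "insert c X \<in> Lam (l + u)"
 shows "exact (l + u) (ee (insert c X))"
proof -
 have Lc: "{c} \<in> Lam u" using assms(6) divs_gen[OF assms(4)] by (auto simp: Lam_iff full_def)
 have "{} ~: Lam u" using divs_gen[OF assms(4)] by (auto simp: Lam_iff)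
 hence "cyc u (ee {c})" by (intro cyc_ee[OF Lc]) auto
 hence "exact (l + u) (tr (l + u) (emul (ee X) (ee {c})))"
  using assms by (intro product_exact[of _ _ _ _ "card X" 1]) (auto simp: hp_ee)
 moreover have "X \<union> {c} = insert c X" "X \<inter> {c} = {}" "finite X" using assms(7) Lam_finite[OF L] by auto
 hence "tr (l + u) (emul (ee X) (ee {c})) = (%U. (-1) ^ inversions X {c} * ee (insert c X) U)"
  using L by (auto simp: emul_ee_ee tr_def ee_def fun_eq_iff simp del: Un_insert_right)
 ultimately show ?thesis
  using exact_scale[of "l + u" "%U. (-1) ^ inversions X {c} * ee (insert c X) U" "(-1) ^ inversions X {c}"]
  by (simp add: mult.assoc[symmetric] flip: power_add)
qed

lemma pair_exact:
 assumes u: "u \<in> gens" "u' \<in> gens" "mon u" "mon u'" and a: "a \<in> ks u" "c \<in> ks u'" "{c, a} \<in> Lam (u + u')" "a ~= c"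
 shows "exact (u + u') (ee {c, a})"
proof (rule product_ee_exact[OF u(3) _ _ u(2,4)])
 show "cyc u (ee {a})" using a(1) divs_gen[OF u(1)] by (intro cyc_ee) (auto simp: Lam_iff full_def)
qed (use a in auto)

lemma triple_exact:
 assumes u: "u \<in> gens" "mon u" "c \<in> ks u" and l: "mon l" "a \<in> ks l" "b \<in> ks l" "{a} ~: Lam l" "{b} ~: Lam l"
  and d: "a ~= b" "c ~= a" "c ~= b" "c ~: ks l" and L: "{c, a, b} \<in> Lam (l + u)"
 shows "exact (l + u) (ee {c, a, b})"
proof (rule product_ee_exact[OF l(1) _ _ u])
 have "mdvd (l - ind {a, b}) (l + u - ind {c, a, b})"
  using d u(3) l by (auto simp: mdvd_def lookup_minus lookup_add cf_ind cf_pos)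
 hence "{a, b} \<in> Lam l" using L l upset by (auto simp: Lam_def)
 moreover have "{a, b} - {a} = {b}" "{a, b} - {b} = {a}" using d(1) by auto
 ultimately show "cyc l (ee {a, b})" using l(4,5) by (intro cyc_ee) (metis, metis insertE singletonD)
qed (use d L in auto)

text \<open>The sum of the contractions by the variables of colour k. It is set to 0 on infinite
  sets so that anticommutation holds as an identity of functions, which allows these operators to be
  permuted inside a composite.\<close>

definition dcol :: "(nat => nat) => nat => 'k ext => 'k ext"
 where "dcol col k f = (%U. if finite U then ediff n (%i. if col i = k then 1 else 0) f U else 0)"

lemma dcol_add: "dcol col k (f + g) = dcol col k f + dcol col k g"
 by (auto simp: dcol_def ediff_def contr_def fun_eq_iff algebra_simps sum.distrib[symmetric] intro!: sum.cong)

lemma dcol_minus: "dcol col k (- f) = - dcol col k f"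
 by (auto simp: dcol_def ediff_def contr_def fun_eq_iff sum_negf[symmetric] intro!: sum.cong)

lemma dcol_zero [simp]: "dcol col k 0 = 0" by (auto simp: dcol_def ediff_def contr_def fun_eq_iff intro!: sum.neutral)

lemma ediff_finite: "finite U ==> (!!V. finite V ==> f V = g V) ==> ediff n x f U = ediff n x g U"
 unfolding ediff_def contr_def by (rule sum.cong) simp_all

lemma dcol_swap: "dcol col k (dcol col l f) = - dcol col l (dcol col k f)"
proof -
 let ?i = "%k i. if col i = k then 1 else 0"
 have "dcol col k (dcol col l f) U = (if finite U then ediff n (?i k) (ediff n (?i l) f) U else 0)" for k l U
  by (auto simp: dcol_def intro: ediff_finite)
 thus ?thesis by (auto simp: fun_eq_iff intro: ediff_anticommute)
qed

lemma dcol_same [simp]: "dcol col k (dcol col k f) = 0"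
proof
 fix U
 let ?i = "%i. if col i = k then 1 else 0"
 have "finite U ==> ediff n ?i (dcol col k f) U = ediff n ?i (ediff n ?i f) U" by (rule ediff_finite) (simp_all add: dcol_def)
 thus "dcol col k (dcol col k f) U = 0 U" by (simp add: dcol_def ediff_ediff)
qed

lemma sum_dcol:
 assumes "finite J" "!!i. i < n ==> col i \<in> J"
 shows "(\<Sum>k\<in>J. dcol col k f) U = (if finite U then ed f U else 0)"
proof -
 have "(\<Sum>k\<in>J. ediff n (%i. if col i = k then 1 else 0) f U) = (\<Sum>i<n. \<Sum>k\<in>J. (if col i = k then 1 else 0) * contr i f U)"
  unfolding ediff_def by (rule sum.swap)
 also have "... = (\<Sum>i<n. 1 * contr i f U)"
  using assms by (intro sum.cong refl) (simp add: if_distrib[where f = "%z. z * _"] cong: if_cong)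
 finally have "(\<Sum>k\<in>J. ediff n (%i. if col i = k then 1 else 0) f U) = ed f U" by (simp add: ediff_def)
 moreover have "(\<Sum>k\<in>J. dcol col k f) U = (\<Sum>k\<in>J. dcol col k f U)" by (induction J rule: infinite_finite_induct) simp_all
 ultimately show ?thesis by (simp add: dcol_def)
qed

lemma dcols_nonzero: "foldr (dcol col) js f U ~= 0 ==> \<exists>xs. map col xs = js & f (set xs \<union> U) ~= 0"
proof (induction js arbitrary: U)
 case (Cons k js)
 hence "(\<Sum>i<n. (if col i = k then 1 else 0) * contr i (foldr (dcol col) js f) U) ~= 0"
  by (simp add: dcol_def[of _ k] ediff_def split: if_splits)
 hence "\<exists>i\<in>{..<n}. (if col i = k then 1 else 0) * contr i (foldr (dcol col) js f) U ~= 0" by (meson sum.neutral)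
 then obtain i where i: "col i = k" "foldr (dcol col) js f (insert i U) ~= 0" by (auto simp: contr_def split: if_splits)
 then obtain xs where "map col xs = js" "f (set xs \<union> insert i U) ~= 0" using Cons.IH by blast
 thus ?case using i by (intro exI[of _ "i # xs"]) simp
qed simp

lemma dcol_insert:
 assumes v: "v ~: Y" "v < n" "finite Y" "!!w. w \<in> Y ==> col w ~= col v"
 shows "\<exists>e. (e = 1 | e = -1) & dcol col (col v) (se c (insert v Y)) = se (e * c) Y"
proof -
 let ?X = "insert v Y"
 have Y: "?X - {v} = Y" using v(1) by auto
 then obtain e where e: "e = 1 | e = -1" "contr v (se c ?X) = se (e * c) Y" using contr_se[of v ?X c] by auto
 have "dcol col (col v) (se c ?X) U = se (e * c) Y U" for U
 proof -
  have "(if col i = col v then 1 else 0) * contr i (se c ?X) U = (if i = v then contr v (se c ?X) U else 0)" for i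
   using v(4)[of i] contr_se_out[of i ?X c] by (cases "i \<in> ?X") auto
  thus ?thesis using v(2,3) e(2) by (auto simp: dcol_def ediff_def se_def)
 qed
 thus ?thesis using e(1) by blast
qed

lemma dcols_value:
 "distinct (map col xs) ==> set xs \<subseteq> {..<n} ==> finite Y ==> col ` set xs \<inter> col ` Y = {} ==>
  \<exists>e. (e = 1 | e = -1) & foldr (dcol col) (map col xs) (se c (set xs \<union> Y)) = se (e * c) Y"
proof (induction xs arbitrary: Y)
 case Nil
 thus ?case by (intro exI[of _ 1]) simp
next
 case (Cons x xs)
 then obtain e where e: "e = 1 | e = -1" "foldr (dcol col) (map col xs) (se c (set xs \<union> insert x Y)) = se (e * c) (insert x Y)"
  using Cons.IH[of "insert x Y"] by auto
 obtain e' where e': "e' = 1 | e' = -1" "dcol col (col x) (se (e * c) (insert x Y)) = se (e' * (e * c)) Y"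
  by (atomize_elim, rule dcol_insert) (insert Cons.prems, auto simp: image_iff)
 show ?case using e e' by (intro exI[of _ "e' * e"]) (auto simp: mult.assoc)
qed

lemma ee_se: "ee X = se 1 X" by (auto simp: ee_def se_def)

lemma dcols_ee:
 assumes "distinct (map col xs)" "set xs \<subseteq> {..<n}"
 shows "foldr (dcol col) (map col xs) (ee (set xs)) {} ~= 0"
 using dcols_value[OF assms finite.emptyI, of 1] by (auto simp: ee_se se_def)

text \<open>The untruncated boundary of a primitive: it differs from f only outside
  \<open>Lam m\<close>. Functionals on the full simplex can be applied to it.\<close>

lemma exact_remainder:
 assumes ex: "exact m f" and col: "finite J" "!!i. i < n ==> col i \<in> J"
 obtains g h where "(\<Sum>k\<in>J. dcol col k g) = f + h" "!!U. h U ~= 0 ==> U \<subseteq> ks m & U ~: Lam m"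
proof -
 obtain g where g: "sup m g" "f = tr m (ed g)" using ex by (auto simp: exact_def)
 let ?E = "\<Sum>k\<in>J. dcol col k g"
 have E: "?E U = (if finite U then ed g U else 0)" for U by (rule sum_dcol[OF col])
 have "U \<subseteq> ks m" if "ed g U ~= 0" for U
 proof -
  have "\<exists>i\<in>{..<n}. 1 * contr i g U ~= 0" using that unfolding ediff_def by (meson sum.neutral)
  then obtain i where "g (insert i U) ~= 0" by (auto simp: contr_def split: if_splits)
  thus ?thesis using g(1) by (auto simp: sup_def Lam_def)
 qed
 hence "!!U. (?E - f) U ~= 0 ==> U \<subseteq> ks m & U ~: Lam m"
  using Lam_finite by (auto simp: g(2) tr_def E split: if_splits)
 thus ?thesis using that[of g "?E - f"] by simp
qed

text \<open>A class $e_U$ is nonzero if \<open>U\<close> is a transversal of a colouring all of whose transversals lie in \<open>Lam m\<close>: the product of the contractions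
 by the sums of the variables of the same colour is a linear functional that vanishes on boundaries.\<close>

lemma colouring_not_exact:
 fixes col :: "nat => nat"
 assumes ex: "exact m (ee (set xs))" and xs: "map col xs = js" "set xs \<subseteq> {..<n}"
  and js: "distinct js" "!!i. i < n ==> col i \<in> set js"
  and rb: "!!ys. set ys \<subseteq> ks m ==> map col ys = js ==> set ys \<in> Lam m"
 shows False
proof -
 let ?D = "foldr (dcol col) js"
 obtain g h where gh: "(\<Sum>k\<in>set js. dcol col k g) = ee (set xs) + h" "!!U. h U ~= 0 ==> U \<subseteq> ks m & U ~: Lam m"
  using exact_remainder[of m "ee (set xs)" "set js" col] ex js(2) by blast
 have add: "foldr (dcol col) js (f + f') = foldr (dcol col) js f + foldr (dcol col) js f'" for js f f'
  by (induction js) (simp_all only: foldr.simps o_apply id_apply dcol_add)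
 have zero: "foldr (dcol col) js 0 = 0" for js by (induction js) (simp_all only: foldr.simps o_apply id_apply dcol_zero)
 have sum: "foldr (dcol col) js (sum F J) = (\<Sum>k\<in>J. foldr (dcol col) js (F k))" for js F and J :: "nat set"
  by (induction J rule: infinite_finite_induct) (simp_all only: sum.infinite sum.empty sum.insert add zero not_False_eq_True)
 have comm: "\<exists>G. foldr (dcol col) js (dcol col k f) = dcol col k G" for js k f
 proof (induction js)
  case (Cons j js)
  thus ?case using dcol_swap[of col j k] by (metis comp_apply dcol_minus foldr.simps(2))
 qed (metis foldr.simps(1) id_apply)
 \<comment> \<open>The operator of colour k can be moved next to its second occurrence up to sign,
   and its square is 0.\<close>
 have van: "k \<in> set js ==> foldr (dcol col) js (dcol col k f) = 0" for js k f
 proof (induction js)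
  case (Cons j js)
  thus ?case using comm[of js k f] by (metis comp_apply dcol_same dcol_zero foldr.simps(2) set_ConsD)
 qed simp
 \<comment> \<open>Only values of h at transversals of the colouring enter; they lie in
   \<open>Lam m\<close> or outside \<open>ks m\<close>, where h vanishes.\<close>
 have "?D h {} = 0" using dcols_nonzero[of col js h "{}"] gh(2) rb by fastforce
 moreover have "?D (\<Sum>k\<in>set js. dcol col k g) = 0" unfolding sum by (intro sum.neutral ballI van)
 hence "?D (ee (set xs)) {} + ?D h {} = 0" unfolding gh(1) add by (metis plus_fun_apply zero_fun_apply)
 ultimately show False using dcols_ee[of col xs] xs js(1) by simp
qed

text \<open>If only u and u' divided their product, every set {x, y} with x in u and y in u' would
  be a hitting set. Colouring by the two supports then shows that e_a e_c is not exact, although it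
  is a product of two cycles of degree 1.\<close>

lemma third_generator:
 assumes u: "u \<in> gens" "u' \<in> gens" "mon u" "mon u'" "ks u \<inter> ks u' = {}" "u ~= 0" "u' ~= 0"
 obtains w where "w \<in> gens" "w ~= u" "w ~= u'" "mdvd w (u + u')"
proof (rule ccontr)
 assume nt: "~ thesis"
 have only: "g = u | g = u'" if "g \<in> gens" "mdvd g (u + u')" for g
  using nt that \<open>!!w. w \<in> gens ==> w ~= u ==> w ~= u' ==> mdvd w (u + u') ==> thesis\<close> by blast
 obtain a c where ac: "a \<in> ks u" "c \<in> ks u'" using u(6,7) by (metis keys_eq_empty ex_in_conv)
 define col where "col v = (if v \<in> ks u then 0 else 1 :: nat)" for v
 have kk: "ks (u + u') = ks u \<union> ks u'" by (auto simp: in_keys_iff lookup_add)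
 have rb: "{x, y} \<in> Lam (u + u')" if "x \<in> ks u" "y \<in> ks u'" for x y
 proof (rule LamI)
  show "{x, y} \<subseteq> ks (u + u')" using that kk by auto
  fix g assume "g \<in> gens" "mdvd g (u + u')"
  then consider "g = u" | "g = u'" using only by blast
  thus "\<exists>v\<in>{x, y}. cf g v = cf (u + u') v"
  proof cases
   case 1
   thus ?thesis using that u(5) by (auto simp: lookup_add in_keys_iff)
  next
   case 2
   thus ?thesis using that u(5) by (auto simp: lookup_add in_keys_iff)
  qed
 qed
 have "exact (u + u') (ee {a, c})"
  using pair_exact[OF u(1-4) ac] u(5) ac rb[OF ac] by (metis disjoint_iff insert_commute)
 moreover have "set [a, c] \<subseteq> {..<n}" "map col [a, c] = [0, 1]" using ac u by (auto simp: col_def)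
 moreover have "set ys \<in> Lam (u + u')" if "set ys \<subseteq> ks (u + u')" "map col ys = [0, 1]" for ys
  using that rb kk by (auto simp: map_eq_Cons_conv col_def split: if_splits)
 moreover have "col i \<in> set [0, 1]" for i by (simp add: col_def)
 ultimately show False using colouring_not_exact[of "u + u'" "[a, c]" col "[0, 1]"] by simp
qed

lemma gen_nonfull: "u \<in> gens ==> w \<in> gens ==> w ~= u ==> \<exists>x\<in>ks u. cf w x < cf u x"
proof (rule ccontr)
 assume a: "u \<in> gens" "w \<in> gens" "w ~= u" "~ (\<exists>x\<in>ks u. cf w x < cf u x)"
 have "cf u x <= cf w x" for x using a(4) by (cases "x \<in> ks u") (auto simp: in_keys_iff not_less)
 hence "mdvd u w" by (simp add: mdvd_def)
 thus False using gens_mdvd a by blast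
qed

definition coprime_word :: "'k label list => bool"
 where "coprime_word w = (\<forall>i j. i < j --> j < length w --> ks (fst (w ! i)) \<inter> ks (fst (w ! j)) = {})"

lemma all_words_good_coprimeI:
 assumes step: "!!w f. w \<in> words ==> length w >= 3 ==> coprime_word w ==>
   PROP smaller_good w ==>
   Oword gam w = lift (wdeg w) f ==> mon (wdeg w) ==> cyc (wdeg w) f ==> hp (wp w + length w - 2) f ==> exact (wdeg w) f"
  and w: "w \<in> words" "w ~= []"
 shows "wgood w"
proof (rule all_words_goodI[OF _ w])
 fix w f assume w: "w \<in> words" "length w >= 3"
  and small: "PROP smaller_good w"
  and f: "Oword gam w = lift (wdeg w) f" "mon (wdeg w)" "cyc (wdeg w) f" "hp (wp w + length w - 2) f"
 show "exact (wdeg w) f"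
 proof (cases "coprime_word w")
  case False
  then obtain i j v where "i < j" "j < length w" "v \<in> ks (fst (w ! i))" "v \<in> ks (fst (w ! j))"
   by (auto simp: coprime_word_def)
  hence "\<exists>y. dd y = Oword gam w" using noncoprime_obstruction[OF w(1) small] by blast
  thus ?thesis using exact_iff[OF f(2)] f(1,3) by (simp add: cyc_def)
 qed (rule step[OF w _ small f])
qed

lemma cf_wdeg: "cf (wdeg w) v = (\<Sum>i<length w. cf (fst (w ! i)) v)"
proof -
 have "cf (sum_list ms) v = (\<Sum>i<length ms. cf (ms ! i) v)" for ms :: "monomial list"
  by (simp add: sum_list_sum_nth lookup_sum atLeast0LessThan)
 from this[of "map fst w"] show ?thesis by (simp add: wdeg_def)
qed

lemma wp_sum: "wp w = (\<Sum>i<length w. fst (snd (w ! i)))" by (simp add: wp_def sum_list_sum_nth atLeast0LessThan)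

lemma cf_wdeg_coprime:
 assumes "coprime_word w" "i < length w" "v \<in> ks (fst (w ! i))"
 shows "cf (wdeg w) v = cf (fst (w ! i)) v"
proof -
 have "cf (fst (w ! j)) v = (if j = i then cf (fst (w ! i)) v else 0)" if "j < length w" for j
 proof (cases j i rule: linorder_cases)
  case less
  hence "ks (fst (w ! j)) \<inter> ks (fst (w ! i)) = {}" using assms by (simp add: coprime_word_def)
  thus ?thesis using assms(3) less by (auto simp: in_keys_iff disjoint_iff)
 next
  case greater
  hence "ks (fst (w ! i)) \<inter> ks (fst (w ! j)) = {}" using assms that by (simp add: coprime_word_def)
  thus ?thesis using assms(3) greater by (auto simp: in_keys_iff disjoint_iff)
 qed simp
 hence "cf (wdeg w) v = (\<Sum>j<length w. if j = i then cf (fst (w ! i)) v else 0)"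
  unfolding cf_wdeg by (intro sum.cong) auto
 thus ?thesis using assms(2) by simp
qed

lemma ks_wdeg: "ks (wdeg w) = (\<Union>i<length w. ks (fst (w ! i)))" by (auto simp: in_keys_iff cf_wdeg)

lemma mdvd_wdeg: "i < length w ==> mdvd (fst (w ! i)) (wdeg w)"
 unfolding mdvd_def cf_wdeg by (auto intro: member_le_sum)

text \<open>A nonzero obstruction needs a set with wp w + length w - 2 elements, which for four
  variables leaves three letters of homological degree 1, that is three coprime generators. Two of
  them are powers of single variables x and y. The third generator for this pair involves only x and
  y and is full in neither, so there are no hitting sets.\<close>

lemma golod_if_four_variables:
 assumes n: "n <= 4" and w: "w \<in> words" "w ~= []"
 shows "wgood w"
proof (rule all_words_good_coprimeI[OF _ w])
 fix w f assume w: "w \<in> words" "length w >= 3" "coprime_word w"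
  and f: "Oword gam w = lift (wdeg w) f" "mon (wdeg w)" "cyc (wdeg w) f" "hp (wp w + length w - 2) f"
 show "exact (wdeg w) f"
 proof (cases "f = 0")
  case False
  then obtain U where U: "f U ~= 0" by (rule fun_nonzeroE)
  hence UL: "U \<in> Lam (wdeg w)" "card U = wp w + length w - 2" using f(3,4) by (auto simp: cyc_def sup_def hp_def)
  hence Uk: "U \<subseteq> ks (wdeg w)" by (simp add: Lam_def)
  hence cU: "card U <= card (ks (wdeg w))" "card (ks (wdeg w)) <= 4"
   using card_mono[of "ks (wdeg w)" U] card_mono[of "{..<n}" "ks (wdeg w)"] f(2) n by auto
  have "wp w >= length w" by (rule wp_ge_length[OF w(1)])
  hence len: "length w = 3" "wp w = 3" using UL(2) cU w(2) by linarith+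
  have lab: "w ! i \<in> labels" if "i < 3" for i using w(1) that len by (auto simp: in_lists_conv_set)
  have p1: "fst (snd (w ! i)) = 1" if "i < 3" for i
  proof -
   have ge: "fst (snd (w ! j)) >= 1" if "j < 3" for j using label_lval(4)[OF lab[OF that]] .
   have s: "fst (snd (w ! 0)) + fst (snd (w ! 1)) + fst (snd (w ! 2)) = 3"
    using wp_sum[of w] len by (simp add: numeral_3_eq_3 numeral_2_eq_2)
   consider "i = 0" | "i = 1" | "i = 2" using \<open>i < 3\<close> by linarith
   thus ?thesis using s ge[of 0] ge[of 1] ge[of 2] by cases simp_all
  qed
  have gen: "fst (w ! i) \<in> gens" "mon (fst (w ! i))" "fst (w ! i) ~= 0" if "i < 3" for i
  proof -
   obtain m p g where e: "w ! i = (m, p, g)" by (metis surj_pair)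
   thus "fst (w ! i) \<in> gens" using label_degree_one[of m p g] lab[OF that] p1[OF that] by simp
   show "mon (fst (w ! i))" "fst (w ! i) ~= 0" using label_lval(3)[OF lab[OF that]] label_deg[OF lab[OF that]] by auto
  qed
  have dis: "ks (fst (w ! i)) \<inter> ks (fst (w ! j)) = {}" if "i < 3" "j < 3" "i ~= j" for i j
   using w(3) that len by (cases i j rule: linorder_cases) (auto simp: coprime_word_def)
  define K where "K i = card (ks (fst (w ! i)))" for i
  have K1: "K i >= 1" if "i < 3" for i using gen(3)[OF that] by (simp add: K_def Suc_le_eq card_gt_0_iff)
  have Ksum: "K 0 + K 1 + K 2 <= 4"
  proof -
   have "ks (wdeg w) = ks (fst (w ! 0)) \<union> ks (fst (w ! 1)) \<union> ks (fst (w ! 2))"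
    unfolding ks_wdeg len by (auto simp: less_Suc_eq numeral_3_eq_3 numeral_2_eq_2)
   moreover have "card ... = K 0 + K 1 + K 2" unfolding K_def using dis[of 0 1] dis[of 0 2] dis[of 1 2]
    by (subst card_Un_disjoint; (subst card_Un_disjoint)?) (auto simp: Int_Un_distrib2)
   ultimately show ?thesis using cU by simp
  qed
  have "\<exists>i j. i < 3 & j < 3 & i ~= j & K i = 1 & K j = 1"
  proof -
   have "(K 0 = 1 & K 1 = 1) | (K 0 = 1 & K 2 = 1) | (K 1 = 1 & K 2 = 1)"
    using Ksum K1[of 0] K1[of 1] K1[of 2] by auto
   thus ?thesis
    by (elim disjE) (rule exI[of _ 0], rule exI[of _ 1], simp, rule exI[of _ 0], rule exI[of _ 2], simp,
      rule exI[of _ 1], rule exI[of _ 2], simp)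
  qed
  then obtain i j where ij: "i < 3" "j < 3" "i ~= j" "K i = 1" "K j = 1" by blast
  obtain x y where xy: "ks (fst (w ! i)) = {x}" "ks (fst (w ! j)) = {y}" using ij by (metis K_def card_1_singletonE)
  obtain g where g: "g \<in> gens" "g ~= fst (w ! i)" "g ~= fst (w ! j)" "mdvd g (fst (w ! i) + fst (w ! j))"
   using third_generator[OF gen(1)[OF ij(1)] gen(1)[OF ij(2)] gen(2)[OF ij(1)] gen(2)[OF ij(2)] dis[OF ij(1-3)] gen(3)[OF ij(1)] gen(3)[OF ij(2)]]
   by blast
  have gx: "cf g x < cf (fst (w ! i)) x" using gen_nonfull[OF gen(1)[OF ij(1)] g(1,2)] xy by auto
  have gy: "cf g y < cf (fst (w ! j)) y" using gen_nonfull[OF gen(1)[OF ij(2)] g(1,3)] xy by auto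
  have "U ~: Lam (wdeg w)"
  proof (rule not_LamI[OF g(1)])
   have "cf g v <= cf (fst (w ! i)) v + cf (fst (w ! j)) v" for v using g(4) by (simp add: mdvd_def lookup_add)
   moreover have "cf (fst (w ! i)) v + cf (fst (w ! j)) v <= cf (wdeg w) v" for v
    unfolding cf_wdeg len using ij sum_mono2[of "{..<3}" "{i, j}" "%k. cf (fst (w ! k)) v"] by simp
   ultimately show "mdvd g (wdeg w)" unfolding mdvd_def using order_trans by blast
   fix v assume "v \<in> U"
   hence vk: "v \<in> ks (wdeg w)" using Uk by blast
   show "cf g v < cf (wdeg w) v"
   proof (cases "v = x | v = y")
    case True
    thus ?thesis using gx gy cf_wdeg_coprime[OF w(3), of i x] cf_wdeg_coprime[OF w(3), of j y] xy ij len by auto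
   next
    case False
    have "ks g \<subseteq> ks (fst (w ! i) + fst (w ! j))" by (rule mdvd_keys[OF g(4)])
    also have "... \<subseteq> {x, y}" using xy Poly_Mapping.keys_add[of "fst (w ! i)" "fst (w ! j)"] by auto
    finally have "cf g v = 0" using False by (auto simp: in_keys_iff)
    thus ?thesis using vk by (simp add: in_keys_iff)
   qed
  qed
  with UL show ?thesis by blast
 qed simp
qed

text \<open>One variable chosen from each set \<open>full m g\<close> gives a minimal hitting set X,
  and within each of these sets the variables are interchangeable. So the homology is spanned by
  e_X, and X has as many elements as there are divisors.\<close>

lemma disjoint_full_exact:
 assumes m: "mon m" "cyc m f" "hp p f" and dis: "!!v g g'. g \<in> divs m ==> g' \<in> divs m ==> v \<in> full m g ==> v \<in> full m g' ==> g = g'"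
  and p: "p ~= card (divs m)"
 shows "exact m f"
proof (cases "(\<forall>v\<in>ks m. \<exists>g\<in>divs m. v \<in> full m g) & (\<forall>g\<in>divs m. full m g ~= {})")
 case False
 then consider v where "v \<in> ks m" "!!g. g \<in> divs m ==> v ~: full m g" | g where "g \<in> divs m" "full m g = {}" by blast
 thus ?thesis
 proof cases
  case 1
  thus ?thesis using free_variable[OF m(1,2)] by blast
 next
  case 2
  hence "U ~: Lam m" for U unfolding Lam_iff by blast
  hence "f = 0" using m(2) by (auto simp: cyc_def sup_def fun_eq_iff)
  thus ?thesis by simp
 qed
next
 case True
 then obtain x where x: "!!g. g \<in> divs m ==> x g \<in> full m g" by (atomize_elim, intro choice_iff[THEN iffD1]) blast
 obtain \<gamma> where \<gamma>: "!!v. v \<in> ks m ==> \<gamma> v \<in> divs m & v \<in> full m (\<gamma> v)" using True by metis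
 let ?X = "x ` divs m"
 have "\<exists>c. sup m (se c ?X) & hp p (se c ?X) & exact m (f - se c ?X)"
 proof (rule cyc_representative[OF m(2,3,1), where \<phi> = "%v. x (\<gamma> v)"])
  show "?X \<subseteq> ks m" using x by (auto simp: full_def)
  show "x (\<gamma> v) \<in> ?X & (\<forall>g\<in>divs m. x (\<gamma> v) \<in> full m g --> v \<in> full m g)" if "v \<in> ks m - ?X" for v
  proof (intro conjI ballI impI)
   show "x (\<gamma> v) \<in> ?X" using \<gamma> that by blast
   fix g assume g: "g \<in> divs m" "x (\<gamma> v) \<in> full m g"
   hence "g = \<gamma> v" using dis[of g "\<gamma> v" "x (\<gamma> v)"] \<gamma>[of v] x[of "\<gamma> v"] that by blast
   thus "v \<in> full m g" using \<gamma> that by blast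
  qed
  show "Y ~: Lam m" if "Y \<subset> ?X" for Y
  proof
   assume Y: "Y \<in> Lam m"
   obtain g where g: "g \<in> divs m" "x g ~: Y" using \<open>Y \<subset> ?X\<close> by blast
   then obtain v where "v \<in> Y" "v \<in> full m g" using Y unfolding Lam_iff by blast
   then obtain g' where "g' \<in> divs m" "v = x g'" using \<open>Y \<subset> ?X\<close> by blast
   thus False using dis[OF g(1), of g' v] x \<open>v \<in> full m g\<close> \<open>v \<in> Y\<close> g(2) by blast
  qed
 qed
 then obtain c where c: "hp p (se c ?X)" "exact m (f - se c ?X)" by blast
 have "inj_on x (divs m)"
 proof (rule inj_onI)
  fix g g' assume "g \<in> divs m" "g' \<in> divs m" "x g = x g'"
  thus "g = g'" using dis[of g g' "x g"] x by metis
 qed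
 hence "card ?X ~= p" using p card_image by metis
 hence "se c ?X ?X = 0" using c(1) by (auto simp: hp_def)
 hence "c = 0" by (simp add: se_def)
 hence "se c ?X = 0" by (auto simp: se_def)
 thus ?thesis using c(2) by (metis diff_zero)
qed

text \<open>Genericity makes the sets \<open>full m g\<close> disjoint wherever \<open>Lam m\<close>
  is nonempty. For a coprime word the divisors of its degree are then the disjoint union of those of
  the letters.\<close>

lemma golod_if_generic:
 assumes gen: "!!s t i. s \<in> gens ==> t \<in> gens ==> s ~= t ==> i < n ==> cf s i = cf t i ==> cf s i > 0 ==>
   \<exists>u\<in>gens. strictly_divides u (mlcm s t)"
  and w: "w \<in> words" "w ~= []"
 shows "wgood w"
proof -
 \<comment> \<open>Two generators full at a common v have the same positive degree there. The
   generator that strictly divides their lcm is full nowhere in m, so \<open>Lam m\<close> would be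
   empty.\<close>
 have dis: "g = g'" if m: "mon m" "sup m f" "f ~= 0" and g: "g \<in> divs m" "g' \<in> divs m" "v \<in> full m g" "v \<in> full m g'" for m f g g' v
 proof (rule ccontr)
  assume ne: "g ~= g'"
  have v: "v \<in> ks m" "cf g v = cf m v" "cf g' v = cf m v" using g by (auto simp: full_def)
  have "v < n" using v(1) m(1) by auto
  moreover have "cf g v > 0" "cf g v = cf g' v" using v by (auto simp: in_keys_iff)
  ultimately obtain u where u: "u \<in> gens" "strictly_divides u (mlcm g g')" using gen[of g g' v] g(1,2) ne unfolding divs_def by blast
  have lm: "cf (mlcm g g') i <= cf m i" for i using g by (simp add: divs_def mdvd_def lookup_mlcm)
  have um: "cf u i <= cf (mlcm g g') i" for i using u(2) by (simp add: strictly_divides_def mdvd_def)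
  obtain U where U: "f U ~= 0" by (rule fun_nonzeroE[OF m(3)])
  hence UL: "U \<in> Lam m" using m(2) by (auto simp: sup_def)
  have "U ~: Lam m"
  proof (rule not_LamI[OF u(1)])
   show "mdvd u m" using lm um order_trans unfolding mdvd_def by blast
   fix i assume "i \<in> U"
   hence i: "cf m i > 0" using UL by (auto simp: Lam_def in_keys_iff)
   show "cf u i < cf m i"
   proof (cases "cf (mlcm g g') i > 0")
    case True
    hence "cf (mlcm g g' - u) i > 0" using u(2) by (simp add: strictly_divides_def)
    thus ?thesis using lm[of i] by (simp add: lookup_minus)
   next
    case False
    thus ?thesis using um[of i] i by simp
   qed
  qed
  with UL show False by blast
 qed
 have lab: "p = card (divs m)" if "(m, p, f) \<in> labels" for m p f
 proof -
  have "mon m" "cyc m f" "hp p f" "~ exact m f" using that by (auto simp: labels_def)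
  thus ?thesis using disjoint_full_exact[of m f p] dis[of m f] exact_zero unfolding cyc_def by metis
 qed
 show ?thesis
 proof (rule all_words_good_coprimeI[OF _ w])
  fix w f assume w: "w \<in> words" "length w >= 3" "coprime_word w"
   and f: "Oword gam w = lift (wdeg w) f" "mon (wdeg w)" "cyc (wdeg w) f" "hp (wp w + length w - 2) f"
  let ?m = "wdeg w"
  show "exact ?m f"
  proof (cases "f = 0 | wp w + length w - 2 ~= card (divs ?m)")
   case True
   thus ?thesis using disjoint_full_exact[OF f(2-4)] dis[OF f(2)] f(3) exact_zero unfolding cyc_def by metis
  next
   case False
   have supf: "sup ?m f" using f(3) by (simp add: cyc_def)
   obtain U where "f U ~= 0" using False fun_nonzeroE by metis
   hence UL: "U \<in> Lam ?m" using supf by (auto simp: sup_def)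
   have li: "w ! i \<in> labels" if "i < length w" for i using w(1) that by (auto simp: in_lists_conv_set)
   have sub: "divs (fst (w ! i)) \<subseteq> divs ?m" if "i < length w" for i
    using mdvd_wdeg[OF that] mdvd_trans by (auto simp: divs_def)
   have "divs ?m = (\<Union>i<length w. divs (fst (w ! i)))"
   proof (intro equalityI subsetI)
    fix g assume g: "g \<in> divs ?m"
    then obtain v where v: "v \<in> full ?m g" using UL unfolding Lam_iff by blast
    then obtain i where i: "i < length w" "v \<in> ks (fst (w ! i))" using ks_wdeg[of w] by (auto simp: full_def)
    obtain m p h where e: "w ! i = (m, p, h)" by (metis surj_pair)
    obtain g' where g': "g' \<in> divs m" "v \<in> full m g'" using label_nonempty[of m p h] li[OF i(1)] e i(2) by auto
    have "v \<in> full ?m g'" using g'(2) cf_wdeg_coprime[OF w(3) i] e v by (auto simp: full_def)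
    moreover have "g' \<in> divs ?m" using sub[OF i(1)] g'(1) e by auto
    ultimately have "g = g'" using dis[OF f(2) supf _ g] v False by blast
    thus "g \<in> (\<Union>i<length w. divs (fst (w ! i)))" using g'(1) i(1) e by force
   qed (use sub in auto)
   moreover have "card (\<Union>i<length w. divs (fst (w ! i))) = (\<Sum>i<length w. card (divs (fst (w ! i))))"
   proof (rule card_UN_disjoint)
    show "\<forall>i\<in>{..<length w}. \<forall>j\<in>{..<length w}. i ~= j --> divs (fst (w ! i)) \<inter> divs (fst (w ! j)) = {}"
    proof (intro ballI impI)
     fix i j assume ij: "i \<in> {..<length w}" "j \<in> {..<length w}" "i ~= j"
     have d: "ks (fst (w ! i)) \<inter> ks (fst (w ! j)) = {}"
      using w(3) ij by (cases i j rule: linorder_cases) (auto simp: coprime_word_def)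
     have "False" if "g \<in> divs (fst (w ! i))" "g \<in> divs (fst (w ! j))" for g
     proof -
      have "ks g \<subseteq> ks (fst (w ! i)) \<inter> ks (fst (w ! j))" using that mdvd_keys by (auto simp: divs_def)
      hence "full ?m g = {}" using d by (auto simp: full_def in_keys_iff)
      moreover have "g \<in> divs ?m" using sub that ij by blast
      ultimately show False using UL unfolding Lam_iff by blast
     qed
     thus "divs (fst (w ! i)) \<inter> divs (fst (w ! j)) = {}" by blast
    qed
   qed (use finite_divs in auto)
   moreover have "(\<Sum>i<length w. card (divs (fst (w ! i)))) = wp w" unfolding wp_sum
   proof (rule sum.cong)
    fix i assume "i \<in> {..<length w}"
    moreover obtain m p h where "w ! i = (m, p, h)" by (metis surj_pair)
    ultimately show "card (divs (fst (w ! i))) = fst (snd (w ! i))" using lab[of m p h] li[of i] by auto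
   qed simp
   \<comment> \<open>For a nonexact obstruction its homological degree equals the number of
     divisors, which is wp w; this contradicts the presence of at least three letters.\<close>
   ultimately have "wp w + length w - 2 = wp w" using False by simp
   thus ?thesis using w(2) by simp
  qed
 qed
qed

end

section \<open>Obstructions of words of length three\<close>

context trivial_koszul
begin

abbreviation label_homog :: "'k label => 'k elt set" where "label_homog b \<equiv> homog (im (fst b)) (int (fst (snd b)))"

text \<open>The product of z0 and z1 vanishes on the nose, that of z1 and z2 after z1 is changed by
  the boundary of Q. The resulting system has the obstruction z0 Q z2 up to signs.\<close>

lemma triple_obstruction:
 assumes w: "[b0, b1, b2] \<in> words"
  and small: "PROP smaller_good [b0, b1, b2]"
  and h: "z0 \<in> label_homog b0" "z1 \<in> label_homog b1"
   "z2 \<in> label_homog b2"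
  and s: "z0 = lval b0 + dd s0" "z1 = lval b1 + dd s1" "z2 = lval b2 + dd s2"
  and Q: "Q \<in> homog (im (fst b1)) (int (fst (snd b1)) + 1)"
  and z: "bar z0 \<cdot> z1 = 0" "bar (z1 - dd Q) \<cdot> z2 = 0" "dd y = bar z0 \<cdot> (bar Q \<cdot> z2)"
 shows "\<exists>y. dd y = Oword gam [b0, b1, b2]"
proof -
 let ?w = "[b0, b1, b2]"
 have lb: "b0 \<in> labels" "b1 \<in> labels" "b2 \<in> labels" using w by auto
 have dz: "dd z2 = 0" using label_lval(2)[OF lb(3)] by (simp add: s d_add d_d)
 \<comment> \<open>The entry on (0, 2) is 0, and the one on (1, 3) is a primitive of
   \<open>bar z1\<close> z2, because z1 and the boundary of Q have the same product with z2.\<close>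
 define a where "a x y = (if (x, y) = (0, 1) then z0 else if (x, y) = (1, 2) then z1 else if (x, y) = (2, 3) then z2
   else if (x, y) = (1, 3) then - (bar Q \<cdot> z2) else (0 :: 'k elt))" for x y :: nat
 have a: "a 0 (Suc 0) = z0" "a (Suc 0) 2 = z1" "a 2 3 = z2" "a (Suc 0) 3 = - (bar Q \<cdot> z2)" "a 0 2 = 0"
  by (simp_all add: a_def)
 have sw: "subw ?w 0 (Suc 0) = [b0]" "subw ?w (Suc 0) 2 = [b1]" "subw ?w 2 3 = [b2]" "subw ?w (Suc 0) 3 = [b1, b2]"
  by (simp_all add: subw_def numeral_2_eq_2)
 have xy: "(x, y) = (0, Suc 0) | (x, y) = (Suc 0, 2) | (x, y) = (2, 3) | (x, y) = (Suc 0, 3) | (x, y) = (0, 2)"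
  if "x < y" "y <= length ?w" "(x, y) ~= (0, length ?w)" for x y :: nat
 proof -
  have "y = 1 | y = 2 | y = 3" "x = 0 | x = 1 | x = 2" using that by (simp_all, linarith+)
  thus ?thesis using that by auto
 qed
 have "\<exists>z. Oword gam ?w = msum a 0 (length ?w) + dd z"
 proof (rule obstruction_unique[OF w _ small])
  fix x y assume "x < y" "y <= length ?w" "(x, y) ~= (0, length ?w)"
  from xy[OF this] consider "x = 0" "y = Suc 0" | "x = Suc 0" "y = 2" | "x = 2" "y = 3" | "x = Suc 0" "y = 3" | "x = 0" "y = 2" by blast
  thus "a x y \<in> homog (im (wdeg (subw ?w x y))) (int (wp (subw ?w x y)) + int (y - x) - 1)"
  proof cases
   case 4
   have "- (bar Q \<cdot> z2) \<in> homog (%i. im (fst b1) i + im (fst b2) i) (int (fst (snd b1)) + 1 + int (fst (snd b2)))"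
    by (intro homog_minus homog_mul homog_bar Q h)
   moreover have "wdeg [b1, b2] = fst b1 + fst b2" "wp [b1, b2] = fst (snd b1) + fst (snd b2)" by (simp_all add: wdeg_def wp_def)
   ultimately show ?thesis by (simp add: 4 a sw im_add algebra_simps)
  qed (simp_all add: a sw h homog_zero)
 next
  fix x y assume "x < y" "y <= length ?w" "(x, y) ~= (0, length ?w)"
  from xy[OF this] consider "x = 0" "y = Suc 0" | "x = Suc 0" "y = 2" | "x = 2" "y = 3" | "x = Suc 0" "y = 3" | "x = 0" "y = 2" by blast
  thus "dd (a x y) = msum a x y"
  proof cases
   case 4
   have "dd (- (bar Q \<cdot> z2)) = bar (dd Q) \<cdot> z2" by (simp add: d_minus d_mul d_bar dz mul_minus_left)
   also have "... = bar z1 \<cdot> z2" using z(2) by (simp add: bar_diff mul_diff_left)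
   also have "{Suc 0<..<3} = {2::nat}" by auto
   hence "bar z1 \<cdot> z2 = msum a (Suc 0) 3" by (simp add: msum_def mm_def a)
   finally show ?thesis by (simp add: 4 a)
  next
   case 5
   have "{0<..<2} = {Suc 0}" by auto
   thus ?thesis by (simp add: 5 a msum_def mm_def z)
  next
   case 1
   have "{0<..<Suc 0} = {}" by auto
   thus ?thesis using label_lval(2)[OF lb(1)] by (simp add: 1 a msum_def mm_def s d_add d_d)
  next
   case 2
   have "{Suc 0<..<2} = {}" by auto
   thus ?thesis using label_lval(2)[OF lb(2)] by (simp add: 2 a msum_def mm_def s d_add d_d)
  next
   case 3
   have "{2<..<3} = ({} :: nat set)" by auto
   thus ?thesis using dz by (simp add: 3 a msum_def mm_def)
  qed
 next
  fix x assume "x < length ?w"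
  hence "x = 0 | x = Suc 0 | x = 2" by auto
  thus "\<exists>z. a x (Suc x) = lval (?w ! x) + dd z" using s by (auto simp: a numeral_2_eq_2[symmetric] numeral_3_eq_3[symmetric])
 qed auto
 then obtain z where "Oword gam ?w = msum a 0 3 + dd z" by (auto simp: numeral_3_eq_3)
 moreover have "{0<..<3} = {Suc 0, 2}" by auto
 hence "msum a 0 3 = dd (- y)" by (simp add: msum_def mm_def a z d_minus mul_minus_right)
 ultimately have "Oword gam ?w = dd (- y + z)" by (simp only: d_add)
 thus ?thesis by metis
qed

text \<open>The class of the letter b is represented by c e_X. Products of such representatives
  vanish as soon as the union of the two sets is not a hitting set.\<close>

definition represents :: "'k label => 'k => nat set => bool"
 where "represents b c X \<longleftrightarrow> sup (fst b) (se c X) & hp (fst (snd b)) (se c X) & exact (fst b) (snd (snd b) - se c X)"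

lemma represents_lift:
 assumes b: "b \<in> labels" "represents b c X"
 obtains s where "lift (fst b) (se c X) = lval b + dd s" "lift (fst b) (se c X) \<in> label_homog b"
proof -
 obtain m p f where e: "b = (m, p, f)" by (metis surj_pair)
 have m: "mon m" using b by (auto simp: labels_def e)
 have r: "sup m (se c X)" "hp p (se c X)" "exact m (f - se c X)" using b(2) by (simp_all add: represents_def e)
 then obtain y where y: "dd y = lift m (f - se c X)" using exact_iff[OF m exact_sup] by blast
 have "lift m (f - se c X) = lift m f - lift m (se c X)" using lift_add[of m f "- se c X"] by (simp add: lift_minus)
 hence "lift m (se c X) = lval b + dd (- y)" using y by (simp add: e lval_def d_minus algebra_simps)
 thus ?thesis using that lift_homog[OF m r(1,2)] by (simp add: e)
qed

lemma bar_lift_se: "\<exists>c'. bar (lift m (se c X)) = lift m (se c' X)"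
proof
 show "bar (lift m (se c X)) = lift m (se (- ((-1) ^ card X * c)) X)"
 proof
  fix U
  show "bar (lift m (se c X)) U = lift m (se (- ((-1) ^ card X * c)) X) U"
   by (cases "even (card X)") (auto simp: bar_def esg_def lift_def se_def single_uminus)
 qed
qed

lemma sup_se: "X \<in> Lam m ==> sup m (se c X)" by (auto simp: sup_def se_def)

lemma mul_lift_se:
 assumes "mon m" "mon m'" "sup m (se c X)" "sup m' (se d Y)"
 shows "\<exists>e. lift m (se c X) \<cdot> lift m' (se d Y) = lift (m + m') (se e (X \<union> Y)) & sup (m + m') (se e (X \<union> Y))"
proof (cases "c = 0 | d = 0")
 case True
 have z: "se 0 Z = (0 :: 'k ext)" for Z by (auto simp: se_def)
 have l0: "lift k 0 = 0" for k by (auto simp: lift_def)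
 have "lift m (se c X) \<cdot> lift m' (se d Y) = 0" using True by (auto simp: z l0)
 thus ?thesis by (intro exI[of _ 0]) (simp add: z l0 sup_def)
next
 case False
 hence L: "X \<in> Lam m" "Y \<in> Lam m'" using assms(3,4)
  by (auto simp: sup_def se_def dest: spec[of _ X] spec[of _ Y])
 obtain e where e: "emul (se c X) (se d Y) = (se e (X \<union> Y) :: 'k ext)"
  using emul_se[OF Lam_finite[OF L(1)] Lam_finite[OF L(2)]] by blast
 have "tr (m + m') (se e (X \<union> Y)) = se (if X \<union> Y \<in> Lam (m + m') then e else 0) (X \<union> Y)"
  by (auto simp: tr_def se_def)
 moreover have "sup (m + m') (se (if X \<union> Y \<in> Lam (m + m') then e else 0) (X \<union> Y))"
  by (auto simp: sup_def se_def split: if_splits)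
 ultimately show ?thesis using mul_lift[OF assms] e by metis
qed

lemma lift_se_zero: "sup m (se c X) ==> X ~: Lam m ==> lift m (se c X) = 0"
proof -
 assume "sup m (se c X)" "X ~: Lam m"
 hence "c = 0" by (auto simp: sup_def se_def dest: spec[of _ X])
 thus ?thesis by (auto simp: lift_def se_def)
qed

lemma bar_mul_lift_se:
 assumes "mon m" "mon m'" "sup m (se c X)" "sup m' (se d Y)"
 shows "\<exists>e. bar (lift m (se c X)) \<cdot> lift m' (se d Y) = lift (m + m') (se e (X \<union> Y)) & sup (m + m') (se e (X \<union> Y))"
proof -
 obtain c' where c': "bar (lift m (se c X)) = lift m (se c' X)" using bar_lift_se by blast
 show ?thesis
 proof (cases "c = 0")
  case True
  hence "lift m (se c X) = 0" by (auto simp: lift_def se_def)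
  moreover have "se 0 (X \<union> Y) = (0 :: 'k ext)" by (auto simp: se_def)
  moreover have "lift (m + m') 0 = 0" by (auto simp: lift_def)
  ultimately show ?thesis by (intro exI[of _ 0]) (simp add: sup_def)
 next
  case False
  hence "X \<in> Lam m" using assms(3) by (auto simp: sup_def se_def dest: spec[of _ X])
  thus ?thesis unfolding c' using mul_lift_se[OF assms(1,2) sup_se assms(4)] by blast
 qed
qed

text \<open>Both products of neighbours vanish on representatives, so
  \<open>triple_obstruction\<close> applies with Q = 0.\<close>

lemma separated_triple:
 assumes w: "[b0, b1, b2] \<in> words"
  and small: "PROP smaller_good [b0, b1, b2]"
  and r: "represents b0 c0 X0" "represents b1 c1 X1" "represents b2 c2 X2"
  and L: "X0 \<union> X1 ~: Lam (fst b0 + fst b1)" "X1 \<union> X2 ~: Lam (fst b1 + fst b2)"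
 shows "\<exists>y. dd y = Oword gam [b0, b1, b2]"
proof -
 have lb: "b0 \<in> labels" "b1 \<in> labels" "b2 \<in> labels" using w by auto
 have m: "mon (fst b0)" "mon (fst b1)" "mon (fst b2)" using label_lval(3) lb by auto
 have s: "sup (fst b0) (se c0 X0)" "sup (fst b1) (se c1 X1)" "sup (fst b2) (se c2 X2)" using r by (simp_all add: represents_def)
 obtain s0 where s0: "lift (fst b0) (se c0 X0) = lval b0 + dd s0" "lift (fst b0) (se c0 X0) \<in> label_homog b0"
  by (rule represents_lift[OF lb(1) r(1)])
 obtain s1 where s1: "lift (fst b1) (se c1 X1) = lval b1 + dd s1" "lift (fst b1) (se c1 X1) \<in> label_homog b1"
  by (rule represents_lift[OF lb(2) r(2)])
 obtain s2 where s2: "lift (fst b2) (se c2 X2) = lval b2 + dd s2" "lift (fst b2) (se c2 X2) \<in> label_homog b2"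
  by (rule represents_lift[OF lb(3) r(3)])
 have z: "bar (lift (fst b0) (se c0 X0)) \<cdot> lift (fst b1) (se c1 X1) = 0"
  using bar_mul_lift_se[OF m(1,2) s(1,2)] lift_se_zero L(1) by metis
 have z': "bar (lift (fst b1) (se c1 X1)) \<cdot> lift (fst b2) (se c2 X2) = 0"
  using bar_mul_lift_se[OF m(2,3) s(2,3)] lift_se_zero L(2) by metis
 show ?thesis by (rule triple_obstruction[OF w small s0(2) s1(2) s2(2) s0(1) s1(1) s2(1) homog_zero z, of 0])
   (simp_all add: z')
qed

lemma wedge_se: "v ~: X ==> wedge v (se c X) = se ((-1) ^ below X v * c) (insert v X)"
proof
 fix U assume v: "v ~: X"
 show "wedge v (se c X) U = se ((-1) ^ below X v * c) (insert v X) U"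
 proof (cases "U = insert v X")
  case True
  hence "U - {v} = X" "v \<in> U" using v by auto
  moreover have "below U v = below X v" using True by simp
  ultimately show ?thesis using True by (simp add: wedge_def se_def)
 next
  case False
  hence "v \<in> U ==> U - {v} ~= X" by blast
  thus ?thesis using False by (auto simp: wedge_def se_def)
 qed
qed

text \<open>The middle letter is a generator, so e_y and e_y' represent the same class up to a
  factor. If e_y suits the left neighbour and e_y' the right one, the obstruction is a multiple of
  e_Z, where Z is the union of X0, {y, y'} and X2.\<close>

lemma linked_triple:
 assumes w: "[b0, b1, b2] \<in> words"
  and small: "PROP smaller_good [b0, b1, b2]"
  and r: "represents b0 c0 X0" "represents b1 c1 {y}" "represents b2 c2 X2"
  and u: "fst b1 \<in> gens" "fst (snd b1) = 1" "y' \<in> ks (fst b1)"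
  and L: "insert y X0 ~: Lam (fst b0 + fst b1)" "insert y' X2 ~: Lam (fst b1 + fst b2)"
  and ex: "y = y' | X0 \<union> ({y, y'} \<union> X2) ~: Lam (fst b0 + (fst b1 + fst b2)) |
   exact (fst b0 + (fst b1 + fst b2)) (ee (X0 \<union> ({y, y'} \<union> X2)))"
 shows "\<exists>y. dd y = Oword gam [b0, b1, b2]"
proof (cases "y = y'")
 case True
 show ?thesis by (rule separated_triple[OF w small r]) (use L True in auto)
next
 case yy: False
 let ?u = "fst b1"
 have lb: "b0 \<in> labels" "b1 \<in> labels" "b2 \<in> labels" using w by auto
 have m: "mon (fst b0)" "mon ?u" "mon (fst b2)" using label_lval(3) lb by auto
 have s: "sup (fst b0) (se c0 X0)" "sup ?u (se c1 {y})" "sup (fst b2) (se c2 X2)" using r by (simp_all add: represents_def)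
 obtain s0 where s0: "lift (fst b0) (se c0 X0) = lval b0 + dd s0" "lift (fst b0) (se c0 X0) \<in> label_homog b0"
  by (rule represents_lift[OF lb(1) r(1)])
 obtain s1 where s1: "lift ?u (se c1 {y}) = lval b1 + dd s1" "lift ?u (se c1 {y}) \<in> label_homog b1"
  by (rule represents_lift[OF lb(2) r(2)])
 obtain s2 where s2: "lift (fst b2) (se c2 X2) = lval b2 + dd s2" "lift (fst b2) (se c2 X2) \<in> label_homog b2"
  by (rule represents_lift[OF lb(3) r(3)])
 have LU: "U \<in> Lam ?u \<longleftrightarrow> U \<subseteq> ks ?u & U ~= {}" for U
  unfolding Lam_iff divs_gen[OF u(1)] by (auto simp: full_def)
 have y'L: "{y'} \<in> Lam ?u" using u(3) by (simp add: LU)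
 show ?thesis
 proof (cases "c1 = 0")
  case True
  have z: "lift ?u (se c1 {y}) = 0" using True by (auto simp: lift_def se_def)
  show ?thesis
   by (rule triple_obstruction[OF w small s0(2) s1(2) s2(2) s0(1) s1(1) s2(1) homog_zero, of 0]) (simp_all add: z)
 next
  case False
  hence yL: "{y} \<in> Lam ?u" using s(2) by (auto simp: sup_def se_def dest: spec[of _ "{y}"])
  have yyL: "{y, y'} \<in> Lam ?u" using yL y'L by (simp add: LU)
  \<comment> \<open>The chain c1 e_y' e_y, whose boundary is c1 (e_y - e_y').\<close>
  define q :: "'k ext" where "q = wedge y' (se c1 {y})"
  obtain k where q: "q = se k {y, y'}" unfolding q_def using wedge_se[of y' "{y}" c1] yy by (auto simp: insert_commute)
  have sq: "sup ?u q" unfolding q by (rule sup_se[OF yyL])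
  have yn: "y < n" "y' < n" using m(2) yL y'L by (auto simp: LU)
  have "tr ?u (ed q) U = (se c1 {y} - se c1 {y'}) U" for U
  proof (cases "U \<in> Lam ?u")
   case True
   have "ed q U = se c1 {y} U - wedge y' (ed (se c1 {y})) U"
    unfolding q_def using ediff_wedge[OF Lam_finite[OF True] yn(2), of "%_. 1"] by simp
   moreover have "ed (se c1 {y}) = se c1 {}"
   proof
    fix V
    have "(\<Sum>i<n. 1 * contr i (se c1 {y}) V) = (\<Sum>i<n. if i = y then contr y (se c1 {y}) V else 0)"
     by (rule sum.cong) (auto simp: contr_se_out)
    also have "... = contr y (se c1 {y}) V" using yn by simp
    also have "... = se c1 {} V" by (auto simp: contr_def se_def below_def)
    finally show "ed (se c1 {y}) V = se c1 {} V" by (simp add: ediff_def)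
   qed
   moreover have "wedge y' (se c1 {}) = se c1 {y'}" using wedge_se[of y' "{}" c1] by (simp add: below_def)
   ultimately show ?thesis using True by (simp add: tr_def)
  next
   case False
   thus ?thesis using yL y'L by (auto simp: tr_def se_def)
  qed
  hence teq: "tr ?u (ed q) = se c1 {y} - se c1 {y'}" by blast
  define Q where "Q = lift ?u q"
  have hQ: "Q \<in> homog (im ?u) (int (fst (snd b1)) + 1)"
  proof -
   have "hp 2 q" using yy by (auto simp: q hp_def se_def split: if_splits)
   from lift_homog[OF m(2) sq this] show ?thesis by (simp add: Q_def u(2))
  qed
  have "dd Q = lift ?u (se c1 {y}) - lift ?u (se c1 {y'})"
   unfolding Q_def dd_lift[OF m(2) sq] teq using lift_add[of ?u "se c1 {y}" "- se c1 {y'}"] by (simp add: lift_minus)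
  hence dQ: "lift ?u (se c1 {y}) - dd Q = lift ?u (se c1 {y'})" by simp
  have z: "bar (lift (fst b0) (se c0 X0)) \<cdot> lift ?u (se c1 {y}) = 0"
   using bar_mul_lift_se[OF m(1,2) s(1,2)] lift_se_zero L(1) by (metis Un_insert_right sup_bot_right)
  have z': "bar (lift ?u (se c1 {y'})) \<cdot> lift (fst b2) (se c2 X2) = 0"
   using bar_mul_lift_se[OF m(2,3) sup_se[OF y'L] s(3)] lift_se_zero L(2) by (metis insert_is_Un)
  obtain e where e: "bar Q \<cdot> lift (fst b2) (se c2 X2) = lift (?u + fst b2) (se e ({y, y'} \<union> X2))" "sup (?u + fst b2) (se e ({y, y'} \<union> X2))"
   using bar_mul_lift_se[OF m(2,3) _ s(3), of k "{y, y'}"] sq unfolding Q_def q by blast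
  have m12: "mon (?u + fst b2)" and m012: "mon (fst b0 + (?u + fst b2))" using m keys_add_subset by auto
  obtain e' where e': "bar (lift (fst b0) (se c0 X0)) \<cdot> (bar Q \<cdot> lift (fst b2) (se c2 X2)) = lift (fst b0 + (?u + fst b2)) (se e' (X0 \<union> ({y, y'} \<union> X2)))"
    "sup (fst b0 + (?u + fst b2)) (se e' (X0 \<union> ({y, y'} \<union> X2)))"
   using bar_mul_lift_se[OF m(1) m12 s(1) e(2)] unfolding e(1) by blast
  have "exact (fst b0 + (?u + fst b2)) (se e' (X0 \<union> ({y, y'} \<union> X2)))" using ex yy
  proof (elim disjE)
   assume "exact (fst b0 + (?u + fst b2)) (ee (X0 \<union> ({y, y'} \<union> X2)))"
   moreover have "se e' Z = (%U. e' * ee Z U)" for Z by (auto simp: se_def ee_def)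
   ultimately show ?thesis using exact_scale by simp
  next
   assume "X0 \<union> ({y, y'} \<union> X2) ~: Lam (fst b0 + (fst b1 + fst b2))"
   hence "e' = 0" using e'(2) by (auto simp: sup_def se_def dest: spec[of _ "X0 \<union> ({y, y'} \<union> X2)"])
   moreover have "se 0 Z = (0 :: 'k ext)" for Z by (auto simp: se_def)
   ultimately show ?thesis by simp
  qed blast
  then obtain t where t: "dd t = bar (lift (fst b0) (se c0 X0)) \<cdot> (bar Q \<cdot> lift (fst b2) (se c2 X2))"
   using exact_iff[OF m012 e'(2)] e'(1) by auto
  show ?thesis
   by (rule triple_obstruction[OF w small s0(2) s1(2) s2(2) s0(1) s1(1) s2(1) hQ z _ t]) (simp_all add: dQ z')
 qed
qed

end

section \<open>Ideals with at most seven generators\<close>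

context trivial_koszul
begin

text \<open>The functional is \<open>\<eta> D\<close>, with \<open>D\<close> the sum of all contractions and \<open>\<eta> = (d\<^sub>0 + d\<^sub>1) d\<^sub>2 - d\<^sub>3 d\<^sub>1\<close>, where \<open>d\<^sub>i\<close>
 is the sum of the contractions by variables of colour \<open>i\<close>: the five colours form a pentagon.\<close>

lemma five_colouring:
 fixes col :: "nat => nat"
 assumes ex: "exact m (ee {a, b, c})" and col: "!!i. i < n ==> col i < 5" "col a = 0" "col b = 2" "col c = 4" "a < n" "b < n" "c < n"
  and rb: "!!x y z. x \<in> ks m ==> y \<in> ks m ==> z \<in> ks m ==>
   (col x, col y, col z) \<in> {(0, 2, 3), (0, 2, 4), (1, 2, 4), (3, 1, 0), (3, 1, 4)} ==> {x, y, z} \<in> Lam m"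
 shows False
proof -
 define D where "D = dcol col"
 define T where "T i j k f = D i (D j (D k f)) {}" for i j k f
 \<comment> \<open>These five terms are what is left of \<eta> D after cancellation. Their colour
   triples are the minimal vertex covers of the pentagon 0-1-2-3-4-0.\<close>
 define \<psi> where "\<psi> f = T 0 2 3 f + T 0 2 4 f + T 1 2 4 f - T 3 1 0 f - T 3 1 4 f" for f
 let ?J = "{0, 1, 2, 3, 4 :: nat}"
 have J: "col i \<in> ?J" if "i < n" for i using col(1)[OF that] by (simp, presburger)
 have sd: "(\<Sum>k\<in>?J. D k f) U = (if finite U then ed f U else 0)" for f U
  unfolding D_def by (rule sum_dcol) (use J in simp_all)
 obtain g h where gh: "(\<Sum>k\<in>?J. D k g) = ee {a, b, c} + h" "!!U. h U ~= 0 ==> U \<subseteq> ks m & U ~: Lam m"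
  using exact_remainder[of m "ee {a, b, c}" ?J col] ex J unfolding D_def by blast
 have Tadd: "T i j k (f + f') = T i j k f + T i j k f'" for i j k f f' by (simp add: T_def D_def dcol_add)
 have Tnz: "\<exists>x y z. col x = i & col y = j & col z = k & f {x, y, z} ~= 0" if nz: "T i j k f ~= 0" for i j k f
 proof -
  have "\<exists>xs. map col xs = [i, j, k] & f (set xs \<union> {}) ~= 0" by (rule dcols_nonzero) (insert nz, simp add: T_def D_def)
  then obtain x y z where "col x = i" "col y = j" "col z = k" "f {x, y, z} ~= 0" by (auto simp: map_eq_Cons_conv)
  thus ?thesis by blast
 qed
 have Th: "T i j k h = 0" if "(i, j, k) \<in> {(0, 2, 3), (0, 2, 4), (1, 2, 4), (3, 1, 0), (3, 1, 4)}" for i j k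
 proof (rule ccontr)
  assume "T i j k h ~= 0"
  then obtain x y z where "col x = i" "col y = j" "col z = k" "h {x, y, z} ~= 0" using Tnz by blast
  thus False using gh(2)[of "{x, y, z}"] rb[of x y z] that by simp
 qed
 have Te: "T i j k (ee {a, b, c}) = 0" if "~ {i, j, k} \<subseteq> {0, 2, 4}" for i j k
 proof (rule ccontr)
  assume "T i j k (ee {a, b, c}) ~= 0"
  then obtain x y z where x: "col x = i" "col y = j" "col z = k" "{x, y, z} = {a, b, c}"
   using Tnz[of i j k "ee {a, b, c}"] by (auto simp: ee_def split: if_splits)
  hence "{i, j, k} = col ` {a, b, c}" unfolding x(4)[symmetric] by simp
  thus False using that col by simp
 qed
 have "T 0 2 4 (ee {a, b, c}) ~= 0" using dcols_ee[of col "[a, b, c]"] col by (simp add: T_def D_def)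
 hence "\<psi> (\<Sum>k\<in>?J. D k g) ~= 0" unfolding gh(1) by (simp add: \<psi>_def Tadd Th Te)
 moreover have "\<psi> (\<Sum>k\<in>?J. D k g) = 0"
 proof -
  define f where "f = (\<Sum>k\<in>?J. D k g)"
  have "(\<Sum>k\<in>?J. D k f) U = 0 U" for U
  proof -
   have "finite U ==> ed f U = ed (ed g) U" by (rule ediff_finite) (simp_all only: f_def sd if_True)
   thus ?thesis unfolding sd by (simp add: ediff_ediff)
  qed
  hence E: "D 0 f + D 1 f + D 2 f + D 3 f + D 4 f = 0" by (simp add: fun_eq_iff add_ac)
  have Tl: "T i j k f = - T j i k f" for i j k f unfolding T_def D_def by (subst dcol_swap) simp
  have Tr: "T i j k f = - T i k j f" for i j k f unfolding T_def D_def by (subst (2) dcol_swap) (simp add: dcol_minus)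
  have T0: "T i i k f = 0" "T i k k f = 0" for i k f by (simp_all add: T_def D_def)
  \<comment> \<open>Each S i j contains the sum D of all contractions as its innermost operator
    applied to f. It vanishes because f itself is D g and D D = 0.\<close>
  define S where "S i j = D i (D j (D 0 f + D 1 f + D 2 f + D 3 f + D 4 f)) {}" for i j
  have S: "S i j = T i j 0 f + T i j 1 f + T i j 2 f + T i j 3 f + T i j 4 f" for i j
   by (simp add: S_def D_def dcol_add T_def)
  have S0: "S i j = 0" for i j unfolding S_def E by (simp only: D_def dcol_zero zero_fun_apply)
  have "T 0 2 0 f = 0" "T 1 2 1 f = 0" "T 3 1 3 f = 0"
   using Tr[of 0 2 0 f] Tr[of 1 2 1 f] Tr[of 3 1 3 f] T0 by simp_all
  moreover have "T 0 2 1 f = - T 1 2 0 f" using Tl[of 0 2 1 f] Tr[of 2 0 1 f] Tl[of 2 1 0 f] by simp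
  moreover have "T 1 2 3 f = T 3 1 2 f" using Tr[of 1 2 3 f] Tl[of 1 3 2 f] by simp
  ultimately have "\<psi> f = S 0 2 + S 1 2 - S 3 1" unfolding S \<psi>_def by (simp add: T0)
  thus ?thesis by (simp add: S0 f_def)
 qed
 ultimately show False by blast
qed

section \<open>Three pairwise coprime generators\<close>

definition nonfull :: "monomial => monomial => nat set"
 where "nonfull u w = {x. cf w x < cf u x}"

text \<open>The configuration forced by three coprime letters: one generator for each letter and,
  from \<open>third_generator\<close>, one for each pair. It is symmetric under permutations of the
  three, which the rules \<open>tri_swap12\<close> and \<open>tri_swap23\<close> exploit.\<close>

definition tri :: "monomial => monomial => monomial => monomial => monomial => monomial => bool"
 where "tri u1 u2 u3 w12 w13 w23 \<longleftrightarrow> {u1, u2, u3, w12, w13, w23} \<subseteq> gens & mon u1 & mon u2 & mon u3 &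
  ks u1 \<inter> ks u2 = {} & ks u1 \<inter> ks u3 = {} & ks u2 \<inter> ks u3 = {} &
  mdvd w12 (u1 + u2) & w12 ~= u1 & w12 ~= u2 & mdvd w13 (u1 + u3) & w13 ~= u1 & w13 ~= u3 &
  mdvd w23 (u2 + u3) & w23 ~= u2 & w23 ~= u3"

lemma tri_swap12: "tri u1 u2 u3 w12 w13 w23 ==> tri u2 u1 u3 w12 w23 w13"
 unfolding tri_def by (simp add: add.commute Int_commute insert_commute)

lemma tri_swap23: "tri u1 u2 u3 w12 w13 w23 ==> tri u1 u3 u2 w13 w12 w23"
 unfolding tri_def by (simp add: add.commute Int_commute insert_commute)

lemmas tri_231 = tri_swap23[OF tri_swap12]
lemmas tri_321 = tri_swap12[OF tri_231]

lemma tri_disjoint: "tri u1 u2 u3 w12 w13 w23 ==> ks u1 \<inter> ks u2 = {} & ks u1 \<inter> ks u3 = {} & ks u2 \<inter> ks u3 = {}"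
 by (simp add: tri_def)

lemma tri_cf:
 assumes t: "tri u1 u2 u3 w12 w13 w23" and x: "x \<in> ks u1"
 shows "cf u2 x = 0" "cf u3 x = 0" "cf w23 x = 0" "cf w12 x <= cf u1 x" "cf w13 x <= cf u1 x" "cf u1 x > 0"
proof -
 show u: "cf u2 x = 0" "cf u3 x = 0" "cf u1 x > 0" using t x by (auto simp: tri_def in_keys_iff disjoint_iff)
 have "cf w23 x <= cf (u2 + u3) x" "cf w12 x <= cf (u1 + u2) x" "cf w13 x <= cf (u1 + u3) x" using t by (simp_all add: tri_def mdvd_def)
 thus "cf w23 x = 0" "cf w12 x <= cf u1 x" "cf w13 x <= cf u1 x" using u by (simp_all add: lookup_add)
qed

lemmas tri_cf2 = tri_cf[OF tri_swap12]
lemmas tri_cf3 = tri_cf[OF tri_swap12[OF tri_swap23]]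

lemma tri_cf_out:
 assumes t: "tri u1 u2 u3 w12 w13 w23" and x: "x ~: ks u1" "x ~: ks u2" "x ~: ks u3"
 shows "cf u1 x = 0" "cf u2 x = 0" "cf u3 x = 0" "cf w23 x = 0" "cf w12 x = 0" "cf w13 x = 0"
proof -
 show u: "cf u1 x = 0" "cf u2 x = 0" "cf u3 x = 0" using x by (auto simp: in_keys_iff)
 have "cf w23 x <= cf (u2 + u3) x" "cf w12 x <= cf (u1 + u2) x" "cf w13 x <= cf (u1 + u3) x" using t by (simp_all add: tri_def mdvd_def)
 thus "cf w23 x = 0" "cf w12 x = 0" "cf w13 x = 0" using u by (simp_all add: lookup_add)
qed

lemma tri_nonfull: "tri u1 u2 u3 w12 w13 w23 ==> \<exists>x. x \<in> ks u1 & x \<in> nonfull u1 w12"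
 using gen_nonfull[of u1 w12] by (auto simp: tri_def nonfull_def)

lemma nonfull_ks: "x \<in> nonfull u w ==> x \<in> ks u" by (simp add: nonfull_def in_keys_iff)

lemma tri_vars:
 assumes t: "tri u1 u2 u3 w12 w13 w23"
 obtains x y y' z where "x \<in> nonfull u1 w12" "y \<in> nonfull u2 w12" "y' \<in> nonfull u2 w23" "z \<in> nonfull u3 w23"
 using tri_nonfull[OF t] tri_nonfull[OF tri_swap12[OF t]] tri_nonfull[OF tri_231[OF t]] tri_nonfull[OF tri_321[OF t]] by blast

lemma tri_pair:
 assumes t: "tri u1 u2 u3 w12 w13 w23" and x: "x \<in> nonfull u1 w12" "y \<in> nonfull u2 w12"
 shows "{x, y} ~: Lam (u1 + u2)" by (rule not_LamI[of w12])
  (insert t x tri_cf[OF t nonfull_ks[OF x(1)]] tri_cf2[OF t nonfull_ks[OF x(2)]], auto simp: tri_def nonfull_def lookup_add)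

text \<open>In the degree lcm(u1, w12) u3 the generator u2 no longer divides, for it would then
  divide w12.\<close>

lemma tri_mlcm:
 assumes t: "tri u1 u2 u3 w12 w13 w23"
 shows "x \<in> ks u1 ==> cf (mlcm u1 w12 + u3) x = cf u1 x" "x \<in> ks u2 ==> cf (mlcm u1 w12 + u3) x = cf w12 x"
  "x \<in> ks u3 ==> cf (mlcm u1 w12 + u3) x = cf u3 x" "ks (mlcm u1 w12 + u3) \<subseteq> ks u1 \<union> ks u2 \<union> ks u3" "~ mdvd u2 (mlcm u1 w12 + u3)"
proof -
 let ?M = "mlcm u1 w12 + u3"
 show "x \<in> ks u1 ==> cf ?M x = cf u1 x" "x \<in> ks u3 ==> cf ?M x = cf u3 x"
  using tri_cf[OF t] tri_cf3[OF t] by (simp_all add: lookup_mlcm lookup_add)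
 show M2: "x \<in> ks u2 ==> cf ?M x = cf w12 x" for x using tri_cf2[OF t] by (simp add: lookup_mlcm lookup_add)
 have "cf ?M x = 0" if "x ~: ks u1 \<union> ks u2 \<union> ks u3" for x using tri_cf_out[OF t, of x] that by (simp add: lookup_add lookup_mlcm)
 thus "ks ?M \<subseteq> ks u1 \<union> ks u2 \<union> ks u3" by (metis in_keys_iff subsetI)
 show "~ mdvd u2 ?M"
 proof
  assume "mdvd u2 ?M"
  hence "cf u2 x <= cf ?M x" for x by (simp only: mdvd_def)
  hence "cf u2 x <= cf w12 x" for x using M2[of x] by (cases "x \<in> ks u2") (metis, simp add: in_keys_iff)
  hence "u2 = w12" using gens_mdvd[of u2 w12] t by (simp add: tri_def mdvd_def)
  thus False using t by (simp add: tri_def)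
 qed
qed

text \<open>Otherwise w12 would divide u1.\<close>

lemma tri_meets:
 assumes t: "tri u1 u2 u3 w12 w13 w23"
 shows "\<exists>b\<in>ks u2. cf w12 b > 0"
proof (rule ccontr)
 assume a: "~ (\<exists>b\<in>ks u2. cf w12 b > 0)"
 have "cf w12 x <= cf u1 x" for x
 proof -
  have "cf w12 x <= cf u1 x + cf u2 x" using t by (simp add: tri_def mdvd_def lookup_add)
  thus ?thesis using a by (cases "x \<in> ks u2") (auto simp: in_keys_iff)
 qed
 hence "mdvd w12 u1" by (simp add: mdvd_def)
 thus False using gens_mdvd[of w12 u1] t by (simp add: tri_def)
qed

text \<open>The set {a} misses w12 and {b} misses u1, so e_a e_b is a cycle in degree lcm(u1, w12).
  Its product with the cycle e_c of u3 bounds.\<close>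

lemma tri_exact:
 assumes t: "tri u1 u2 u3 w12 w13 w23" and a: "a \<in> nonfull u1 w12" and b: "b \<in> ks u2" "cf w12 b > 0" and c: "c \<in> ks u3"
  and L: "{a, b, c} \<in> Lam (mlcm u1 w12 + u3)"
 shows "exact (mlcm u1 w12 + u3) (ee {a, b, c})"
proof -
 have s: "{a, b, c} = {c, a, b}" by auto
 show ?thesis unfolding s
 proof (rule triple_exact)
  note c2 = tri_cf2[OF t] and c3 = tri_cf3[OF t]
  have a1: "a \<in> ks u1" by (rule nonfull_ks[OF a])
  have sub: "ks (mlcm u1 w12) \<subseteq> ks u1 \<union> ks u2"
  proof (rule subsetI, rule ccontr)
   fix x assume x: "x \<in> ks (mlcm u1 w12)" "x ~: ks u1 \<union> ks u2"
   have "cf u1 x = 0" "cf w12 x = 0" using x(2) tri_cf_out(5)[OF t, of x] c3(3)[of x] by (auto simp: in_keys_iff)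
   thus False using x(1) by (simp add: in_keys_iff lookup_mlcm)
  qed
  show "u3 \<in> gens" "mon u3" using t by (auto simp: tri_def)
  show "mon (mlcm u1 w12)" using sub t unfolding tri_def by blast
  show "a \<in> ks (mlcm u1 w12)" using a1 by (simp add: in_keys_iff lookup_mlcm)
  show "b \<in> ks (mlcm u1 w12)" using b by (simp add: in_keys_iff lookup_mlcm)
  note d = tri_disjoint[OF t]
  show "a ~= b" "c ~= a" "c ~= b" using a1 b(1) c d by auto
  show "c ~: ks (mlcm u1 w12)" using sub c d by blast
  show "{a} ~: Lam (mlcm u1 w12)"
   by (rule not_LamI[of w12]) (insert t a, auto simp: tri_def nonfull_def mdvd_def lookup_mlcm)
  show "{b} ~: Lam (mlcm u1 w12)"
   by (rule not_LamI[of u1]) (insert t c2(1)[OF b(1)] b(2), auto simp: tri_def mdvd_def lookup_mlcm)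
 qed (insert L c, auto simp: s)
qed

text \<open>If there were no such v, all generators dividing the degree would be full at one of x,
  y, z whenever these come from the three colour classes: u3 at z; u1, w13 and any generator outside
  the six at x; w12 at y. Then \<open>colouring_not_exact\<close> contradicts
  \<open>tri_exact\<close>.\<close>

lemma extra_generator:
 assumes t: "tri u1 u2 u3 w12 w13 w23" and fail1: "nonfull u1 w12 \<inter> nonfull u1 w13 = {}"
  and w23: "~ mdvd w23 (mlcm u1 w12 + u3)"
 shows "\<exists>v\<in>gens - {u1, u2, u3, w12, w13, w23}. mdvd v (mlcm u1 w12 + u3) & (\<exists>x\<in>nonfull u1 w12. cf v x < cf u1 x)"
proof (rule ccontr)
 assume no: "~ ?thesis"
 let ?M = "mlcm u1 w12 + u3"
 note c3 = tri_cf3[OF t] and c1 = tri_cf[OF t]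
 note M = tri_mlcm[OF t]
 have L: "{x, y, z} \<in> Lam ?M" if x: "x \<in> nonfull u1 w12" and y: "y \<in> ks ?M" "y \<in> ks u1 & y ~: nonfull u1 w12 | y \<in> ks u2" and z: "z \<in> ks u3" for x y z
 proof (rule LamI)
  have x1: "x \<in> ks u1" by (rule nonfull_ks[OF x])
  show "{x, y, z} \<subseteq> ks ?M" using y(1) x1 z M(1)[OF x1] M(3)[OF z] c1(6)[OF x1] c3(6)[OF z] by (auto simp: in_keys_iff)
  fix g assume g: "g \<in> gens" "mdvd g ?M"
  have "cf w13 x = cf u1 x" using x x1 fail1 c1(5)[OF x1] by (force simp: nonfull_def)
  moreover have "cf w12 y = cf ?M y" using y(2)
  proof
   assume "y \<in> ks u1 & y ~: nonfull u1 w12"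
   thus ?thesis using M(1)[of y] c1(4)[of y] by (auto simp: nonfull_def)
  qed (simp add: M(2))
  moreover have "cf g x = cf u1 x" if "g ~: {u1, u2, u3, w12, w13, w23}"
  proof -
   have "~ cf g x < cf u1 x" using no g that x by blast
   moreover have "cf g x <= cf u1 x" using g(2) M(1)[OF x1] by (metis mdvd_def)
   ultimately show ?thesis by simp
  qed
  ultimately show "\<exists>v\<in>{x, y, z}. cf g v = cf ?M v" using g(2) M(5) w23 M(1)[OF x1] M(3)[OF z] by (cases "g \<in> {u1, u2, u3, w12, w13, w23}") auto
 qed
 obtain a where a: "a \<in> nonfull u1 w12" using tri_nonfull[OF t] by blast
 obtain b where b: "b \<in> ks u2" "cf w12 b > 0" using tri_meets[OF t] by blast
 have "u3 ~= 0" using third_generator tri_meets[OF tri_swap23[OF t]] by auto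
 then obtain c where c: "c \<in> ks u3" by (metis keys_eq_empty ex_in_conv)
 have a1: "a \<in> ks u1" by (rule nonfull_ks[OF a])
 have bM: "b \<in> ks ?M" using b M(2)[OF b(1)] by (simp add: in_keys_iff)
 \<comment> \<open>Colour 1 consists, within the degree, of the remaining variables of u1 and those
   of u2. In all of these w12 is full.\<close>
 define col where "col x = (if x \<in> ks u3 then 2 else if x \<in> nonfull u1 w12 then 0 else 1 :: nat)" for x
 note d = tri_disjoint[OF t]
 have "exact ?M (ee {a, b, c})" by (rule tri_exact[OF t a b c L[OF a bM _ c]]) (use b in blast)
 moreover have "{x, y, z} \<in> Lam ?M" if k: "x \<in> ks ?M" "y \<in> ks ?M" "col x = 0" "col y = 1" "col z = 2" for x y z
 proof (rule L)
  show "x \<in> nonfull u1 w12" "z \<in> ks u3" using k(3,5) by (auto simp: col_def split: if_splits)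
  show "y \<in> ks u1 & y ~: nonfull u1 w12 | y \<in> ks u2" using k(2,4) M(4) by (auto simp: col_def split: if_splits)
 qed (rule k)
 hence "set ys \<in> Lam ?M" if "set ys \<subseteq> ks ?M" "map col ys = [0, 1, 2]" for ys
  using that by (auto simp: map_eq_Cons_conv)
 moreover have "map col [a, b, c] = [0, 1, 2]" using a a1 b c d nonfull_ks[of b u1 w12] by (auto simp: col_def)
 moreover have "set [a, b, c] \<subseteq> {..<n}" using a1 b c t by (auto simp: tri_def)
 moreover have "col i \<in> set [0, 1, 2]" for i by (simp add: col_def)
 ultimately show False using colouring_not_exact[of ?M "[a, b, c]" col "[0, 1, 2]"] by simp
qed

text \<open>The variables of the degree lcm(u1, w13) u2 fall into five classes arranged in a circle,
  such that each of the generators u1, w13, w23, u2, w12 is full exactly on two adjacent ones, at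
  least as far as needed. Vertex covers of the pentagon then yield hitting sets, and
  \<open>five_colouring\<close> contradicts \<open>tri_exact\<close>.\<close>

lemma pentagon:
 assumes t: "tri u1 u2 u3 w12 w13 w23" and fail1: "nonfull u1 w12 \<inter> nonfull u1 w13 = {}" and fail2: "nonfull u2 w12 \<inter> nonfull u2 w23 = {}"
  and eq: "!!x. x \<in> ks u3 ==> cf w13 x = cf w23 x"
  and v: "!!v. v \<in> gens - {u1, u2, u3, w12, w13, w23} ==> mdvd v (mlcm u1 w13 + u2) ==>
   (\<forall>x\<in>nonfull u1 w13. cf v x = cf u1 x) & (\<forall>x\<in>nonfull u2 w23. cf v x = cf u2 x)"
 shows False
proof -
 let ?M = "mlcm u1 w13 + u2"
 note c2 = tri_cf2[OF t] and c1 = tri_cf[OF t]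
 note M = tri_mlcm[OF tri_swap23[OF t]] and d = tri_disjoint[OF t]
 \<comment> \<open>In the circle X1, X2, Z, Y2, Y1 the edges belong to u1, w13, w23, u2 and w12 in
   this order. Any further divisor is full on both X1 and Y1.\<close>
 define X1 where "X1 = nonfull u1 w13"
 define X2 where "X2 = ks u1 - X1"
 define Y1 where "Y1 = nonfull u2 w23"
 define Y2 where "Y2 = ks u2 - Y1"
 define Z where "Z = {x \<in> ks u3. cf w13 x > 0}"
 have XY: "X1 \<subseteq> ks u1" "Y1 \<subseteq> ks u2" using nonfull_ks by (auto simp: X1_def Y1_def)
 have f1: "x \<in> X1 | x \<in> X2 ==> cf u1 x = cf ?M x" for x using M(1)[of x] XY by (auto simp: X2_def)
 have f2: "x \<in> Y1 | x \<in> Y2 ==> cf u2 x = cf ?M x" for x using M(3)[of x] XY by (auto simp: Y2_def)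
 have f12: "x \<in> X1 ==> cf w12 x = cf ?M x" for x
  using fail1 XY M(1)[of x] c1(4)[of x] by (force simp: X1_def nonfull_def)
 have g12: "x \<in> Y1 ==> cf w12 x = cf ?M x" for x
  using fail2 XY M(3)[of x] c2(4)[of x] by (force simp: Y1_def nonfull_def)
 have f13: "x \<in> X2 | x \<in> Z ==> cf w13 x = cf ?M x" for x
  using M(1)[of x] c1(5)[of x] M(2)[of x] by (auto simp: X1_def X2_def Z_def nonfull_def)
 have f23: "x \<in> Y2 | x \<in> Z ==> cf w23 x = cf ?M x" for x
  using M(3)[of x] c2(5)[of x] M(2)[of x] eq[of x] by (auto simp: Y1_def Y2_def Z_def nonfull_def)
 have fv: "x \<in> X1 | x \<in> Y1 ==> cf g x = cf ?M x" if "g \<in> gens" "mdvd g ?M" "g ~: {u1, u2, u3, w12, w13, w23}" for g x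
  using v[of g] that M(1)[of x] M(3)[of x] XY unfolding X1_def Y1_def by (metis DiffI subsetD)
 have L: "{x, y, z} \<in> Lam ?M" if k: "{x, y, z} \<subseteq> ks ?M"
   and h: "x \<in> X1 & y \<in> Z & z \<in> Y2 | x \<in> X1 & y \<in> Z & z \<in> Y1 | x \<in> X2 & y \<in> Z & z \<in> Y1 |
    x \<in> Y2 & y \<in> X2 & z \<in> X1 | x \<in> Y2 & y \<in> X2 & z \<in> Y1" for x y z
 proof (rule LamI[OF k])
  fix g assume g: "g \<in> gens" "mdvd g ?M"
  have "g ~= u3" using g(2) M(5) by blast
  then consider "g = u1" | "g = u2" | "g = w12" | "g = w13" | "g = w23" | "g ~: {u1, u2, u3, w12, w13, w23}" by blast
  thus "\<exists>v\<in>{x, y, z}. cf g v = cf ?M v"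
  proof cases
   case 1
   thus ?thesis using h f1[of x] f1[of y] f1[of z] by blast
  next
   case 2
   thus ?thesis using h f2[of x] f2[of y] f2[of z] by blast
  next
   case 3
   thus ?thesis using h f12[of x] f12[of y] f12[of z] g12[of x] g12[of y] g12[of z] by blast
  next
   case 4
   thus ?thesis using h f13[of x] f13[of y] f13[of z] by blast
  next
   case 5
   thus ?thesis using h f23[of x] f23[of y] f23[of z] by blast
  next
   case 6
   thus ?thesis using h fv[OF g 6, of x] fv[OF g 6, of y] fv[OF g 6, of z] by blast
  qed
 qed
 obtain a where a: "a \<in> X1" using tri_nonfull[OF tri_swap23[OF t]] by (auto simp: X1_def)
 obtain b where b: "b \<in> ks u3" "cf w13 b > 0" using tri_meets[OF tri_swap23[OF t]] by blast
 obtain c where c: "c \<in> Y1" using tri_nonfull[OF tri_swap23[OF tri_swap12[OF t]]] by (auto simp: Y1_def)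
 have kM: "a \<in> ks ?M" "b \<in> ks ?M" "c \<in> ks ?M"
  using a b c XY M(1)[of a] M(2)[of b] M(3)[of c] by (auto simp: in_keys_iff)
 have "exact ?M (ee {a, b, c})"
 proof (rule tri_exact[OF tri_swap23[OF t]])
  show "{a, b, c} \<in> Lam ?M" by (rule L) (insert kM a b c, auto simp: Z_def)
 qed (insert a b c XY, auto simp: X1_def)
 define col where "col x = (if x \<in> X1 then 0 else if x \<in> X2 then 1 else if x \<in> ks u3 then 2 else if x \<in> Y2 then 3 else 4 :: nat)" for x
 have c0: "x \<in> X1" if "col x = 0" for x using that by (auto simp: col_def split: if_splits)
 have c1': "x \<in> X2" if "col x = 1" for x using that by (auto simp: col_def split: if_splits)
 have c2': "x \<in> Z" if "col x = 2" "x \<in> ks ?M" for x using that M(2)[of x] by (auto simp: col_def Z_def in_keys_iff split: if_splits)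
 have c3': "x \<in> Y2" if "col x = 3" for x using that by (auto simp: col_def split: if_splits)
 have c4': "x \<in> Y1" if "col x = 4" "x \<in> ks ?M" for x using that M(4) by (auto simp: col_def X2_def Y2_def split: if_splits)
 from \<open>exact ?M (ee {a, b, c})\<close> show False
 proof (rule five_colouring[where col = col])
  show "col a = 0" using a by (simp add: col_def)
  show "col b = 2" using b XY d by (auto simp: col_def X2_def)
  show "col c = 4" using c XY d by (auto simp: col_def X2_def Y2_def)
  show "a < n" "b < n" "c < n" using a b c XY t by (auto simp: tri_def)
  fix x y z assume k: "x \<in> ks ?M" "y \<in> ks ?M" "z \<in> ks ?M"
   and h: "(col x, col y, col z) \<in> {(0, 2, 3), (0, 2, 4), (1, 2, 4), (3, 1, 0), (3, 1, 4)}"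
  show "{x, y, z} \<in> Lam ?M"
  proof (rule L)
   show "{x, y, z} \<subseteq> ks ?M" using k by simp
   from h consider "col x = 0" "col y = 2" "col z = 3" | "col x = 0" "col y = 2" "col z = 4" | "col x = 1" "col y = 2" "col z = 4" |
    "col x = 3" "col y = 1" "col z = 0" | "col x = 3" "col y = 1" "col z = 4" by auto
   thus "x \<in> X1 & y \<in> Z & z \<in> Y2 | x \<in> X1 & y \<in> Z & z \<in> Y1 | x \<in> X2 & y \<in> Z & z \<in> Y1 |
    x \<in> Y2 & y \<in> X2 & z \<in> X1 | x \<in> Y2 & y \<in> X2 & z \<in> Y1"
    by cases (use c0 c1' c2' c3' c4' k in blast)+
  qed
 qed (auto simp: col_def)
qed

text \<open>At a variable of u2 where w12 is not full, w23 is full by \<open>fail2\<close>, hence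
  exceeds the exponent w12 of the degree. So w23 does not divide it.\<close>

lemma extra_generator_dvd:
 assumes t: "tri u1 u2 u3 w12 w13 w23" and fail1: "nonfull u1 w12 \<inter> nonfull u1 w13 = {}" and fail2: "nonfull u2 w12 \<inter> nonfull u2 w23 = {}"
 shows "\<exists>v\<in>gens - {u1, u2, u3, w12, w13, w23}. mdvd v (mlcm u1 w12 + u3)"
proof -
 note c2 = tri_cf2[OF t]
 have "~ mdvd w23 (mlcm u1 w12 + u3)"
 proof
  assume d: "mdvd w23 (mlcm u1 w12 + u3)"
  obtain y where y: "y \<in> nonfull u2 w12" using tri_nonfull[OF tri_swap12[OF t]] by blast
  have "cf w23 y <= cf (mlcm u1 w12 + u3) y" using d by (simp only: mdvd_def)
  hence "cf w23 y <= cf w12 y" using c2[OF nonfull_ks[OF y]] by (simp add: lookup_mlcm lookup_add)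
  hence "y \<in> nonfull u2 w23" using y by (simp add: nonfull_def)
  thus False using fail2 y by blast
 qed
 thus ?thesis using extra_generator[OF t fail1] by blast
qed

text \<open>In the boundary of e_U only U - {x} can survive truncation.\<close>

lemma exact_boundary:
 assumes U: "U \<in> Lam m" "mon m" and x: "x \<in> U" and L: "!!v. v \<in> U ==> v ~= x ==> U - {v} ~: Lam m"
 shows "exact m (ee (U - {x})) | U - {x} ~: Lam m"
proof (cases "U - {x} \<in> Lam m")
 case True
 obtain e where e: "e = 1 | e = -1" "contr x (se 1 U) = (se (e * 1) (U - {x}) :: 'k ext)" using contr_se[OF x] by blast
 have xn: "x < n" using U x by (auto simp: Lam_def)
 have "tr m (ed (se 1 U)) = (%V. e * ee (U - {x}) V)"
 proof
  fix V
  show "tr m (ed (se 1 U)) V = e * ee (U - {x}) V"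
  proof (cases "V \<in> Lam m")
   case VL: True
   have "(\<Sum>i<n. 1 * contr i (se 1 U) V) = (\<Sum>i<n. if i = x then contr x (se 1 U) V else (0 :: 'k))"
   proof (rule sum.cong, rule refl)
    fix i
    have "contr i (se 1 U) V = (0 :: 'k)" if "i ~= x"
    proof (rule ccontr)
     assume "contr i (se 1 U) V ~= (0 :: 'k)"
     hence "i ~: V" "insert i V = U" by (auto simp: contr_def se_def split: if_splits)
     hence "V = U - {i}" "i \<in> U" by auto
     thus False using L[of i] that VL by blast
    qed
    thus "1 * contr i (se 1 U) V = (if i = x then contr x (se 1 U) V else (0 :: 'k))" by simp
   qed
   also have "... = contr x (se 1 U) V" using xn by simp
   finally show ?thesis using VL e(2) by (simp add: tr_def ediff_def se_def ee_def)
  next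
   case False
   thus ?thesis using True by (auto simp: tr_def ee_def)
  qed
 qed
 hence "exact m (%V. e * ee (U - {x}) V)" using exact_tr_ed[OF sup_se[OF U(1)], of 1] by simp
 hence "exact m (%V. e * (e * ee (U - {x}) V))" by (rule exact_scale)
 moreover have "e * (e * z) = z" for z using e(1) by auto
 ultimately show ?thesis by simp
qed simp

text \<open>Variables as required by \<open>linked_triple\<close> for three letters whose degrees
  are u1, u2 and u3.\<close>

definition link :: "monomial => monomial => monomial => monomial => monomial => bool"
 where "link u1 u2 u3 w12 w23 = (\<exists>x\<in>nonfull u1 w12. \<exists>y\<in>nonfull u2 w12. \<exists>y'\<in>nonfull u2 w23. \<exists>z\<in>nonfull u3 w23.
  y = y' | {x, y, y', z} ~: Lam (u1 + u2 + u3) | exact (u1 + u2 + u3) (ee {x, y, y', z}))"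

lemma link_sym: "link u3 u2 u1 w23 w12 ==> link u1 u2 u3 w12 w23"
proof -
 assume "link u3 u2 u1 w23 w12"
 then obtain x y y' z where h: "x \<in> nonfull u3 w23" "y \<in> nonfull u2 w23" "y' \<in> nonfull u2 w12" "z \<in> nonfull u1 w12"
  "y = y' | {x, y, y', z} ~: Lam (u3 + u2 + u1) | exact (u3 + u2 + u1) (ee {x, y, y', z})" unfolding link_def by blast
 have "{x, y, y', z} = {z, y', y, x}" "u3 + u2 + u1 = u1 + u2 + u3" by (auto simp: add_ac)
 thus ?thesis unfolding link_def using h by metis
qed

lemma tri_sum:
 assumes t: "tri u1 u2 u3 w12 w13 w23"
 shows "x \<in> ks u1 ==> cf (u1 + u2 + u3) x = cf u1 x" "x \<in> ks u2 ==> cf (u1 + u2 + u3) x = cf u2 x" "x \<in> ks u3 ==> cf (u1 + u2 + u3) x = cf u3 x"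
  "mdvd w12 (u1 + u2 + u3)" "mdvd w13 (u1 + u2 + u3)" "mdvd w23 (u1 + u2 + u3)" "mon (u1 + u2 + u3)"
  "ks (u1 + u2 + u3) = ks u1 \<union> ks u2 \<union> ks u3"
proof -
 show "x \<in> ks u1 ==> cf (u1 + u2 + u3) x = cf u1 x" using tri_cf[OF t] by (simp add: lookup_add)
 show "x \<in> ks u2 ==> cf (u1 + u2 + u3) x = cf u2 x" using tri_cf2[OF t] by (simp add: lookup_add)
 show "x \<in> ks u3 ==> cf (u1 + u2 + u3) x = cf u3 x" using tri_cf3[OF t] by (simp add: lookup_add)
 have "mdvd (u1 + u2) (u1 + u2 + u3)" "mdvd (u1 + u3) (u1 + u2 + u3)" "mdvd (u2 + u3) (u1 + u2 + u3)"
  by (simp_all add: mdvd_def lookup_add)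
 thus "mdvd w12 (u1 + u2 + u3)" "mdvd w13 (u1 + u2 + u3)" "mdvd w23 (u1 + u2 + u3)"
  using t[unfolded tri_def] by (auto intro: mdvd_trans)
 show "ks (u1 + u2 + u3) = ks u1 \<union> ks u2 \<union> ks u3" by (auto simp: in_keys_iff lookup_add)
 thus "mon (u1 + u2 + u3)" using t by (simp add: tri_def)
qed

text \<open>By \<open>extra_generator_dvd\<close>, used for (u1, u2) and (u2, u1), the seventh
  generator v divides both degrees and so is bounded by w12 on u1 and on u2. Either v is full on
  none of the four variables, which are then no hitting set, or their class bounds, or the
  configuration of \<open>pentagon\<close> arises.\<close>

lemma link_if_fail:
 assumes t: "tri u1 u2 u3 w12 w13 w23" and G: "gens \<subseteq> {v, u1, u2, u3, w12, w13, w23}"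
  and fail1: "nonfull u1 w12 \<inter> nonfull u1 w13 = {}" and fail2: "nonfull u2 w12 \<inter> nonfull u2 w23 = {}"
 shows "link u1 u2 u3 w12 w23"
proof -
 let ?m = "u1 + u2 + u3"
 note c2 = tri_cf2[OF t] and c3 = tri_cf3[OF t] and c1 = tri_cf[OF t]
 have vG: "v \<in> gens - {u1, u2, u3, w12, w13, w23}" "mdvd v (mlcm u1 w12 + u3)" "mdvd v (mlcm u2 w12 + u3)"
  using extra_generator_dvd[OF t fail1 fail2] extra_generator_dvd[OF tri_swap12[OF t] fail2 fail1] G by blast+
 hence vg: "v \<in> gens" by simp
 have v1: "cf v x <= cf w12 x" if "x \<in> ks u1" for x
 proof -
  have "cf v x <= cf (mlcm u2 w12 + u3) x" using vG(3) by (simp only: mdvd_def)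
  thus ?thesis using c1[OF that] by (simp add: lookup_add lookup_mlcm)
 qed
 have v2: "cf v x <= cf w12 x" if "x \<in> ks u2" for x
 proof -
  have "cf v x <= cf (mlcm u1 w12 + u3) x" using vG(2) by (simp only: mdvd_def)
  thus ?thesis using c2[OF that] by (simp add: lookup_add lookup_mlcm)
 qed
 have vm: "mdvd v ?m"
 proof -
  have "cf (mlcm u1 w12 + u3) i <= cf ?m i" for i
   using t unfolding tri_def mdvd_def by (auto simp: lookup_add lookup_mlcm)
  thus ?thesis using vG(2) mdvd_trans unfolding mdvd_def by blast
 qed
 obtain x y y' z0 where x: "x \<in> nonfull u1 w12" and y: "y \<in> nonfull u2 w12" and y': "y' \<in> nonfull u2 w23" and z0: "z0 \<in> nonfull u3 w23" by (rule tri_vars[OF t])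
 note k = x[THEN nonfull_ks] y[THEN nonfull_ks] y'[THEN nonfull_ks]
 have vx: "cf v x < cf ?m x" using v1[OF k(1)] x tri_sum(1)[OF t k(1)] by (simp add: nonfull_def)
 have vy: "cf v y < cf ?m y" using v2[OF k(2)] y tri_sum(2)[OF t k(2)] by (simp add: nonfull_def)
 show ?thesis
 proof (cases "nonfull u3 w13 \<inter> nonfull u3 w23 = {}")
  case True
  have vv: "mdvd v (mlcm u2 w23 + u1)" "mdvd v (mlcm u3 w23 + u1)"
   using extra_generator_dvd[OF tri_231[OF t] _ _] extra_generator_dvd[OF tri_321[OF t] _ _] fail2 True G by blast+
  note kz = z0[THEN nonfull_ks]
  have "cf v z0 <= cf (mlcm u2 w23 + u1) z0" using vv(1) by (simp only: mdvd_def)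
  hence "cf v z0 < cf ?m z0" using c3[OF kz] tri_sum(3)[OF t kz] z0 by (simp add: lookup_add lookup_mlcm nonfull_def)
  moreover have "cf v y' <= cf (mlcm u3 w23 + u1) y'" using vv(2) by (simp only: mdvd_def)
  hence "cf v y' < cf ?m y'" using c2[OF k(3)] tri_sum(2)[OF t k(3)] y' by (simp add: lookup_add lookup_mlcm nonfull_def)
  ultimately have "{x, y, y', z0} ~: Lam ?m" using vx vy by (intro not_LamI[OF vg vm]) auto
  thus ?thesis unfolding link_def using x y y' z0 by blast
 next
  case False
  then obtain z where z: "z \<in> nonfull u3 w13" "z \<in> nonfull u3 w23" by blast
  note kz = z(1)[THEN nonfull_ks]
  consider "cf v z < cf u3 z" "\<exists>y'\<in>nonfull u2 w23. cf v y' < cf u2 y'" | "cf v z < cf u3 z" "\<exists>x'\<in>nonfull u1 w13. cf v x' < cf u1 x'"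
   | "cf v z < cf u3 z ==> (\<forall>x'\<in>nonfull u1 w13. ~ cf v x' < cf u1 x') & (\<forall>y'\<in>nonfull u2 w23. ~ cf v y' < cf u2 y')" by blast
  thus ?thesis
  proof cases
   case 1
   then obtain y'' where y'': "y'' \<in> nonfull u2 w23" "cf v y'' < cf u2 y''" by blast
   have "{x, y, y'', z} ~: Lam ?m"
    by (rule not_LamI[OF vg vm]) (use vx vy y'' 1(1) tri_sum(2)[OF t nonfull_ks[OF y''(1)]] tri_sum(3)[OF t kz] in auto)
   thus ?thesis unfolding link_def using x y y''(1) z by blast
  next
   case 2
   then obtain x' where x': "x' \<in> nonfull u1 w13" "cf v x' < cf u1 x'" by blast
   note kx' = nonfull_ks[OF x'(1)]
   note d = tri_disjoint[OF t]
   have ne: "x' ~= x" "x' ~= y" "x' ~= y'" "x' ~= z" "y ~= y'" using fail1 fail2 x x' y y' d kx' k kz by blast+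
   note S = tri_sum(1)[OF t kx'] tri_sum(1)[OF t k(1)] tri_sum(2)[OF t k(2)] tri_sum(2)[OF t k(3)] tri_sum(3)[OF t kz]
   note P = c1(6)[OF kx'] c1(6)[OF k(1)] c2(6)[OF k(2)] c2(6)[OF k(3)] c3(6)[OF kz]
   \<comment> \<open>The face without x' bounds because every other face misses a generator: the one
     without x misses w13, without y w23, without y' v, and without z u3.\<close>
   let ?U = "{x', x, y, y', z}"
   have gm: "w12 \<in> gens" "w13 \<in> gens" "w23 \<in> gens" "u3 \<in> gens" using t by (auto simp: tri_def)
   have u3m: "mdvd u3 ?m" by (simp add: mdvd_def lookup_add)
   have nx: "?U - {a} ~: Lam ?m" if "a \<in> ?U" "a ~= x'" for a
   proof -
    from that consider "a = x" | "a = y" | "a = y'" | "a = z" by blast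
    thus ?thesis
    proof cases
     case 1
     show ?thesis by (rule not_LamI[OF gm(2) tri_sum(5)[OF t]])
       (insert 1 S P x' z c2(3)[OF k(2)] c2(3)[OF k(3)], auto simp: nonfull_def)
    next
     case 2
     show ?thesis by (rule not_LamI[OF gm(3) tri_sum(6)[OF t]])
       (insert 2 S P y' z c1(3)[OF k(1)] c1(3)[OF kx'], auto simp: nonfull_def)
    next
     case 3
     show ?thesis by (rule not_LamI[OF vg vm]) (use 3 S x'(2) vx vy \<open>cf v z < cf u3 z\<close> in auto)
    next
     case 4
     show ?thesis
      by (rule not_LamI[OF gm(4) u3m]) (use 4 S P c1(2)[OF k(1)] c1(2)[OF kx'] c2(2)[OF k(2)] c2(2)[OF k(3)] in auto)
    qed
   qed
   have eq: "?U - {x'} = {x, y, y', z}" using ne by blast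
   show ?thesis
   proof (cases "?U \<in> Lam ?m")
    case True
    have "exact ?m (ee (?U - {x'})) | ?U - {x'} ~: Lam ?m"
     by (rule exact_boundary[OF True tri_sum(7)[OF t] _ nx]) auto
    thus ?thesis unfolding link_def eq using x y y' z by blast
   next
    case False
    hence "{x, y, y', z} ~: Lam ?m" using Lam_up[of "{x, y, y', z}" ?m ?U] k kz kx' tri_sum(8)[OF t] by blast
    thus ?thesis unfolding link_def using x y y' z by blast
   qed
  next
   case 3
   have uniq: "g = v" if "g \<in> gens - {u1, u2, u3, w12, w13, w23}" for g using that G by blast
   have nz: "cf v z < cf u3 z" if "mdvd v M" "cf M z < cf u3 z" for M using that by (auto simp: mdvd_def intro: le_less_trans)
   have d13: "mdvd w23 (mlcm u1 w13 + u2)"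
   proof (rule ccontr)
    assume "~ ?thesis"
    then obtain g where g: "g \<in> gens - {u1, u3, u2, w13, w12, w23}" "mdvd g (mlcm u1 w13 + u2)" "\<exists>x\<in>nonfull u1 w13. cf g x < cf u1 x"
     using extra_generator[OF tri_swap23[OF t]] fail1 by blast
    have "cf (mlcm u1 w13 + u2) z < cf u3 z" using z(1) c3[OF kz] by (simp add: lookup_add lookup_mlcm nonfull_def)
    thus False using g nz uniq[of g] 3 by blast
   qed
   have d23: "mdvd w13 (mlcm u2 w23 + u1)"
   proof (rule ccontr)
    assume "~ ?thesis"
    then obtain g where g: "g \<in> gens - {u2, u3, u1, w23, w12, w13}" "mdvd g (mlcm u2 w23 + u1)" "\<exists>x\<in>nonfull u2 w23. cf g x < cf u2 x"
     using extra_generator[OF tri_231[OF t]] fail2 by blast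
    have "cf (mlcm u2 w23 + u1) z < cf u3 z" using z(2) c3[OF kz] by (simp add: lookup_add lookup_mlcm nonfull_def)
    thus False using g nz uniq[of g] 3 by blast
   qed
   have "False"
   proof (rule pentagon[OF t fail1 fail2])
    fix a assume a: "a \<in> ks u3"
    have "cf w23 a <= cf (mlcm u1 w13 + u2) a" "cf w13 a <= cf (mlcm u2 w23 + u1) a" using d13 d23 by (simp_all only: mdvd_def)
    thus "cf w13 a = cf w23 a" using c3[OF a] by (simp add: lookup_add lookup_mlcm)
   next
    fix g assume g: "g \<in> gens - {u1, u2, u3, w12, w13, w23}" "mdvd g (mlcm u1 w13 + u2)"
    have gv: "g = v" by (rule uniq[OF g(1)])
    have "cf (mlcm u1 w13 + u2) z < cf u3 z" using z(1) c3[OF kz] by (simp add: lookup_add lookup_mlcm nonfull_def)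
    hence h: "(\<forall>x'\<in>nonfull u1 w13. ~ cf v x' < cf u1 x') & (\<forall>y'\<in>nonfull u2 w23. ~ cf v y' < cf u2 y')"
     using nz g(2) gv 3 by blast
    have "cf v a <= cf u1 a" if "a \<in> ks u1" for a using v1[OF that] c1(4)[OF that] by simp
    moreover have "cf v a <= cf u2 a" if "a \<in> ks u2" for a using v2[OF that] c2(4)[OF that] by simp
    ultimately show "(\<forall>x\<in>nonfull u1 w13. cf g x = cf u1 x) & (\<forall>x\<in>nonfull u2 w23. cf g x = cf u2 x)"
     using h unfolding gv by (meson antisym_conv2 nonfull_ks)
   qed
   thus ?thesis ..
  qed
 qed
qed

text \<open>If w12 and w23 share a nonfull variable in u2, take y = y'. If w13 shares one with w12
  in u1 and one with w23 in u3, the four variables miss w13. Otherwise \<open>link_if_fail\<close>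
  applies, up to reversal of the order.\<close>

lemma tri_link:
 assumes t: "tri u1 u2 u3 w12 w13 w23" and G: "gens \<subseteq> {v, u1, u2, u3, w12, w13, w23}"
 shows "link u1 u2 u3 w12 w23"
proof -
 note c2 = tri_cf2[OF t]
 obtain x y y' z where x: "x \<in> nonfull u1 w12" and y: "y \<in> nonfull u2 w12" and y': "y' \<in> nonfull u2 w23" and z: "z \<in> nonfull u3 w23" by (rule tri_vars[OF t])
 show ?thesis
 proof (cases "nonfull u2 w12 \<inter> nonfull u2 w23 = {}")
  case False
  thus ?thesis unfolding link_def using x z by blast
 next
  case fail2: True
  show ?thesis
  proof (cases "nonfull u1 w12 \<inter> nonfull u1 w13 = {}")
   case True
   thus ?thesis using link_if_fail[OF t G] fail2 by blast
  next
   case nf1: False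
   show ?thesis
   proof (cases "nonfull u3 w23 \<inter> nonfull u3 w13 = {}")
    case True
    have "gens \<subseteq> {v, u3, u2, u1, w23, w13, w12}" using G by blast
    hence "link u3 u2 u1 w23 w12" by (rule link_if_fail[OF tri_321[OF t] _ True]) (use fail2 in blast)
    thus ?thesis by (rule link_sym)
   next
    case False
    then obtain z' where z': "z' \<in> nonfull u3 w23" "z' \<in> nonfull u3 w13" by blast
    obtain x' where x': "x' \<in> nonfull u1 w12" "x' \<in> nonfull u1 w13" using nf1 by blast
    have "{x', y, y', z'} ~: Lam (u1 + u2 + u3)"
    proof (rule not_LamI[OF _ tri_sum(5)[OF t]])
     show "w13 \<in> gens" using t by (simp add: tri_def)
     fix a assume "a \<in> {x', y, y', z'}"
     then consider "a = x'" | "a \<in> ks u2" | "a = z'" using nonfull_ks[OF y] nonfull_ks[OF y'] by blast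
     thus "cf w13 a < cf (u1 + u2 + u3) a"
     proof cases
      case 1
      thus ?thesis using x'(2) tri_sum(1)[OF t nonfull_ks[OF x'(1)]] by (simp add: nonfull_def)
     next
      case 2
      thus ?thesis using c2[OF 2] tri_sum(2)[OF t 2] by simp
     next
      case 3
      thus ?thesis using z'(2) tri_sum(3)[OF t nonfull_ks[OF z'(1)]] by (simp add: nonfull_def)
     qed
    qed
    thus ?thesis unfolding link_def using x'(1) y y' z'(1) by blast
   qed
  qed
 qed
qed

section \<open>Letters with one or two dividing generators\<close>

lemma single_divisor_label:
 assumes b: "b \<in> labels" "divs (fst b) = {g}"
 shows "fst b = g" "fst (snd b) = 1" "x \<in> ks g ==> \<exists>c. represents b c {x}"
proof -
 obtain m p f where e: "b = (m, p, f)" by (metis surj_pair)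
 have b': "(m, p, f) \<in> labels" "divs m = {g}" using b by (simp_all add: e)
 have p: "p = 1" by (rule label_single_divisor[OF b'])
 hence m: "m \<in> gens" "divs m = {m}" using label_degree_one[OF b'(1)] divs_gen by auto
 hence mg: "m = g" using b'(2) by auto
 show "fst b = g" "fst (snd b) = 1" using p mg by (simp_all add: e)
 show "\<exists>c. represents b c {x}" if x: "x \<in> ks g"
 proof -
  have l: "mon m" "cyc m f" "hp p f" using b'(1) by (auto simp: labels_def)
  have "\<exists>c. sup m (se c {x}) & hp p (se c {x}) & exact m (f - se c {x})"
   by (rule cyc_representative[OF l(2,3,1), where \<phi> = "%_. x"]) (insert x mg m(2), auto simp: full_def Lam_iff)
  thus ?thesis by (simp add: represents_def e)
 qed
qed

text \<open>One variable is full only for u, the other only for u'. Every variable is full for one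
  of the two, so it can be substituted.\<close>

lemma two_divisors_label:
 assumes b: "b \<in> labels" "divs (fst b) = {u, u'}" "u ~= u'"
 obtains x x' c where "represents b c {x, x'}" "x \<in> ks (fst b)" "x' \<in> ks (fst b)" "cf u' x < cf (fst b) x" "cf u x' < cf (fst b) x'"
proof -
 obtain m p f where e: "b = (m, p, f)" by (metis surj_pair)
 have b': "(m, p, f) \<in> labels" "divs m = {u, u'}" using b by (simp_all add: e)
 have l: "mon m" "cyc m f" "hp p f" using b'(1) by (auto simp: labels_def)
 have cov: "\<forall>v\<in>ks m. v \<in> full m u | v \<in> full m u'" using label_nonempty[OF b'(1)] b'(2) by auto
 have um: "mdvd u m" "mdvd u' m" "u \<in> gens" "u' \<in> gens" using b'(2) by (auto simp: divs_def)
 have sep: "\<exists>x. x \<in> full m k & x ~: full m k'" if "k \<in> {u, u'}" "k' \<in> {u, u'}" "k ~= k'" for k k'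
 proof (rule ccontr)
  assume "~ ?thesis"
  hence "ks m \<subseteq> full m k'" using cov that by blast
  hence "k' = m" using mdvd_full_eq[of k' m] um that by blast
  thus False using gens_mdvd[of k k'] um that by auto
 qed
 obtain x where x: "x \<in> full m u" "x ~: full m u'" using sep[of u u'] b(3) by auto
 obtain x' where x': "x' \<in> full m u'" "x' ~: full m u" using sep[of u' u] b(3) by auto
 have k: "x \<in> ks m" "x' \<in> ks m" using x x' by (auto simp: full_def)
 have "\<exists>c. sup m (se c {x, x'}) & hp p (se c {x, x'}) & exact m (f - se c {x, x'})"
 proof (rule cyc_representative[OF l(2,3,1), where \<phi> = "%v. if v \<in> full m u then x else x'"])
  show "{x, x'} \<subseteq> ks m" using k by simp
  show "(if v \<in> full m u then x else x') \<in> {x, x'} & (\<forall>g\<in>divs m. (if v \<in> full m u then x else x') \<in> full m g --> v \<in> full m g)"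
   if "v \<in> ks m - {x, x'}" for v using that cov x x' unfolding b'(2) by auto
  show "Y ~: Lam m" if "Y \<subset> {x, x'}" for Y
  proof -
   have "x ~: Y | x' ~: Y" using that by blast
   moreover have "Y \<subseteq> {x, x'}" using that by blast
   ultimately have "Y \<inter> full m u = {} | Y \<inter> full m u' = {}" using x x' by blast
   thus ?thesis unfolding Lam_iff b'(2) by blast
  qed
 qed
 then obtain c where "represents b c {x, x'}" by (auto simp: represents_def e)
 moreover have "cf u' x < cf m x" "cf u x' < cf m x'" using x x' um k by (auto simp: full_def mdvd_def less_le)
 ultimately show ?thesis using that k by (simp add: e)
qed

text \<open>The third generator for u and u2 cannot involve the variables of u3, and it is not u1
  since this would divide u. Among at most seven generators only w12 is left.\<close>

lemma same_third:
 assumes t: "tri u1 u2 u3 w12 w13 w23" and G: "gens \<subseteq> {u, u1, u2, u3, w12, w13, w23}"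
  and u: "u \<in> gens" "u ~= u1" "mon u" "ks u \<inter> ks u2 = {}" "ks u \<inter> ks u3 = {}"
 shows "mdvd w12 (u + u2)"
proof -
 note c3 = tri_cf3[OF t]
 have g: "u1 \<in> gens" "u2 \<in> gens" "mon u2" using t by (simp_all add: tri_def)
 have "u ~= 0" using gens_mdvd[OF u(1) g(1)] u(2) by (auto simp: mdvd_def)
 moreover have "u2 ~= 0" using tri_meets[OF t] by auto
 ultimately obtain w where w: "w \<in> gens" "w ~= u" "w ~= u2" "mdvd w (u + u2)"
  using third_generator[OF u(1) g(2) u(3) g(3) u(4)] by blast
 have le: "cf w x <= cf u x + cf u2 x" for x using w(4) by (simp add: mdvd_def lookup_add)
 have z: "cf w x = 0" if "x \<in> ks u3" for x
 proof -
  have "x ~: ks u" using u(5) that by blast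
  thus ?thesis using le[of x] c3(1,2)[OF that] by (simp add: in_keys_iff)
 qed
 have "w ~= u1"
 proof
  assume e: "w = u1"
  have "cf u1 x <= cf u x" for x
   using le[of x] tri_cf(1)[OF t, of x] unfolding e by (cases "x \<in> ks u1") (auto simp: in_keys_iff)
  hence "mdvd u1 u" by (simp add: mdvd_def)
  thus False using gens_mdvd[OF g(1) u(1)] u(2) by simp
 qed
 moreover obtain a where "a \<in> ks u3" "cf w13 a > 0" using tri_meets[OF tri_swap23[OF t]] by blast
 hence "w ~= w13" using z by force
 moreover obtain a where "a \<in> ks u3" "cf w23 a > 0" using tri_meets[OF tri_swap23[OF tri_swap12[OF t]]] by blast
 hence "w ~= w23" using z by force
 moreover have "a \<in> ks u3 ==> cf u3 a > 0" for a by (simp add: in_keys_iff)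
 hence "w ~= u3" using z \<open>a \<in> ks u3\<close> by force
 ultimately have "w = w12" using w G by blast
 thus ?thesis using w(4) by simp
qed

text \<open>If both choices failed, \<open>extra_generator_dvd\<close> for (u2, u3, u1) would
  produce a seventh generator, which must be u. Being coprime to u2 and u3, it would divide
  u1.\<close>

lemma end_variables:
 assumes t: "tri u1 u2 u3 w12 w13 w23" and G: "gens \<subseteq> {u, u1, u2, u3, w12, w13, w23}"
  and u: "u \<in> gens" "u ~= u1" "ks u \<inter> ks u2 = {}" "ks u \<inter> ks u3 = {}"
 shows "\<exists>y\<in>nonfull u2 w12. \<exists>y'\<in>nonfull u2 w23. \<exists>z\<in>nonfull u3 w23. y = y' | z \<in> nonfull u3 w13"
proof -
 obtain x y y' z where x: "x \<in> nonfull u1 w12" and y: "y \<in> nonfull u2 w12" and y': "y' \<in> nonfull u2 w23" and z: "z \<in> nonfull u3 w23" by (rule tri_vars[OF t])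
 show ?thesis
 proof (cases "nonfull u2 w23 \<inter> nonfull u2 w12 = {} & nonfull u3 w23 \<inter> nonfull u3 w13 = {}")
  case True
  then obtain v where v: "v \<in> gens - {u2, u3, u1, w23, w12, w13}" "mdvd v (mlcm u2 w23 + u1)"
   using extra_generator_dvd[OF tri_231[OF t]] by blast
  hence vu: "v = u" using G by blast
  have "cf u x <= cf u1 x" for x
  proof (cases "x \<in> ks u")
   case True
   have "cf u x <= cf (mlcm u2 w23 + u1) x" using v(2) unfolding vu by (simp only: mdvd_def)
   moreover have "x ~: ks u2" "x ~: ks u3" using True u by auto
   hence "cf u2 x = 0" "cf w23 x = 0"
    using tri_cf_out(2,4)[OF t, of x] tri_cf(1,3)[OF t, of x] by (auto simp: in_keys_iff)
   ultimately show ?thesis by (simp add: lookup_add lookup_mlcm)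
  qed (simp add: in_keys_iff)
  hence "u = u1" using gens_mdvd[OF u(1), of u1] t by (simp add: tri_def mdvd_def)
  with u(2) show ?thesis by blast
 next
  case False
  thus ?thesis using y y' z by blast
 qed
qed

lemma singles_triple:
 assumes w: "[b0, b1, b2] \<in> words"
  and small: "PROP smaller_good [b0, b1, b2]"
  and t: "tri u1 u2 u3 w12 w13 w23" and G: "gens \<subseteq> {v, u1, u2, u3, w12, w13, w23}"
  and d: "divs (fst b0) = {u1}" "divs (fst b1) = {u2}" "divs (fst b2) = {u3}"
 shows "\<exists>y. dd y = Oword gam [b0, b1, b2]"
proof -
 have lb: "b0 \<in> labels" "b1 \<in> labels" "b2 \<in> labels" using w by auto
 have e: "fst b0 = u1" "fst b1 = u2" "fst b2 = u3" "fst (snd b1) = 1" using single_divisor_label(1,2) lb d by blast+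
 have g: "w12 \<in> gens" "w23 \<in> gens" "mdvd w12 (u1 + u2)" "mdvd w23 (u2 + u3)" "u2 \<in> gens" using t by (simp_all add: tri_def)
 obtain x y y' z where h: "x \<in> nonfull u1 w12" "y \<in> nonfull u2 w12" "y' \<in> nonfull u2 w23" "z \<in> nonfull u3 w23"
  "y = y' | {x, y, y', z} ~: Lam (u1 + u2 + u3) | exact (u1 + u2 + u3) (ee {x, y, y', z})"
  using tri_link[OF t G] unfolding link_def by blast
 note k = nonfull_ks[OF h(1)] nonfull_ks[OF h(2)] nonfull_ks[OF h(3)] nonfull_ks[OF h(4)]
 obtain r0 where r0: "represents b0 r0 {x}" using single_divisor_label(3)[OF lb(1) d(1) k(1)] by blast
 obtain r1 where r1: "represents b1 r1 {y}" using single_divisor_label(3)[OF lb(2) d(2) k(2)] by blast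
 obtain r2 where r2: "represents b2 r2 {z}" using single_divisor_label(3)[OF lb(3) d(3) k(4)] by blast
 have U: "{x} \<union> ({y, y'} \<union> {z}) = {x, y, y', z}" by auto
 show ?thesis by (rule linked_triple[OF w small r0 r1 r2, where y' = y'])
   (insert tri_pair[OF t h(1,2), unfolded insert_commute[of x]] tri_pair[OF tri_231[OF t] h(3,4)] e k g h(5), simp_all only: U add.assoc, blast+)
qed

text \<open>By \<open>same_third\<close> the generators w12 and w23 serve for v as well as for u2.
  At x their exponents are bounded by that of v and at x' by that of u2, hence they are full at
  neither, and \<open>separated_triple\<close> applies.\<close>

lemma double_middle_triple:
 assumes w: "[b0, b1, b2] \<in> words"
  and small: "PROP smaller_good [b0, b1, b2]"
  and t: "tri u1 u2 u3 w12 w13 w23" and G: "gens \<subseteq> {v, u1, u2, u3, w12, w13, w23}"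
  and d: "divs (fst b0) = {u1}" "divs (fst b1) = {u2, v}" "divs (fst b2) = {u3}" "v ~= u2"
  and dis: "ks (fst b0) \<inter> ks (fst b1) = {}" "ks (fst b1) \<inter> ks (fst b2) = {}"
 shows "\<exists>y. dd y = Oword gam [b0, b1, b2]"
proof -
 have lb: "b0 \<in> labels" "b1 \<in> labels" "b2 \<in> labels" using w by auto
 have e: "fst b0 = u1" "fst b2 = u3" using single_divisor_label(1) lb d by blast+
 have g: "w12 \<in> gens" "w23 \<in> gens" "mdvd w12 (u1 + u2)" "mdvd w23 (u2 + u3)" using t by (simp_all add: tri_def)
 have v: "v \<in> gens" "mdvd v (fst b1)" "mdvd u2 (fst b1)" using d(2) by (auto simp: divs_def)
 have kv: "ks v \<subseteq> ks (fst b1)" "mon v" using mdvd_keys[OF v(2)] label_lval(3)[OF lb(2)] by auto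
 have "mdvd w12 (v + u1)" by (rule same_third[OF tri_swap12[OF t] _ v(1) d(4)]) (use G kv dis e in blast)+
 hence w12: "cf w12 i <= cf v i + cf u1 i" for i by (simp add: mdvd_def lookup_add)
 have "mdvd w23 (v + u3)"
  by (rule same_third[OF tri_swap23[OF tri_swap12[OF t]] _ v(1) d(4)]) (use G kv dis e in blast)+
 hence w23: "cf w23 i <= cf v i + cf u3 i" for i by (simp add: mdvd_def lookup_add)
 have w12': "cf w12 i <= cf u1 i + cf u2 i" and w23': "cf w23 i <= cf u2 i + cf u3 i" for i
  using g(3,4) by (simp_all add: mdvd_def lookup_add)
 obtain x x' c where X: "represents b1 c {x, x'}" "x \<in> ks (fst b1)" "x' \<in> ks (fst b1)" "cf v x < cf (fst b1) x" "cf u2 x' < cf (fst b1) x'"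
  by (rule two_divisors_label[OF lb(2) d(2) d(4)[symmetric]])
 have z: "cf u1 x = 0" "cf u1 x' = 0" "cf u3 x = 0" "cf u3 x' = 0" using X(2,3) dis e by (auto simp: in_keys_iff disjoint_iff)
 obtain a where a: "a \<in> nonfull u1 w12" using tri_nonfull[OF t] by blast
 obtain b where b: "b \<in> nonfull u3 w23" using tri_nonfull[OF tri_swap12[OF tri_swap23[OF tri_swap12[OF t]]]] by blast
 obtain r0 where r0: "represents b0 r0 {a}" using single_divisor_label(3)[OF lb(1) d(1) nonfull_ks[OF a]] by blast
 obtain r2 where r2: "represents b2 r2 {b}" using single_divisor_label(3)[OF lb(3) d(3) nonfull_ks[OF b]] by blast
 show ?thesis
 proof (rule separated_triple[OF w small r0 X(1) r2])
  show "{a} \<union> {x, x'} ~: Lam (fst b0 + fst b1)"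
  proof (rule not_LamI[OF g(1)])
   show "mdvd w12 (fst b0 + fst b1)" using g(3) v(3) e unfolding mdvd_def lookup_add by (meson add_left_mono order_trans)
   fix i assume "i \<in> {a} \<union> {x, x'}"
   thus "cf w12 i < cf (fst b0 + fst b1) i"
    using a X(4,5) w12[of x] w12'[of x'] z e by (auto simp: lookup_add nonfull_def)
  qed
  show "{x, x'} \<union> {b} ~: Lam (fst b1 + fst b2)"
  proof (rule not_LamI[OF g(2)])
   show "mdvd w23 (fst b1 + fst b2)" using g(4) v(3) e unfolding mdvd_def lookup_add by (meson add_right_mono order_trans)
   fix i assume "i \<in> {x, x'} \<union> {b}"
   thus "cf w23 i < cf (fst b1 + fst b2) i"
    using b X(4,5) w23[of x] w23'[of x'] z e by (auto simp: lookup_add nonfull_def)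
  qed
 qed
qed

text \<open>By \<open>same_third\<close> both w12 and w13 are full at neither of the two variables
  representing the end letter. With y and y' distinct, z is chosen such that w13 is full on none of
  the five variables.\<close>

lemma double_end_lemma:
 assumes t: "tri u1 u2 u3 w12 w13 w23" and G: "gens \<subseteq> {v, u1, u2, u3, w12, w13, w23}"
  and b: "b \<in> labels" "divs (fst b) = {u1, v}" "v ~= u1" and dis: "ks (fst b) \<inter> ks u2 = {}" "ks (fst b) \<inter> ks u3 = {}"
 shows "\<exists>X c. \<exists>y\<in>nonfull u2 w12. \<exists>y'\<in>nonfull u2 w23. \<exists>z\<in>nonfull u3 w23. represents b c X &
  insert y X ~: Lam (fst b + u2) & (y = y' | X \<union> {y, y', z} ~: Lam (fst b + u2 + u3))"
proof -
 note c2 = tri_cf2[OF t]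
 have g: "w12 \<in> gens" "w13 \<in> gens" "mdvd w12 (u1 + u2)" "mdvd w13 (u1 + u3)" using t by (simp_all add: tri_def)
 have v: "v \<in> gens" "mdvd v (fst b)" "mdvd u1 (fst b)" using b(2) by (auto simp: divs_def)
 have kv: "ks v \<subseteq> ks (fst b)" "mon v" using mdvd_keys[OF v(2)] label_lval(3)[OF b(1)] by auto
 have dv: "ks v \<inter> ks u2 = {}" "ks v \<inter> ks u3 = {}" using kv dis by blast+
 have "mdvd w12 (v + u2)" by (rule same_third[OF t G v(1) b(3) kv(2) dv])
 hence w12: "cf w12 i <= cf v i + cf u2 i" for i by (simp add: mdvd_def lookup_add)
 have "mdvd w13 (v + u3)" by (rule same_third[OF tri_swap23[OF t] _ v(1) b(3) kv(2) dv(2,1)]) (use G in blast)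
 hence w13: "cf w13 i <= cf v i + cf u3 i" for i by (simp add: mdvd_def lookup_add)
 have w12': "cf w12 i <= cf u1 i + cf u2 i" and w13': "cf w13 i <= cf u1 i + cf u3 i" for i
  using g(3,4) by (simp_all add: mdvd_def lookup_add)
 obtain x x' c where X: "represents b c {x, x'}" "x \<in> ks (fst b)" "x' \<in> ks (fst b)" "cf v x < cf (fst b) x" "cf u1 x' < cf (fst b) x'"
  by (rule two_divisors_label[OF b(1,2) b(3)[symmetric]])
 have z: "cf u2 x = 0" "cf u2 x' = 0" "cf u3 x = 0" "cf u3 x' = 0" using X(2,3) dis by (auto simp: in_keys_iff disjoint_iff)
 obtain y y' a where y: "y \<in> nonfull u2 w12" "y' \<in> nonfull u2 w23" "a \<in> nonfull u3 w23" "y = y' | a \<in> nonfull u3 w13"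
  using end_variables[OF t G v(1) b(3) dv] by blast
 note k = nonfull_ks[OF y(1)] nonfull_ks[OF y(2)] nonfull_ks[OF y(3)]
 have "insert y {x, x'} ~: Lam (fst b + u2)"
 proof (rule not_LamI[OF g(1)])
  show "mdvd w12 (fst b + u2)" using g(3) v(3) unfolding mdvd_def lookup_add by (meson add_right_mono order_trans)
  fix i assume "i \<in> insert y {x, x'}"
  thus "cf w12 i < cf (fst b + u2) i"
   using y(1) X(4,5) w12[of x] w12'[of x'] z by (auto simp: lookup_add nonfull_def)
 qed
 moreover have "y = y' | {x, x'} \<union> {y, y', a} ~: Lam (fst b + u2 + u3)"
 proof (cases "y = y'")
  case False
  hence a: "a \<in> nonfull u3 w13" using y(4) by blast
  have "{x, x'} \<union> {y, y', a} ~: Lam (fst b + u2 + u3)"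
  proof (rule not_LamI[OF g(2)])
   show "mdvd w13 (fst b + u2 + u3)" unfolding mdvd_def lookup_add
   proof
    fix i
    show "cf w13 i <= cf (fst b) i + cf u2 i + cf u3 i" using w13'[of i] v(3) unfolding mdvd_def by (meson add_le_mono add_right_mono le_add1 order_refl order_trans)
   qed
   fix i assume "i \<in> {x, x'} \<union> {y, y', a}"
   thus "cf w13 i < cf (fst b + u2 + u3) i"
    using a X(4,5) w13[of x] w13'[of x'] z c2[OF k(1)] c2[OF k(2)] by (auto simp: lookup_add nonfull_def)
  qed
  thus ?thesis by blast
 qed blast
 ultimately show ?thesis using X(1) y(1-3) by blast
qed

lemma double_left_triple:
 assumes w: "[b0, b1, b2] \<in> words"
  and small: "PROP smaller_good [b0, b1, b2]"
  and t: "tri u1 u2 u3 w12 w13 w23" and G: "gens \<subseteq> {v, u1, u2, u3, w12, w13, w23}"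
  and d: "divs (fst b0) = {u1, v}" "divs (fst b1) = {u2}" "divs (fst b2) = {u3}" "v ~= u1"
  and dis: "ks (fst b0) \<inter> ks (fst b1) = {}" "ks (fst b0) \<inter> ks (fst b2) = {}"
 shows "\<exists>y. dd y = Oword gam [b0, b1, b2]"
proof -
 have lb: "b0 \<in> labels" "b1 \<in> labels" "b2 \<in> labels" using w by auto
 have e: "fst b1 = u2" "fst b2 = u3" "fst (snd b1) = 1" using single_divisor_label(1,2) lb d by blast+
 have g: "w23 \<in> gens" "mdvd w23 (u2 + u3)" "u2 \<in> gens" using t by (simp_all add: tri_def)
 obtain X c y y' z where h: "y \<in> nonfull u2 w12" "y' \<in> nonfull u2 w23" "z \<in> nonfull u3 w23" "represents b0 c X"
  "insert y X ~: Lam (fst b0 + u2)" "y = y' | X \<union> {y, y', z} ~: Lam (fst b0 + u2 + u3)"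
  using double_end_lemma[OF t G lb(1) d(1,4)] dis e by blast
 note k = nonfull_ks[OF h(1)] nonfull_ks[OF h(2)] nonfull_ks[OF h(3)]
 obtain r1 where r1: "represents b1 r1 {y}" using single_divisor_label(3)[OF lb(2) d(2) k(1)] by blast
 obtain r2 where r2: "represents b2 r2 {z}" using single_divisor_label(3)[OF lb(3) d(3) k(3)] by blast
 have U: "X \<union> ({y, y'} \<union> {z}) = X \<union> {y, y', z}" by auto
 show ?thesis by (rule linked_triple[OF w small h(4) r1 r2, where y' = y'])
   (insert tri_pair[OF tri_231[OF t] h(2,3)] e k g h(5,6), simp_all only: U add.assoc, blast+)
qed

lemma double_right_triple:
 assumes w: "[b0, b1, b2] \<in> words"
  and small: "PROP smaller_good [b0, b1, b2]"
  and t: "tri u1 u2 u3 w12 w13 w23" and G: "gens \<subseteq> {v, u1, u2, u3, w12, w13, w23}"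
  and d: "divs (fst b0) = {u1}" "divs (fst b1) = {u2}" "divs (fst b2) = {u3, v}" "v ~= u3"
  and dis: "ks (fst b0) \<inter> ks (fst b2) = {}" "ks (fst b1) \<inter> ks (fst b2) = {}"
 shows "\<exists>y. dd y = Oword gam [b0, b1, b2]"
proof -
 have G': "gens \<subseteq> {v, u3, u2, u1, w23, w13, w12}" using G by blast
 have lb: "b0 \<in> labels" "b1 \<in> labels" "b2 \<in> labels" using w by auto
 have e: "fst b1 = u2" "fst b0 = u1" "fst (snd b1) = 1" using single_divisor_label(1,2) lb d by blast+
 have g: "w12 \<in> gens" "mdvd w12 (u1 + u2)" "u2 \<in> gens" using t by (simp_all add: tri_def)
 obtain X c y y' z where h: "y \<in> nonfull u2 w23" "y' \<in> nonfull u2 w12" "z \<in> nonfull u1 w12" "represents b2 c X"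
  "insert y X ~: Lam (fst b2 + u2)" "y = y' | X \<union> {y, y', z} ~: Lam (fst b2 + u2 + u1)"
  using double_end_lemma[OF tri_321[OF t] G' lb(3) d(3,4)] dis e by blast
 note k = nonfull_ks[OF h(1)] nonfull_ks[OF h(2)] nonfull_ks[OF h(3)]
 obtain r1 where r1: "represents b1 r1 {y'}" using single_divisor_label(3)[OF lb(2) d(2) k(2)] by blast
 obtain r0 where r0: "represents b0 r0 {z}" using single_divisor_label(3)[OF lb(1) d(1) k(3)] by blast
 have U: "{z} \<union> ({y', y} \<union> X) = X \<union> {y, y', z}" by auto
 have ac: "fst b2 + u2 = u2 + fst b2" "u2 + fst b2 + u1 = u1 + (u2 + fst b2)" by (simp_all add: add_ac)
 show ?thesis by (rule linked_triple[OF w small r0 r1 h(4), where y' = y])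
   (insert tri_pair[OF t h(3,2)] e k g h(5,6), simp_all only: U ac insert_commute, blast+)
qed

lemma golod_if_seven_generators:
 assumes fin: "finite gens" and card: "card gens <= 7" and w: "w \<in> words" "w ~= []"
 shows "wgood w"
proof (rule all_words_good_coprimeI[OF _ w])
 fix w f assume w: "w \<in> words" "length w >= 3" "coprime_word w"
  and small: "PROP smaller_good w"
  and f: "Oword gam w = lift (wdeg w) f" "mon (wdeg w)" "cyc (wdeg w) f" "hp (wp w + length w - 2) f"
 define k where "k = length w"
 define m where "m i = fst (w ! i)" for i
 have lab: "w ! i \<in> labels" if "i < k" for i using w(1) that by (auto simp: in_lists_conv_set k_def)
 have mon: "mon (m i)" if "i < k" for i using label_lval(3)[OF lab[OF that]] by (simp add: m_def)
 have dis: "ks (m i) \<inter> ks (m j) = {}" if "i < k" "j < k" "i ~= j" for i j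
  using w(3) that by (cases i j rule: linorder_cases) (auto simp: coprime_word_def m_def k_def)
 have ne: "divs (m i) ~= {}" "\<forall>g\<in>divs (m i). full (m i) g ~= {}" if "i < k" for i
  using label_nonempty[of "m i" "fst (snd (w ! i))" "snd (snd (w ! i))"] lab[OF that] by (simp_all add: m_def)
 have dk: "ks g \<subseteq> ks (m i)" "g \<in> gens" "g ~= 0" if ig: "i < k" "g \<in> divs (m i)" for i g
 proof -
  show "ks g \<subseteq> ks (m i)" "g \<in> gens" using ig(2) mdvd_keys by (auto simp: divs_def)
  have "full (m i) g ~= {}" using ne(2)[OF ig(1)] ig(2) by blast
  then obtain v where "v \<in> ks (m i)" "cf g v = cf (m i) v" by (auto simp: full_def)
  thus "g ~= 0" by (auto simp: in_keys_iff)
 qed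
 define u where "u i = (SOME g. g \<in> divs (m i))" for i
 have u: "u i \<in> divs (m i)" if "i < k" for i unfolding u_def using ne(1)[OF that] by (simp add: some_in_eq)
 have ug: "u i \<in> gens" "mon (u i)" "u i ~= 0" if "i < k" for i
  using dk[OF that u[OF that]] mon[OF that] by auto
 have ud: "ks (u i) \<inter> ks (u j) = {}" if "i < k" "j < k" "i ~= j" for i j
  using dis[OF that] dk(1)[OF that(1) u[OF that(1)]] dk(1)[OF that(2) u[OF that(2)]] by blast
 have ex: "\<exists>g. g \<in> gens & g ~= u i & g ~= u j & mdvd g (u i + u j)" if "i < k" "j < k" "i ~= j" for i j
  using third_generator[OF ug(1)[OF that(1)] ug(1)[OF that(2)] ug(2)[OF that(1)] ug(2)[OF that(2)] ud[OF that] ug(3)[OF that(1)] ug(3)[OF that(2)]] by blast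
 define W where "W i j = (SOME g. g \<in> gens & g ~= u i & g ~= u j & mdvd g (u i + u j))" for i j
 have W: "W i j \<in> gens" "W i j ~= u i" "W i j ~= u j" "mdvd (W i j) (u i + u j)" if "i < k" "j < k" "i ~= j" for i j
  unfolding W_def using someI_ex[OF ex[OF that]] by blast+
 \<comment> \<open>The letters whose variables g involves. It tells apart the generators belonging
   to single letters and those belonging to pairs.\<close>
 define T where "T g = {i. i < k & ks g \<inter> ks (m i) ~= {}}" for g :: monomial
 have Td: "T g = {i}" if "i < k" "g \<in> divs (m i)" for i g
 proof -
  have "ks g ~= {}" using dk(3)[OF that] by simp
  moreover have "ks g \<inter> ks (m j) = {}" if "j < k" "j ~= i" for j using dk(1)[of i g] \<open>i < k\<close> \<open>g \<in> divs (m i)\<close> dis[of i j] that by blast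
  moreover have "ks g \<inter> ks (m i) = ks g" using dk(1)[OF that] by blast
  ultimately show ?thesis using that(1) by (auto simp: T_def simp del: keys_eq_empty)
 qed
 have TW: "T (W i j) = {i, j}" if ij: "i < k" "j < k" "i ~= j" for i j
 proof -
  have sub: "ks (W i j) \<subseteq> ks (u i) \<union> ks (u j)"
   using mdvd_keys[OF W(4)[OF ij]] Poly_Mapping.keys_add[of "u i" "u j"] by blast
  have meets: "ks (W i j) \<inter> ks (m a) ~= {}" if ab: "{a, b} = {i, j}" "a ~= b" for a b
  proof
   assume em: "ks (W i j) \<inter> ks (m a) = {}"
   have ak: "a < k" "b < k" using ab ij by (auto simp: doubleton_eq_iff)
   have "cf (W i j) x <= cf (u b) x" for x
   proof (cases "x \<in> ks (u a)")
    case True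
    hence "x ~: ks (W i j)" using em dk(1)[OF ak(1) u[OF ak(1)]] by blast
    thus ?thesis by (simp add: in_keys_iff)
   next
    case False
    have "cf (W i j) x <= cf (u i) x + cf (u j) x" using W(4)[OF ij] by (simp add: mdvd_def lookup_add)
    also have "... = cf (u a) x + cf (u b) x" using ab by (auto simp: doubleton_eq_iff)
    finally show ?thesis using False by (simp add: in_keys_iff)
   qed
   hence "mdvd (W i j) (u b)" by (simp add: mdvd_def)
   hence "W i j = u b" using gens_mdvd W(1)[OF ij] ug(1)[OF ak(2)] by blast
   thus False using W(2,3)[OF ij] ab by (auto simp: doubleton_eq_iff)
  qed
  have "ks (W i j) \<inter> ks (m l) = {}" if "l < k" "l ~= i" "l ~= j" for l
   using sub dis[OF that(1) ij(1)] dis[OF that(1) ij(2)] dk(1)[OF ij(1) u[OF ij(1)]] dk(1)[OF ij(2) u[OF ij(2)]] that by blast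
  thus ?thesis using meets[of i j] meets[of j i] ij by (auto simp: T_def insert_commute)
 qed
 have k3: "k = 3"
 proof (rule ccontr)
  assume "k ~= 3"
  \<comment> \<open>Four letters already give eight generators with distinct sets T.\<close>
  hence k4: "k > 3" using w(2) by (simp add: k_def)
  have "T ` {u 0, u 1, u 2, u 3, W 0 1, W 0 2, W 0 3, W 1 2} = {{0}, {1}, {2}, {3}, {0, 1}, {0, 2}, {0, 3}, {1, 2}}"
   using k4 Td[OF _ u] TW by simp
  moreover have "card {{0}, {1}, {2}, {3}, {0, 1}, {0, 2}, {0, 3}, {1, 2 :: nat}} = 8" by (simp add: doubleton_eq_iff)
  moreover have "{u 0, u 1, u 2, u 3, W 0 1, W 0 2, W 0 3, W 1 2} \<subseteq> gens" using ug(1) W(1) k4 by simp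
  ultimately show False using card_image_le[OF finite_subset[OF _ fin], of "{u 0, u 1, u 2, u 3, W 0 1, W 0 2, W 0 3, W 1 2}" T]
    card_mono[OF fin, of "{u 0, u 1, u 2, u 3, W 0 1, W 0 2, W 0 3, W 1 2}"] card by simp
 qed
 define u1 where "u1 = u 0" define u2 where "u2 = u 1" define u3 where "u3 = u 2"
 define w12 where "w12 = W 0 1" define w13 where "w13 = W 0 2" define w23 where "w23 = W 1 2"
 note defs = u1_def u2_def u3_def w12_def w13_def w23_def
 have t: "tri u1 u2 u3 w12 w13 w23" unfolding tri_def defs using ug W ud k3 by simp
 let ?six = "{u1, u2, u3, w12, w13, w23}"
 have Tv: "T u1 = {0}" "T u2 = {1}" "T u3 = {2}" "T w12 = {0, 1}" "T w13 = {0, 2}" "T w23 = {1, 2}"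
  using Td[OF _ u] TW k3 by (simp_all add: defs)
 have "card (T ` ?six) = 6" by (simp add: Tv doubleton_eq_iff)
 hence "card ?six >= 6" using card_image_le[of ?six T] by simp
 moreover have "?six \<subseteq> gens" using t by (simp add: tri_def)
 ultimately have "card (gens - ?six) <= 1" using card card_Diff_subset[of ?six gens] by simp
 hence "\<forall>a\<in>gens - ?six. \<forall>b\<in>gens - ?six. a = b"
  unfolding One_nat_def card_le_Suc0_iff_eq[OF finite_Diff[OF fin, of ?six]] .
 moreover have "\<exists>v. S \<subseteq> {v}" if "\<forall>a\<in>S. \<forall>b\<in>S. a = b" for S :: "monomial set" using that by blast
 ultimately obtain v where "gens - ?six \<subseteq> {v}" by meson
 hence G: "gens \<subseteq> {v, u1, u2, u3, w12, w13, w23}" by blast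
 obtain b0 b1 b2 where we: "w = [b0, b1, b2]" using k3 by (auto simp: k_def numeral_3_eq_3 length_Suc_conv)
 have mb: "m 0 = fst b0" "m 1 = fst b1" "m 2 = fst b2" by (simp_all add: m_def we)
 have ub: "u1 \<in> divs (fst b0)" "u2 \<in> divs (fst b1)" "u3 \<in> divs (fst b2)" using u k3 by (simp_all add: defs flip: mb)
 have dm: "ks (fst b0) \<inter> ks (fst b1) = {}" "ks (fst b0) \<inter> ks (fst b2) = {}" "ks (fst b1) \<inter> ks (fst b2) = {}"
  using dis k3 by (simp_all flip: mb)
 have only: "divs (m i) \<subseteq> {v, u i}" if "i < 3" for i
 proof
  fix g assume g: "g \<in> divs (m i)"
  have Tg: "T g = {i}" using Td[of i g] g that k3 by simp
  have "g \<in> gens" using g by (simp add: divs_def)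
  hence "g = v | g = u1 | g = u2 | g = u3 | g = w12 | g = w13 | g = w23" using G by blast
  moreover have "T w12 ~= {i}" "T w13 ~= {i}" "T w23 ~= {i}" unfolding Tv by auto
  ultimately show "g \<in> {v, u i}" using Tv(1-3) Tg unfolding defs by (metis insertCI singleton_inject)
 qed
 have D: "divs (fst b0) = {u1} | v ~= u1 & divs (fst b0) = {u1, v}" "divs (fst b1) = {u2} | v ~= u2 & divs (fst b1) = {u2, v}"
  "divs (fst b2) = {u3} | v ~= u3 & divs (fst b2) = {u3, v}"
  using only[of 0] only[of 1] only[of 2] ub mb by (auto simp: defs)
 \<comment> \<open>The seventh generator v can divide at most one letter, so at most one letter has
   two divisors.\<close>
 have vT: "v \<in> divs (fst b0) ==> T v = {0}" "v \<in> divs (fst b1) ==> T v = {1}" "v \<in> divs (fst b2) ==> T v = {2}"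
  using Td k3 by (simp_all flip: mb)
 have vne: "~ (v \<in> divs (fst b0) & v \<in> divs (fst b1))" "~ (v \<in> divs (fst b0) & v \<in> divs (fst b2))"
  "~ (v \<in> divs (fst b1) & v \<in> divs (fst b2))"
  using vT(1,2) vT(1,3) vT(2,3) by (metis singleton_inject zero_neq_one zero_neq_numeral one_eq_numeral_iff numeral_eq_iff num.distinct(1))+
 have D': "divs (fst b0) = {u1} | v ~= u1 & divs (fst b0) = {u1, v} & v \<in> divs (fst b0)"
  "divs (fst b1) = {u2} | v ~= u2 & divs (fst b1) = {u2, v} & v \<in> divs (fst b1)"
  "divs (fst b2) = {u3} | v ~= u3 & divs (fst b2) = {u3, v} & v \<in> divs (fst b2)"
  using D(1) D(2) D(3) by (metis insertCI)+
 have w': "[b0, b1, b2] \<in> words" using w(1) we by simp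
 have small': "wgood w'" if "w' \<in> words" "w' ~= []" "smaller w' [b0, b1, b2]" for w'
  using small[of w'] that we by simp
 have "\<exists>y. dd y = Oword gam [b0, b1, b2]"
 proof -
  consider "divs (fst b0) = {u1}" "divs (fst b1) = {u2}" "divs (fst b2) = {u3}"
   | "v ~= u1" "divs (fst b0) = {u1, v}" "divs (fst b1) = {u2}" "divs (fst b2) = {u3}"
   | "v ~= u2" "divs (fst b0) = {u1}" "divs (fst b1) = {u2, v}" "divs (fst b2) = {u3}"
   | "v ~= u3" "divs (fst b0) = {u1}" "divs (fst b1) = {u2}" "divs (fst b2) = {u3, v}" using D' vne by argo
  thus ?thesis
  proof cases
   case 1
   thus ?thesis using singles_triple[OF w' small' t G] by blast
  next
   case 2
   thus ?thesis using double_left_triple[OF w' small' t G] dm by blast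
  next
   case 3
   thus ?thesis using double_middle_triple[OF w' small' t G] dm by blast
  next
   case 4
   thus ?thesis using double_right_triple[OF w' small' t G] dm by blast
  qed
 qed
 hence "\<exists>y. dd y = Oword gam w" by (simp add: we)
 thus "exact (wdeg w) f" using exact_iff[OF f(2)] f(1,3) by (simp add: cyc_def)
qed

end

section \<open>The Koszul complex of the quotient ring\<close>

context monomial_koszul
begin

section \<open>The quotient ring and normal forms\<close>

abbreviation Rn :: "'k polynomial ring" where "Rn \<equiv> poly_ring n"

definition ideal_of :: "'k polynomial set" where "ideal_of = {f \<in> carrier Rn. ks f \<subseteq> A}"

lemma carrier_Rn: "f \<in> carrier Rn \<longleftrightarrow> (\<forall>t. cf f t ~= 0 --> ks t \<subseteq> {..<n})"
 by (auto simp: poly_ring_def monomials_def in_keys_iff)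

lemma ops_Rn [simp]: "x \<oplus>\<^bsub>Rn\<^esub> y = x + y" "x \<otimes>\<^bsub>Rn\<^esub> y = x * y" "\<zero>\<^bsub>Rn\<^esub> = 0" "\<one>\<^bsub>Rn\<^esub> = 1"
 by (simp_all add: poly_ring_def)

interpretation Rn: cring Rn by (rule cring_poly_ring)

lemma Rn_closed: "x \<in> carrier Rn ==> y \<in> carrier Rn ==> x + y \<in> carrier Rn" "x \<in> carrier Rn ==> y \<in> carrier Rn ==> x * y \<in> carrier Rn"
 "0 \<in> carrier Rn" "1 \<in> carrier Rn" "x \<in> carrier Rn ==> - x \<in> carrier Rn"
 using Rn.add.m_closed[of x y] Rn.m_closed[of x y] Rn.zero_closed Rn.one_closed by (simp_all add: poly_ring_def)

lemma Rn_sum: "(!!i. i \<in> S ==> f i \<in> carrier Rn) ==> sum f S \<in> carrier Rn"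
 by (induction S rule: infinite_finite_induct) (auto intro: Rn_closed)

lemma Rn_sign: "x \<in> carrier Rn ==> (-1) ^ k * x \<in> carrier Rn"
 by (cases "even k") (auto intro: Rn_closed)

lemma Rn_minus: "x \<in> carrier Rn ==> \<ominus>\<^bsub>Rn\<^esub> x = - x"
 using Rn.minus_equality[of "- x" x] Rn_closed(5)[of x] by simp

lemma var_Rn: "i < n ==> var i \<in> carrier Rn"
 by (auto simp: carrier_Rn var_def mono_poly_def lookup_single when_def)

lemma mult_in_A:
 assumes "ks f \<subseteq> A" shows "ks (f * g) \<subseteq> (A :: monomial set)"
proof
 fix t assume "t \<in> ks (f * g)"
 then obtain r s where "t = r + s" "r \<in> ks f" using Poly_Mapping.keys_mult[of f g] by blast
 thus "t \<in> A" using assms upset[of r t] by (auto simp: mdvd_def lookup_add)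
qed

lemma ideal_ideal_of: "ideal ideal_of Rn"
proof (rule idealI[OF Rn.ring_axioms])
 show "subgroup ideal_of (add_monoid Rn)"
 proof (rule group.subgroupI[OF Rn.add.group_axioms])
  show "ideal_of \<subseteq> carrier (add_monoid Rn)" "ideal_of ~= {}"
   using Rn_closed(3) by (auto simp: ideal_of_def)
  fix a assume a: "a \<in> ideal_of"
  hence "inv\<^bsub>add_monoid Rn\<^esub> a = - a" using Rn_minus[of a] by (simp add: ideal_of_def a_inv_def)
  thus "inv\<^bsub>add_monoid Rn\<^esub> a \<in> ideal_of" using a Rn_closed(5) by (simp add: ideal_of_def)
  fix b assume b: "b \<in> ideal_of"
  have "ks (a + b) \<subseteq> A" using a b Poly_Mapping.keys_add[of a b] by (auto simp: ideal_of_def)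
  thus "a \<otimes>\<^bsub>add_monoid Rn\<^esub> b \<in> ideal_of" using a b Rn_closed(1) by (simp add: ideal_of_def)
 qed
next
 fix a x assume "a \<in> ideal_of" "x \<in> carrier Rn"
 thus "x \<otimes>\<^bsub>Rn\<^esub> a \<in> ideal_of" "a \<otimes>\<^bsub>Rn\<^esub> x \<in> ideal_of"
  using mult_in_A[of a x] Rn_closed(2) by (auto simp: ideal_of_def mult.commute)
qed

interpretation I: ideal ideal_of Rn by (rule ideal_ideal_of)

abbreviation Qn :: "'k polynomial set ring" where "Qn \<equiv> Rn Quot ideal_of"

interpretation Qn: cring Qn by (rule I.quotient_is_cring[OF cring_poly_ring])

definition cls :: "'k polynomial => 'k polynomial set" where "cls p = ideal_of +>\<^bsub>Rn\<^esub> p"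

text \<open>Two classes agree if the difference of the polynomials is supported on A, that is, if
  nothing of it survives in the normal form.\<close>

lemma cls_eq_iff: "p \<in> carrier Rn ==> q \<in> carrier Rn ==> cls p = cls q \<longleftrightarrow> nfp p = nfp q"
proof -
 assume pq: "p \<in> carrier Rn" "q \<in> carrier Rn"
 have "cls p = cls q \<longleftrightarrow> p \<ominus>\<^bsub>Rn\<^esub> q \<in> ideal_of"
  unfolding cls_def using Rn.quotient_eq_iff_same_a_r_cos[OF ideal_ideal_of pq] by simp
 also have "p \<ominus>\<^bsub>Rn\<^esub> q = p - q" using Rn_minus[OF pq(2)] by (simp add: a_minus_def)
 also have "p - q \<in> ideal_of \<longleftrightarrow> ks (p - q) \<subseteq> A"
 proof -
  have "p + - q \<in> carrier Rn" by (intro Rn_closed pq)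
  hence "p - q \<in> carrier Rn" by (simp only: diff_conv_add_uminus)
  thus ?thesis unfolding ideal_of_def by blast
 qed
 also have "... = (\<forall>t. cf (p - q) t ~= 0 --> t \<in> A)" by (simp only: subset_iff in_keys_iff)
 also have "... = (\<forall>t. cf (nfp p) t = cf (nfp q) t)" by (auto simp: cf_nfp lookup_minus)
 also have "... = (nfp p = nfp q)" by (auto intro: poly_mapping_eqI)
 finally show ?thesis .
qed

lemma cls_ops:
 assumes "p \<in> carrier Rn" "q \<in> carrier Rn"
 shows "cls p \<in> carrier Qn" "cls p \<oplus>\<^bsub>Qn\<^esub> cls q = cls (p + q)" "cls p \<otimes>\<^bsub>Qn\<^esub> cls q = cls (p * q)"
 using I.rcos_ring_hom assms by (auto simp: ring_hom_def cls_def)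

lemma cls_carrier: "p \<in> carrier Rn ==> cls p \<in> carrier Qn" using cls_ops(1)[of p p] by simp

lemma cls_zero: "cls 0 = \<zero>\<^bsub>Qn\<^esub>"
 using Qn.l_zero ring_hom_zero[OF I.rcos_ring_hom Rn.ring_axioms Qn.ring_axioms] by (simp add: cls_def)

lemma cls_minus: "p \<in> carrier Rn ==> \<ominus>\<^bsub>Qn\<^esub> cls p = cls (- p)"
 using Qn.minus_equality[of "cls (- p)" "cls p"] cls_ops[of "- p" p] cls_ops[of p p] cls_ops[of "- p" "- p"] Rn_closed(5)[of p] cls_zero
 by simp

lemma signed_cls: "p \<in> carrier Rn ==> signed Qn k (cls p) = cls ((-1) ^ k * p)"
 by (simp add: signed_def cls_minus)

lemma finsum_cls: "finite S ==> (!!i. i \<in> S ==> f i \<in> carrier Rn) ==> (\<Oplus>\<^bsub>Qn\<^esub>i\<in>S. cls (f i)) = cls (sum f S)"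
proof (induction S rule: finite_induct)
 case (insert i S)
 thus ?case by (subst Qn.finsum_insert) (auto simp: cls_ops Rn_sum intro: cls_carrier)
qed (simp add: cls_zero)

lemma carrier_Qn: "c \<in> carrier Qn ==> \<exists>p\<in>carrier Rn. c = cls p"
 by (auto simp: FactRing_def A_RCOSETS_def' cls_def)

section \<open>The isomorphism of the model with the Koszul complex\<close>

definition normal :: "'k elt set"
 where "normal = {c. \<forall>U t. cf (c U) t ~= 0 --> U \<subseteq> {..<n} & ks t \<subseteq> {..<n} & t ~: A}"

text \<open>Residue classes are taken coefficientwise. Restricted to \<open>normal\<close> this is a
  bijection onto the carrier that respects products and differentials, as every residue class
  contains exactly one normal form.\<close>

definition Phi :: "'k elt => nat set => 'k polynomial set"
 where "Phi c = (\<lambda>U\<in>Pow {..<n}. cls (c U))"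

abbreviation Kn :: "(nat set => 'k polynomial set) dga" where "Kn \<equiv> quotient_koszul n ideal_of"

lemma homog_p_normal: "homog_p p \<subseteq> normal" unfolding homog_p_def normal_def by blast

lemma normal_Rn: "c \<in> normal ==> c U \<in> carrier Rn" by (auto simp: normal_def carrier_Rn)

lemma normal_zero: "0 \<in> normal" and normal_add: "x \<in> normal ==> y \<in> normal ==> x + y \<in> normal"
 and normal_minus: "x \<in> normal ==> - x \<in> normal"
proof -
 show "0 \<in> normal" by (simp add: normal_def)
 show "- x \<in> normal" if "x \<in> normal" using that by (simp add: normal_def)
 show "x + y \<in> normal" if xy: "x \<in> normal" "y \<in> normal" unfolding normal_def mem_Collect_eq
 proof (intro allI impI)
  fix U t assume "cf ((x + y) U) t ~= 0"
  hence "cf (x U) t ~= 0 | cf (y U) t ~= 0" by (auto simp: lookup_add)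
  thus "U \<subseteq> {..<n} & ks t \<subseteq> {..<n} & t ~: A" using xy unfolding normal_def by blast
 qed
qed

lemma nf_normal: "c \<in> normal ==> nf c = c"
proof
 fix U assume c: "c \<in> normal"
 show "nf c U = c U"
 proof (rule poly_mapping_eqI)
  fix t show "cf (nf c U) t = cf (c U) t" using c by (auto simp: nf_def cf_nfp normal_def)
 qed
qed

lemma nf_in_normal: "(!!U. U \<subseteq> {..<n} ==> c U \<in> carrier Rn) ==> nf c \<in> normal"
 by (auto simp: normal_def nf_def cf_nfp carrier_Rn split: if_splits)

lemma emul_Rn: "x \<in> normal ==> y \<in> normal ==> emul x y U \<in> carrier Rn"
 unfolding emul_def by (intro Rn_sum Rn_sign Rn_closed normal_Rn)

lemma ediff_Rn: "x \<in> normal ==> ediff n var x U \<in> carrier Rn"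
 unfolding ediff_def contr_def by (intro Rn_sum Rn_closed(2)) (auto intro: Rn_sign normal_Rn Rn_closed var_Rn)

lemma normal_mul: "x \<in> normal ==> y \<in> normal ==> x \<cdot> y \<in> normal"
 unfolding mul_def by (intro nf_in_normal emul_Rn)

lemma normal_dd: "x \<in> normal ==> dd x \<in> normal"
 unfolding dd_def by (intro nf_in_normal ediff_Rn)

lemma Phi_eq_iff: "x \<in> normal ==> y \<in> normal ==> Phi x = Phi y \<longleftrightarrow> x = y"
proof
 assume n: "x \<in> normal" "y \<in> normal" and e: "Phi x = Phi y"
 have "nf x = nf y"
 proof
  fix U
  show "nf x U = nf y U"
  proof (cases "U \<subseteq> {..<n}")
   case True
   hence "cls (x U) = cls (y U)" using fun_cong[OF e, of U] by (simp add: Phi_def)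
   thus ?thesis using cls_eq_iff[OF normal_Rn[OF n(1)] normal_Rn[OF n(2)]] True by (simp add: nf_def)
  qed (simp add: nf_def)
 qed
 thus "x = y" by (simp add: nf_normal n)
qed simp

lemma Phi_nf: "(!!U. U \<subseteq> {..<n} ==> c U \<in> carrier Rn) ==> Phi (nf c) = Phi c"
 unfolding Phi_def
proof (rule restrict_ext)
 fix U assume c: "!!U. U \<subseteq> {..<n} ==> c U \<in> carrier Rn" and U: "U \<in> Pow {..<n}"
 have "nf c \<in> normal" by (rule nf_in_normal[OF c])
 moreover have "nfp (nfp (c U)) = nfp (c U)" by (rule poly_mapping_eqI) (simp add: cf_nfp)
 ultimately show "cls (nf c U) = cls (c U)" using cls_eq_iff[OF normal_Rn[of "nf c" U] c[of U]] U by (simp add: nf_def)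
qed

lemma Kn_carrier: "carrier Kn = Phi ` normal"
proof
 show "Phi ` normal \<subseteq> carrier Kn"
 proof (rule image_subsetI)
  fix x assume x: "x \<in> normal"
  have "Phi x \<in> Pow {..<n} \<rightarrow>\<^sub>E carrier Qn"
   unfolding Phi_def restrict_PiE_iff using cls_carrier normal_Rn[OF x] by blast
  thus "Phi x \<in> carrier Kn" by (simp add: quotient_koszul_def koszul_def)
 qed
 show "carrier Kn \<subseteq> Phi ` normal"
 proof
  fix f assume f: "f \<in> carrier Kn"
  hence "\<forall>U\<in>Pow {..<n}. \<exists>p\<in>carrier Rn. f U = cls p" using carrier_Qn by (auto simp: quotient_koszul_def koszul_def)
  then obtain c where c: "!!U. U \<subseteq> {..<n} ==> c U \<in> carrier Rn" "!!U. U \<subseteq> {..<n} ==> f U = cls (c U)"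
   by (metis Pow_iff)
  have "f = Phi c"
  proof
   fix U show "f U = Phi c U"
    using f c(2) by (cases "U \<subseteq> {..<n}") (auto simp: Phi_def quotient_koszul_def koszul_def PiE_def extensional_def)
  qed
  hence e: "f = Phi (nf c)" using Phi_nf[OF c(1)] by simp
  show "f \<in> Phi ` normal" unfolding e by (rule imageI) (rule nf_in_normal[OF c(1)])
 qed
qed

lemma Phi_component:
 assumes "x \<in> normal" shows "Phi x \<in> component Kn p \<longleftrightarrow> x \<in> homog_p (int p)"
proof -
 have "Phi x \<in> Pow {..<n} \<rightarrow>\<^sub>E carrier Qn" using Kn_carrier assms by (auto simp: quotient_koszul_def koszul_def)
 moreover have "Phi x U = \<zero>\<^bsub>Qn\<^esub> \<longleftrightarrow> x U = 0" if U: "U \<subseteq> {..<n}" for U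
 proof -
  have "Phi x U = \<zero>\<^bsub>Qn\<^esub> \<longleftrightarrow> nfp (x U) = nfp 0"
   using cls_eq_iff[OF normal_Rn[OF assms] Rn_closed(3)] U by (simp add: Phi_def flip: cls_zero)
  also have "nfp (x U) = nf x U" using U by (simp add: nf_def)
  also have "nfp 0 = 0" by (rule poly_mapping_eqI) (simp add: cf_nfp)
  finally show ?thesis by (simp add: nf_normal[OF assms])
 qed
 ultimately have "Phi x \<in> component Kn p \<longleftrightarrow> (\<forall>U\<subseteq>{..<n}. x U ~= 0 --> card U = p)"
  by (auto simp: quotient_koszul_def koszul_def)
 also have "... \<longleftrightarrow> x \<in> homog_p (int p)"
 proof
  assume c: "\<forall>U\<subseteq>{..<n}. x U ~= 0 --> card U = p"
  have "x U ~= 0" if "cf (x U) t ~= 0" for U t using that by auto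
  thus "x \<in> homog_p (int p)" using assms c unfolding homog_p_def normal_def by blast
 next
  assume x: "x \<in> homog_p (int p)"
  have "\<exists>t. cf (x U) t ~= 0" if "x U ~= 0" for U using that by (metis lookup_zero poly_mapping_eqI)
  thus "\<forall>U\<subseteq>{..<n}. x U ~= 0 --> card U = p" using x by (fastforce simp: homog_p_def)
 qed
 finally show ?thesis .
qed

lemma Phi_zero: "Phi 0 = \<zero>\<^bsub>Kn\<^esub>" by (simp add: Phi_def quotient_koszul_def koszul_def cls_zero)

lemma Phi_add: "x \<in> normal ==> y \<in> normal ==> Phi x \<oplus>\<^bsub>Kn\<^esub> Phi y = Phi (x + y)"
 unfolding Phi_def quotient_koszul_def koszul_def by (simp add: cls_ops normal_Rn cong: restrict_cong)

lemma Phi_mul: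
 assumes "x \<in> normal" "y \<in> normal" shows "Phi x \<otimes>\<^bsub>Kn\<^esub> Phi y = Phi (x \<cdot> y)"
proof -
 have "Phi x \<otimes>\<^bsub>Kn\<^esub> Phi y = Phi (emul x y)"
  unfolding quotient_koszul_def koszul_def Phi_def dga.simps ring.simps monoid.simps partial_object.simps
 proof (rule restrict_ext)
  fix U :: "nat set" assume U: "U \<in> Pow {..<n}"
  hence fin: "finite (Pow U)" using finite_below_n by auto
  have "(\<Oplus>\<^bsub>Qn\<^esub>V\<in>Pow U. signed Qn (inversions V (U - V)) ((\<lambda>U\<in>Pow {..<n}. cls (x U)) V \<otimes>\<^bsub>Qn\<^esub> (\<lambda>U\<in>Pow {..<n}. cls (y U)) (U - V)))
    = (\<Oplus>\<^bsub>Qn\<^esub>V\<in>Pow U. cls ((-1) ^ inversions V (U - V) * (x V * y (U - V))))"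
  proof (rule Qn.finsum_cong')
   fix V assume "V \<in> Pow U"
   hence "V \<in> Pow {..<n}" "U - V \<in> Pow {..<n}" using U by auto
   thus "signed Qn (inversions V (U - V)) ((\<lambda>U\<in>Pow {..<n}. cls (x U)) V \<otimes>\<^bsub>Qn\<^esub> (\<lambda>U\<in>Pow {..<n}. cls (y U)) (U - V))
    = cls ((-1) ^ inversions V (U - V) * (x V * y (U - V)))"
    by (simp add: cls_ops signed_cls normal_Rn assms Rn_closed)
  qed (auto intro!: cls_carrier Rn_sign Rn_closed(2) normal_Rn[OF assms(1)] normal_Rn[OF assms(2)])
  also have "... = cls (emul x y U)"
   unfolding emul_def by (rule finsum_cls[OF fin]) (intro Rn_sign Rn_closed(2) normal_Rn[OF assms(1)] normal_Rn[OF assms(2)])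
  finally show "(\<Oplus>\<^bsub>Qn\<^esub>V\<in>Pow U. signed Qn (inversions V (U - V)) ((\<lambda>U\<in>Pow {..<n}. cls (x U)) V \<otimes>\<^bsub>Qn\<^esub> (\<lambda>U\<in>Pow {..<n}. cls (y U)) (U - V))) = cls (emul x y U)" .
 qed
 also have "... = Phi (x \<cdot> y)" unfolding mul_def using Phi_nf[of "emul x y"] emul_Rn[OF assms] by simp
 finally show ?thesis .
qed

lemma Phi_dd:
 assumes "x \<in> normal" shows "differential Kn (Phi x) = Phi (dd x)"
proof -
 have "differential Kn (Phi x) = Phi (ediff n var x)" unfolding quotient_koszul_def koszul_def Phi_def dga.simps
 proof (rule restrict_ext)
  fix U :: "nat set" assume U: "U \<in> Pow {..<n}"
  have "(\<Oplus>\<^bsub>Qn\<^esub>i\<in>{..<n} - U. signed Qn (card {j \<in> U. j < i}) ((ideal_of +>\<^bsub>Rn\<^esub> var i) \<otimes>\<^bsub>Qn\<^esub> (\<lambda>U\<in>Pow {..<n}. cls (x U)) (insert i U)))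
    = (\<Oplus>\<^bsub>Qn\<^esub>i\<in>{..<n} - U. cls ((-1) ^ below U i * (var i * x (insert i U))))"
  proof (rule Qn.finsum_cong')
   fix i assume "i \<in> {..<n} - U"
   hence "insert i U \<in> Pow {..<n}" "var i \<in> carrier Rn" using U var_Rn by auto
   thus "signed Qn (card {j \<in> U. j < i}) ((ideal_of +>\<^bsub>Rn\<^esub> var i) \<otimes>\<^bsub>Qn\<^esub> (\<lambda>U\<in>Pow {..<n}. cls (x U)) (insert i U))
    = cls ((-1) ^ below U i * (var i * x (insert i U)))"
    by (simp add: cls_def[symmetric] cls_ops signed_cls normal_Rn assms Rn_closed below_def)
  qed (auto intro!: cls_carrier Rn_sign Rn_closed(2) normal_Rn[OF assms] var_Rn)
  also have "... = cls (\<Sum>i\<in>{..<n} - U. (-1) ^ below U i * (var i * x (insert i U)))"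
   by (rule finsum_cls) (auto intro!: Rn_sign Rn_closed(2) normal_Rn[OF assms] var_Rn)
  also have "(\<Sum>i\<in>{..<n} - U. (-1) ^ below U i * (var i * x (insert i U))) = ediff n var x U"
   unfolding ediff_def contr_def by (rule sum.mono_neutral_cong_left) (auto simp: algebra_simps)
  finally show "(\<Oplus>\<^bsub>Qn\<^esub>i\<in>{..<n} - U. signed Qn (card {j \<in> U. j < i}) ((ideal_of +>\<^bsub>Rn\<^esub> var i) \<otimes>\<^bsub>Qn\<^esub> (\<lambda>U\<in>Pow {..<n}. cls (x U)) (insert i U))) = cls (ediff n var x U)" .
 qed
 also have "... = Phi (dd x)" unfolding dd_def using Phi_nf[of "ediff n var x"] ediff_Rn[OF assms] by simp
 finally show ?thesis .
qed

lemma abelian_group_Kn: "abelian_group Kn"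
proof (rule abelian_groupI)
 fix x y z assume "x \<in> carrier Kn" "y \<in> carrier Kn" "z \<in> carrier Kn"
 then obtain a b c where abc: "x = Phi a" "y = Phi b" "z = Phi c" "a \<in> normal" "b \<in> normal" "c \<in> normal"
  unfolding Kn_carrier by blast
 show "x \<oplus>\<^bsub>Kn\<^esub> y \<in> carrier Kn" "x \<oplus>\<^bsub>Kn\<^esub> y \<oplus>\<^bsub>Kn\<^esub> z = x \<oplus>\<^bsub>Kn\<^esub> (y \<oplus>\<^bsub>Kn\<^esub> z)" "x \<oplus>\<^bsub>Kn\<^esub> y = y \<oplus>\<^bsub>Kn\<^esub> x"
  using abc normal_add by (auto simp: Phi_add Kn_carrier add_ac)
next
 show "\<zero>\<^bsub>Kn\<^esub> \<in> carrier Kn" using Phi_zero normal_zero unfolding Kn_carrier by force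
next
 fix x assume "x \<in> carrier Kn"
 then obtain a where a: "x = Phi a" "a \<in> normal" unfolding Kn_carrier by blast
 show "\<zero>\<^bsub>Kn\<^esub> \<oplus>\<^bsub>Kn\<^esub> x = x" using Phi_add[OF normal_zero a(2)] a(1) by (simp add: Phi_zero)
 show "\<exists>y\<in>carrier Kn. y \<oplus>\<^bsub>Kn\<^esub> x = \<zero>\<^bsub>Kn\<^esub>"
 proof
  show "Phi (- a) \<oplus>\<^bsub>Kn\<^esub> x = \<zero>\<^bsub>Kn\<^esub>" using Phi_add[OF normal_minus[OF a(2)] a(2)] a(1) Phi_zero by simp
  show "Phi (- a) \<in> carrier Kn" using normal_minus[OF a(2)] unfolding Kn_carrier by blast
 qed
qed

interpretation Kn: abelian_group Kn by (rule abelian_group_Kn)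

lemma Phi_minus: "x \<in> normal ==> \<ominus>\<^bsub>Kn\<^esub> Phi x = Phi (- x)"
proof -
 assume x: "x \<in> normal"
 have c: "Phi x \<in> carrier Kn" "Phi (- x) \<in> carrier Kn" using x normal_minus[OF x] unfolding Kn_carrier by blast+
 have "Phi (- x) \<oplus>\<^bsub>Kn\<^esub> Phi x = \<zero>\<^bsub>Kn\<^esub>" using Phi_add[OF normal_minus[OF x] x] Phi_zero by simp
 thus ?thesis using Kn.minus_equality c by blast
qed

lemma Phi_sum: "finite S ==> (!!i. i \<in> S ==> f i \<in> normal) ==> (\<Oplus>\<^bsub>Kn\<^esub>i\<in>S. Phi (f i)) = Phi (sum f S) & sum f S \<in> normal"
proof (induction S rule: finite_induct)
 case (insert i S)
 have "(\<Oplus>\<^bsub>Kn\<^esub>j\<in>insert i S. Phi (f j)) = Phi (f i) \<oplus>\<^bsub>Kn\<^esub> (\<Oplus>\<^bsub>Kn\<^esub>j\<in>S. Phi (f j))"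
  using insert by (intro Kn.finsum_insert) (auto simp: Kn_carrier)
 thus ?case using insert unfolding sum.insert[OF insert(1,2)] by (metis Phi_add normal_add insertCI)
qed (simp add: Phi_zero normal_zero)

text \<open>Truncation to \<open>n\<close> variables.\<close>

lemma boundary_normal:
 assumes "dd f \<in> normal" shows "\<exists>g\<in>normal. dd g = dd f"
proof -
 define g where "g U = (if U \<subseteq> {..<n} then Poly_Mapping.mapp (%t c. if ks t \<subseteq> {..<n} & t ~: A then c else 0) (f U) else 0)" for U
 have cg: "cf (g U) t = (if U \<subseteq> {..<n} & ks t \<subseteq> {..<n} & t ~: A then cf (f U) t else 0)" for U t
  by (auto simp: g_def lookup_mapp in_keys_iff when_def)
 have gn: "g \<in> normal" by (auto simp: normal_def cg split: if_splits)
 have "cf (dd g U) t = cf (dd f U) t" for U t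
 proof (cases "U \<subseteq> {..<n} & ks t \<subseteq> {..<n} & t ~: A")
  case False
  hence "cf (dd f U) t = 0" "cf (dd g U) t = 0" using assms normal_dd[OF gn] unfolding normal_def by blast+
  thus ?thesis by simp
 next
  case True
  have "cf (var i * contr i g U) t = cf (var i * contr i f U) t" if i: "i < n" for i
  proof -
   have "ks (t - sing i 1) \<subseteq> {..<n}" "t - sing i 1 ~: A"
    using True ks_diff_le[of t "sing i 1"] upset[of "t - sing i 1" t] by (auto simp: mdvd_def lookup_minus)
   moreover have "insert i U \<subseteq> {..<n}" using True i by auto
   ultimately show ?thesis by (simp add: cf_var_mult contr_def cf_neg_one cg)
  qed
  thus ?thesis using True by (simp add: dd_def nf_def cf_nfp ediff_def cf_sum)
 qed
 hence "dd g = dd f" by (intro ext poly_mapping_eqI)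
 thus ?thesis using gn by blast
qed

section \<open>Homology classes, products and Massey products\<close>

lemma Kn_boundaries: "x \<in> normal ==> Phi x \<in> boundaries Kn \<longleftrightarrow> (\<exists>f. dd f = x)"
proof -
 assume x: "x \<in> normal"
 have "Phi x \<in> boundaries Kn \<longleftrightarrow> (\<exists>z\<in>normal. Phi x = Phi (dd z))"
  unfolding boundaries_def Kn_carrier using Phi_dd by (auto simp: image_iff)
 also have "... = (\<exists>z\<in>normal. dd z = x)" using Phi_eq_iff[OF x] normal_dd by auto
 also have "... = (\<exists>f. dd f = x)" using boundary_normal x by metis
 finally show ?thesis .
qed

lemma boundaries_image: "boundaries Kn = (%z. Phi (dd z)) ` normal"
 unfolding boundaries_def Kn_carrier image_image by (rule image_cong[OF refl Phi_dd])

lemma homology_class_Phi: "homology_class Kn (Phi x) = {Phi (dd z + x) | z. z \<in> normal}" if x: "x \<in> normal"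
proof -
 have "homology_class Kn (Phi x) = {b \<oplus>\<^bsub>Kn\<^esub> Phi x | b. b \<in> boundaries Kn}"
  by (auto simp: homology_class_def a_r_coset_def')
 also have "... = {Phi (dd z) \<oplus>\<^bsub>Kn\<^esub> Phi x | z. z \<in> normal}" unfolding boundaries_image by blast
 also have "... = {Phi (dd z + x) | z. z \<in> normal}"
  unfolding Setcompr_eq_image by (rule image_cong[OF refl Phi_add[OF normal_dd x]])
 finally show ?thesis .
qed

lemma homology_class_eqI:
 assumes "x \<in> normal" "y \<in> normal" "b \<in> normal" "x = y + dd b"
 shows "homology_class Kn (Phi x) = homology_class Kn (Phi y)"
proof -
 have sub: "{Phi (dd z + x) | z. z \<in> normal} \<subseteq> {Phi (dd z + y) | z. z \<in> normal}" if "b \<in> normal" "x = y + dd b" for x y b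
 proof
  fix t assume "t \<in> {Phi (dd z + x) | z. z \<in> normal}"
  then obtain z where z: "t = Phi (dd z + x)" "z \<in> normal" by blast
  have e: "dd z + x = dd (z + b) + y" by (simp add: that(2) d_add add_ac)
  show "t \<in> {Phi (dd z + y) | z. z \<in> normal}" unfolding z(1) e using normal_add[OF z(2) that(1)] by blast
 qed
 have "y = x + dd (- b)" by (simp only: assms(4) d_minus add.assoc right_minus add_0_right)
 from sub[OF normal_minus[OF assms(3)] this] sub[OF assms(3,4)]
 show ?thesis unfolding homology_class_Phi[OF assms(1)] homology_class_Phi[OF assms(2)] by blast
qed

lemma homology_zero: "\<zero>\<^bsub>homology Kn\<^esub> = boundaries Kn" by (simp add: homology_def FactRing_def)

lemma homology_class_zero: "homology_class Kn (Phi (dd f)) = \<zero>\<^bsub>homology Kn\<^esub>" if df: "dd f \<in> normal"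
proof -
 obtain g where g: "g \<in> normal" "dd g = dd f" using boundary_normal[OF df] by blast
 have "homology_class Kn (Phi (dd f)) = homology_class Kn (Phi 0)"
  by (rule homology_class_eqI[OF df normal_zero g(1)]) (simp add: g)
 also have "... = boundaries Kn"
  unfolding homology_class_Phi[OF normal_zero] boundaries_image add_0_right by blast
 finally show ?thesis by (simp add: homology_zero)
qed

lemma Phi_cycle: "x \<in> normal ==> differential Kn (Phi x) = \<zero>\<^bsub>Kn\<^esub> \<longleftrightarrow> dd x = 0"
 using Phi_dd Phi_eq_iff[OF normal_dd normal_zero] Phi_zero by metis

lemma trivial_koszul_Kn:
 assumes "trivial_product Kn" shows "trivial_koszul TYPE('k) n A"
proof
 fix x y :: "'k elt" and p q
 assume x: "x \<in> homog_p (int p)" and y: "y \<in> homog_p (int q)" and d: "dd x = 0" "dd y = 0" and pq: "p >= 1" "q >= 1"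
 have n: "x \<in> normal" "y \<in> normal" using x y homog_p_normal by auto
 have cyc: "Phi x \<in> cycles Kn \<inter> component Kn p" "Phi y \<in> cycles Kn \<inter> component Kn q"
  using n x y d by (auto simp: cycles_def Kn_carrier Phi_component Phi_cycle)
 let ?a = "homology_class Kn (Phi x)" and ?b = "homology_class Kn (Phi y)"
 have "?a \<otimes>\<^bsub>homology Kn\<^esub> ?b = \<zero>\<^bsub>homology Kn\<^esub>"
  using assms[unfolded trivial_product_def homology_component_def, rule_format, of p q, OF _ _ imageI[OF cyc(1)] imageI[OF cyc(2)]] pq
  by (simp only: One_nat_def Suc_le_eq)
 \<comment> \<open>The product of two cosets is a union of cosets; one of its elements is the image
   of the product of x and y.\<close>
 moreover have "?a \<otimes>\<^bsub>homology Kn\<^esub> ?b = (\<Union>a\<in>?a. \<Union>b\<in>?b. boundaries Kn +>\<^bsub>Kn\<^esub> (a \<otimes>\<^bsub>Kn\<^esub> b))"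
  by (simp add: homology_def FactRing_def rcoset_mult_def a_r_coset_def')
 moreover have "Phi x \<in> ?a" "Phi y \<in> ?b" unfolding homology_class_Phi[OF n(1)] homology_class_Phi[OF n(2)]
  using normal_zero by (force simp: d_zero)+
 moreover have "Phi (x \<cdot> y) \<in> boundaries Kn +>\<^bsub>Kn\<^esub> (Phi x \<otimes>\<^bsub>Kn\<^esub> Phi y)"
  using homology_class_Phi[OF normal_mul[OF n]] normal_zero unfolding Phi_mul[OF n] homology_class_def by (force simp: d_zero)
 ultimately have "Phi (x \<cdot> y) \<in> boundaries Kn" unfolding homology_zero by blast
 thus "\<exists>z. dd z = x \<cdot> y" using Kn_boundaries[OF normal_mul[OF n]] by blast
qed

lemma Phi_sign: "x \<in> normal ==> signed Kn k (Phi x) = Phi (%U. (-1) ^ k * x U)"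
proof (cases "even k")
 case False
 assume x: "x \<in> normal"
 have "- x = (%U. (-1) ^ k * x U)" using False by (simp add: fun_eq_iff)
 thus ?thesis using False Phi_minus[OF x] by (simp add: signed_def)
qed (simp add: signed_def)

text \<open>The indices of defining systems start at 1, those of matrices at 0: b i j corresponds to
  a (i - 1) j. The sign given by \<open>massey_degree\<close> is \<open>bar\<close> because a (i -
  1) v is homogeneous of that degree.\<close>

lemma massey_sum_Phi:
 assumes ij: "1 <= i" "i <= j"
  and a: "!!v. i <= v ==> v < j ==> a (i - 1) v \<in> homog_p (int (massey_degree \<delta> i v)) & a v j \<in> normal"
  and b: "!!v. i <= v ==> v < j ==> b i v = Phi (a (i - 1) v) & b (v + 1) j = Phi (a v j)"
 shows "massey_sum Kn \<delta> b i j = Phi (msum a (i - 1) j)" "msum a (i - 1) j \<in> normal"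
proof -
 have n: "a (i - 1) v \<in> normal" "a v j \<in> normal" if "i <= v" "v < j" for v using a[OF that] homog_p_normal by auto
 have bar: "bar (a (i - 1) v) = (%U. (-1) ^ (massey_degree \<delta> i v + 1) * a (i - 1) v U)" if "i <= v" "v < j" for v
  using esg_homog_p[of "a (i - 1) v" "massey_degree \<delta> i v"] a[OF that] by (simp add: bar_def fun_eq_iff)
 have t: "signed Kn (massey_degree \<delta> i v + 1) (b i v) \<otimes>\<^bsub>Kn\<^esub> b (v + 1) j = Phi (bar (a (i - 1) v) \<cdot> a v j)"
  "bar (a (i - 1) v) \<cdot> a v j \<in> normal" if v: "i <= v" "v < j" for v
 proof -
  have bn: "bar (a (i - 1) v) \<in> normal" using homog_p_bar a[OF v] homog_p_normal by blast
  thus "bar (a (i - 1) v) \<cdot> a v j \<in> normal" using n[OF v] by (intro normal_mul)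
  show "signed Kn (massey_degree \<delta> i v + 1) (b i v) \<otimes>\<^bsub>Kn\<^esub> b (v + 1) j = Phi (bar (a (i - 1) v) \<cdot> a v j)"
   using b[OF v] Phi_sign[OF n(1)[OF v], of "massey_degree \<delta> i v + 1"] Phi_mul[OF bn n(2)[OF v]] bar[OF v] by simp
 qed
 have "massey_sum Kn \<delta> b i j = (\<Oplus>\<^bsub>Kn\<^esub>v\<in>{i..<j}. Phi (bar (a (i - 1) v) \<cdot> a v j))"
  unfolding massey_sum_def by (rule Kn.finsum_cong') (insert t, auto simp: Kn_carrier)
 moreover have "{i - 1<..<j} = {i..<j}" using ij by auto
 hence "msum a (i - 1) j = (\<Sum>v\<in>{i..<j}. bar (a (i - 1) v) \<cdot> a v j)" by (simp add: msum_def mm_def)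
 ultimately show "massey_sum Kn \<delta> b i j = Phi (msum a (i - 1) j)" "msum a (i - 1) j \<in> normal"
  using Phi_sum[of "{i..<j}" "%v. bar (a (i - 1) v) \<cdot> a v j"] t(2) by simp_all
qed

lemma trivial_higher_massey:
 assumes good: "!!w. w \<in> words ==> w ~= [] ==> wgood w"
 shows "trivial_higher_massey_products Kn" unfolding trivial_higher_massey_products_def
proof (intro allI impI conjI)
 fix k :: nat and \<delta> \<alpha> assume k: "3 <= k" and c: "\<forall>i\<in>{1..k}. \<delta> i > 0 & \<alpha> i \<in> homology_component Kn (\<delta> i)"
 \<comment> \<open>Degrees outside 1..k are arbitrary and may be 0. Raising them to at least 1 makes
   q increase by at least 2 at every step, as \<open>system_obstruction_exact\<close>
   demands.\<close>
 define \<epsilon> where "\<epsilon> v = max 1 (\<delta> v)" for v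
 have \<epsilon>: "\<epsilon> v = \<delta> v" if "1 <= v" "v <= k" for v using bspec[OF c, of v] that by (simp add: \<epsilon>_def max_def)
 define q where "q x = int ((\<Sum>v=1..x. \<epsilon> v) + x)" for x :: nat
 have qS': "q (Suc x) = q x + int (\<epsilon> (x + 1)) + 1" for x by (simp add: q_def)
 have qS: "q (Suc x) = q x + int (\<delta> (x + 1)) + 1" if "x < k" for x using qS'[of x] \<epsilon>[of "x + 1"] that by simp
 have deg: "q j - q (i - 1) - 1 = int (massey_degree \<delta> i j)" if ij: "1 <= i" "i <= j" "j <= k" for i j
 proof -
  have "(\<Sum>v=1..j. \<epsilon> v) = (\<Sum>v=1..i-1. \<epsilon> v) + (\<Sum>v=i..j. \<epsilon> v)"
   using sum.ub_add_nat[of 1 "i - 1" \<epsilon> "j - (i - 1)"] ij by simp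
  moreover have "(\<Sum>v=i..j. \<epsilon> v) = (\<Sum>v=i..j. \<delta> v)" by (rule sum.cong) (use \<epsilon> ij in auto)
  ultimately show ?thesis using ij by (simp add: q_def massey_degree_def)
 qed
 have hom: "homog_p (q j - q (i - 1) - 1) = homog_p (int (massey_degree \<delta> i j))" if "1 <= i" "i <= j" "j <= k" for i j using deg[OF that] by simp
 have "\<exists>z. z \<in> homog_p (int (\<delta> (x + 1))) & dd z = 0 & \<alpha> (x + 1) = homology_class Kn (Phi z)" if x: "x < k" for x
 proof -
  have "\<alpha> (x + 1) \<in> homology_component Kn (\<delta> (x + 1))" using c x by auto
  then obtain f where f: "f \<in> cycles Kn" "f \<in> component Kn (\<delta> (x + 1))" "\<alpha> (x + 1) = homology_class Kn f"
   unfolding homology_component_def by blast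
  then obtain z where z: "f = Phi z" "z \<in> normal" unfolding cycles_def Kn_carrier by blast
  thus ?thesis using f Phi_component[OF z(2)] Phi_cycle[OF z(2)] unfolding cycles_def by blast
 qed
 then obtain z where z: "!!x. x < k ==> z x \<in> homog_p (int (\<delta> (x + 1))) & dd (z x) = 0 & \<alpha> (x + 1) = homology_class Kn (Phi (z x))"
  by metis
 show "massey_defined Kn k \<delta> \<alpha>"
 proof -
  have zz: "z x \<in> homog_p (int (\<delta> (x + 1))) & dd (z x) = 0 & 1 <= \<delta> (x + 1)" if "x < k" for x
   using z[OF that] c that by (simp add: Suc_le_eq)
  obtain a where a: "!!x y. x < y ==> y <= k ==> a x y \<in> homog_p (q y - q x - 1)"
   "!!x y. x < y ==> y <= k ==> dd (a x y) = msum a x y"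
   "!!x. x < k ==> \<exists>\<beta>\<in>homog_p (int (\<delta> (x + 1)) + 1). z x = a x (Suc x) + dd \<beta>"
   by (rule system_exists[of k z "%x. \<delta> (x + 1)" q, OF good zz qS]) blast+
  define b where "b i j = Phi (a (i - 1) j)" for i j
  have an: "a x y \<in> normal" if "x < y" "y <= k" for x y using a(1)[OF that] homog_p_normal by blast
  have "defining_system Kn k \<delta> \<alpha> b" unfolding defining_system_def
  proof (intro conjI allI ballI impI)
   fix i j assume ij: "1 <= i & i <= j & j <= k & (i, j) ~= (1, k)"
   hence h: "i - 1 < j" "j <= k" by auto
   show "b i j \<in> component Kn (massey_degree \<delta> i j)"
    unfolding b_def Phi_component[OF an[OF h]] using a(1)[OF h] hom[of i j] ij by simp
  next
   fix i assume i: "i \<in> {1..k}"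
   hence h: "i - 1 < i" "i <= k" "i - 1 < k" "Suc (i - 1) = i" by auto
   have "{i - 1<..<i} = {}" by auto
   hence "dd (a (i - 1) i) = 0" using a(2)[OF h(1,2)] by (simp add: msum_def mm_def)
   thus "differential Kn (b i i) = \<zero>\<^bsub>Kn\<^esub>" unfolding b_def using Phi_cycle[OF an[OF h(1,2)]] by simp
   obtain \<beta> where \<beta>: "\<beta> \<in> homog_p (int (\<delta> i) + 1)" "z (i - 1) = a (i - 1) i + dd \<beta>" using a(3)[OF h(3)] h(4) by auto
   have "z (i - 1) \<in> normal" using z[OF h(3)] homog_p_normal by blast
   hence "homology_class Kn (Phi (z (i - 1))) = homology_class Kn (Phi (a (i - 1) i))"
    using homology_class_eqI[OF _ an[OF h(1,2)] _ \<beta>(2)] subsetD[OF homog_p_normal \<beta>(1)] by blast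
   thus "homology_class Kn (b i i) = \<alpha> i" unfolding b_def using z[OF h(3)] h(4) by simp
  next
   fix i j assume ij: "1 <= i & i < j & j <= k & (i, j) ~= (1, k)"
   hence h: "i - 1 < j" "j <= k" by auto
   have "massey_sum Kn \<delta> b i j = Phi (msum a (i - 1) j)"
   proof (rule massey_sum_Phi)
    fix v assume v: "i <= v" "v < j"
    have v': "i - 1 < v" "v <= k" "1 <= i" using v ij by auto
    show "a (i - 1) v \<in> homog_p (int (massey_degree \<delta> i v)) & a v j \<in> normal"
     using a(1)[OF v'(1,2)] hom[OF v'(3) v(1) v'(2)] an[OF v(2) h(2)] by simp
    show "b i v = Phi (a (i - 1) v) & b (v + 1) j = Phi (a v j)" by (simp add: b_def)
   qed (use ij in auto)
   thus "differential Kn (b i j) = massey_sum Kn \<delta> b i j" unfolding b_def[of i j] Phi_dd[OF an[OF h]] a(2)[OF h] by simp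
  qed
  thus ?thesis unfolding massey_defined_def by blast
 qed
 show "massey_product Kn k \<delta> \<alpha> \<subseteq> {\<zero>\<^bsub>homology Kn\<^esub>}"
 proof
  fix t assume "t \<in> massey_product Kn k \<delta> \<alpha>"
  then obtain b where b: "defining_system Kn k \<delta> \<alpha> b" "t = homology_class Kn (massey_sum Kn \<delta> b 1 k)"
   unfolding massey_product_def by blast
  have "\<exists>x\<in>normal. b i j = Phi x" if "1 <= i" "i <= j" "j <= k" "(i, j) ~= (1, k)" for i j
  proof -
   have "b i j \<in> component Kn (massey_degree \<delta> i j)" using b(1) that unfolding defining_system_def by blast
   hence "b i j \<in> carrier Kn" by (simp add: quotient_koszul_def koszul_def)
   thus ?thesis unfolding Kn_carrier by blast
  qed
  then obtain c where c: "!!i j. 1 <= i ==> i <= j ==> j <= k ==> (i, j) ~= (1, k) ==> c i j \<in> normal & b i j = Phi (c i j)"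
   by metis
  \<comment> \<open>The shift of the first index back to matrices.\<close>
  define a where "a x y = c (x + 1) y" for x y
  have ah: "a x y \<in> homog_p (q y - q x - 1) & a x y \<in> normal & b (x + 1) y = Phi (a x y)" if xy: "x < y" "y <= k" "(x, y) ~= (0, k)" for x y
  proof -
   have h: "1 <= x + 1" "x + 1 <= y" "y <= k" "(x + 1, y) ~= (1, k)" using xy by auto
   have "b (x + 1) y \<in> component Kn (massey_degree \<delta> (x + 1) y)" using b(1) h unfolding defining_system_def by blast
   hence "a x y \<in> homog_p (int (massey_degree \<delta> (x + 1) y))" using c[OF h] Phi_component by (simp add: a_def)
   thus ?thesis using hom[OF h(1-3)] c[OF h] by (simp add: a_def)
  qed
  have MS: "massey_sum Kn \<delta> b i j = Phi (msum a (i - 1) j)" "msum a (i - 1) j \<in> normal" if ij: "1 <= i" "i <= j" "j <= k" for i j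
  proof -
   have h: "a (i - 1) v \<in> homog_p (int (massey_degree \<delta> i v)) & a v j \<in> normal" "b i v = Phi (a (i - 1) v) & b (v + 1) j = Phi (a v j)"
    if v: "i <= v" "v < j" for v
   proof -
    have v': "i - 1 < v" "v <= k" "(i - 1, v) ~= (0, k)" "i - 1 + 1 = i" "v < j" "(v, j) ~= (0, k)" using v ij by auto
    show "a (i - 1) v \<in> homog_p (int (massey_degree \<delta> i v)) & a v j \<in> normal" "b i v = Phi (a (i - 1) v) & b (v + 1) j = Phi (a v j)"
     using ah[OF v'(1-3)] ah[OF v'(5) ij(3) v'(6)] hom[OF ij(1) v(1) v'(2)] v'(4) by simp_all
   qed
   show "massey_sum Kn \<delta> b i j = Phi (msum a (i - 1) j)" "msum a (i - 1) j \<in> normal"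
    using massey_sum_Phi[OF ij(1,2) h] by blast+
  qed
  have "\<exists>f. msum a 0 k = dd f"
  proof (rule system_obstruction_exact[OF good])
   show "k > 0" using k by simp
   have gap: "q y >= q x + 2 * int (y - x)" if "x <= y" for x y using that
   proof (induction y rule: dec_induct)
    case (step y)
    have "1 <= \<epsilon> (y + 1)" by (simp add: \<epsilon>_def)
    thus ?case using step qS'[of y] by (simp add: of_nat_diff)
   qed simp
   show "2 <= q y - q x" if xy: "x < y" for x y
   proof -
    have "q y >= q x + 2 * int (y - x)" using gap[of x y] xy by simp
    moreover have "int (y - x) >= 1" using xy by simp
    ultimately show ?thesis by linarith
   qed
   show "a x y \<in> homog_p (q y - q x - 1)" if "x < y" "y <= k" "(x, y) ~= (0, k)" for x y using ah[OF that] by blast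
   show "dd (a x y) = msum a x y" if xy: "x < y" "y <= k" "(x, y) ~= (0, k)" for x y
   proof -
    have an: "a x y \<in> normal" using ah[OF xy] by blast
    show ?thesis
    proof (cases "y = Suc x")
     case True
     have "differential Kn (b y y) = \<zero>\<^bsub>Kn\<^esub>" using b(1) xy True unfolding defining_system_def by auto
     hence "dd (a x y) = 0" using ah[OF xy] Phi_cycle[OF an] True by simp
     moreover have "{x<..<y} = {}" using True by auto
     ultimately show ?thesis by (simp add: msum_def mm_def)
    next
     case False
     hence h: "1 <= x + 1" "x + 1 < y" "y <= k" "(x + 1, y) ~= (1, k)" using xy by auto
     have "differential Kn (b (x + 1) y) = massey_sum Kn \<delta> b (x + 1) y" using b(1) h unfolding defining_system_def by blast
     hence "Phi (dd (a x y)) = Phi (msum a x y)" using MS(1)[of "x + 1" y] h ah[OF xy] Phi_dd[OF an] by simp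
     moreover have "msum a x y \<in> normal" using MS(2)[of "x + 1" y] h by simp
     ultimately show ?thesis using Phi_eq_iff[OF normal_dd[OF an]] by blast
    qed
   qed
  qed
  then obtain f where "msum a 0 k = dd f" by blast
  thus "t \<in> {\<zero>\<^bsub>homology Kn\<^esub>}" using MS[of 1 k] k homology_class_zero[of f] b(2) by simp
 qed
qed

end

section \<open>Regularity\<close>

abbreviation polys :: "nat => 'k::field polynomial set" where "polys n \<equiv> carrier (poly_ring n)"

definition hpart :: "int => 'k::field polynomial => 'k polynomial"
 where "hpart e p = Poly_Mapping.mapp (%t c. if int (mdegree t) = e then c else 0) p"

lemma cf_hpart: "cf (hpart e p) t = (if int (mdegree t) = e then cf p t else 0)"
 by (auto simp: hpart_def lookup_mapp in_keys_iff when_def)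

lemma hpart_add: "hpart e (p + q) = hpart e p + hpart e q" by (rule poly_mapping_eqI) (simp add: cf_hpart lookup_add)

lemma hpart_sum: "hpart e (sum f S) = (\<Sum>i\<in>S. hpart e (f i))"
 by (rule poly_mapping_eqI) (simp add: cf_hpart cf_sum)

lemma hpart_id: "(!!t. cf p t ~= 0 ==> int (mdegree t) = e) ==> hpart e p = p"
 by (rule poly_mapping_eqI) (auto simp: cf_hpart)

text \<open>The remainder of p has no terms of degree e - d, so its product with a has none of
  degree e.\<close>

lemma hpart_mult:
 assumes "!!t. t \<in> ks a ==> int (mdegree t) = d"
 shows "hpart e (a * p) = a * hpart (e - d) p"
proof -
 define p' where "p' = p - hpart (e - d) p"
 have "hpart e (a * hpart (e - d) p) = a * hpart (e - d) p"
 proof (rule hpart_id)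
  fix t assume "cf (a * hpart (e - d) p) t ~= 0"
  then obtain r s where "t = r + s" "r \<in> ks a" "s \<in> ks (hpart (e - d) p)"
   using Poly_Mapping.keys_mult[of a "hpart (e - d) p"] by (auto simp: in_keys_iff)
  thus "int (mdegree t) = e" using assms[of r] by (auto simp: mdegree_add in_keys_iff cf_hpart split: if_splits)
 qed
 moreover have "hpart e (a * p') = 0"
 proof (rule poly_mapping_eqI)
  fix t
  have "cf (a * p') t = 0" if e: "int (mdegree t) = e"
  proof (rule ccontr)
   assume "cf (a * p') t ~= 0"
   then obtain r s where "t = r + s" "r \<in> ks a" "s \<in> ks p'"
    using Poly_Mapping.keys_mult[of a p'] by (auto simp: in_keys_iff)
   thus False using assms[of r] e by (auto simp: mdegree_add in_keys_iff p'_def lookup_minus cf_hpart split: if_splits)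
  qed
  thus "cf (hpart e (a * p')) t = cf 0 t" by (simp add: cf_hpart)
 qed
 moreover have "a * p = a * hpart (e - d) p + a * p'" by (simp add: p'_def algebra_simps)
 ultimately show ?thesis by (simp add: hpart_add)
qed

lemma ediff_linear:
 "ediff n x (%U. \<Sum>l<r. M l * c l U) U = (\<Sum>l<r. M l * ediff n x (c l) U)"
proof -
 have "contr i (%U. \<Sum>l<r. M l * c l U) U = (\<Sum>l<r. M l * contr i (c l) U)" for i
  by (simp add: contr_def sum_distrib_left mult_ac)
 hence "ediff n x (%U. \<Sum>l<r. M l * c l U) U = (\<Sum>i<n. \<Sum>l<r. M l * (x i * contr i (c l) U))"
  by (simp add: ediff_def sum_distrib_left mult_ac)
 also have "... = (\<Sum>l<r. \<Sum>i<n. M l * (x i * contr i (c l) U))" by (rule sum.swap)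
 finally show ?thesis by (simp add: ediff_def sum_distrib_left)
qed

lemma ediff_diff: "ediff n x (%U. f U - g U) U = ediff n x f U - ediff n x g U"
 by (auto simp: ediff_def contr_def algebra_simps simp flip: sum_subtractf intro!: sum.cong)

lemma sum_monomials: "(\<Sum>t\<in>ks g. sing t (cf g t)) = (g :: 'k::field polynomial)"
proof (rule poly_mapping_eqI)
 fix k
 have "cf (\<Sum>t\<in>ks g. sing t (cf g t)) k = (\<Sum>t\<in>ks g. if t = k then cf g k else 0)"
  unfolding cf_sum by (rule sum.cong) (auto simp: lookup_single when_def)
 thus "cf (\<Sum>t\<in>ks g. sing t (cf g t)) k = cf g k" by (simp add: in_keys_iff)
qed

section \<open>Exactness of the Koszul complex of the polynomial ring\<close>

definition polyK :: "nat => nat => (nat set => 'k::field polynomial) set"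
 where "polyK n q = {c. \<forall>U t. cf (c U) t ~= 0 --> U \<subseteq> {..<n} & ks t \<subseteq> {..<n} & card U = q}"

lemma polyK_zero: "c \<in> polyK n q ==> ~ U \<subseteq> {..<n} | card U ~= q ==> c U = 0"
proof (rule poly_mapping_eqI)
 fix t assume "c \<in> polyK n q" "~ U \<subseteq> {..<n} | card U ~= q"
 hence "cf (c U) t = 0" unfolding polyK_def by blast
 thus "cf (c U) t = cf 0 t" by simp
qed

lemma polyK_carrier: "c \<in> polyK n q ==> c U \<in> polys n"
 unfolding polyK_def poly_ring_def monomials_def partial_object.simps mem_Collect_eq subset_iff[of "ks (c U)"] in_keys_iff by blast

lemma polyKI: "(!!U. c U \<in> polys n) ==> (!!U. c U ~= 0 ==> U \<subseteq> {..<n} & card U = q) ==> c \<in> polyK n q"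
 unfolding polyK_def poly_ring_def monomials_def partial_object.simps mem_Collect_eq subset_iff in_keys_iff
 by (metis lookup_zero)

lemma poly_ring_closed:
 "x \<in> polys n ==> y \<in> polys n ==> x + y \<in> polys n"
 "x \<in> polys n ==> y \<in> polys n ==> x * y \<in> polys n"
 "0 \<in> carrier (poly_ring n :: 'k polynomial ring)" "x \<in> polys n ==> - x \<in> polys n"
 "x \<in> polys n ==> y \<in> polys n ==> x - y \<in> polys n"
 "(!!i. i \<in> S ==> f i \<in> polys n) ==> sum f S \<in> polys n"
 for x y :: "'k::field polynomial" and f :: "'i => 'k polynomial"
proof -
 interpret m: monomial_koszul n "{}" "TYPE('k)" by unfold_locales simp
 show "x \<in> polys n ==> y \<in> polys n ==> x + y \<in> polys n"
  "x \<in> polys n ==> y \<in> polys n ==> x * y \<in> polys n"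
  "0 \<in> carrier (poly_ring n :: 'k polynomial ring)" "x \<in> polys n ==> - x \<in> polys n"
  using m.Rn_closed by auto
 show "(!!i. i \<in> S ==> f i \<in> polys n) ==> sum f S \<in> polys n" by (rule m.Rn_sum)
 show "x \<in> polys n ==> y \<in> polys n ==> x - y \<in> polys n"
  using m.Rn_closed(1)[of x "- y"] m.Rn_closed(5)[of y] by simp
qed

lemma hpart_carrier: "p \<in> polys n ==> hpart e p \<in> polys n"
 by (auto simp: poly_ring_def in_keys_iff cf_hpart subset_iff split: if_splits)

lemma ediff_carrier:
 assumes "!!U. c U \<in> polys n" shows "ediff n var c U \<in> carrier (poly_ring n :: 'k::field polynomial ring)"
proof -
 have "var i \<in> carrier (poly_ring n :: 'k polynomial ring)" if "i < n" for i
  using that by (auto simp: poly_ring_def monomials_def var_def mono_poly_def)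
 moreover have "contr i c U \<in> polys n" for i
  using assms poly_ring_closed(3,4) by (cases "even (below U i)") (auto simp: contr_def)
 ultimately show ?thesis unfolding ediff_def by (intro poly_ring_closed(6) poly_ring_closed(2)) auto
qed

lemma ediff_polyK:
 assumes "c \<in> polyK n (Suc q)" shows "ediff n var c \<in> polyK n q"
proof (rule polyKI)
 show "ediff n var c U \<in> polys n" for U by (rule ediff_carrier[OF polyK_carrier[OF assms]])
 fix U assume "ediff n var c U ~= 0"
 then obtain i where i: "i < n" "contr i c U ~= 0"
  by (metis (no_types, lifting) ediff_def lessThan_iff mult_zero_right sum.neutral)
 hence iU: "i ~: U" "c (insert i U) ~= 0" by (auto simp: contr_def split: if_splits)
 hence h: "insert i U \<subseteq> {..<n}" "card (insert i U) = Suc q" using polyK_zero[OF assms] by blast+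
 hence "finite U" using finite_subset[of U "{..<n}"] by auto
 thus "U \<subseteq> {..<n} & card U = q" using h iU(1) by simp
qed

text \<open>In positive degree this is the theory above for A empty. In degree 0 the statement is
  that a polynomial without constant term is a combination of the variables.\<close>

lemma koszul_polynomial_exact:
 fixes e :: "nat set => 'k::field polynomial"
 assumes e: "e \<in> polyK n q" "ediff n var e = (%_. 0)" "q = 0 ==> cf (e {}) 0 = 0"
 obtains y where "y \<in> polyK n (Suc q)" "ediff n var y = e"
proof (cases "q = 0")
 case False
 interpret m: monomial_koszul n "{}" "TYPE('k)" by unfold_locales simp
 have hp: "m.homog_p (int p) = polyK n p" for p by (auto simp: m.homog_p_def polyK_def)
 have nf: "m.nf c = c" if "c \<in> polyK n p" for c p using that m.nf_eq_self[of c "int p"] hp by auto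
 have dd: "m.dd c = ediff n var c" if "c \<in> polyK n (Suc p)" for c p
  unfolding m.dd_def by (rule nf[OF ediff_polyK[OF that]])
 obtain q' where q': "q = Suc q'" using False not0_implies_Suc by blast
 have d0: "m.dd e = 0" using dd[of e q'] e q' by (simp add: zero_fun_def)
 have eh: "e \<in> m.homog_p (int q)" using e(1) hp by blast
 have q1: "1 <= q" using False by simp
 obtain S \<beta> where S: "S \<subseteq> m.labels" "\<beta> \<in> m.homog_p (int q + 1)" "e = (\<Sum>b\<in>S. m.lval b) + m.dd \<beta>"
  by (rule m.homog_p_select[OF eh d0 q1])
 \<comment> \<open>As A is empty, \<open>no_divisor_exact\<close> makes every cycle of positive
   homological degree exact, so there are no letters.\<close>
 have "m.labels = {}"
 proof (rule equals0I)
  fix b assume b: "b \<in> m.labels"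
  obtain t p f where e: "b = (t, p, f)" by (metis surj_pair)
  have h: "m.mon t" "p >= 1" "m.hp p f" "m.cyc t f" "~ m.exact t f" using b unfolding m.labels_def e by simp_all
  thus False using m.no_divisor_exact[OF h(1,4,3,2)] by blast
 qed
 hence "e = m.dd \<beta>" using S by simp
 moreover have b: "\<beta> \<in> polyK n (Suc q)" using S(2) hp[of "Suc q"] by (simp add: add.commute)
 ultimately show ?thesis using that dd[OF b] by metis
next
 case True
 define g where "g = e {}"
 have g: "g \<in> polys n" "cf g 0 = 0" using polyK_carrier[OF e(1)] e(3) True by (auto simp: g_def)
 have "\<exists>i. i \<in> ks t" if "t \<in> ks g" for t using g(2) that by (metis in_keys_iff keys_eq_empty ex_in_conv)
 \<comment> \<open>A variable is chosen in every monomial of g; grouping by it writes g as the sum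
   of x_i h_i.\<close>
 then obtain v where v: "!!t. t \<in> ks g ==> v t \<in> ks t" by metis
 define h where "h i = (\<Sum>t\<in>{t\<in>ks g. v t = i}. sing (t - sing i 1) (cf g t))" for i
 define y where "y U = (if \<exists>i<n. U = {i} then h (the_elem U) else 0)" for U
 have tn: "ks t \<subseteq> {..<n}" if "t \<in> ks g" for t using g(1) that by (auto simp: poly_ring_def monomials_def)
 have hc: "h i \<in> polys n" for i unfolding h_def
 proof (rule poly_ring_closed(6))
  fix t assume "t \<in> {t\<in>ks g. v t = i}"
  hence "ks (t - sing i 1) \<subseteq> {..<n}" using tn[of t] by (auto simp: in_keys_iff lookup_minus subset_iff)
  thus "sing (t - sing i 1) (cf g t) \<in> polys n" by (simp add: poly_ring_def monomials_def)
 qed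
 have "y \<in> polyK n (Suc q)"
  by (rule polyKI) (insert hc poly_ring_closed(3) True, auto simp: y_def split: if_splits)
 moreover have "ediff n var y = e"
 proof
  fix U
  show "ediff n var y U = e U"
  proof (cases "U = {}")
   case Ue: True
   have "ediff n var y U = (\<Sum>i<n. var i * h i)"
    unfolding ediff_def by (rule sum.cong) (auto simp: contr_def y_def Ue below_def)
   also have "... = (\<Sum>i<n. \<Sum>t\<in>{t\<in>ks g. v t = i}. sing t (cf g t))"
   proof (rule sum.cong, rule refl)
    fix i
    have "var i * sing (t - sing i 1) (cf g t) = sing t (cf g t)" if "t \<in> {t\<in>ks g. v t = i}" for t
    proof -
     have "i \<in> ks t" using v[of t] that by auto
     hence "sing i 1 + (t - sing i 1) = t"
      by (intro poly_mapping_eqI) (auto simp: lookup_add lookup_minus lookup_single when_def cf_pos)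
     thus ?thesis by (simp add: var_def mono_poly_def mult_single)
    qed
    thus "var i * h i = (\<Sum>t\<in>{t\<in>ks g. v t = i}. sing t (cf g t))" by (simp add: h_def sum_distrib_left)
   qed
   also have "... = (\<Sum>t\<in>ks g. sing t (cf g t))" by (rule sum.group) (use v tn in auto)
   also have "... = g" by (rule sum_monomials)
   finally show ?thesis by (simp add: g_def Ue)
  next
   case False
   have "y (insert i U) = 0" if "i ~: U" for i using False that by (auto simp: y_def)
   hence "ediff n var y U = 0" by (auto simp: ediff_def contr_def intro!: sum.neutral)
   moreover have "e U = 0"
   proof (cases "U \<subseteq> {..<n}")
    case Un: True
    hence "card U ~= 0" using False finite_subset[OF Un] by simp
    thus ?thesis using polyK_zero[OF e(1), of U] True by simp
   qed (use polyK_zero[OF e(1)] in blast)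
   ultimately show ?thesis by simp
  qed
 qed
 ultimately show ?thesis by (rule that)
qed

lemma restrict_free: "(!!l. l < r ==> u l \<in> polys n) ==> (\<lambda>l\<in>{..<r}. u l) \<in> free_module n r"
 by (simp add: free_module_def)

lemma resolutionD:
 fixes I :: "'k::field polynomial set"
 assumes "minimal_free_resolution n I r s \<epsilon> \<phi>"
 shows "graded_matrix n (r 0) (s 0) 1 (%_. 0) (%_. \<epsilon>)"
  "graded_matrix n (r (Suc i)) (s (Suc i)) (r i) (s i) (\<phi> (Suc i))"
  "p \<in> polys n ==> \<exists>u\<in>free_module n (r 0). p - (\<Sum>l<r 0. \<epsilon> l * u l) \<in> I"
  "{u \<in> free_module n (r 0). (\<Sum>l<r 0. \<epsilon> l * u l) \<in> I} = matrix_apply (r (Suc 0)) (r 0) (\<phi> (Suc 0)) ` free_module n (r (Suc 0))"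
  "{u \<in> free_module n (r (Suc i)). matrix_apply (r (Suc i)) (r i) (\<phi> (Suc i)) u = (\<lambda>m\<in>{..<r i}. 0)}
   = matrix_apply (r (Suc (Suc i))) (r (Suc i)) (\<phi> (Suc (Suc i))) ` free_module n (r (Suc (Suc i)))"
 using assms[unfolded minimal_free_resolution_def] by (elim conjE, simp)+

text \<open>Diagram chase in the double complex that is the tensor product of the Koszul complex and the resolution.\<close>

lemma resolution_zigzag:
 fixes I :: "'k::field polynomial set"
 assumes res: "minimal_free_resolution n I r s \<epsilon> \<phi>" and low: "!!l. l < r p ==> s p l < j"
 shows "q + i = p ==> (!!l. l < r i ==> u l \<in> polyK n q) ==>
  (!!l U t. l < r i ==> cf (u l U) t ~= 0 ==> int (mdegree t) + int q + s i l = j) ==>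
  (!!U. (\<lambda>l\<in>{..<r i}. ediff n var (u l) U) \<in> matrix_apply (r (Suc i)) (r i) (\<phi> (Suc i)) ` free_module n (r (Suc i))) ==>
  \<exists>y y'. (\<forall>l<r i. y l \<in> polyK n (Suc q)) & (\<forall>l<r (Suc i). y' l \<in> polyK n q) &
   (\<forall>l<r i. \<forall>U. u l U = ediff n var (y l) U + (\<Sum>l'<r (Suc i). \<phi> (Suc i) l l' * y' l' U))"
proof (induction q arbitrary: i u)
 case 0
 have "\<exists>y\<in>polyK n (Suc 0). ediff n var y = u l" if l: "l < r i" for l
 proof -
  have "ediff n var (u l) = (%_. 0)"
  proof
   fix U
   have "contr a (u l) U = 0" for a
   proof (cases "a \<in> U | ~ insert a U \<subseteq> {..<n}")
    case True
    thus ?thesis using polyK_zero[OF 0(2)[OF l], of "insert a U"] by (auto simp: contr_def)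
   next
    case False
    hence "card (insert a U) ~= 0" using finite_subset by fastforce
    thus ?thesis using polyK_zero[OF 0(2)[OF l], of "insert a U"] by (simp add: contr_def)
   qed
   thus "ediff n var (u l) U = 0" by (simp add: ediff_def)
  qed
  \<comment> \<open>A constant term would belong to a basis element of the p-th module in degree j,
    and \<open>low\<close> says that there is none.\<close>
  moreover have "cf (u l {}) 0 = 0"
  proof (rule ccontr)
   assume "cf (u l {}) 0 ~= 0"
   hence "s i l = j" using 0(3)[OF l] by fastforce
   thus False using low[of l] 0(1) l by simp
  qed
  ultimately show ?thesis using koszul_polynomial_exact[OF 0(2)[OF l]] by metis
 qed
 then obtain y where y: "!!l. l < r i ==> y l \<in> polyK n (Suc 0) & ediff n var (y l) = u l" by metis
 show ?case by (rule exI[of _ y], rule exI[of _ "%_ _. 0"]) (insert y, auto simp: polyK_def)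
next
 case (Suc q)
 let ?r = "r (Suc i)" and ?\<phi> = "\<phi> (Suc i)"
 have gmat: "graded_matrix n ?r (s (Suc i)) (r i) (s i) ?\<phi>" by (rule resolutionD(2)[OF res])
 have gm: "?\<phi> l l' \<in> polys n" "!!t. t \<in> ks (?\<phi> l l') ==> int (mdegree t) = s (Suc i) l' - s i l"
  if "l < r i" "l' < ?r" for l l' using gmat that unfolding graded_matrix_def by blast+
 have ker: "{w \<in> free_module n ?r. matrix_apply ?r (r i) ?\<phi> w = (\<lambda>m\<in>{..<r i}. 0)}
   = matrix_apply (r (Suc (Suc i))) ?r (\<phi> (Suc (Suc i))) ` free_module n (r (Suc (Suc i)))"
  by (rule resolutionD(5)[OF res])
 have "\<exists>v\<in>free_module n ?r. \<forall>l<r i. ediff n var (u l) U = (\<Sum>l'<?r. ?\<phi> l l' * v l')" for U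
 proof -
  obtain v where v: "v \<in> free_module n ?r" "(\<lambda>l\<in>{..<r i}. ediff n var (u l) U) = matrix_apply ?r (r i) ?\<phi> v"
   using Suc.prems(4)[of U] by blast
  have "ediff n var (u l) U = (\<Sum>l'<?r. ?\<phi> l l' * v l')" if "l < r i" for l
   using fun_cong[OF v(2), of l] that by (simp add: matrix_apply_def)
  thus ?thesis using v(1) by blast
 qed
 then obtain v0 where v0: "!!U. v0 U \<in> free_module n ?r" "!!U l. l < r i ==> ediff n var (u l) U = (\<Sum>l'<?r. ?\<phi> l l' * v0 U l')"
  by metis
 \<comment> \<open>The lifts v0 are arbitrary; their parts of matching degree are lifts as well,
   because \<phi> is homogeneous, and they keep the total degree at j.\<close>
 define v where "v l' U = (if U \<subseteq> {..<n} & card U = q then hpart (j - int q - s (Suc i) l') (v0 U l') else 0)" for l' U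
 have vc: "v l' U \<in> polys n" if "l' < ?r" for l' U
 proof -
  have "v0 U l' \<in> polys n" using v0(1)[of U] that by (auto simp: free_module_def PiE_iff)
  thus ?thesis using hpart_carrier poly_ring_closed(3) by (auto simp: v_def)
 qed
 have vK: "v l' \<in> polyK n q" if "l' < ?r" for l'
  by (rule polyKI) (insert vc[OF that], auto simp: v_def split: if_splits)
 have du: "ediff n var (u l) U = (\<Sum>l'<?r. ?\<phi> l l' * v l' U)" if l: "l < r i" for l U
 proof (cases "U \<subseteq> {..<n} & card U = q")
  case True
  have "hpart (j - s i l - int q) (ediff n var (u l) U) = ediff n var (u l) U"
  proof (rule hpart_id)
   fix t assume "cf (ediff n var (u l) U) t ~= 0"
   then obtain a where a: "cf (var a * contr a (u l) U) t ~= 0"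
    unfolding ediff_def cf_sum by (meson sum.neutral)
   hence "1 <= cf t a" "cf (contr a (u l) U) (t - sing a 1) ~= 0" by (auto simp: cf_var_mult split: if_splits)
   hence "cf (u l (insert a U)) (t - sing a 1) ~= 0" by (auto simp: contr_def cf_neg_one split: if_splits)
   hence "int (mdegree (t - sing a 1)) + int (Suc q) + s i l = j" by (rule Suc.prems(3)[OF l])
   moreover have "sing a 1 + (t - sing a 1) = t"
    using \<open>1 <= cf t a\<close> by (intro poly_mapping_eqI) (auto simp: lookup_add lookup_minus lookup_single when_def)
   hence "mdegree t = 1 + mdegree (t - sing a 1)" using mdegree_add[of "sing a 1" "t - sing a 1"] by simp
   ultimately show "int (mdegree t) = j - s i l - int q" by simp
  qed
  hence "ediff n var (u l) U = (\<Sum>l'<?r. hpart (j - s i l - int q) (?\<phi> l l' * v0 U l'))"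
   using v0(2)[OF l, of U] by (simp add: hpart_sum)
  also have "... = (\<Sum>l'<?r. ?\<phi> l l' * v l' U)"
  proof (rule sum.cong, rule refl)
   fix l' assume "l' \<in> {..<?r}"
   hence "hpart (j - s i l - int q) (?\<phi> l l' * v0 U l') = ?\<phi> l l' * hpart (j - s i l - int q - (s (Suc i) l' - s i l)) (v0 U l')"
    using gm(2)[OF l] by (intro hpart_mult) auto
   moreover have "j - s i l - int q - (s (Suc i) l' - s i l) = j - int q - s (Suc i) l'" by simp
   ultimately show "hpart (j - s i l - int q) (?\<phi> l l' * v0 U l') = ?\<phi> l l' * v l' U" using True by (simp add: v_def)
  qed
  finally show ?thesis .
 next
  case False
  hence "ediff n var (u l) U = 0" using polyK_zero[OF ediff_polyK[OF Suc.prems(2)[OF l]]] by blast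
  moreover have "v l' U = 0" for l' using False by (auto simp: v_def)
  ultimately show ?thesis by simp
 qed
 have edv: "ediff n var (v l') U \<in> polys n" if "l' < ?r" for l' U
  by (rule ediff_carrier) (rule vc[OF that])
 have dv: "(\<Sum>l'<?r. ?\<phi> l l' * ediff n var (v l') U) = 0" if l: "l < r i" for l U
 proof -
  have "(\<Sum>l'<?r. ?\<phi> l l' * ediff n var (v l') U) = ediff n var (%U. \<Sum>l'<?r. ?\<phi> l l' * v l' U) U"
   by (rule ediff_linear[symmetric])
  also have "(%U. \<Sum>l'<?r. ?\<phi> l l' * v l' U) = ediff n var (u l)" using du[OF l] by auto
  also have "ediff n var (ediff n var (u l)) U = 0"
  proof (cases "finite U")
   case False
   have "ediff n var (u l) (insert a U) = 0" for a
    by (rule polyK_zero[OF ediff_polyK[OF Suc.prems(2)[OF l]]]) (use False finite_subset[of U "{..<n}"] in auto)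
   hence "contr a (ediff n var (u l)) U = 0" for a by (simp add: contr_def)
   thus ?thesis by (simp add: ediff_def)
  qed (rule ediff_ediff)
  finally show ?thesis .
 qed
 have img: "(\<lambda>l'\<in>{..<?r}. ediff n var (v l') U) \<in> matrix_apply (r (Suc (Suc i))) ?r (\<phi> (Suc (Suc i))) ` free_module n (r (Suc (Suc i)))" for U
 proof -
  have "matrix_apply ?r (r i) ?\<phi> (\<lambda>l'\<in>{..<?r}. ediff n var (v l') U) = (\<lambda>m\<in>{..<r i}. 0)"
   using dv by (auto simp: matrix_apply_def)
  moreover have "(\<lambda>l'\<in>{..<?r}. ediff n var (v l') U) \<in> free_module n ?r" by (rule restrict_free[OF edv])
  ultimately have "(\<lambda>l'\<in>{..<?r}. ediff n var (v l') U) \<in> {w \<in> free_module n ?r. matrix_apply ?r (r i) ?\<phi> w = (\<lambda>m\<in>{..<r i}. 0)}"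
   by (simp only: mem_Collect_eq)
  thus ?thesis unfolding ker .
 qed
 have deg: "int (mdegree t) + int q + s (Suc i) l' = j" if "l' < ?r" "cf (v l' U) t ~= 0" for l' U t
  using that(2) by (auto simp: v_def cf_hpart split: if_splits)
 have "\<exists>y y'. (\<forall>l<?r. y l \<in> polyK n (Suc q)) & (\<forall>l<r (Suc (Suc i)). y' l \<in> polyK n q) &
   (\<forall>l<?r. \<forall>U. v l U = ediff n var (y l) U + (\<Sum>l'<r (Suc (Suc i)). \<phi> (Suc (Suc i)) l l' * y' l' U))"
  by (rule Suc.IH[OF _ vK deg img]) (use Suc.prems(1) in simp_all)
 then obtain y y' where y: "!!l. l < ?r ==> y l \<in> polyK n (Suc q)" "!!l. l < r (Suc (Suc i)) ==> y' l \<in> polyK n q"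
   "!!l U. l < ?r ==> v l U = ediff n var (y l) U + (\<Sum>l'<r (Suc (Suc i)). \<phi> (Suc (Suc i)) l l' * y' l' U)"
  by blast
 \<comment> \<open>The correction makes u a Koszul cycle in positive degree, hence a
   boundary.\<close>
 define e where "e l U = u l U - (\<Sum>l'<?r. ?\<phi> l l' * y l' U)" for l U
 have "\<exists>z\<in>polyK n (Suc (Suc q)). ediff n var z = e l" if l: "l < r i" for l
 proof -
  have "e l \<in> polyK n (Suc q)"
  proof (rule polyKI)
   show "e l U \<in> polys n" for U
    unfolding e_def using gm(1)[OF l] polyK_carrier[OF y(1)] polyK_carrier[OF Suc.prems(2)[OF l]]
    by (intro poly_ring_closed(5,6) poly_ring_closed(2)) auto
   fix U assume nz: "e l U ~= 0"
   show "U \<subseteq> {..<n} & card U = Suc q"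
   proof (rule ccontr)
    assume "~ ?thesis"
    hence "u l U = 0" "!!l'. l' < ?r ==> y l' U = 0" using polyK_zero[OF Suc.prems(2)[OF l]] polyK_zero[OF y(1)] by blast+
    thus False using nz by (simp add: e_def)
   qed
  qed
  moreover have "ediff n var (e l) U = 0" for U
  proof -
   have "ediff n var (e l) U = ediff n var (u l) U - (\<Sum>l'<?r. ?\<phi> l l' * ediff n var (y l') U)"
    unfolding e_def ediff_diff ediff_linear by (rule refl)
   also have "ediff n var (u l) U = (\<Sum>l'<?r. ?\<phi> l l' * v l' U)" by (rule du[OF l])
   also have "... = (\<Sum>l'<?r. ?\<phi> l l' * ediff n var (y l') U + ?\<phi> l l' * (\<Sum>l''<r (Suc (Suc i)). \<phi> (Suc (Suc i)) l' l'' * y' l'' U))"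
    by (rule sum.cong) (simp_all add: y(3) distrib_left)
   also have "... = (\<Sum>l'<?r. ?\<phi> l l' * ediff n var (y l') U) + (\<Sum>l'<?r. ?\<phi> l l' * (\<Sum>l''<r (Suc (Suc i)). \<phi> (Suc (Suc i)) l' l'' * y' l'' U))"
    by (rule sum.distrib)
   also have "(\<Sum>l'<?r. ?\<phi> l l' * (\<Sum>l''<r (Suc (Suc i)). \<phi> (Suc (Suc i)) l' l'' * y' l'' U)) = 0"
   proof -
    let ?w = "\<lambda>l\<in>{..<r (Suc (Suc i))}. y' l U"
    have "?w \<in> free_module n (r (Suc (Suc i)))" by (rule restrict_free) (use y(2) polyK_carrier in blast)
    hence "matrix_apply ?r (r i) ?\<phi> (matrix_apply (r (Suc (Suc i))) ?r (\<phi> (Suc (Suc i))) ?w) = (\<lambda>m\<in>{..<r i}. 0)"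
     using ker by blast
    from fun_cong[OF this, of l] show ?thesis using l by (simp add: matrix_apply_def)
   qed
   finally show ?thesis by simp
  qed
  ultimately show ?thesis using koszul_polynomial_exact[of "e l" n "Suc q"] by (metis ext nat.distinct(1))
 qed
 then obtain z where z: "!!l. l < r i ==> z l \<in> polyK n (Suc (Suc q)) & ediff n var (z l) = e l" by metis
 have "u l U = ediff n var (z l) U + (\<Sum>l'<?r. ?\<phi> l l' * y l' U)" if "l < r i" for l U
  using z[OF that] by (simp add: e_def)
 thus ?case using z y(1) by blast
qed

context monomial_koszul
begin

text \<open>The class of f lies in degree \<open>mdegree m\<close> of Tor_p. Lifting f to the
  resolution and chasing it to the p-th module, where no basis element has this degree, expresses it
  as a boundary.\<close>

lemma regularity_exact:
 assumes res: "minimal_free_resolution n ideal_of r s \<epsilon> \<phi>" and low: "!!l. l < r p ==> s p l < int (mdegree m)"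
  and m: "mon m" "cyc m f" "hp p f"
 shows "exact m f"
proof -
 have sf: "sup m f" using m(2) by (simp add: cyc_def)
 define c where "c = lift m f"
 let ?j = "int (mdegree m)"
 have ch: "c \<in> homog (im m) (int p)" unfolding c_def by (rule lift_homog[OF m(1) sf m(3)])
 have cn: "c \<in> normal" using ch homog_subset homog_p_normal by blast
 have cK: "c \<in> polyK n p" using subsetD[OF homog_subset ch] by (auto simp: homog_p_def polyK_def)
 have cdeg: "int (mdegree t) + int p = ?j" if "cf (c U) t ~= 0" for U t
 proof -
  have "U \<subseteq> ks m" "t = m - ind U" "f U ~= 0" using that by (auto simp: c_def cf_lift split: if_splits)
  thus ?thesis using mdegree_diff_ind[of U m] m(3) by (auto simp: hp_def)
 qed
 have dc: "ediff n var c U \<in> ideal_of" for U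
 proof -
  have "dd c = 0" using cyc_iff[OF m(1) sf] m(2) by (simp add: c_def)
  hence z: "nf (ediff n var c) U = 0" by (simp add: dd_def)
  have "ediff n var c U \<in> carrier Rn" by (rule ediff_Rn[OF cn])
  moreover have "ks (ediff n var c U) \<subseteq> A"
  proof (cases "U \<subseteq> {..<n}")
   case True
   hence "nfp (ediff n var c U) = 0" using z by (simp add: nf_def)
   hence "cf (nfp (ediff n var c U)) t = 0" for t by simp
   thus ?thesis unfolding cf_nfp in_keys_iff subset_iff by (metis (full_types))
  next
   case False
   have "contr a c U = 0" for a using False polyK_zero[OF cK, of "insert a U"] by (auto simp: contr_def)
   thus ?thesis by (simp add: ediff_def)
  qed
  ultimately show ?thesis by (simp add: ideal_of_def)
 qed
 interpret I: ideal ideal_of Rn by (rule ideal_ideal_of)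
 have Icl: "a \<in> ideal_of ==> b \<in> ideal_of ==> a + b \<in> ideal_of" "a \<in> ideal_of ==> - a \<in> ideal_of" "0 \<in> ideal_of"
   "a \<in> ideal_of ==> x \<in> carrier Rn ==> x * a \<in> ideal_of" for a b x
 proof -
  show "a + b \<in> ideal_of" if "a \<in> ideal_of" "b \<in> ideal_of"
   using that Rn_closed(1)[of a b] Poly_Mapping.keys_add[of a b] unfolding ideal_of_def by blast
  show "- a \<in> ideal_of" if "a \<in> ideal_of" using that Rn_closed(5)[of a] unfolding ideal_of_def by auto
  show "0 \<in> ideal_of" using Rn_closed(3) unfolding ideal_of_def by auto
  show "a \<in> ideal_of ==> x \<in> carrier Rn ==> x * a \<in> ideal_of" using I.I_l_closed[of a x] by simp
 qed
 have Isum: "(!!i. i \<in> S ==> g i \<in> ideal_of) ==> sum g S \<in> ideal_of" for g :: "nat => 'k polynomial" and S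
  by (induction S rule: infinite_finite_induct) (auto intro: Icl)
 have eps: "\<epsilon> l \<in> carrier Rn" "!!t. t \<in> ks (\<epsilon> l) ==> int (mdegree t) = s 0 l" if "l < r 0" for l
  using resolutionD(1)[OF res] that unfolding graded_matrix_def by auto
 have surj: "\<exists>w\<in>free_module n (r 0). q - (\<Sum>l<r 0. \<epsilon> l * w l) \<in> ideal_of" if "q \<in> carrier Rn" for q
  by (rule resolutionD(3)[OF res that])
 have ker: "{w \<in> free_module n (r 0). (\<Sum>l<r 0. \<epsilon> l * w l) \<in> ideal_of} = matrix_apply (r (Suc 0)) (r 0) (\<phi> (Suc 0)) ` free_module n (r (Suc 0))"
  by (rule resolutionD(4)[OF res])
 obtain u0 where u0: "!!U. u0 U \<in> free_module n (r 0)" "!!U. c U - (\<Sum>l<r 0. \<epsilon> l * u0 U l) \<in> ideal_of"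
  using surj[OF polyK_carrier[OF cK]] by metis
 \<comment> \<open>Only the part of u0 with total degree \<open>mdegree m\<close> is kept. The error
   g stays in the ideal because the ideal is closed under taking homogeneous parts.\<close>
 define u where "u l U = (if U \<subseteq> {..<n} & card U = p then hpart (?j - int p - s 0 l) (u0 U l) else 0)" for l U
 have uc: "u l U \<in> carrier Rn" if "l < r 0" for l U
 proof -
  have "u0 U l \<in> carrier Rn" using u0(1)[of U] that by (auto simp: free_module_def PiE_iff)
  thus ?thesis using hpart_carrier poly_ring_closed(3) by (auto simp: u_def)
 qed
 have uK: "u l \<in> polyK n p" if "l < r 0" for l
  by (rule polyKI) (insert uc[OF that], auto simp: u_def split: if_splits)
 define g where "g U = c U - (\<Sum>l<r 0. \<epsilon> l * u l U)" for U
 have gI: "g U \<in> ideal_of" for U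
 proof (cases "U \<subseteq> {..<n} & card U = p")
  case True
  have "g U = hpart (?j - int p) (c U) - (\<Sum>l<r 0. hpart (?j - int p) (\<epsilon> l * u0 U l))"
  proof -
   have "hpart (?j - int p) (c U) = c U" by (rule hpart_id) (use cdeg in force)
   moreover have "(\<Sum>l<r 0. hpart (?j - int p) (\<epsilon> l * u0 U l)) = (\<Sum>l<r 0. \<epsilon> l * u l U)"
    by (rule sum.cong) (insert hpart_mult[OF eps(2)] True, simp_all add: u_def)
   ultimately show ?thesis by (simp add: g_def)
  qed
  also have "... = hpart (?j - int p) (c U - (\<Sum>l<r 0. \<epsilon> l * u0 U l))"
   by (rule poly_mapping_eqI) (simp add: cf_hpart lookup_minus cf_sum)
  finally have e: "g U = hpart (?j - int p) (c U - (\<Sum>l<r 0. \<epsilon> l * u0 U l))" .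
  have "hpart d b \<in> ideal_of" if b: "b \<in> ideal_of" for b d
  proof -
   have "ks (hpart d b) \<subseteq> ks b" by (auto simp: in_keys_iff cf_hpart split: if_splits)
   moreover have "hpart d b \<in> carrier Rn" using b hpart_carrier unfolding ideal_of_def by blast
   ultimately show ?thesis using b unfolding ideal_of_def by blast
  qed
  thus ?thesis unfolding e using u0(2) by blast
 next
  case False
  hence "c U = 0" "!!l. u l U = 0" using polyK_zero[OF cK] by (auto simp: u_def)
  thus ?thesis using Icl(3) by (simp add: g_def)
 qed
 have "(\<lambda>l\<in>{..<r 0}. ediff n var (u l) U) \<in> matrix_apply (r (Suc 0)) (r 0) (\<phi> (Suc 0)) ` free_module n (r (Suc 0))" for U
 proof -
  have "(\<Sum>l<r 0. \<epsilon> l * ediff n var (u l) U) = ediff n var (%U. c U - g U) U"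
   unfolding g_def ediff_linear[symmetric] by simp
  also have "... = ediff n var c U - ediff n var g U" by (rule ediff_diff)
  also have "... \<in> ideal_of"
  proof -
   have "contr a g U \<in> ideal_of" for a using gI Icl(2,3) by (cases "even (below U a)") (auto simp: contr_def)
   hence "ediff n var g U \<in> ideal_of" unfolding ediff_def by (intro Isum Icl(4) var_Rn) auto
   thus ?thesis using Icl(1)[OF dc Icl(2)] by (simp only: diff_conv_add_uminus)
  qed
  finally have "(\<Sum>l<r 0. \<epsilon> l * ediff n var (u l) U) \<in> ideal_of" .
  moreover have "(\<lambda>l\<in>{..<r 0}. ediff n var (u l) U) \<in> free_module n (r 0)"
   by (rule restrict_free) (rule ediff_carrier, rule uc)
  ultimately show ?thesis using ker by fastforce
 qed
 moreover have "int (mdegree t) + int p + s 0 l = ?j" if "cf (u l U) t ~= 0" for l U t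
  using that by (auto simp: u_def cf_hpart split: if_splits)
 ultimately have "\<exists>y y'. (\<forall>l<r 0. y l \<in> polyK n (Suc p)) & (\<forall>l<r (Suc 0). y' l \<in> polyK n p) &
   (\<forall>l<r 0. \<forall>U. u l U = ediff n var (y l) U + (\<Sum>l'<r (Suc 0). \<phi> (Suc 0) l l' * y' l' U))"
  by (intro resolution_zigzag[OF res low]) (auto intro: uK)
 then obtain y y' where y: "!!l. l < r 0 ==> y l \<in> polyK n (Suc p)" "!!l. l < r (Suc 0) ==> y' l \<in> polyK n p"
   "!!l U. l < r 0 ==> u l U = ediff n var (y l) U + (\<Sum>l'<r (Suc 0). \<phi> (Suc 0) l l' * y' l' U)"
  by blast
 define Y where "Y U = (\<Sum>l<r 0. \<epsilon> l * y l U)" for U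
 have diff: "c U - ediff n var Y U \<in> ideal_of" for U
 proof -
  let ?w = "\<lambda>l\<in>{..<r (Suc 0)}. y' l U"
  have "?w \<in> free_module n (r (Suc 0))" by (rule restrict_free) (use y(2) polyK_carrier in blast)
  hence "matrix_apply (r (Suc 0)) (r 0) (\<phi> (Suc 0)) ?w \<in> {w \<in> free_module n (r 0). (\<Sum>l<r 0. \<epsilon> l * w l) \<in> ideal_of}"
   unfolding ker by blast
  hence k: "(\<Sum>l<r 0. \<epsilon> l * (\<Sum>l'<r (Suc 0). \<phi> (Suc 0) l l' * y' l' U)) \<in> ideal_of" by (simp add: matrix_apply_def)
  have "c U = g U + (\<Sum>l<r 0. \<epsilon> l * u l U)" by (simp add: g_def)
  also have "(\<Sum>l<r 0. \<epsilon> l * u l U) = (\<Sum>l<r 0. \<epsilon> l * ediff n var (y l) U + \<epsilon> l * (\<Sum>l'<r (Suc 0). \<phi> (Suc 0) l l' * y' l' U))"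
   by (rule sum.cong) (simp_all add: y(3) distrib_left)
  also have "... = ediff n var Y U + (\<Sum>l<r 0. \<epsilon> l * (\<Sum>l'<r (Suc 0). \<phi> (Suc 0) l l' * y' l' U))"
   unfolding Y_def ediff_linear by (rule sum.distrib)
  finally have "c U - ediff n var Y U = g U + (\<Sum>l<r 0. \<epsilon> l * (\<Sum>l'<r (Suc 0). \<phi> (Suc 0) l l' * y' l' U))" by simp
  thus ?thesis using Icl(1)[OF gI k] by simp
 qed
 have "nf c = nf (ediff n var Y)"
 proof
  fix U
  show "nf c U = nf (ediff n var Y) U"
  proof (cases "U \<subseteq> {..<n}")
   case True
   have "nfp (c U) = nfp (ediff n var Y U)"
   proof (rule poly_mapping_eqI)
    fix t
    have "cf (c U - ediff n var Y U) t = 0" if tA: "t ~: A"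
    proof -
     have "t ~: ks (c U - ediff n var Y U)" using diff[of U] tA unfolding ideal_of_def by blast
     thus ?thesis by (simp only: in_keys_iff not_not)
    qed
    thus "cf (nfp (c U)) t = cf (nfp (ediff n var Y U)) t" by (simp add: cf_nfp lookup_minus)
   qed
   thus ?thesis using True by (simp add: nf_def)
  qed (simp add: nf_def)
 qed
 hence "dd Y = lift m f" using nf_normal[OF cn] by (simp add: dd_def c_def)
 thus ?thesis using exact_iff[OF m(1) sf] by blast
qed

end

section \<open>Monomial ideals\<close>

definition upset_of :: "monomial set => monomial set" where "upset_of G = {t. \<exists>g\<in>G. mdvd g t}"

lemma monomial_koszul_upset_of: "monomial_koszul (upset_of G)"
 by unfold_locales (auto simp: upset_of_def intro: mdvd_trans)

lemma generator_upset: "g \<in> G ==> g \<in> upset_of G"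
 unfolding upset_of_def using mdvd_refl by blast

lemma mono_poly_ideal_of:
 assumes "t \<in> monomials n"
 shows "(mono_poly t :: 'k::field polynomial) \<in> monomial_koszul.ideal_of n (upset_of G) \<longleftrightarrow> t \<in> upset_of G"
proof -
 interpret monomial_koszul n "upset_of G" "TYPE('k)" by (rule monomial_koszul_upset_of)
 show ?thesis using assms by (auto simp: ideal_of_def mono_poly_def poly_ring_def)
qed

text \<open>Each term of a polynomial supported on the up-set is a multiple of a monomial in G. This
  identifies the ideal with the one modelled by normal forms.\<close>

lemma monomial_span_eq:
 assumes G: "G \<subseteq> monomials n"
 shows "(monomial_span n G :: 'k::field polynomial set) = monomial_koszul.ideal_of n (upset_of G)"
proof -
 interpret monomial_koszul n "upset_of G" "TYPE('k)" by (rule monomial_koszul_upset_of)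
 interpret R: cring Rn by (rule cring_poly_ring)
 have car: "mono_poly ` G \<subseteq> carrier Rn" using G by (auto simp: mono_poly_def poly_ring_def)
 show ?thesis
 proof
  have "mono_poly g \<in> ideal_of" if "g \<in> G" for g
   using mono_poly_ideal_of[of g n G] that G generator_upset by blast
  thus "monomial_span n G \<subseteq> ideal_of"
   unfolding monomial_span_def by (intro R.genideal_minimal[OF ideal_ideal_of]) auto
  interpret J: ideal "monomial_span n G" Rn unfolding monomial_span_def by (rule R.genideal_ideal[OF car])
  have sumJ: "sum h S \<in> monomial_span n G" if "!!i. i \<in> S ==> h i \<in> monomial_span n G" for h :: "monomial => 'k polynomial" and S
   using that
  proof (induction S rule: infinite_finite_induct)
   case (insert i S)
   thus ?case using J.a_closed[of "h i" "sum h S"] by simp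
  qed (use additive_subgroup.zero_closed[OF J.additive_subgroup_axioms] in simp_all)
  show "ideal_of \<subseteq> monomial_span n G"
  proof
   fix f assume f: "f \<in> ideal_of"
   have "sing t (cf f t) \<in> monomial_span n G" if t: "t \<in> ks f" for t
   proof -
    have "t \<in> upset_of G" using f t unfolding ideal_of_def by blast
    moreover have "f \<in> carrier Rn" using f unfolding ideal_of_def by blast
    hence "ks t \<subseteq> {..<n}" using t unfolding carrier_Rn in_keys_iff by blast
    ultimately have "t \<in> upset_of G" "ks t \<subseteq> {..<n}" by blast+
    then obtain g where g: "g \<in> G" "mdvd g t" by (auto simp: upset_of_def)
    have "ks (t - g) \<subseteq> {..<n}" using \<open>ks t \<subseteq> {..<n}\<close> ks_diff_le by blast
    hence c: "sing (t - g) (cf f t) \<in> carrier Rn" by (auto simp: poly_ring_def monomials_def)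
    have "(mono_poly g :: 'k polynomial) \<in> monomial_span n G"
     by (rule subsetD[OF R.genideal_self[OF car, folded monomial_span_def] imageI[OF g(1)]])
    from J.I_l_closed[OF this c] have "sing (t - g) (cf f t) * mono_poly g \<in> monomial_span n G" unfolding ops_Rn .
    moreover have "t - g + g = t" using mdvd_imp_add[OF g(2)] by (simp add: add.commute)
    ultimately show ?thesis by (simp add: mono_poly_def mult_single)
   qed
   hence "(\<Sum>t\<in>ks f. sing t (cf f t)) \<in> monomial_span n G" by (rule sumJ)
   thus "f \<in> monomial_span n G" by (simp add: sum_monomials)
  qed
 qed
qed

lemma min_gens_eq:
 assumes G: "G \<subseteq> monomials n"
 shows "min_gens n (monomial_span n G :: 'k::field polynomial set) = monomial_koszul.gens (upset_of G)"
proof -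
 interpret monomial_koszul n "upset_of G" "TYPE('k)" by (rule monomial_koszul_upset_of)
 have "gens \<subseteq> G"
 proof
  fix g assume g: "g \<in> gens"
  then obtain h where h: "h \<in> G" "mdvd h g" using gens_A[OF g] unfolding upset_of_def by blast
  hence "h = g" using g generator_upset[OF h(1)] unfolding gens_def by blast
  thus "g \<in> G" using h(1) by simp
 qed
 moreover have "s \<in> monomials n" if "t \<in> monomials n" "mdvd s t" for s t
  using that mdvd_keys[OF that(2)] by (auto simp: monomials_def)
 ultimately show ?thesis using G unfolding min_gens_def monomial_span_eq[OF G] gens_def
  by (auto simp: mono_poly_ideal_of)
qed

lemma golodI:
 fixes I :: "'k::field polynomial set"
 assumes G: "G \<subseteq> monomials n" "I = monomial_span n G" and tp: "trivial_product (quotient_koszul n I)"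
  and good: "!!w. trivial_koszul TYPE('k) n (upset_of G) ==> w \<in> lists (monomial_koszul.labels n (upset_of G) :: (monomial \<times> nat \<times> 'k ext) set) ==> w ~= [] ==>
   monomial_koszul.wgood n (upset_of G) w"
 shows "golod n I"
proof -
 interpret monomial_koszul n "upset_of G" "TYPE('k)" by (rule monomial_koszul_upset_of)
 have I: "I = ideal_of" using G monomial_span_eq by blast
 have "trivial_koszul TYPE('k) n (upset_of G)" using trivial_koszul_Kn tp unfolding I by blast
 hence "trivial_higher_massey_products Kn" using good by (intro trivial_higher_massey)
 thus ?thesis using tp unfolding I golod_def by blast
qed

text \<open>The ideals (x_0, ..., x_{i-1}) for i = 0, ..., n form a chain of primes. This bound
  suffices, as a bound on the dimension is used only to bound n.\<close>

lemma krull_dim_poly_ring: "ereal (real n) <= krull_dim (poly_ring n :: 'k::field polynomial ring)"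
proof -
 define V where "V i = {t :: monomial. \<exists>j<i. cf t j > 0}" for i :: nat
 have mk: "monomial_koszul (V i)" for i
 proof
  fix s t :: monomial assume "s \<in> V i" "mdvd s t"
  thus "t \<in> V i" unfolding V_def mdvd_def using less_le_trans by blast
 qed
 define P where "P i = (monomial_koszul.ideal_of n (V i) :: 'k polynomial set)" for i
 have mem: "f \<in> P i \<longleftrightarrow> f \<in> polys n & ks f \<subseteq> V i" for f i
 proof -
  interpret monomial_koszul n "V i" "TYPE('k)" by (rule mk)
  show ?thesis by (simp add: P_def ideal_of_def)
 qed
 have prime: "primeideal (P i) (poly_ring n)" for i
 proof -
  interpret monomial_koszul n "V i" "TYPE('k)" by (rule mk)
  show ?thesis
  proof (rule primeidealI[OF _ cring_poly_ring])
   show "ideal (P i) (poly_ring n)" unfolding P_def by (rule ideal_ideal_of)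
   have "1 ~: P i" by (simp add: mem V_def)
   thus "polys n ~= P i" using Rn_closed(4) by blast
   fix a b :: "'k polynomial" assume ab: "a \<in> polys n" "b \<in> polys n" "a \<otimes>\<^bsub>poly_ring n\<^esub> b \<in> P i"
   show "a \<in> P i | b \<in> P i"
   proof (rule ccontr)
    have in_P: "f \<in> P i" if "f \<in> polys n" "nfp f = 0" for f
    proof -
     have "cf (nfp f) t = 0" for t using that(2) by simp
     hence "cf f t ~= 0 ==> t \<in> V i" for t unfolding cf_nfp by (meson)
     thus ?thesis using that(1) by (auto simp: mem in_keys_iff)
    qed
    assume "~ ?thesis"
    hence "nfp a ~= 0" "nfp b ~= 0" using in_P ab by blast+
    \<comment> \<open>Normal forms involve only monomials free of the first i variables. So does
      their product, which is nonzero and therefore has a term outside \<open>V i\<close> that is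
      also a term of a b.\<close>
    hence "nfp a * nfp b ~= 0" by simp
    then obtain t where t: "t \<in> ks (nfp a * nfp b)" by (metis keys_eq_empty ex_in_conv)
    then obtain r s where "t = r + s" "r \<in> ks (nfp a)" "s \<in> ks (nfp b)" using Poly_Mapping.keys_mult[of "nfp a" "nfp b"] by blast
    moreover from this have "r ~: V i" "s ~: V i" by (auto simp: in_keys_iff cf_nfp split: if_splits)
    ultimately have tV: "t ~: V i" by (auto simp: V_def lookup_add)
    have "nfp (nfp a * nfp b) = nfp (a * b)" by (simp add: nfp_mult_nfp nfp_mult_nfp')
    hence "cf (a * b) t = cf (nfp a * nfp b) t" using tV cf_nfp[of "nfp a * nfp b" t] cf_nfp[of "a * b" t] by simp
    hence "t \<in> ks (a * b)" using t by (simp add: in_keys_iff)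
    thus False using ab(3) tV by (auto simp: mem)
   qed
  qed
 qed
 have "P i \<subset> P (Suc i)" if "i < n" for i
 proof
  have "V i \<subseteq> V (Suc i)" unfolding V_def using less_SucI by blast
  thus "P i \<subseteq> P (Suc i)" using mem by blast
  have "var i \<in> P (Suc i)" "var i ~: P i"
   using that by (auto simp: mem V_def var_def mono_poly_def poly_ring_def monomials_def lookup_single when_def split: if_splits)
  thus "P i ~= P (Suc i)" by blast
 qed
 thus ?thesis unfolding krull_dim_def by (intro SUP_upper) (use prime in blast)
qed

lemma prod_var: "finite M ==> (\<Prod>v\<in>M. var v) = (mono_poly (ind M) :: 'k::field polynomial)"
proof (induction M rule: finite_induct)
 case (insert v M)
 thus ?case by (simp add: var_def mono_poly_def ind_def mult_single)
qed (simp add: mono_poly_def ind_def)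

lemma squarefree_upset:
 assumes "!!g i. g \<in> G ==> cf g i <= 1" "t \<in> upset_of G"
 shows "ind (ks t) \<in> upset_of G"
proof -
 obtain g where g: "g \<in> G" "mdvd g t" using assms(2) by (auto simp: upset_of_def)
 have "cf g i <= cf (ind (ks t)) i" for i
  using assms(1)[OF g(1), of i] mdvd_keys[OF g(2)] by (auto simp: cf_ind in_keys_iff subset_iff)
 thus ?thesis using g(1) by (auto simp: upset_of_def mdvd_def)
qed

lemma mdegree_squarefree: "(!!v. cf m v < 2) ==> mdegree m = card (ks m)"
proof -
 assume a: "!!v. cf m v < 2"
 have "cf m v = 1" if "v \<in> ks m" for v using a[of v] that by (simp add: in_keys_iff)
 thus ?thesis by (simp add: mdegree_def)
qed

text \<open>Degrees that are not squarefree carry no homology, and in the squarefree ones of strand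
  at least 5 and degree at least 9 there are no cells by \<open>van\<close>.\<close>

lemma (in trivial_koszul) golod_if_squarefree:
 assumes sq: "!!t. t \<in> A ==> ind (ks t) \<in> A"
  and van: "!!m U. mon m ==> (!!v. cf m v < 2) ==> mdegree m >= card U + 5 ==> mdegree m >= 9 ==> U \<subseteq> ks m ==> m - ind U ~: A ==> False"
  and w: "w \<in> words" "w ~= []"
 shows "wgood w"
proof (rule golod_if_low_strands[OF _ w])
 fix m p f assume m: "mon m" "cyc m f" "hp p f" "mdegree m >= p + 5" "mdegree m >= 9"
 show "exact m f"
 proof (cases "\<exists>v. cf m v >= 2")
  case True
  thus ?thesis using squarefree_exact[OF sq m(1,2)] by blast
 next
  case False
  hence "cf m v < 2" for v by (simp add: not_le)
  hence "f U = 0" for U using van[OF m(1), of U] m(2-5) by (auto simp: cyc_def sup_def hp_def Lam_def)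
  hence "f = 0" by (simp add: fun_eq_iff)
  thus ?thesis by simp
 qed
qed

theorem theorem6p3:
  fixes n :: nat and I :: "'k::field polynomial set"
  assumes "monomial_ideal n I"
    and "trivial_product (quotient_koszul n I)"
    and "generated_in_degree n 2 I
       \<or> generic_ideal n I
       \<or> (finite (min_gens n I) \<and> card (min_gens n I) \<le> 7)
       \<or> krull_dim (poly_ring n :: 'k polynomial ring) \<le> 4
       \<or> (squarefree_ideal n I \<and> krull_dim (poly_ring n :: 'k polynomial ring) \<le> 8)
       \<or> regularity n I \<le> 4
       \<or> (\<exists>\<Delta>. simplicial_complex n \<Delta> \<and> simplicial_dim \<Delta> \<le> 3 \<and> I = stanley_reisner_ideal n \<Delta>)"
  shows "golod n I"
proof -
 note golodI' = golodI[OF _ _ assms(2)]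
 obtain G where G: "G \<subseteq> monomials n" "I = monomial_span n G" using assms(1) by (auto simp: monomial_ideal_def)
 have gens: "min_gens n I = monomial_koszul.gens (upset_of G)" using min_gens_eq[OF G(1)] G(2) by blast
 have dim: "n <= k" if "krull_dim (poly_ring n :: 'k polynomial ring) <= ereal (real k)" for k
  using order_trans[OF krull_dim_poly_ring[where 'k = 'k] that] by simp
 from assms(3) show ?thesis
 proof (elim disjE)
  assume "generated_in_degree n 2 I"
  then obtain G where G: "G \<subseteq> monomials n" "!!t. t \<in> G ==> mdegree t = 2" "I = monomial_span n G" by (auto simp: generated_in_degree_def)
  have "\<exists>s\<in>upset_of G. mdvd s t & mdegree s = 2" if t: "t \<in> upset_of G" for t
  proof -
   obtain g where "g \<in> G" "mdvd g t" using t unfolding upset_of_def by blast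
   thus ?thesis using G(2) generator_upset by blast
  qed
  thus ?thesis by (intro golodI'[OF G(1,3) trivial_koszul.golod_if_quadratic])
 next
  assume "generic_ideal n I"
  thus ?thesis by (intro golodI'[OF G trivial_koszul.golod_if_generic]) (unfold generic_ideal_def gens, blast+)
 next
  assume "finite (min_gens n I) & card (min_gens n I) <= 7"
  thus ?thesis by (intro golodI'[OF G trivial_koszul.golod_if_seven_generators]) (auto simp: gens)
 next
  assume "krull_dim (poly_ring n :: 'k polynomial ring) <= 4"
  hence "n <= 4" using dim[of 4] by simp
  thus ?thesis by (intro golodI'[OF G trivial_koszul.golod_if_four_variables])
 next
  assume a: "squarefree_ideal n I & krull_dim (poly_ring n :: 'k polynomial ring) <= 8"
  hence n: "n <= 8" using dim[of 8] by simp
  obtain G where G: "G \<subseteq> monomials n" "!!t i. t \<in> G ==> cf t i <= 1" "I = monomial_span n G" using a by (auto simp: squarefree_ideal_def)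
  show ?thesis
  proof (rule golodI'[OF G(1,3) trivial_koszul.golod_if_squarefree])
   fix m U assume m: "ks m \<subseteq> {..<n}" "!!v. cf m v < 2" "mdegree m >= 9"
   \<comment> \<open>A squarefree degree is at most n, hence below 9.\<close>
   have "mdegree m = card (ks m)" by (rule mdegree_squarefree[OF m(2)])
   also have "... <= n" using card_mono[OF _ m(1)] by simp
   finally show False using m(3) n by simp
  qed (assumption | rule squarefree_upset[OF G(2)])+
 next
  assume reg: "regularity n I <= 4"
  \<comment> \<open>A strict bound on the infimum yields a resolution satisfying it. Since degrees
    are integers, the bound 4 is recovered in \<open>low\<close>.\<close>
  have "regularity n I < 5" using reg by (rule le_less_trans) simp
  then obtain r s \<epsilon> \<phi> where res: "minimal_free_resolution n I r s \<epsilon> \<phi>"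
   and lt: "(SUP (i, l)\<in>{(i, l). l < r i}. ereal (real_of_int (s i l - int i))) < 5"
   unfolding regularity_def Inf_less_iff by blast
  have low: "s i l <= int i + 4" if "l < r i" for i l
  proof -
   have "ereal (real_of_int (s i l - int i)) <= (SUP (i, l)\<in>{(i, l). l < r i}. ereal (real_of_int (s i l - int i)))"
    using that by (intro SUP_upper2[of "(i, l)"]) auto
   hence "ereal (real_of_int (s i l - int i)) < 5" using lt by (rule le_less_trans)
   hence "real_of_int (s i l - int i) < real_of_int 5" by simp
   hence "s i l - int i < 5" by (simp only: of_int_less_iff)
   thus ?thesis by simp
  qed
  show ?thesis
  proof (rule golodI'[OF G])
   fix w assume "trivial_koszul TYPE('k) n (upset_of G)"
   then interpret trivial_koszul n "upset_of G" "TYPE('k)" .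
   assume w: "w \<in> words" "w ~= []"
   have I: "I = ideal_of" using G monomial_span_eq by blast
   show "wgood w"
   proof (rule golod_if_low_strands[OF _ w])
    fix m p f assume m: "mon m" "cyc m f" "hp p f" "mdegree m >= p + 5"
    show "exact m f" by (rule regularity_exact[OF res[unfolded I] _ m(1-3)]) (use low m(4) in fastforce)
   qed
  qed
 next
  assume "\<exists>\<Delta>. simplicial_complex n \<Delta> & simplicial_dim \<Delta> <= 3 & I = stanley_reisner_ideal n \<Delta>"
  then obtain \<Delta> where D: "simplicial_complex n \<Delta>" "simplicial_dim \<Delta> <= 3" "I = stanley_reisner_ideal n \<Delta>" by blast
  let ?N = "{M. M \<subseteq> {..<n} & M ~: \<Delta>}"
  define G where "G = ind ` ?N"
  have fin: "finite M" if "M \<subseteq> {..<n}" for M using that finite_subset by blast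
  have G1: "G \<subseteq> monomials n" using fin by (auto simp: G_def monomials_def ks_ind)
  have "(%M. \<Prod>v\<in>M. var v :: 'k polynomial) ` ?N = (%M. mono_poly (ind M)) ` ?N" by (rule image_cong) (use prod_var fin in auto)
  moreover have "{\<Prod>v\<in>M. var v | M. M \<subseteq> {..<n} & M ~: \<Delta>} = (%M. \<Prod>v\<in>M. var v :: 'k polynomial) ` ?N" by blast
  ultimately have G2: "I = monomial_span n G" unfolding D(3) stanley_reisner_ideal_def monomial_span_def by (simp add: G_def image_image)
  have card4: "card M <= 4" if "M \<in> \<Delta>" for M
  proof -
   have "ereal (real (card M) - 1) <= simplicial_dim \<Delta>" unfolding simplicial_dim_def by (rule SUP_upper[OF that])
   hence "ereal (real (card M) - 1) <= 3" using D(2) order_trans by blast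
   thus ?thesis by simp
  qed
  show ?thesis
  proof (rule golodI'[OF G1 G2 trivial_koszul.golod_if_squarefree])
   show "ind (ks t) \<in> upset_of G" if "t \<in> upset_of G" for t
    by (rule squarefree_upset[OF _ that]) (insert fin, auto simp: G_def cf_ind)
   fix m U assume m: "ks m \<subseteq> {..<n}" "!!v. cf m v < 2" "mdegree m >= card U + 5"
    and U: "U \<subseteq> ks m" "m - ind U ~: upset_of G"
   \<comment> \<open>The monomial of a cell in strand at least 5 is squarefree of degree at least 5
     and not in the ideal, so its support would be a face with at least five vertices.\<close>
   let ?t = "m - ind U"
   have "mdvd ?t m" by (simp add: mdvd_def lookup_minus)
   hence kt: "ks ?t \<subseteq> {..<n}" using mdvd_keys m(1) by blast
   have "cf ?t v < 2" for v using m(2)[of v] by (simp add: lookup_minus less_imp_diff_less)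
   hence "mdegree ?t = card (ks ?t)" by (rule mdegree_squarefree)
   moreover have "mdegree ?t >= 5" using mdegree_diff_ind[OF U(1)] m(3) by simp
   moreover have "ks ?t \<in> \<Delta>"
   proof (rule ccontr)
    assume "ks ?t ~: \<Delta>"
    hence "ind (ks ?t) \<in> G" using kt by (auto simp: G_def)
    moreover have "mdvd (ind (ks ?t)) ?t" by (simp add: mdvd_ind)
    ultimately show False using U(2) by (auto simp: upset_of_def)
   qed
   ultimately show False using card4 by fastforce
  qed assumption+
 qed
qed

end
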